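(* Let $\xi\in L^2(\Omega,\mathcal G,\mathbb P;\mathbb R^d)$ and $\eta\in L^2(\Omega,\mathcal G,\mathbb P;\mathbb R^k)$, and suppose that Assumptions (A) and (B) stated in the context hold. Let $(\widehat X,\widehat\alpha)\in\mathbb S_d^2\times\mathbb H_k^2$ be the pair given by Assumption (B) for the initial condition $\xi$, i.e. $$d\widehat X_t=b(t,\widehat X_t,\mathbb P_{\widehat X_t},\widehat\alpha_t,\mathbb P_{\widehat\alpha_t})\,dt+\sigma(t,\widehat X_t,\mathbb P_{\widehat X_t},\widehat\alpha_t,\mathbb P_{\widehat\alpha_t})\,dW_t,\quad t\in[0,T],\qquad \widehat X_0=\xi,$$ $$\mathbb E\Big[\int_0^T\big|B(t,\widehat X_t,\mathbb P_{\widehat X_t},\widehat\alpha_t,\mathbb P_{\widehat\alpha_t})\big|^2dt\Big]=0.$$ For every $\varepsilon>0$, let $(X^\varepsilon,A^\varepsilon)\in\mathbb S_d^2\times\mathbb S_k^2$ be the unique solution of the two-scale system on $[0,T]$ $$\begin{cases}dX^\varepsilon_t=b(t,X^\varepsilon_t,\mathbb P_{X^\varepsilon_t},A^\varepsilon_t,\mathbb P_{A^\varepsilon_t})\,dt+\sigma(t,X^\varepsilon_t,\mathbb P_{X^\varepsilon_t},A^\varepsilon_t,\mathbb P_{A^\varepsilon_t})\,dW_t,\\ \varepsilon\, dA^\varepsilon_t=B(t,X^\varepsilon_t,\mathbb P_{X^\varepsilon_t},A^\varepsilon_t,\mathbb P_{A^\varepsilon_t})\,dt+\beta^\varepsilon\,\Sigma(t,X^\varepsilon_t,\mathbb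 P_{X^\varepsilon_t},A^\varepsilon_t,\mathbb P_{A^\varepsilon_t})\,dW_t,\\ X^\varepsilon_0=\xi,\quad A^\varepsilon_0=\eta.\end{cases}$$ Then $$\|A^\varepsilon-\widehat\alpha\|_{\mathbb H^2}\longrightarrow 0\quad\text{and}\quad \|X^\varepsilon-\widehat X\|_{\mathbb S^2}\longrightarrow 0\qquad\text{as }\varepsilon\to0.$$
   Context: Probabilistic setting. Fix $T>0$ and $d,k,m\in\mathbb N$. $(\Omega,\mathcal F,\mathbb P)$ is a complete probability space carrying an $m$-dimensional Brownian motion $W=(W_t)_{t\ge0}$; $(\mathcal F^W_t)_{t\ge0}$ is the $\mathbb P$-completion of the filtration generated by $W$. $\mathcal G\subset\mathcal F$ is a sub-$\sigma$-algebra independent of $\mathcal F^W_\infty$ such that there is a $\mathcal G$-measurable random variable uniformly distributed on $[0,1]$. The filtration $\mathbb F=(\mathcal F_t)_{t\ge0}$ is $\mathcal F_t=\mathcal G\vee\mathcal F_t^W$. $\mathbb P_\zeta$ denotes the law of a random variable $\zeta$. $L^2(\Omega,\mathcal H,\mathbb P;\mathbb R^n)$ is the space of square-integrable $\mathcal H$-measurable $\mathbb R^n$-valued random variables. Wasserstein space. $\mathcal P_2(\mathbb R^n)$ is the set of Borel probability measures on $\mathbb R^n$ with finite second moment, endowed with the 2-Wasserstein metric $\mathcal W_2(\mu,\mu')=\inf_\pi(\int|x-y|^2\pi(dx,dy))^{1/2}$, infimum over couplings $\pi$ of $\mu,\mu'$; $\|\mu\|_2:=(\int_{\mathbb R^n}|x|^2\mu(dx))^{1/2}$.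 Process spaces on $[0,T]$. $\mathbb S_n^2$: continuous $\mathbb F$-adapted $\mathbb R^n$-valued processes $Y$ with $\|Y\|_{\mathbb S^2}^2:=\mathbb E[\sup_{0\le t\le T}|Y_t|^2]<\infty$. $\mathbb H_n^2$: $\mathbb F$-progressively measurable $\mathbb R^n$-valued processes $Z$ with $\|Z\|_{\mathbb H^2}^2:=\mathbb E[\int_0^T|Z_t|^2dt]<\infty$. Assumption (A). $(\beta^\varepsilon)_{\varepsilon>0}$ are real numbers and $b,\sigma,B,\Sigma$ are functions on $[0,T]\times\Omega\times\mathbb R^d\times\mathcal P_2(\mathbb R^d)\times\mathbb R^k\times\mathcal P_2(\mathbb R^k)$ with values in $\mathbb R^d,\mathbb R^{d\times m},\mathbb R^k,\mathbb R^{k\times m}$ respectively (the argument $\omega$ is often omitted in the notation), such that: 1) $\lim_{\varepsilon\to0}\beta^\varepsilon/\varepsilon=0$. 2) $b,\sigma,B,\Sigma$ are measurable with respect to $Prog\otimes\mathcal B(\mathbb R^d)\otimes\mathcal B(\mathcal P_2(\mathbb R^d))\otimes\mathcal B(\mathbb R^k)\otimes\mathcal B(\mathcal P_2(\mathbb R^k))$, where $Prog$ is the $\sigma$-algebra of $\mathbb F$-progressive subsets of $[0,T]\times\Omega$. 3) There is $K>0$ such that $|b|+|\sigma|\le K(1+|x|+\|\mu\|_2+|a|+\|\nu\|_2)$ and $|B|+|\Sigma|\le K(1+|x|+\|\mu\|_2+|a|+\|\nu\|_2)$ at every $(t,\omega,x,\mu,a,\nu)$. 4) There is $K>0$ such that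 for all $(t,\omega)$ and all $(x,\mu,a,\nu),(x',\mu',a',\nu')$: each $h\in\{b,\sigma,\Sigma\}$ satisfies $|h(t,\omega,x,\mu,a,\nu)-h(t,\omega,x',\mu',a',\nu')|\le K(|x-x'|+\mathcal W_2(\mu,\mu')+|a-a'|+\mathcal W_2(\nu,\nu'))$, and $|B(t,\omega,x,\mu,a,\nu)-B(t,\omega,x',\mu',a,\nu)|\le K(|x-x'|+\mathcal W_2(\mu,\mu'))$. 5) There is $\lambda>0$ such that $\mathbb E[\langle B(t,\zeta,\mathbb P_\zeta,\theta,\mathbb P_\theta)-B(t,\zeta,\mathbb P_\zeta,\theta',\mathbb P_{\theta'}),\theta-\theta'\rangle]\le-\lambda\,\mathbb E[|\theta-\theta'|^2]$ for all $t\in[0,T]$, $\zeta\in L^2(\Omega,\mathcal F,\mathbb P;\mathbb R^d)$, $\theta,\theta'\in L^2(\Omega,\mathcal F,\mathbb P;\mathbb R^k)$. Assumption (B). For every $\xi\in L^2(\Omega,\mathcal G,\mathbb P;\mathbb R^d)$ there exists $\widehat\alpha\in\mathbb H_k^2$ such that $\mathbb E[\int_0^T|B(t,\widehat X_t,\mathbb P_{\widehat X_t},\widehat\alpha_t,\mathbb P_{\widehat\alpha_t})|^2dt]=0$, where $\widehat X$ is the unique solution in $\mathbb S_d^2$ of $d\widehat X_t=b(t,\widehat X_t,\mathbb P_{\widehat X_t},\widehat\alpha_t,\mathbb P_{\widehat\alpha_t})dt+\sigma(t,\widehat X_t,\mathbb P_{\widehat X_t},\widehat\alpha_t,\mathbb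 P_{\widehat\alpha_t})dW_t$ on $[0,T]$, $\widehat X_0=\xi$. *)

theory Defs
  imports "HOL-Probability.Probability"
begin

section \<open>Square-integrable random variables and the Wasserstein space\<close>

definition L2_rv :: "'w measure \<Rightarrow> 'w measure \<Rightarrow> ('w \<Rightarrow> 'a::euclidean_space) set" where
  "L2_rv M H = {\<zeta> \<in> borel_measurable H. integrable M (\<lambda>\<omega>. (norm (\<zeta> \<omega>))\<^sup>2)}"

abbreviation law :: "'w measure \<Rightarrow> ('w \<Rightarrow> 'a::euclidean_space) \<Rightarrow> 'a measure" where
  "law M \<zeta> \<equiv> distr M borel \<zeta>"

definition P2 :: "('a::euclidean_space) measure set" where
  "P2 = {\<mu>. prob_space \<mu> \<and> sets \<mu> = sets borel \<and> integrable \<mu> (\<lambda>x. (norm x)\<^sup>2)}"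

definition norm_P2 :: "('a::euclidean_space) measure \<Rightarrow> real" where
  "norm_P2 \<mu> = sqrt (LINT x|\<mu>. (norm x)\<^sup>2)"

definition couplings ::
  "('a::euclidean_space) measure \<Rightarrow> 'a measure \<Rightarrow> ('a \<times> 'a) measure set" where
  "couplings \<mu> \<mu>' = {\<pi>. prob_space \<pi> \<and> sets \<pi> = sets (borel \<Otimes>\<^sub>M borel) \<and>
     distr \<pi> borel fst = \<mu> \<and> distr \<pi> borel snd = \<mu>'}"

text \<open>Only used on \<open>P2\<close>, where the set of couplings is nonempty and all the integrals are finite.\<close>

definition W2 :: "('a::euclidean_space) measure \<Rightarrow> 'a measure \<Rightarrow> real" where
  "W2 \<mu> \<mu>' = (INF \<pi>\<in>couplings \<mu> \<mu>'. sqrt (LINT z|\<pi>. (norm (fst z - snd z))\<^sup>2))"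

text \<open>The Borel \<open>\<sigma>\<close>-algebra of the metric space \<open>(P2, W2)\<close>.\<close>

definition borel_P2 :: "('a::euclidean_space) measure measure" where
  "borel_P2 = sigma P2
     {U. U \<subseteq> P2 \<and> (\<forall>\<mu>\<in>U. \<exists>r>0. {\<mu>'\<in>P2. W2 \<mu> \<mu>' < r} \<subseteq> U)}"


section \<open>The probabilistic setting\<close>

definition generated_by :: "'w measure \<Rightarrow> (real \<Rightarrow> 'w \<Rightarrow> 'a::euclidean_space) \<Rightarrow> real set \<Rightarrow> 'w measure" where
  "generated_by M Y J = sigma (space M) (\<Union>r\<in>J. sets (vimage_algebra (space M) (Y r) borel))"

definition brownian_motion :: "'w measure \<Rightarrow> (real \<Rightarrow> 'w \<Rightarrow> real ^ 'm) \<Rightarrow> bool" where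
  "brownian_motion M W \<longleftrightarrow>
     (\<forall>t\<ge>0. W t \<in> borel_measurable M) \<and>
     (AE \<omega> in M. W 0 \<omega> = 0) \<and>
     (AE \<omega> in M. continuous_on {0..} (\<lambda>t. W t \<omega>)) \<and>
     (\<forall>s t. 0 \<le> s \<and> s < t \<longrightarrow>
        prob_space.indep_set M (sets (generated_by M W {0..s}))
          (sets (vimage_algebra (space M) (\<lambda>\<omega>. W t \<omega> - W s \<omega>) borel)) \<and>
        distributed M lborel (\<lambda>\<omega>. W t \<omega> - W s \<omega>)
          (\<lambda>x. ennreal (\<Prod>i\<in>UNIV. normal_density 0 (sqrt (t - s)) (x $ i))))"

text \<open>\<open>FW M W {0..t}\<close> is \<open>\<F>\<^sup>W\<^sub>t\<close> and \<open>FW M W {0..}\<close> is \<open>\<F>\<^sup>W\<^sub>\<infinity>\<close>: completion means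
  augmentation by all null sets of the (complete) space \<open>M\<close>.\<close>

definition FW :: "'w measure \<Rightarrow> (real \<Rightarrow> 'w \<Rightarrow> real ^ 'm) \<Rightarrow> real set \<Rightarrow> 'w measure" where
  "FW M W J = sigma (space M) (sets (generated_by M W J) \<union> null_sets M)"

definition filt :: "'w measure \<Rightarrow> 'w measure \<Rightarrow> (real \<Rightarrow> 'w \<Rightarrow> real ^ 'm) \<Rightarrow> real \<Rightarrow> 'w measure" where
  "filt M G W t = sigma (space M) (sets G \<union> sets (FW M W {0..t}))"

lemma filtration_filt: "filtration (space M) (filt M G W)" if "subalgebra M G"
proof -
  have G: "sets G \<subseteq> Pow (space M)"
    using that sets.space_closed[of G] by (simp add: subalgebra_def)
  have gen: "(\<Union>r\<in>J. sets (vimage_algebra (space M) (W r) borel)) \<subseteq> Pow (space M)" for J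
    using sets.space_closed[of "vimage_algebra (space M) (W r) borel" for r] by auto
  have sg: "sets (generated_by M W J) \<subseteq> Pow (space M)" for J
    using sets.space_closed[of "generated_by M W J"] by (simp add: generated_by_def space_measure_of_conv)
  have sf: "sets (FW M W J) \<subseteq> Pow (space M)" for J
    using sets.space_closed[of "FW M W J"] by (simp add: FW_def space_measure_of_conv)
  have nl: "null_sets M \<subseteq> Pow (space M)" by (auto dest: sets.sets_into_space)
  have gm: "sets (generated_by M W J) \<subseteq> sets (generated_by M W J')" if "J \<subseteq> J'" for J J'
  proof -
    have "(\<Union>r\<in>J. sets (vimage_algebra (space M) (W r) borel))
        \<subseteq> (\<Union>r\<in>J'. sets (vimage_algebra (space M) (W r) borel))" using that by blast
    then show ?thesis
      unfolding generated_by_def using gen by (simp add: sets_measure_of sigma_sets_mono')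
  qed
  have fm: "sets (FW M W J) \<subseteq> sets (FW M W J')" if "J \<subseteq> J'" for J J'
  proof -
    have "sets (generated_by M W J) \<union> null_sets M \<subseteq> sets (generated_by M W J') \<union> null_sets M"
      using gm[OF that] by blast
    then show ?thesis
      unfolding FW_def using sg nl by (simp add: sets_measure_of sigma_sets_mono')
  qed
  show ?thesis
  proof
    fix s t :: real assume "s \<le> t"
    then have "sets G \<union> sets (FW M W {0..s}) \<subseteq> sets G \<union> sets (FW M W {0..t})"
      using fm[of "{0..s}" "{0..t}"] by auto
    then show "sets (filt M G W s) \<subseteq> sets (filt M G W t)"
      unfolding filt_def using G sf by (simp add: sets_measure_of sigma_sets_mono')
  qed (simp add: filt_def space_measure_of_conv)
qed

locale two_scale_setting = prob_space M + complete_measure M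
  for M :: "'w measure" +
  fixes G :: "'w measure" and W :: "real \<Rightarrow> 'w \<Rightarrow> real ^ 'm" and T :: real
  assumes T_pos: "0 < T"
    and brownian: "brownian_motion M W"
    and G_sub: "subalgebra M G"
    and G_indep: "indep_set (sets G) (sets (FW M W {0..}))"
    and G_uniform: "\<exists>U\<in>borel_measurable G. distr M borel U = uniform_measure lborel {0..1::real}"


section \<open>Process spaces on \<open>[0,T]\<close>\<close>

text \<open>Here and below \<open>F\<close> is a filtration; processes are indexed by \<open>real\<close>, but only their values
  on \<open>[0,T]\<close> matter. The generating family of \<open>Prog\<close> is already a \<open>\<sigma>\<close>-algebra.\<close>

definition Prog :: "'w measure \<Rightarrow> (real \<Rightarrow> 'w measure) \<Rightarrow> real \<Rightarrow> (real \<times> 'w) measure" where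
  "Prog M F T = sigma ({0..T} \<times> space M)
     {C. C \<subseteq> {0..T} \<times> space M \<and>
         (\<forall>t\<in>{0..T}. C \<inter> ({0..t} \<times> space M) \<in> sets (restrict_space borel {0..t} \<Otimes>\<^sub>M F t))}"

lemma sets_Prog:
  assumes "\<And>t. space (F t) = space M"
  shows "sets (Prog M F T) = {C. C \<subseteq> {0..T} \<times> space M \<and>
    (\<forall>t\<in>{0..T}. C \<inter> ({0..t} \<times> space M) \<in> sets (restrict_space borel {0..t} \<Otimes>\<^sub>M F t))}"
    (is "_ = ?S")
proof -
  have sp: "space (restrict_space borel {0..t} \<Otimes>\<^sub>M F t) = {0..t} \<times> space M" for t :: real
    by (simp add: space_pair_measure space_restrict_space assms)
  have "sigma_algebra ({0..T} \<times> space M) ?S"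
  proof (rule sigma_algebra_iff2[THEN iffD2], intro conjI ballI allI impI)
    show "{} \<in> ?S" by simp
  next
    fix C assume C: "C \<in> ?S"
    have "({0..T} \<times> space M - C) \<inter> ({0..t} \<times> space M) \<in> sets (restrict_space borel {0..t} \<Otimes>\<^sub>M F t)"
      if t: "t \<in> {0..T}" for t
    proof -
      have "({0..T} \<times> space M - C) \<inter> ({0..t} \<times> space M) =
          space (restrict_space borel {0..t} \<Otimes>\<^sub>M F t) - C \<inter> ({0..t} \<times> space M)"
        using t unfolding sp by auto
      then show ?thesis using C t by (metis (no_types, lifting) mem_Collect_eq sets.compl_sets)
    qed
    then show "{0..T} \<times> space M - C \<in> ?S" by auto
  next
    fix D :: "nat \<Rightarrow> (real \<times> 'a) set" assume D: "range D \<subseteq> ?S"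
    have "(\<Union>i. D i) \<inter> ({0..t} \<times> space M) = (\<Union>i. D i \<inter> ({0..t} \<times> space M))" for t
      by auto
    moreover have "(\<Union>i. D i \<inter> ({0..t} \<times> space M)) \<in> sets (restrict_space borel {0..t} \<Otimes>\<^sub>M F t)"
      if "t \<in> {0..T}" for t
      using D that by (intro sets.countable_UN) blast
    ultimately show "(\<Union>i. D i) \<in> ?S" using D by auto
  qed auto
  then show ?thesis
    unfolding Prog_def by (subst sigma_algebra.sets_measure_of_eq) auto
qed

definition S2_sq :: "'w measure \<Rightarrow> real \<Rightarrow> (real \<Rightarrow> 'w \<Rightarrow> 'a::euclidean_space) \<Rightarrow> ennreal" where
  "S2_sq M T Y = (\<integral>\<^sup>+\<omega>. (SUP t\<in>{0..T}. ennreal ((norm (Y t \<omega>))\<^sup>2)) \<partial>M)"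

definition H2_sq :: "'w measure \<Rightarrow> real \<Rightarrow> (real \<Rightarrow> 'w \<Rightarrow> 'a::euclidean_space) \<Rightarrow> ennreal" where
  "H2_sq M T Z = (\<integral>\<^sup>+\<omega>. (\<integral>\<^sup>+t\<in>{0..T}. ennreal ((norm (Z t \<omega>))\<^sup>2) \<partial>lborel) \<partial>M)"

definition S2 :: "'w measure \<Rightarrow> (real \<Rightarrow> 'w measure) \<Rightarrow> real \<Rightarrow> (real \<Rightarrow> 'w \<Rightarrow> 'a::euclidean_space) set" where
  "S2 M F T = {Y. (\<forall>t\<in>{0..T}. Y t \<in> borel_measurable (F t)) \<and>
     (\<forall>\<omega>\<in>space M. continuous_on {0..T} (\<lambda>t. Y t \<omega>)) \<and> S2_sq M T Y < \<infinity>}"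

definition H2 :: "'w measure \<Rightarrow> (real \<Rightarrow> 'w measure) \<Rightarrow> real \<Rightarrow> (real \<Rightarrow> 'w \<Rightarrow> 'a::euclidean_space) set" where
  "H2 M F T = {Z. (\<lambda>(t, \<omega>). Z t \<omega>) \<in> borel_measurable (Prog M F T) \<and> H2_sq M T Z < \<infinity>}"

text \<open>The norms of \<open>S2\<close> and \<open>H2\<close>; they are only meaningful on these spaces, since
  \<open>enn2real \<infinity> = 0\<close>.\<close>

definition S2_norm :: "'w measure \<Rightarrow> real \<Rightarrow> (real \<Rightarrow> 'w \<Rightarrow> 'a::euclidean_space) \<Rightarrow> real" where
  "S2_norm M T Y = sqrt (enn2real (S2_sq M T Y))"

definition H2_norm :: "'w measure \<Rightarrow> real \<Rightarrow> (real \<Rightarrow> 'w \<Rightarrow> 'a::euclidean_space) \<Rightarrow> real" where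
  "H2_norm M T Z = sqrt (enn2real (H2_sq M T Z))"


section \<open>Stochastic integrals and stochastic differentials\<close>

text \<open>A triple \<open>(N, p, \<Phi>)\<close> stands for the simple integrand
  \<open>\<Sum>i<N. \<Phi>\<^sub>i 1\<^bsub>(p\<^sub>i, p\<^sub>i\<^sub>+\<^sub>1]\<^esub>\<close> with bounded, \<open>F\<^bsub>p\<^sub>i\<^esub>\<close>-measurable matrices \<open>\<Phi>\<^sub>i\<close>.\<close>

definition simple_integrand ::
  "'w measure \<Rightarrow> (real \<Rightarrow> 'w measure) \<Rightarrow> real \<Rightarrow>
    nat \<Rightarrow> (nat \<Rightarrow> real) \<Rightarrow> (nat \<Rightarrow> 'w \<Rightarrow> real ^ 'm ^ 'n) \<Rightarrow> bool" where
  "simple_integrand M F T N p \<Phi> \<longleftrightarrow>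
     p 0 = 0 \<and> p N = T \<and> (\<forall>i<N. p i < p (Suc i)) \<and>
     (\<forall>i<N. \<Phi> i \<in> borel_measurable (F (p i)) \<and> (\<exists>C. \<forall>\<omega>\<in>space M. norm (\<Phi> i \<omega>) \<le> C))"

definition simple_process ::
  "nat \<Rightarrow> (nat \<Rightarrow> real) \<Rightarrow> (nat \<Rightarrow> 'w \<Rightarrow> real ^ 'm ^ 'n) \<Rightarrow> real \<Rightarrow> 'w \<Rightarrow> real ^ 'm ^ 'n" where
  "simple_process N p \<Phi> t \<omega> = (\<Sum>i<N. indicator {p i<..p (Suc i)} t *\<^sub>R \<Phi> i \<omega>)"

definition simple_integral ::
  "(real \<Rightarrow> 'w \<Rightarrow> real ^ 'm) \<Rightarrow> nat \<Rightarrow> (nat \<Rightarrow> real) \<Rightarrow> (nat \<Rightarrow> 'w \<Rightarrow> real ^ 'm ^ 'n) \<Rightarrow>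
    real \<Rightarrow> 'w \<Rightarrow> real ^ 'n" where
  "simple_integral W N p \<Phi> t \<omega> =
     (\<Sum>i<N. \<Phi> i \<omega> *v (W (min (p (Suc i)) t) \<omega> - W (min (p i) t) \<omega>))"

text \<open>\<open>ito_integral M F W T Z I\<close> states that \<open>I\<^sub>t = \<integral>\<^sub>0\<^sup>t Z\<^sub>s dW\<^sub>s\<close> on \<open>[0,T]\<close>: the integral of
  \<open>Z \<in> H2\<close> is the \<open>S2\<close>-limit of the integrals of simple integrands approximating \<open>Z\<close> in \<open>H2\<close>.
  This determines \<open>I\<close> up to indistinguishability.\<close>

definition ito_integral ::
  "'w measure \<Rightarrow> (real \<Rightarrow> 'w measure) \<Rightarrow> (real \<Rightarrow> 'w \<Rightarrow> real ^ 'm) \<Rightarrow> real \<Rightarrow>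
    (real \<Rightarrow> 'w \<Rightarrow> real ^ 'm ^ 'n) \<Rightarrow> (real \<Rightarrow> 'w \<Rightarrow> real ^ 'n) \<Rightarrow> bool" where
  "ito_integral M F W T Z I \<longleftrightarrow> Z \<in> H2 M F T \<and> I \<in> S2 M F T \<and>
     (\<exists>N p \<Phi>. (\<forall>n. simple_integrand M F T (N n) (p n) (\<Phi> n)) \<and>
       ((\<lambda>n. H2_sq M T (\<lambda>t \<omega>. simple_process (N n) (p n) (\<Phi> n) t \<omega> - Z t \<omega>)) \<longlonglongrightarrow> 0) \<and>
       ((\<lambda>n. S2_sq M T (\<lambda>t \<omega>. simple_integral W (N n) (p n) (\<Phi> n) t \<omega> - I t \<omega>)) \<longlonglongrightarrow> 0))"

text \<open>\<open>dY\<^sub>t = f\<^sub>t dt + Z\<^sub>t dW\<^sub>t\<close> on \<open>[0,T]\<close>.\<close>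

definition has_stoch_differential ::
  "'w measure \<Rightarrow> (real \<Rightarrow> 'w measure) \<Rightarrow> (real \<Rightarrow> 'w \<Rightarrow> real ^ 'm) \<Rightarrow> real \<Rightarrow>
    (real \<Rightarrow> 'w \<Rightarrow> real ^ 'n) \<Rightarrow> (real \<Rightarrow> 'w \<Rightarrow> real ^ 'n) \<Rightarrow> (real \<Rightarrow> 'w \<Rightarrow> real ^ 'm ^ 'n) \<Rightarrow> bool" where
  "has_stoch_differential M F W T Y f Z \<longleftrightarrow>
     (\<lambda>(t, \<omega>). f t \<omega>) \<in> borel_measurable (Prog M F T) \<and>
     (AE \<omega> in M. set_integrable lborel {0..T} (\<lambda>t. f t \<omega>)) \<and>
     (\<exists>I. ito_integral M F W T Z I \<and>
       (AE \<omega> in M. \<forall>t\<in>{0..T}. Y t \<omega> = Y 0 \<omega> + (LINT s:{0..t}|lborel. f s \<omega>) + I t \<omega>))"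


section \<open>Mean-field coefficients and the two assumptions\<close>

type_synonym ('w, 'd, 'k, 'v) coefficient =
  "real \<Rightarrow> 'w \<Rightarrow> real ^ 'd \<Rightarrow> (real ^ 'd) measure \<Rightarrow> real ^ 'k \<Rightarrow> (real ^ 'k) measure \<Rightarrow> 'v"

text \<open>The process \<open>h(t, X\<^sub>t, \<P>\<^bsub>X\<^sub>t\<^esub>, A\<^sub>t, \<P>\<^bsub>A\<^sub>t\<^esub>)\<close>. For \<open>A \<in> H2\<close> the law of \<open>A\<^sub>t\<close> lies in \<open>P2\<close> only
  for almost every \<open>t\<close>; at the remaining times, where \<open>h\<close> is mathematically undefined (and the
  total function \<open>h\<close> unconstrained), the process is set to \<open>0\<close>.\<close>

definition along ::
  "'w measure \<Rightarrow> ('w, 'd::finite, 'k::finite, 'v::euclidean_space) coefficient \<Rightarrow>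
    (real \<Rightarrow> 'w \<Rightarrow> real ^ 'd) \<Rightarrow> (real \<Rightarrow> 'w \<Rightarrow> real ^ 'k) \<Rightarrow> real \<Rightarrow> 'w \<Rightarrow> 'v" where
  "along M h X A t \<omega> =
     (if law M (X t) \<in> P2 \<and> law M (A t) \<in> P2
      then h t \<omega> (X t \<omega>) (law M (X t)) (A t \<omega>) (law M (A t)) else 0)"

definition coeff_measurable ::
  "'w measure \<Rightarrow> (real \<Rightarrow> 'w measure) \<Rightarrow> real \<Rightarrow> ('w, 'd::finite, 'k::finite, 'v::euclidean_space) coefficient \<Rightarrow> bool" where
  "coeff_measurable M F T h \<longleftrightarrow>
     (\<lambda>((t, \<omega>), x, \<mu>, a, \<nu>). h t \<omega> x \<mu> a \<nu>) \<in>
       borel_measurable (Prog M F T \<Otimes>\<^sub>M borel \<Otimes>\<^sub>M borel_P2 \<Otimes>\<^sub>M borel \<Otimes>\<^sub>M borel_P2)"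

text \<open>The parameter \<open>\<beta>\<close> matters only on positive \<open>\<epsilon>\<close>. On matrices, \<open>norm\<close> is the Frobenius norm.\<close>

locale assumption_A =
  fixes M :: "'w measure" and F :: "real \<Rightarrow> 'w measure" and T :: real
    and \<beta> :: "real \<Rightarrow> real"
    and b :: "('w, 'd::finite, 'k::finite, real ^ 'd) coefficient"
    and \<sigma> :: "('w, 'd, 'k, real ^ 'm ^ 'd) coefficient"
    and B :: "('w, 'd, 'k, real ^ 'k) coefficient"
    and \<Sigma> :: "('w, 'd, 'k, real ^ 'm ^ 'k) coefficient"
  assumes beta: "((\<lambda>\<epsilon>. \<beta> \<epsilon> / \<epsilon>) \<longlongrightarrow> 0) (at_right 0)"
    and meas: "coeff_measurable M F T b" "coeff_measurable M F T \<sigma>"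
      "coeff_measurable M F T B" "coeff_measurable M F T \<Sigma>"
    and growth: "\<exists>K>0. \<forall>t\<in>{0..T}. \<forall>\<omega>\<in>space M. \<forall>x a. \<forall>\<mu>\<in>P2. \<forall>\<nu>\<in>P2.
        norm (b t \<omega> x \<mu> a \<nu>) + norm (\<sigma> t \<omega> x \<mu> a \<nu>)
          \<le> K * (1 + norm x + norm_P2 \<mu> + norm a + norm_P2 \<nu>) \<and>
        norm (B t \<omega> x \<mu> a \<nu>) + norm (\<Sigma> t \<omega> x \<mu> a \<nu>)
          \<le> K * (1 + norm x + norm_P2 \<mu> + norm a + norm_P2 \<nu>)"
    and lipschitz: "\<exists>K>0. \<forall>t\<in>{0..T}. \<forall>\<omega>\<in>space M. \<forall>x x' a a'. \<forall>\<mu>\<in>P2. \<forall>\<mu>'\<in>P2. \<forall>\<nu>\<in>P2. \<forall>\<nu>'\<in>P2.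
        norm (b t \<omega> x \<mu> a \<nu> - b t \<omega> x' \<mu>' a' \<nu>')
          \<le> K * (norm (x - x') + W2 \<mu> \<mu>' + norm (a - a') + W2 \<nu> \<nu>') \<and>
        norm (\<sigma> t \<omega> x \<mu> a \<nu> - \<sigma> t \<omega> x' \<mu>' a' \<nu>')
          \<le> K * (norm (x - x') + W2 \<mu> \<mu>' + norm (a - a') + W2 \<nu> \<nu>') \<and>
        norm (\<Sigma> t \<omega> x \<mu> a \<nu> - \<Sigma> t \<omega> x' \<mu>' a' \<nu>')
          \<le> K * (norm (x - x') + W2 \<mu> \<mu>' + norm (a - a') + W2 \<nu> \<nu>') \<and>
        norm (B t \<omega> x \<mu> a \<nu> - B t \<omega> x' \<mu>' a \<nu>) \<le> K * (norm (x - x') + W2 \<mu> \<mu>')"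
    and monotone: "\<exists>c>0. \<forall>t\<in>{0..T}. \<forall>\<zeta>\<in>L2_rv M M. \<forall>\<theta>\<in>L2_rv M M. \<forall>\<theta>'\<in>L2_rv M M.
        (LINT \<omega>|M. (B t \<omega> (\<zeta> \<omega>) (law M \<zeta>) (\<theta> \<omega>) (law M \<theta>)
                     - B t \<omega> (\<zeta> \<omega>) (law M \<zeta>) (\<theta>' \<omega>) (law M \<theta>')) \<bullet> (\<theta> \<omega> - \<theta>' \<omega>))
          \<le> - c * (LINT \<omega>|M. (norm (\<theta> \<omega> - \<theta>' \<omega>))\<^sup>2)"

definition equilibrium_pair ::
  "'w measure \<Rightarrow> (real \<Rightarrow> 'w measure) \<Rightarrow> (real \<Rightarrow> 'w \<Rightarrow> real ^ 'm) \<Rightarrow> real \<Rightarrow>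
    ('w, 'd, 'k, real ^ 'd) coefficient \<Rightarrow> ('w, 'd, 'k, real ^ 'm ^ 'd) coefficient \<Rightarrow>
    ('w, 'd, 'k, real ^ 'k) coefficient \<Rightarrow> ('w \<Rightarrow> real ^ 'd) \<Rightarrow>
    (real \<Rightarrow> 'w \<Rightarrow> real ^ 'd) \<Rightarrow> (real \<Rightarrow> 'w \<Rightarrow> real ^ 'k) \<Rightarrow> bool" where
  "equilibrium_pair M F W T b \<sigma> B \<xi> X \<alpha> \<longleftrightarrow>
     X \<in> S2 M F T \<and> \<alpha> \<in> H2 M F T \<and>
     has_stoch_differential M F W T X (along M b X \<alpha>) (along M \<sigma> X \<alpha>) \<and>
     (AE \<omega> in M. X 0 \<omega> = \<xi> \<omega>) \<and>
     H2_sq M T (along M B X \<alpha>) = 0"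

definition assumption_B ::
  "'w measure \<Rightarrow> 'w measure \<Rightarrow> (real \<Rightarrow> 'w measure) \<Rightarrow> (real \<Rightarrow> 'w \<Rightarrow> real ^ 'm) \<Rightarrow> real \<Rightarrow>
    ('w, 'd, 'k, real ^ 'd) coefficient \<Rightarrow> ('w, 'd, 'k, real ^ 'm ^ 'd) coefficient \<Rightarrow>
    ('w, 'd, 'k, real ^ 'k) coefficient \<Rightarrow> bool" where
  "assumption_B M G F W T b \<sigma> B \<longleftrightarrow>
     (\<forall>\<xi>\<in>L2_rv M G. \<exists>\<alpha> X. equilibrium_pair M F W T b \<sigma> B \<xi> X \<alpha>)"

text \<open>The second equation is written for \<open>\<epsilon> A\<^sup>\<epsilon>\<close>, i.e. \<open>\<epsilon> dA\<^sup>\<epsilon>\<^sub>t = B dt + \<beta>\<^sup>\<epsilon> \<Sigma> dW\<^sub>t\<close>.\<close>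

definition two_scale_solution ::
  "'w measure \<Rightarrow> (real \<Rightarrow> 'w measure) \<Rightarrow> (real \<Rightarrow> 'w \<Rightarrow> real ^ 'm) \<Rightarrow> real \<Rightarrow> (real \<Rightarrow> real) \<Rightarrow>
    ('w, 'd, 'k, real ^ 'd) coefficient \<Rightarrow> ('w, 'd, 'k, real ^ 'm ^ 'd) coefficient \<Rightarrow>
    ('w, 'd, 'k, real ^ 'k) coefficient \<Rightarrow> ('w, 'd, 'k, real ^ 'm ^ 'k) coefficient \<Rightarrow>
    ('w \<Rightarrow> real ^ 'd) \<Rightarrow> ('w \<Rightarrow> real ^ 'k) \<Rightarrow> real \<Rightarrow>
    (real \<Rightarrow> 'w \<Rightarrow> real ^ 'd) \<Rightarrow> (real \<Rightarrow> 'w \<Rightarrow> real ^ 'k) \<Rightarrow> bool" where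
  "two_scale_solution M F W T \<beta> b \<sigma> B \<Sigma> \<xi> \<eta> \<epsilon> X A \<longleftrightarrow>
     X \<in> S2 M F T \<and> A \<in> S2 M F T \<and>
     has_stoch_differential M F W T X (along M b X A) (along M \<sigma> X A) \<and>
     has_stoch_differential M F W T (\<lambda>t \<omega>. \<epsilon> *\<^sub>R A t \<omega>)
       (along M B X A) (\<lambda>t \<omega>. \<beta> \<epsilon> *\<^sub>R along M \<Sigma> X A t \<omega>) \<and>
     (AE \<omega> in M. X 0 \<omega> = \<xi> \<omega>) \<and> (AE \<omega> in M. A 0 \<omega> = \<eta> \<omega>)"

end

theory Submission
  imports Defs
begin

text \<open>
  With the Ito isometry and Fubini one obtains the energy identity for a process with a square-integrable
  drift without Ito's formula. The process \<open>\<alpha>hat\<close> is only progressively measurable, so it cannot be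
  subtracted from \<open>A\<^sup>\<epsilon>\<close> inside that identity; it is replaced there by \<open>p(t) = \<integral>\<^sub>0\<^sup>t q(s) ds\<close> with \<open>q\<close>
  adapted, obtained from backward averages of truncations of \<open>\<alpha>hat\<close>. Monotonicity, however, is applied
  between \<open>A\<^sup>\<epsilon>\<close> and \<open>\<alpha>hat\<close> themselves, because \<open>B\<close> need not be continuous in \<open>a\<close>; the term
  \<open>B \<bullet> (p - \<alpha>hat)\<close> that this leaves over is controlled by linear growth. This bounds
  \<open>E \<integral> |A\<^sup>\<epsilon> - \<alpha>hat|\<^sup>2\<close> by \<open>E \<integral> |X\<^sup>\<epsilon> - Xhat|\<^sup>2\<close> plus a remainder, and Gronwall's inequality gives, for the
  total squared error \<open>S\<close>,
  \<open>S \<le> C (1 + S) (r + \<epsilon> (1 + r\<^sup>2 + \<parallel>q\<parallel>\<^sup>2) + \<beta>(\<epsilon>)\<^sup>2 / \<epsilon>)\<close> with \<open>r = \<parallel>p - \<alpha>hat\<parallel>\<close>. One first makes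
  \<open>r\<close> small and then lets \<open>\<epsilon> \<rightarrow> 0\<close>; Doob's inequality turns the \<open>L\<^sup>2\<close> bounds on \<open>X\<^sup>\<epsilon> - Xhat\<close> into bounds on
  the supremum.
\<close>

section \<open>Square-integrable functions\<close>

text \<open>No bound on the solutions that is uniform in \<epsilon> is established beforehand. The
  linear growth terms are measured against the fixed pair (\<open>Xhat\<close>,
  \<open>\<alpha>hat\<close>) plus the error, and this is the origin of the factor 1 + S: the
  estimate refers to itself and becomes a bound once its prefactor is at most 1/2. The constant C
  depends neither on \<epsilon> nor on p and q. Nothing controls the norm of q as r becomes small,
  so p has to be fixed before \<epsilon> is sent to 0.

  A second obstacle is measurability. That B vanishes along (\<open>Xhat\<close>,
  \<open>\<alpha>hat\<close>) is given as a vanishing iterated integral, which yields an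
  almost-everywhere identity through joint measurability of the integrand. This in turn asks for
  measurability in t of the law of \<open>\<alpha>hat t\<close>, for a process without continuity in
  time. The same primitives p settle it: they move continuously in L2 and converge to
  \<open>\<alpha>hat\<close> at almost every time along a subsequence.\<close>

definition sq_int :: "'a measure \<Rightarrow> ('a \<Rightarrow> 'b::euclidean_space) \<Rightarrow> bool" where
  "sq_int N f \<longleftrightarrow> f \<in> borel_measurable N \<and> integrable N (\<lambda>x. (norm (f x))\<^sup>2)"

definition l2 :: "'a measure \<Rightarrow> ('a \<Rightarrow> 'b::euclidean_space) \<Rightarrow> real" where
  "l2 N f = sqrt (LINT x|N. (norm (f x))\<^sup>2)"

lemma sq_int_integrable: "sq_int N f \<Longrightarrow> integrable N (\<lambda>x. (norm (f x))\<^sup>2)"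
  by (simp add: sq_int_def)

lemma l2_nonneg[simp]: "0 \<le> l2 N f"
  by (simp add: l2_def)

lemma l2_squared: "(l2 N f)\<^sup>2 = (LINT x|N. (norm (f x))\<^sup>2)"
  by (simp add: l2_def)

lemma sq_int_mono:
  assumes "sq_int N f" "g \<in> borel_measurable N" "AE x in N. norm (g x) \<le> norm (f x)"
  shows "sq_int N g"
proof -
  have [measurable]: "f \<in> borel_measurable N" using assms by (simp add: sq_int_def)
  note [measurable] = assms(2)
  show ?thesis unfolding sq_int_def
    by (intro conjI assms Bochner_Integration.integrable_bound[OF sq_int_integrable[OF assms(1)]])
       (use assms(3) in \<open>auto elim!: eventually_mono intro: power_mono\<close>)
qed

lemma l2_mono:
  assumes "sq_int N f" "AE x in N. norm (g x) \<le> norm (f x)"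
  shows "l2 N g \<le> l2 N f"
proof (cases "integrable N (\<lambda>x. (norm (g x))\<^sup>2)")
  case True
  show ?thesis unfolding l2_def
    using assms(2)
    by (intro real_sqrt_le_mono integral_mono_AE True sq_int_integrable[OF assms(1)])
       (auto elim!: eventually_mono intro: power_mono)
next
  \<comment> \<open>A Bochner integral that does not converge has value 0, so the left-hand norm is
    0 by convention.\<close>
  case False
  then show ?thesis by (simp add: l2_def not_integrable_integral_eq)
qed

lemma sq_int_mult_norm:
  assumes "sq_int N f" "sq_int N g"
  shows "integrable N (\<lambda>x. norm (f x) * norm (g x))"
proof -
  have [measurable]: "f \<in> borel_measurable N" "g \<in> borel_measurable N" using assms by (simp_all add: sq_int_def)
  have "norm (f x) * norm (g x) \<le> (norm (f x))\<^sup>2 + (norm (g x))\<^sup>2" for x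
  proof -
    have "0 \<le> norm (f x) * norm (g x)" by simp
    then show ?thesis using sum_squares_bound[of "norm (f x)" "norm (g x)"] by linarith
  qed
  then show ?thesis
    by (intro Bochner_Integration.integrable_bound[OF Bochner_Integration.integrable_add[OF assms[THEN sq_int_integrable]]])
       auto
qed

lemma sq_int_inner:
  assumes "sq_int N f" "sq_int N g"
  shows "integrable N (\<lambda>x. f x \<bullet> g x)"
proof -
  have [measurable]: "f \<in> borel_measurable N" "g \<in> borel_measurable N" using assms by (simp_all add: sq_int_def)
  show ?thesis
  proof (rule Bochner_Integration.integrable_bound[OF sq_int_mult_norm[OF assms]])
    show "(\<lambda>x. f x \<bullet> g x) \<in> borel_measurable N" by simp
    have "norm (f x \<bullet> g x) \<le> norm (norm (f x) * norm (g x))" for x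
      using Cauchy_Schwarz_ineq2[of "f x" "g x"] by simp
    then show "AE x in N. norm (f x \<bullet> g x) \<le> norm (norm (f x) * norm (g x))" by blast
  qed
qed

lemma sq_int_add:
  assumes "sq_int N f" "sq_int N g"
  shows "sq_int N (\<lambda>x. f x + g x)"
proof -
  have [measurable]: "f \<in> borel_measurable N" "g \<in> borel_measurable N" using assms by (simp_all add: sq_int_def)
  have "integrable N (\<lambda>x. (norm (f x))\<^sup>2 + 2 * (f x \<bullet> g x) + (norm (g x))\<^sup>2)"
    using sq_int_inner[OF assms] assms[THEN sq_int_integrable] by auto
  moreover have "(norm (f x + g x))\<^sup>2 = (norm (f x))\<^sup>2 + 2 * (f x \<bullet> g x) + (norm (g x))\<^sup>2" for x
    by (simp add: power2_norm_eq_inner inner_add_left inner_add_right inner_commute)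
  ultimately show ?thesis by (simp add: sq_int_def)
qed

lemma sq_int_scaleR: "sq_int N f \<Longrightarrow> sq_int N (\<lambda>x. c *\<^sub>R f x)"
  by (auto simp: sq_int_def power_mult_distrib)

lemma sq_int_minus: "sq_int N f \<Longrightarrow> sq_int N (\<lambda>x. - f x)"
  by (simp add: sq_int_def)

lemma sq_int_diff: "sq_int N f \<Longrightarrow> sq_int N g \<Longrightarrow> sq_int N (\<lambda>x. f x - g x)"
  using sq_int_add[of N f "\<lambda>x. - g x"] sq_int_minus[of N g] by simp

lemma sq_int_zero[simp]: "sq_int N (\<lambda>x. 0)"
  by (simp add: sq_int_def)

lemma sq_int_sum: "(\<And>i. i \<in> I \<Longrightarrow> sq_int N (f i)) \<Longrightarrow> sq_int N (\<lambda>x. \<Sum>i\<in>I. f i x)"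
  by (induction I rule: infinite_finite_induct) (auto intro: sq_int_add)

lemma sq_int_norm: "sq_int N f \<Longrightarrow> sq_int N (\<lambda>x. norm (f x))"
  by (auto simp: sq_int_def)

lemma sq_int_const: "finite_measure N \<Longrightarrow> sq_int N (\<lambda>x. c)"
  by (simp add: sq_int_def finite_measure.integrable_const)

lemma sq_int_bounded:
  assumes "finite_measure N" "f \<in> borel_measurable N" "\<And>x. x \<in> space N \<Longrightarrow> norm (f x) \<le> C"
  shows "sq_int N f"
  using assms
  by (intro sq_int_mono[OF sq_int_const[OF assms(1), of C]] AE_I2) (auto intro: order_trans[OF _ abs_ge_self])

lemma sq_int_cong_AE:
  assumes "sq_int N f" "g \<in> borel_measurable N" "AE x in N. f x = g x"
  shows "sq_int N g"
  by (rule sq_int_mono[OF assms(1,2)]) (use assms(3) in \<open>auto elim!: eventually_mono\<close>)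

lemma l2_cong_AE:
  assumes "f \<in> borel_measurable N" "g \<in> borel_measurable N" "AE x in N. f x = g x"
  shows "l2 N f = l2 N g"
  unfolding l2_def using assms by (intro arg_cong[where f=sqrt] integral_cong_AE) auto

lemma l2_cong: "(\<And>x. x \<in> space N \<Longrightarrow> norm (f x) = norm (g x)) \<Longrightarrow> l2 N f = l2 N g"
  unfolding l2_def by (intro arg_cong[where f=sqrt] Bochner_Integration.integral_cong) auto

lemma l2_zero[simp]: "l2 N (\<lambda>x. 0) = 0"
  by (simp add: l2_def)

lemma l2_scaleR: "l2 N (\<lambda>x. c *\<^sub>R f x) = \<bar>c\<bar> * l2 N f"
  by (simp add: l2_def power_mult_distrib real_sqrt_mult)

lemma l2_minus: "l2 N (\<lambda>x. - f x) = l2 N f"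
  by (simp add: l2_def)

lemma l2_minus_commute: "l2 N (\<lambda>x. f x - g x) = l2 N (\<lambda>x. g x - f x)"
  by (simp add: l2_def norm_minus_commute)

lemma l2_norm: "l2 N (\<lambda>x. norm (f x)) = l2 N f"
  by (simp add: l2_def)

text \<open>Cauchy-Schwarz, read off from the nonnegativity of the quadratic polynomial in t given
  by the squared L2 norm of |f| - t |g|.\<close>

lemma LINT_norm_mult_le_l2:
  assumes "sq_int N f" "sq_int N g"
  shows "(LINT x|N. norm (f x) * norm (g x)) \<le> l2 N f * l2 N g"
proof -
  let ?a = "LINT x|N. (norm (f x))\<^sup>2" and ?b = "LINT x|N. (norm (g x))\<^sup>2"
    and ?c = "LINT x|N. norm (f x) * norm (g x)"
  note i = assms[THEN sq_int_integrable] sq_int_mult_norm[OF assms]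
  have q: "0 \<le> ?b * t\<^sup>2 - 2 * t * ?c + ?a" for t
  proof -
    have "0 \<le> (LINT x|N. (norm (f x) - t * norm (g x))\<^sup>2)" by (intro integral_nonneg_AE) auto
    also have "\<dots> = (LINT x|N. (norm (f x))\<^sup>2 - 2 * t * (norm (f x) * norm (g x)) + t\<^sup>2 * (norm (g x))\<^sup>2)"
      by (intro Bochner_Integration.integral_cong refl) (simp add: power2_eq_square algebra_simps)
    also have "\<dots> = ?a - 2 * t * ?c + t\<^sup>2 * ?b" using i by simp
    finally show ?thesis by (simp add: algebra_simps)
  qed
  have a0: "0 \<le> ?a" "0 \<le> ?b" by (auto intro!: integral_nonneg_AE)
  have "?c\<^sup>2 \<le> ?a * ?b"
  proof (cases "?b = 0")
    case True
    have "?c = 0"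
    proof (rule ccontr)
      assume "?c \<noteq> 0"
      \<comment> \<open>With b = 0 the polynomial is affine in t, and this choice of t gives it the
        value -1.\<close>
      then have "2 * ((?a + 1) / (2 * ?c)) * ?c = ?a + 1" by simp
      with q[of "(?a + 1) / (2 * ?c)"] True show False by simp
    qed
    then show ?thesis using True by simp
  next
    case False
    then have b: "0 < ?b" using a0(2) by (metis less_le)
    \<comment> \<open>For b > 0 the polynomial is smallest at t = c / b.\<close>
    have "?b * (?c / ?b)\<^sup>2 - 2 * (?c / ?b) * ?c + ?a = ?a - ?c\<^sup>2 / ?b"
      using b by (simp add: power2_eq_square field_simps)
    with q[of "?c / ?b"] have "?c\<^sup>2 / ?b \<le> ?a" by simp
    then show ?thesis using b by (simp add: field_simps)
  qed
  then have "?c \<le> sqrt (?a * ?b)" using real_le_rsqrt by blast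
  then show ?thesis unfolding l2_def real_sqrt_mult .
qed

lemma abs_LINT_inner_le_l2:
  assumes "sq_int N f" "sq_int N g"
  shows "\<bar>LINT x|N. f x \<bullet> g x\<bar> \<le> l2 N f * l2 N g"
proof -
  have "\<bar>LINT x|N. f x \<bullet> g x\<bar> \<le> (LINT x|N. norm (f x) * norm (g x))"
    using integral_norm_bound[of N "\<lambda>x. f x \<bullet> g x"]
      integral_mono[OF integrable_abs[OF sq_int_inner[OF assms]] sq_int_mult_norm[OF assms] Cauchy_Schwarz_ineq2]
    by (simp only: real_norm_def)
  then show ?thesis using LINT_norm_mult_le_l2[OF assms] by linarith
qed

lemma l2_add_squared:
  assumes "sq_int N f" "sq_int N g"
  shows "(l2 N (\<lambda>x. f x + g x))\<^sup>2 = (l2 N f)\<^sup>2 + 2 * (LINT x|N. f x \<bullet> g x) + (l2 N g)\<^sup>2"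
proof -
  have "(norm (f x + g x))\<^sup>2 = (norm (f x))\<^sup>2 + 2 * (f x \<bullet> g x) + (norm (g x))\<^sup>2" for x
    by (simp add: power2_norm_eq_inner inner_add_left inner_add_right inner_commute)
  then show ?thesis
    using assms[THEN sq_int_integrable] sq_int_inner[OF assms] by (simp add: l2_squared)
qed

lemma l2_triangle:
  assumes "sq_int N f" "sq_int N g"
  shows "l2 N (\<lambda>x. f x + g x) \<le> l2 N f + l2 N g"
proof (rule power2_le_imp_le)
  show "(l2 N (\<lambda>x. f x + g x))\<^sup>2 \<le> (l2 N f + l2 N g)\<^sup>2"
    using abs_LINT_inner_le_l2[OF assms] by (simp add: l2_add_squared[OF assms] power2_sum)
qed simp

lemma l2_triangle_diff:
  assumes "sq_int N f" "sq_int N g"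
  shows "l2 N (\<lambda>x. f x - g x) \<le> l2 N f + l2 N g"
  using l2_triangle[OF assms(1) sq_int_minus[OF assms(2)]] by (simp add: l2_minus)

lemma l2_triangle3:
  assumes "sq_int N f" "sq_int N g" "sq_int N h"
  shows "l2 N (\<lambda>x. f x - h x) \<le> l2 N (\<lambda>x. f x - g x) + l2 N (\<lambda>x. g x - h x)"
  using l2_triangle[OF sq_int_diff[OF assms(1,2)] sq_int_diff[OF assms(2,3)]] by simp

text \<open>Joint continuity of the inner product in L2: the difference is expanded around the
  limits and every term is bounded by Cauchy-Schwarz. It carries orthogonality relations from simple
  integrals to their limits.\<close>

lemma LINT_inner_tendsto_l2:
  assumes "\<And>n. sq_int N (f n)" "\<And>n. sq_int N (g n)" "sq_int N f'" "sq_int N g'"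
    and lim: "(\<lambda>n. l2 N (\<lambda>x. f n x - f' x)) \<longlonglongrightarrow> 0" "(\<lambda>n. l2 N (\<lambda>x. g n x - g' x)) \<longlonglongrightarrow> 0"
  shows "(\<lambda>n. LINT x|N. f n x \<bullet> g n x) \<longlonglongrightarrow> (LINT x|N. f' x \<bullet> g' x)"
proof -
  let ?a = "\<lambda>n. l2 N (\<lambda>x. f n x - f' x)" and ?b = "\<lambda>n. l2 N (\<lambda>x. g n x - g' x)"
  have "\<bar>(LINT x|N. f n x \<bullet> g n x) - (LINT x|N. f' x \<bullet> g' x)\<bar> \<le> ?a n * ?b n + ?a n * l2 N g' + l2 N f' * ?b n" for n
  proof -
    note d = sq_int_diff[OF assms(1)[of n] assms(3)] sq_int_diff[OF assms(2)[of n] assms(4)]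
    have "(LINT x|N. f n x \<bullet> g n x) - (LINT x|N. f' x \<bullet> g' x)
        = (LINT x|N. (f n x - f' x) \<bullet> (g n x - g' x) + (f n x - f' x) \<bullet> g' x + f' x \<bullet> (g n x - g' x))"
      using sq_int_inner[OF assms(1,2)] sq_int_inner[OF assms(3,4)]
      by (subst Bochner_Integration.integral_diff[symmetric])
         (auto intro!: Bochner_Integration.integral_cong simp: inner_diff_left inner_diff_right)
    also have "\<dots> = (LINT x|N. (f n x - f' x) \<bullet> (g n x - g' x)) + (LINT x|N. (f n x - f' x) \<bullet> g' x)
        + (LINT x|N. f' x \<bullet> (g n x - g' x))"
      using sq_int_inner[OF d] sq_int_inner[OF d(1) assms(4)] sq_int_inner[OF assms(3) d(2)] by simp
    finally show ?thesis
      using abs_LINT_inner_le_l2[OF d] abs_LINT_inner_le_l2[OF d(1) assms(4)] abs_LINT_inner_le_l2[OF assms(3) d(2)]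
      by linarith
  qed
  then have b: "eventually (\<lambda>n. norm ((LINT x|N. f n x \<bullet> g n x) - (LINT x|N. f' x \<bullet> g' x))
      \<le> ?a n * ?b n + ?a n * l2 N g' + l2 N f' * ?b n) sequentially"
    by (simp only: real_norm_def eventually_True)
  from lim have "(\<lambda>n. ?a n * ?b n + ?a n * l2 N g' + l2 N f' * ?b n) \<longlonglongrightarrow> 0 * 0 + 0 * l2 N g' + l2 N f' * 0"
    by (intro tendsto_intros lim)
  then have "(\<lambda>n. ?a n * ?b n + ?a n * l2 N g' + l2 N f' * ?b n) \<longlonglongrightarrow> 0"
    by simp
  then have "(\<lambda>n. (LINT x|N. f n x \<bullet> g n x) - (LINT x|N. f' x \<bullet> g' x)) \<longlonglongrightarrow> 0"
    by (rule Lim_null_comparison[OF b])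
  then show ?thesis
    by (rule LIM_zero_cancel)
qed

lemma sq_intI_nn_integral:
  assumes "f \<in> borel_measurable N" "(\<integral>\<^sup>+x. ennreal ((norm (f x))\<^sup>2) \<partial>N) < \<infinity>"
  shows "sq_int N f"
  using assms unfolding sq_int_def by (auto intro!: integrableI_bounded)

lemma nn_integral_eq_l2:
  assumes "sq_int N f"
  shows "(\<integral>\<^sup>+x. ennreal ((norm (f x))\<^sup>2) \<partial>N) = ennreal ((l2 N f)\<^sup>2)"
  using assms by (simp add: l2_squared nn_integral_eq_integral sq_int_def)

lemma sq_int_imp_integrable:
  assumes "finite_measure N" "sq_int N f"
  shows "integrable N f"
proof -
  interpret finite_measure N by fact
  show ?thesis
    using sq_int_mult_norm[OF sq_int_const[OF assms(1), of "1::real"] assms(2)] assms(2)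
    by (auto simp: sq_int_def intro: integrable_norm_cancel)
qed

lemma borel_measurable_matrix_component:
  "\<Phi> \<in> borel_measurable N \<Longrightarrow> (\<lambda>\<omega>. (\<Phi> \<omega> :: real^'m^'n) $ i $ j) \<in> borel_measurable N"
  by (rule measurable_compose[of \<Phi> N borel "\<lambda>x. x $ i $ j"])
     (simp_all add: borel_measurable_continuous_onI continuous_on_component continuous_on_id)

lemma borel_measurable_vec_component:
  "f \<in> borel_measurable N \<Longrightarrow> (\<lambda>\<omega>. (f \<omega> :: real^'n) $ i) \<in> borel_measurable N"
  by (rule measurable_compose[of f N borel "\<lambda>x. x $ i"])
     (simp_all add: borel_measurable_continuous_onI continuous_on_component continuous_on_id)

lemma (in prob_space) indep_set_mono:
  assumes "indep_set A B" "A' \<subseteq> A" "B' \<subseteq> B"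
  shows "indep_set A' B'"
  using assms indep_setD_ev1[OF assms(1)] indep_setD_ev2[OF assms(1)]
  by (intro indep_setI) (auto intro: indep_setD[OF assms(1)])

section \<open>Brownian increments and the filtration\<close>

context two_scale_setting
begin

abbreviation "F \<equiv> filt M G W"

lemma W_measurable[measurable]: "0 \<le> t \<Longrightarrow> W t \<in> borel_measurable M"
  using brownian by (auto simp: brownian_motion_def)

lemma sets_G: "sets G \<subseteq> sets M" and space_G: "space G = space M"
  using G_sub by (auto simp: subalgebra_def)

lemma sets_generated_by: "J \<subseteq> {0..} \<Longrightarrow> sets (generated_by M W J) \<subseteq> sets M"
proof -
  assume J: "J \<subseteq> {0..}"
  have "(\<Union>r\<in>J. sets (vimage_algebra (space M) (W r) borel)) \<subseteq> sets M"
    using J measurable_sets[OF W_measurable] by (auto simp: sets_vimage_algebra2 subset_iff)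
  then show ?thesis
    unfolding generated_by_def using sets.sets_into_space
    by (subst sets_measure_of) (auto intro!: sets.sigma_sets_subset)
qed

lemma space_FW[simp]: "space (FW M W J) = space M"
  by (simp add: FW_def space_measure_of_conv)

lemma sets_FW_eq: "J \<subseteq> {0..} \<Longrightarrow>
    sets (FW M W J) = sigma_sets (space M) (sets (generated_by M W J) \<union> null_sets M)"
  unfolding FW_def
  by (rule sets_measure_of) (use sets_generated_by[of J] sets.sets_into_space in blast)

lemma sets_FW: "J \<subseteq> {0..} \<Longrightarrow> sets (FW M W J) \<subseteq> sets M"
  unfolding sets_FW_eq using sets_generated_by[of J] by (intro sets.sigma_sets_subset) auto

lemma sets_FW_mono: "J \<subseteq> J' \<Longrightarrow> J' \<subseteq> {0..} \<Longrightarrow> sets (FW M W J) \<subseteq> sets (FW M W J')"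
proof -
  assume J: "J \<subseteq> J'" "J' \<subseteq> {0..}"
  have "sets (generated_by M W J) \<subseteq> sets (generated_by M W J')"
    using J unfolding generated_by_def
    by (subst (1 2) sets_measure_of) (auto intro!: sigma_sets_mono' simp: sets_vimage_algebra2)
  then show ?thesis
    using J by (simp add: sets_FW_eq subset_trans[OF J]) (intro sigma_sets_mono', auto)
qed

lemma space_F[simp]: "space (F t) = space M"
  by (simp add: filt_def space_measure_of_conv)

lemma sets_F_eq: "sets (F t) = sigma_sets (space M) (sets G \<union> sets (FW M W {0..t}))"
  unfolding filt_def
proof (rule sets_measure_of)
  have "sets G \<union> sets (FW M W {0..t}) \<subseteq> sets M" using sets_G sets_FW[of "{0..t}"] by auto
  then show "sets G \<union> sets (FW M W {0..t}) \<subseteq> Pow (space M)" using sets.space_closed by blast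
qed

lemma subalgebra_F: "subalgebra M (F t)"
  unfolding subalgebra_def sets_F_eq
  using sets_G sets_FW[of "{0..t}"] by (auto intro!: sets.sigma_sets_subset)

lemma sets_F_mono: "s \<le> t \<Longrightarrow> sets (F s) \<subseteq> sets (F t)"
  using filtration.sets_F_mono[OF filtration_filt[OF G_sub]] by blast

lemma measurable_F_M: "f \<in> borel_measurable (F t) \<Longrightarrow> f \<in> borel_measurable M"
  using measurable_from_subalg[OF subalgebra_F] .

lemma measurable_F_mono: "f \<in> borel_measurable (F s) \<Longrightarrow> s \<le> t \<Longrightarrow> f \<in> borel_measurable (F t)"
  using sets_F_mono[of s t] by (rule_tac measurable_from_subalg) (auto simp: subalgebra_def)

lemma W_measurable_FW: "t \<in> J \<Longrightarrow> J \<subseteq> {0..} \<Longrightarrow> W t \<in> borel_measurable (FW M W J)"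
proof -
  assume t: "t \<in> J" "J \<subseteq> {0..}"
  show ?thesis
  proof (rule measurableI)
    fix S :: "(real ^ 'm) set" assume S: "S \<in> sets borel"
    have "W t -` S \<inter> space M \<in> sets (generated_by M W J)"
      unfolding generated_by_def
      using t S by (subst sets_measure_of) (auto simp: sets_vimage_algebra2)
    then show "W t -` S \<inter> space (FW M W J) \<in> sets (FW M W J)"
      by (simp add: sets_FW_eq[OF t(2)])
  qed simp
qed

lemma W_measurable_F: "0 \<le> t \<Longrightarrow> t \<le> s \<Longrightarrow> W t \<in> borel_measurable (F s)"
proof -
  assume t: "0 \<le> t" "t \<le> s"
  have "W t \<in> borel_measurable (FW M W {0..s})" using t by (intro W_measurable_FW) auto
  then show ?thesis
    by (rule measurable_from_subalg[rotated]) (auto simp: subalgebra_def sets_F_eq)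
qed

text \<open>The definition of Brownian motion gives independence only from the raw history. Null
  sets are added by comparing each set with a raw one up to a null symmetric difference;
  \<open>G\<close> is added through the \<pi>-system of intersections, using its independence of the
  whole Brownian history.\<close>

lemma indep_increment_F:
  assumes st: "0 \<le> s" "s < t"
  shows "indep_set (sets (F s)) (sets (vimage_algebra (space M) (\<lambda>\<omega>. W t \<omega> - W s \<omega>) borel))"
proof -
  let ?V = "sets (vimage_algebra (space M) (\<lambda>\<omega>. W t \<omega> - W s \<omega>) borel)"
  have D: "(\<lambda>\<omega>. W t \<omega> - W s \<omega>) \<in> borel_measurable (FW M W {0..t})"
    using st by (intro borel_measurable_diff W_measurable_FW) auto
  have V0: "?V \<subseteq> sets (FW M W {0..t})"
    using measurable_sets[OF D] by (auto simp: sets_vimage_algebra2)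
  have VM: "?V \<subseteq> events" using V0 sets_FW[of "{0..t}"] by auto
  have VI: "?V \<subseteq> sets (FW M W {0..})" using V0 sets_FW_mono[of "{0..t}" "{0..}"] by auto
  have indW: "indep_set (sets (generated_by M W {0..s})) ?V"
    using brownian st by (auto simp: brownian_motion_def)
  have gs: "sigma_sets (space M) (sets (generated_by M W {0..s})) = sets (generated_by M W {0..s})"
    using sets.sigma_sets_eq[of "generated_by M W {0..s}"] by (simp add: generated_by_def space_measure_of_conv)
  have vs: "sigma_sets (space M) ?V = ?V"
    using sets.sigma_sets_eq[of "vimage_algebra (space M) (\<lambda>\<omega>. W t \<omega> - W s \<omega>) borel"]
    by simp
  have Vst: "Int_stable ?V" by (auto simp: Int_stable_def)
  have "indep_set (sets (FW M W {0..s})) ?V"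
  proof -
    have "indep_set {x \<in> events. \<exists>y\<in>sets (generated_by M W {0..s}). sym_diff x y \<in> null_sets M} ?V"
    proof (rule indep_setI)
      fix a v assume "a \<in> {x \<in> events. \<exists>y\<in>sets (generated_by M W {0..s}). sym_diff x y \<in> null_sets M}"
        and v: "v \<in> ?V"
      then obtain y where a: "a \<in> events" and y: "y \<in> sets (generated_by M W {0..s})"
        and n: "sym_diff a y \<in> null_sets M" by auto
      have ye: "y \<in> events" using y sets_generated_by[of "{0..s}"] by auto
      have ve: "v \<in> events" using v VM by auto
      have ae: "AE x in M. x \<in> a \<longleftrightarrow> x \<in> y"
        using AE_not_in[OF n] by eventually_elim auto
      have "prob (a \<inter> v) = prob (y \<inter> v)" "prob a = prob y"
        using ae by (auto intro!: finite_measure_eq_AE a ye ve)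
      then show "prob (a \<inter> v) = prob a * prob v"
        using indep_setD[OF indW y v] by simp
    qed (use VM in auto)
    moreover have "sets (FW M W {0..s}) \<subseteq> {x \<in> events. \<exists>y\<in>sets (generated_by M W {0..s}). sym_diff x y \<in> null_sets M}"
      (is "_ \<subseteq> ?S")
    proof -
      \<comment> \<open>The events that agree with a raw event up to a null set form a
        \<sigma>-algebra: complements keep the symmetric difference, and a union enlarges it at most
        to a countable union of null sets.\<close>
      have "sigma_sets (space M) (sets (generated_by M W {0..s}) \<union> null_sets M) \<subseteq> ?S"
      proof
        fix x assume "x \<in> sigma_sets (space M) (sets (generated_by M W {0..s}) \<union> null_sets M)"
        then show "x \<in> ?S"
        proof induction
          case (Basic a)
          then show ?case
          proof
            assume "a \<in> sets (generated_by M W {0..s})"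
            then show ?thesis using sets_generated_by[of "{0..s}"] by (auto intro!: bexI[of _ a])
          next
            assume "a \<in> null_sets M"
            then show ?thesis by (auto intro!: bexI[of _ "{}"])
          qed
        next
          case Empty
          then show ?case by (auto intro!: bexI[of _ "{}"])
        next
          case (Compl a)
          then obtain y where y: "y \<in> sets (generated_by M W {0..s})" "sym_diff a y \<in> null_sets M" "a \<in> events"
            by auto
          have "y \<subseteq> space M" using y(1) sets_generated_by[of "{0..s}"] sets.sets_into_space by auto
          moreover have "a \<subseteq> space M" using y(3) sets.sets_into_space by auto
          ultimately have "sym_diff (space M - a) (space M - y) = sym_diff a y" by auto
          moreover have "space M - y \<in> sets (generated_by M W {0..s})"
            using sets.compl_sets[OF y(1)] by (simp add: generated_by_def space_measure_of_conv)
          ultimately show ?case using y by (auto intro!: bexI[of _ "space M - y"])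
        next
          case (Union a)
          then have "\<forall>i. \<exists>y. y \<in> sets (generated_by M W {0..s}) \<and> sym_diff (a i) y \<in> null_sets M" by blast
          then obtain y where y: "\<And>i. y i \<in> sets (generated_by M W {0..s})" "\<And>i. sym_diff (a i) (y i) \<in> null_sets M"
            by metis
          have ev: "(\<Union>i. a i) \<in> events" using Union by auto
          have yU: "(\<Union>i. y i) \<in> sets (generated_by M W {0..s})" using y by auto
          have "sym_diff (\<Union>i. a i) (\<Union>i. y i) \<in> null_sets M"
          proof (rule null_sets_subset)
            show "(\<Union>i. sym_diff (a i) (y i)) \<in> null_sets M" using y by auto
            show "sym_diff (\<Union>i. a i) (\<Union>i. y i) \<in> events"
              using ev yU sets_generated_by[of "{0..s}"] by auto
          qed auto
          then show ?case using ev yU by blast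
        qed
      qed
      then show ?thesis by (simp add: sets_FW_eq)
    qed
    ultimately show ?thesis
      by (rule indep_set_mono) simp
  qed
  then have indFW: "prob (f \<inter> v) = prob f * prob v" if "f \<in> sets (FW M W {0..s})" "v \<in> ?V" for f v
    using that by (rule indep_setD)
  let ?P = "{g \<inter> f | g f. g \<in> sets G \<and> f \<in> sets (FW M W {0..s})}"
  have Gf: "prob (g \<inter> f) = prob g * prob f" if "g \<in> sets G" "f \<in> sets (FW M W {0..})" for g f
    using G_indep that by (rule indep_setD)
  have FWI: "sets (FW M W {0..s}) \<subseteq> sets (FW M W {0..})" by (rule sets_FW_mono) auto
  have "indep_set ?P ?V"
  proof (rule indep_setI)
    show "?P \<subseteq> events" using sets_G sets_FW[of "{0..s}"] by auto
    show "?V \<subseteq> events" by (rule VM)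
    fix p v assume "p \<in> ?P" and v: "v \<in> ?V"
    then obtain g f where p: "p = g \<inter> f" and g: "g \<in> sets G" and f: "f \<in> sets (FW M W {0..s})" by auto
    \<comment> \<open>The increment after s also belongs to the Brownian history, so
      \<open>f \<inter> v\<close> is a single set of that history and \<open>G\<close> separates
      from both factors at once.\<close>
    have "prob (g \<inter> (f \<inter> v)) = prob g * prob (f \<inter> v)"
      using f v FWI VI by (intro Gf g sets.Int) auto
    also have "\<dots> = prob g * prob f * prob v" using indFW[OF f v] by simp
    also have "prob g * prob f = prob (g \<inter> f)" using Gf[OF g] f FWI by auto
    finally show "prob (p \<inter> v) = prob p * prob v" by (simp add: p Int_assoc)
  qed
  moreover have "Int_stable ?P"
  proof (rule Int_stableI)
    fix a b assume "a \<in> ?P" "b \<in> ?P"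
    then obtain g f g' f' where "a = g \<inter> f" "g \<in> sets G" "f \<in> sets (FW M W {0..s})"
      "b = g' \<inter> f'" "g' \<in> sets G" "f' \<in> sets (FW M W {0..s})" by auto
    then show "a \<inter> b \<in> ?P" 
      by (intro CollectI exI[of _ "g \<inter> g'"] exI[of _ "f \<inter> f'"]) auto
  qed
  ultimately have ind: "indep_set (sigma_sets (space M) ?P) (sigma_sets (space M) ?V)"
    using Vst by (intro indep_set_sigma_sets)
  have "sets G \<union> sets (FW M W {0..s}) \<subseteq> ?P"
  proof -
    have "space M \<in> sets (FW M W {0..s})" using sets.top[of "FW M W {0..s}"] by simp
    moreover have "space M \<in> sets G" using sets.top[of G] by (simp add: space_G)
    moreover have "g \<inter> space M = g" if "g \<in> sets G" for g using sets.sets_into_space[OF that] space_G by auto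
    moreover have "space M \<inter> f = f" if "f \<in> sets (FW M W {0..s})" for f using sets.sets_into_space[OF that] by auto
    ultimately show ?thesis by (intro subsetI) (elim UnE; metis (mono_tags, lifting) mem_Collect_eq)
  qed
  then have "sets (F s) \<subseteq> sigma_sets (space M) ?P"
    unfolding sets_F_eq by (rule sigma_sets_mono')
  with ind show ?thesis
    unfolding vs by (rule indep_set_mono) simp
qed

text \<open>The function g is left general so that one independence statement serves single
  coordinates of the increment as well as products of two coordinates.\<close>

lemma indep_var_increment:
  fixes \<zeta> :: "'w \<Rightarrow> real" and g :: "real ^ 'm \<Rightarrow> real"
  assumes st: "0 \<le> s" "s < t" and z: "\<zeta> \<in> borel_measurable (F s)" and g: "g \<in> borel_measurable borel"
  shows "indep_var borel \<zeta> borel (\<lambda>\<omega>. g (W t \<omega> - W s \<omega>))"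
proof (subst indep_var_eq, intro conjI)
  show "random_variable borel \<zeta>" using z by (rule measurable_F_M)
  show "random_variable borel (\<lambda>\<omega>. g (W t \<omega> - W s \<omega>))"
    using g st by (intro measurable_compose[OF _ g] borel_measurable_diff W_measurable) auto
  let ?V = "sets (vimage_algebra (space M) (\<lambda>\<omega>. W t \<omega> - W s \<omega>) borel)"
  have 1: "sigma_sets (space M) {\<zeta> -` A \<inter> space M |A. A \<in> sets borel} \<subseteq> sets (F s)"
    using measurable_sets[OF z] by (intro sets.sigma_sets_subset[of _ "F s", simplified]) auto
  have 2: "sigma_sets (space M) {(\<lambda>\<omega>. g (W t \<omega> - W s \<omega>)) -` A \<inter> space M |A. A \<in> sets borel} \<subseteq> ?V"
  proof -
    have "(\<lambda>\<omega>. g (W t \<omega> - W s \<omega>)) \<in> borel_measurable (vimage_algebra (space M) (\<lambda>\<omega>. W t \<omega> - W s \<omega>) borel)"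
      by (rule measurable_compose[OF measurable_vimage_algebra1 g]) auto
    from measurable_sets[OF this] show ?thesis
      by (intro sets.sigma_sets_subset[of _ "vimage_algebra (space M) (\<lambda>\<omega>. W t \<omega> - W s \<omega>) borel", simplified]) auto
  qed
  show "indep_set (sigma_sets (space M) {\<zeta> -` A \<inter> space M |A. A \<in> sets borel})
     (sigma_sets (space M) {(\<lambda>\<omega>. g (W t \<omega> - W s \<omega>)) -` A \<inter> space M |A. A \<in> sets borel})"
    using indep_increment_F[OF st] 1 2 by (rule indep_set_mono)
qed

end

section \<open>Gaussian moments of Brownian increments\<close>

lemma lborel_vec_integral_prod:
  fixes f :: "'m::finite \<Rightarrow> real \<Rightarrow> real"
  assumes "\<And>i. integrable lborel (f i)"
  shows "integrable lborel (\<lambda>x::real^'m. \<Prod>i\<in>UNIV. f i (x $ i))"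
    and "(LINT x|lborel. (\<Prod>i\<in>UNIV. f i ((x::real^'m) $ i))) = (\<Prod>i\<in>UNIV. LINT x|lborel. f i x)"
proof -
  interpret product_sigma_finite "\<lambda>b::real^'m. lborel :: real measure" by standard
  \<comment> \<open>The basis vectors of \<open>real ^ 'm\<close> are the \<open>axis i 1\<close>;
    this carries Fubini for the product measure over \<open>Basis\<close> to products over the index
    type.\<close>
  have bij: "bij_betw (\<lambda>i. axis i (1::real)) (UNIV :: 'm set) Basis"
    unfolding bij_betw_def Basis_vec_def by (auto simp: inj_on_def axis_eq_axis)
  let ?h = "\<lambda>y::real^'m \<Rightarrow> real. \<Sum>b\<in>Basis. y b *\<^sub>R b"
  have [measurable]: "f i \<in> borel_measurable borel" for i using assms[of i] by (auto dest: borel_measurable_integrable)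
  have h: "?h y $ i = y (axis i 1)" for y i
  proof -
    have "?h y $ i = ?h y \<bullet> axis i 1" by (simp add: inner_axis)
    also have "\<dots> = y (axis i 1)" by (subst inner_sum_left_Basis) (auto simp: Basis_vec_def)
    finally show ?thesis .
  qed
  define k where "k b = (the_inv_into UNIV (\<lambda>i::'m. axis i (1::real)) b)" for b
  have k: "k (axis i 1) = i" for i
    unfolding k_def by (rule the_inv_into_f_f) (auto simp: inj_on_def axis_eq_axis)
  have p: "(\<Prod>i\<in>UNIV. f i (?h y $ i)) = (\<Prod>b\<in>Basis. f (k b) (y b))" for y
    by (subst prod.reindex_bij_betw[OF bij, symmetric]) (simp only: h k)
  have hm: "?h \<in> (\<Pi>\<^sub>M b\<in>Basis. lborel) \<rightarrow>\<^sub>M borel" by measurable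
  have I: "integrable (\<Pi>\<^sub>M b\<in>(Basis::(real^'m) set). lborel) (\<lambda>y. \<Prod>b\<in>Basis. f (k b) (y b))"
    by (rule product_integrable_prod) (auto intro: assms)
  have "(\<lambda>x::real^'m. x $ i) \<in> borel_measurable borel" for i
    by (intro borel_measurable_continuous_onI continuous_intros)
  then have fm: "(\<lambda>x::real^'m. \<Prod>i\<in>UNIV. f i (x $ i)) \<in> borel_measurable borel"
    by (intro borel_measurable_prod) (auto intro: measurable_compose)
  show "integrable lborel (\<lambda>x::real^'m. \<Prod>i\<in>UNIV. f i (x $ i))"
    by (subst lborel_eq) (unfold integrable_distr_eq[OF hm fm] p, rule I)
  have "(LINT x|lborel. (\<Prod>i\<in>UNIV. f i ((x::real^'m) $ i)))
      = (LINT y|(\<Pi>\<^sub>M b\<in>(Basis::(real^'m) set). lborel). (\<Prod>b\<in>Basis. f (k b) (y b)))"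
    by (subst lborel_eq) (simp only: integral_distr[OF hm fm] p)
  also have "\<dots> = (\<Prod>b\<in>Basis. LINT x|lborel. f (k b) x)"
    by (rule product_integral_prod) (auto intro: assms)
  also have "\<dots> = (\<Prod>i\<in>UNIV. LINT x|lborel. f i x)"
    by (subst prod.reindex_bij_betw[OF bij, symmetric]) (simp add: k)
  finally show "(LINT x|lborel. (\<Prod>i\<in>UNIV. f i ((x::real^'m) $ i))) = (\<Prod>i\<in>UNIV. LINT x|lborel. f i x)" .
qed

context two_scale_setting
begin

text \<open>Every moment wanted is that of a monomial in the coordinates. The density is a product,
  so such a moment factors into one-dimensional normal moments of order at most 2.\<close>

lemma increment_moments:
  assumes st: "0 \<le> s" "s < t"
  shows "integrable M (\<lambda>\<omega>. (W t \<omega> - W s \<omega>) $ j)"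
    and "expectation (\<lambda>\<omega>. (W t \<omega> - W s \<omega>) $ j) = 0"
    and "integrable M (\<lambda>\<omega>. (W t \<omega> - W s \<omega>) $ j * (W t \<omega> - W s \<omega>) $ l)"
    and "expectation (\<lambda>\<omega>. (W t \<omega> - W s \<omega>) $ j * (W t \<omega> - W s \<omega>) $ l) = (if j = l then t - s else 0)"
proof -
  let ?n = "normal_density 0 (sqrt (t - s))"
  let ?d = "\<lambda>x::real^'m. \<Prod>i\<in>UNIV. ?n (x $ i)"
  have D: "distributed M lborel (\<lambda>\<omega>. W t \<omega> - W s \<omega>) (\<lambda>x. ennreal (?d x))"
    using brownian st by (auto simp: brownian_motion_def)
  have pos: "0 < sqrt (t - s)" using st by simp
  have d0: "0 \<le> ?d x" for x by (intro prod_nonneg) simp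
  have i1: "integrable lborel (\<lambda>x. ?n x * x ^ k)" for k
    using integrable_normal_moment[OF pos, of 0 k] by simp
  have m0: "(LINT x|lborel. ?n x) = 1" using pos by simp
  have m1: "(LINT x|lborel. ?n x * x) = 0"
    using integral_normal_moment_nz_1[OF pos, of 0] by simp
  have m2: "(LINT x|lborel. ?n x * x ^ 2) = t - s"
    using integral_normal_moment_even[OF pos, of 0 1] st by simp
  have xm: "(\<lambda>x::real^'m. x $ i) \<in> borel_measurable lborel" for i
    by (intro borel_measurable_vec_component) simp
  define f where "f e i x = ?n x * x ^ e i" for e :: "'m \<Rightarrow> nat" and i x
  have fi: "integrable lborel (f e i)" for e i unfolding f_def by (rule i1)
  have pj: "(\<Prod>i\<in>UNIV. x $ i ^ (if i = j then 1 else 0)) = x $ j" for x :: "real^'m" and j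
    by (simp add: if_distrib[of "\<lambda>k. _ ^ k"] prod.delta cong: if_cong)
  have ex: "integrable M (\<lambda>\<omega>. \<Prod>i\<in>UNIV. (W t \<omega> - W s \<omega>) $ i ^ e i) \<and>
      expectation (\<lambda>\<omega>. \<Prod>i\<in>UNIV. (W t \<omega> - W s \<omega>) $ i ^ e i) = (\<Prod>i\<in>UNIV. LINT x|lborel. f e i x)" for e
  proof -
    have gm: "(\<lambda>x::real^'m. \<Prod>i\<in>UNIV. x $ i ^ e i) \<in> borel_measurable lborel"
      using xm by (intro borel_measurable_prod borel_measurable_power) auto
    have p: "(\<Prod>i\<in>UNIV. f e i (x $ i)) = ?d x * (\<Prod>i\<in>UNIV. x $ i ^ e i)" for x :: "real^'m"
      by (simp add: f_def prod.distrib)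
    have "integrable M (\<lambda>\<omega>. \<Prod>i\<in>UNIV. (W t \<omega> - W s \<omega>) $ i ^ e i)"
      using lborel_vec_integral_prod(1)[of "f e", OF fi] unfolding p
      by (subst (asm) distributed_integrable[OF D gm d0]) 
    moreover have "expectation (\<lambda>\<omega>. \<Prod>i\<in>UNIV. (W t \<omega> - W s \<omega>) $ i ^ e i) = (\<Prod>i\<in>UNIV. LINT x|lborel. f e i x)"
      using lborel_vec_integral_prod(2)[of "f e", OF fi] unfolding p
      by (subst (asm) distributed_integral[OF D gm d0]) 
    ultimately show ?thesis by simp
  qed
  show "integrable M (\<lambda>\<omega>. (W t \<omega> - W s \<omega>) $ j)"
    using ex[of "\<lambda>i. if i = j then 1 else 0"] unfolding pj by simp
  have "(\<Prod>i\<in>UNIV. LINT x|lborel. f (\<lambda>i. if i = j then 1 else 0) i x) = 0"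
    by (rule prod_zero) (auto intro!: bexI[of _ j] simp: f_def m1)
  then show "expectation (\<lambda>\<omega>. (W t \<omega> - W s \<omega>) $ j) = 0"
    using ex[of "\<lambda>i. if i = j then 1 else 0"] unfolding pj by simp
  \<comment> \<open>The exponent counts how often i occurs among j and l, so one computation covers
    the diagonal and the off-diagonal case.\<close>
  define e where "e i = (if i = j then 1 else 0) + (if i = l then 1 else (0::nat))" for i
  have pe: "(\<Prod>i\<in>UNIV. x $ i ^ e i) = x $ j * x $ l" for x :: "real^'m"
    unfolding e_def power_add prod.distrib pj ..
  show "integrable M (\<lambda>\<omega>. (W t \<omega> - W s \<omega>) $ j * (W t \<omega> - W s \<omega>) $ l)"
    using ex[of e] unfolding pe by simp
  have "(\<Prod>i\<in>UNIV. LINT x|lborel. f e i x) = (if j = l then t - s else 0)"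
  proof (cases "j = l")
    case True
    have "(LINT x|lborel. f e i x) = (if i = j then t - s else 1)" for i
      using True m0 m2 by (simp add: f_def e_def numeral_2_eq_2)
    then show ?thesis using True by (simp add: prod.delta)
  next
    case False
    then have "(LINT x|lborel. f e j x) = 0" by (simp add: f_def e_def m1)
    then have "(\<Prod>i\<in>UNIV. LINT x|lborel. f e i x) = 0" by (intro prod_zero) auto
    then show ?thesis using False by simp
  qed
  then show "expectation (\<lambda>\<omega>. (W t \<omega> - W s \<omega>) $ j * (W t \<omega> - W s \<omega>) $ l) = (if j = l then t - s else 0)"
    using ex[of e] unfolding pe by simp
qed

lemma increment_sq_int:
  assumes "0 \<le> s" "s \<le> t"
  shows "sq_int M (\<lambda>\<omega>. W t \<omega> - W s \<omega>)"
proof (cases "s = t")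
  case False
  with assms have st: "s < t" by simp
  have "integrable M (\<lambda>\<omega>. \<Sum>j\<in>UNIV. (W t \<omega> - W s \<omega>) $ j * (W t \<omega> - W s \<omega>) $ j)"
    using increment_moments(3)[OF assms(1) st] by simp
  moreover have "(norm x)\<^sup>2 = (\<Sum>j\<in>UNIV. x $ j * x $ j)" for x :: "real^'m"
    by (simp add: power2_norm_eq_inner inner_vec_def)
  ultimately show ?thesis
    using assms by (simp add: sq_int_def)
qed simp

text \<open>The factor \<zeta> is known at time s, hence independent of the increment. Equal times
  are included because a partition interval that has been cut may degenerate.\<close>

lemma expectation_mult_increment:
  assumes st: "0 \<le> s" "s \<le> t" and z: "\<zeta> \<in> borel_measurable (F s)" "integrable M \<zeta>"
  shows "integrable M (\<lambda>\<omega>. \<zeta> \<omega> * (W t \<omega> - W s \<omega>) $ j)"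
    and "expectation (\<lambda>\<omega>. \<zeta> \<omega> * (W t \<omega> - W s \<omega>) $ j) = 0"
    and "integrable M (\<lambda>\<omega>. \<zeta> \<omega> * ((W t \<omega> - W s \<omega>) $ j * (W t \<omega> - W s \<omega>) $ l))"
    and "expectation (\<lambda>\<omega>. \<zeta> \<omega> * ((W t \<omega> - W s \<omega>) $ j * (W t \<omega> - W s \<omega>) $ l)) =
      (if j = l then (t - s) * expectation \<zeta> else 0)"
proof -
  have "(integrable M (\<lambda>\<omega>. \<zeta> \<omega> * (W t \<omega> - W s \<omega>) $ j) \<and>
    expectation (\<lambda>\<omega>. \<zeta> \<omega> * (W t \<omega> - W s \<omega>) $ j) = 0) \<and>
    (integrable M (\<lambda>\<omega>. \<zeta> \<omega> * ((W t \<omega> - W s \<omega>) $ j * (W t \<omega> - W s \<omega>) $ l)) \<and>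
    expectation (\<lambda>\<omega>. \<zeta> \<omega> * ((W t \<omega> - W s \<omega>) $ j * (W t \<omega> - W s \<omega>) $ l)) =
      (if j = l then (t - s) * expectation \<zeta> else 0))"
  proof (cases "s = t")
    case False
    with st have lt: "s < t" by simp
    have cm: "(\<lambda>x::real^'m. x $ i) \<in> borel_measurable borel" for i
      by (intro borel_measurable_continuous_onI continuous_intros)
    have cm2: "(\<lambda>x::real^'m. x $ i * x $ k) \<in> borel_measurable borel" for i k
      by (intro borel_measurable_continuous_onI continuous_intros)
    note i1 = indep_var_increment[OF st(1) lt z(1) cm[of j]]
    note i2 = indep_var_increment[OF st(1) lt z(1) cm2[of j l]]
    note m = increment_moments[OF st(1) lt]
    show ?thesis
      using indep_var_lebesgue_integral[OF i1 z(2) m(1)] indep_var_integrable[OF i1 z(2) m(1)]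
        indep_var_lebesgue_integral[OF i2 z(2) m(3)] indep_var_integrable[OF i2 z(2) m(3)]
      unfolding m(2) m(4) by simp
  qed simp
  then show "integrable M (\<lambda>\<omega>. \<zeta> \<omega> * (W t \<omega> - W s \<omega>) $ j)"
    and "expectation (\<lambda>\<omega>. \<zeta> \<omega> * (W t \<omega> - W s \<omega>) $ j) = 0"
    and "integrable M (\<lambda>\<omega>. \<zeta> \<omega> * ((W t \<omega> - W s \<omega>) $ j * (W t \<omega> - W s \<omega>) $ l))"
    and "expectation (\<lambda>\<omega>. \<zeta> \<omega> * ((W t \<omega> - W s \<omega>) $ j * (W t \<omega> - W s \<omega>) $ l)) =
      (if j = l then (t - s) * expectation \<zeta> else 0)" by blast+
qed

lemma matrix_inner_expand: "((\<Phi>::real^'m^'n) *v x) \<bullet> y = (\<Sum>i\<in>UNIV. \<Sum>j\<in>UNIV. (\<Phi> $ i $ j * y $ i) * x $ j)"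
  by (simp add: inner_vec_def matrix_vector_mult_def sum_distrib_left sum_distrib_right mult_ac)

lemma abs_matrix_component_le: "\<bar>(A::real^'m^'n) $ i $ j\<bar> \<le> norm A"
  using component_le_norm_cart[of "A $ i" j] Finite_Cartesian_Product.norm_nth_le[of A i] by simp

text \<open>Independence is used for real variables, so the inner product is expanded into
  coordinates: each summand is an integrable factor known at s times one centred coordinate of the
  increment.\<close>

lemma expectation_inner_matrix_increment:
  fixes \<Phi> :: "'w \<Rightarrow> real^'m^'n"
  assumes st: "0 \<le> s" "s \<le> t" and P: "\<Phi> \<in> borel_measurable (F s)" "\<And>\<omega>. \<omega> \<in> space M \<Longrightarrow> norm (\<Phi> \<omega>) \<le> C"
    and z: "\<zeta> \<in> borel_measurable (F s)" "sq_int M \<zeta>"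
  shows "expectation (\<lambda>\<omega>. \<zeta> \<omega> \<bullet> (\<Phi> \<omega> *v (W t \<omega> - W s \<omega>))) = 0"
proof -
  have zi: "integrable M (\<lambda>\<omega>. \<Phi> \<omega> $ i $ j * \<zeta> \<omega> $ i)" for i j
  proof (rule Bochner_Integration.integrable_bound[OF integrable_mult_right[OF integrable_norm[OF sq_int_imp_integrable[OF finite_measure_axioms z(2)]]]])
    show "(\<lambda>\<omega>. \<Phi> \<omega> $ i $ j * \<zeta> \<omega> $ i) \<in> borel_measurable M"
      by (intro borel_measurable_times borel_measurable_matrix_component borel_measurable_vec_component measurable_F_M[OF P(1)] measurable_F_M[OF z(1)])
    show "AE \<omega> in M. norm (\<Phi> \<omega> $ i $ j * \<zeta> \<omega> $ i) \<le> norm (\<bar>C\<bar> * norm (\<zeta> \<omega>))"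
    proof (rule AE_I2)
      fix \<omega> assume "\<omega> \<in> space M"
      then have "\<bar>\<Phi> \<omega> $ i $ j\<bar> \<le> \<bar>C\<bar>" using abs_matrix_component_le[of "\<Phi> \<omega>" i j] P(2) by fastforce
      then show "norm (\<Phi> \<omega> $ i $ j * \<zeta> \<omega> $ i) \<le> norm (\<bar>C\<bar> * norm (\<zeta> \<omega>))"
        using component_le_norm_cart[of "\<zeta> \<omega>" i] by (simp add: abs_mult mult_mono)
    qed
  qed
  have zm: "(\<lambda>\<omega>. \<Phi> \<omega> $ i $ j * \<zeta> \<omega> $ i) \<in> borel_measurable (F s)" for i j
    by (intro borel_measurable_times borel_measurable_matrix_component borel_measurable_vec_component P z)
  note e = expectation_mult_increment[OF st zm zi]
  show ?thesis
    by (subst inner_commute, subst matrix_inner_expand)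
       (simp only: e Bochner_Integration.integral_sum Bochner_Integration.integrable_sum sum.neutral_const)
qed

text \<open>Different coordinates of the increment are uncorrelated and each has variance t - s, so
  the triple sum collapses to the Frobenius inner product.\<close>

lemma expectation_inner_matrix_increment2:
  fixes \<Phi> \<Psi> :: "'w \<Rightarrow> real^'m^'n"
  assumes st: "0 \<le> s" "s \<le> t" and P: "\<Phi> \<in> borel_measurable (F s)" "\<And>\<omega>. \<omega> \<in> space M \<Longrightarrow> norm (\<Phi> \<omega>) \<le> C"
    and Q: "\<Psi> \<in> borel_measurable (F s)" "\<And>\<omega>. \<omega> \<in> space M \<Longrightarrow> norm (\<Psi> \<omega>) \<le> C'"
  shows "expectation (\<lambda>\<omega>. (\<Phi> \<omega> *v (W t \<omega> - W s \<omega>)) \<bullet> (\<Psi> \<omega> *v (W t \<omega> - W s \<omega>))) =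
    (t - s) * expectation (\<lambda>\<omega>. \<Phi> \<omega> \<bullet> \<Psi> \<omega>)"
proof -
  have zm: "(\<lambda>\<omega>. \<Phi> \<omega> $ i $ j * \<Psi> \<omega> $ i $ l) \<in> borel_measurable (F s)" for i j l
    by (intro borel_measurable_times borel_measurable_matrix_component P Q)
  have zi: "integrable M (\<lambda>\<omega>. \<Phi> \<omega> $ i $ j * \<Psi> \<omega> $ i $ l)" for i j l
  proof (rule integrable_const_bound)
    show "AE \<omega> in M. norm (\<Phi> \<omega> $ i $ j * \<Psi> \<omega> $ i $ l) \<le> \<bar>C\<bar> * \<bar>C'\<bar>"
    proof (rule AE_I2)
      fix \<omega> assume "\<omega> \<in> space M"
      then have "\<bar>\<Phi> \<omega> $ i $ j\<bar> \<le> \<bar>C\<bar>" "\<bar>\<Psi> \<omega> $ i $ l\<bar> \<le> \<bar>C'\<bar>"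
        using abs_matrix_component_le[of "\<Phi> \<omega>" i j] P(2) abs_matrix_component_le[of "\<Psi> \<omega>" i l] Q(2) by fastforce+
      then show "norm (\<Phi> \<omega> $ i $ j * \<Psi> \<omega> $ i $ l) \<le> \<bar>C\<bar> * \<bar>C'\<bar>"
        by (simp add: abs_mult mult_mono)
    qed
  qed (rule measurable_F_M[OF zm])
  note e = expectation_mult_increment[OF st zm zi]
  have ex: "(\<Phi> \<omega> *v x) \<bullet> (\<Psi> \<omega> *v x) = (\<Sum>i\<in>UNIV. \<Sum>j\<in>UNIV. \<Sum>l\<in>UNIV. (\<Phi> \<omega> $ i $ j * \<Psi> \<omega> $ i $ l) * (x $ j * x $ l))" for \<omega> x
    by (simp add: inner_vec_def matrix_vector_mult_def sum_product mult_ac)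
  have "expectation (\<lambda>\<omega>. (\<Phi> \<omega> *v (W t \<omega> - W s \<omega>)) \<bullet> (\<Psi> \<omega> *v (W t \<omega> - W s \<omega>)))
      = (\<Sum>i\<in>UNIV. \<Sum>j\<in>UNIV. \<Sum>l\<in>UNIV. if j = l then (t - s) * expectation (\<lambda>\<omega>. \<Phi> \<omega> $ i $ j * \<Psi> \<omega> $ i $ l) else 0)"
    unfolding ex by (simp only: e Bochner_Integration.integral_sum Bochner_Integration.integrable_sum)
  also have "\<dots> = (\<Sum>i\<in>UNIV. \<Sum>j\<in>UNIV. (t - s) * expectation (\<lambda>\<omega>. \<Phi> \<omega> $ i $ j * \<Psi> \<omega> $ i $ j))"
    by (simp add: sum.delta)
  also have "\<dots> = (t - s) * expectation (\<lambda>\<omega>. \<Phi> \<omega> \<bullet> \<Psi> \<omega>)"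
    by (simp add: inner_vec_def sum_distrib_left zi Bochner_Integration.integral_sum)
  finally show ?thesis .
qed

end

section \<open>Isometry for elementary integrands\<close>

abbreviation leb :: "real \<Rightarrow> real measure" where
  "leb T \<equiv> restrict_space lborel {0..T}"

lemma finite_measure_leb: "finite_measure (leb T)"
  by (rule finite_measureI) (simp add: emeasure_restrict_space space_restrict_space emeasure_lborel_Icc_eq)

text \<open>Cauchy-Schwarz in every row: the Frobenius norm dominates the operator norm.\<close>

lemma norm_matrix_vector_le: "norm ((A::real^'m^'n) *v x) \<le> norm A * norm x"
proof (rule power2_le_imp_le)
  have "(norm (A *v x))\<^sup>2 = (\<Sum>i\<in>UNIV. (A $ i \<bullet> x)\<^sup>2)"
    by (subst power2_norm_eq_inner) (simp add: inner_vec_def[of "A *v x"] matrix_vector_mul_component power2_eq_square)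
  also have "\<dots> \<le> (\<Sum>i\<in>UNIV. (norm (A $ i))\<^sup>2 * (norm x)\<^sup>2)"
  proof (rule sum_mono)
    fix i
    have "\<bar>A $ i \<bullet> x\<bar>\<^sup>2 \<le> (norm (A $ i) * norm x)\<^sup>2"
      by (rule power_mono[OF Cauchy_Schwarz_ineq2]) simp
    then show "(A $ i \<bullet> x)\<^sup>2 \<le> (norm (A $ i))\<^sup>2 * (norm x)\<^sup>2" by (simp add: power_mult_distrib)
  qed
  also have "\<dots> = (norm A * norm x)\<^sup>2"
    unfolding power_mult_distrib sum_distrib_right[symmetric] power2_norm_eq_inner[of A] inner_vec_def[of A]
    by (simp add: power2_norm_eq_inner)
  finally show "(norm (A *v x))\<^sup>2 \<le> (norm A * norm x)\<^sup>2" .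
qed simp

lemma borel_measurable_matrix_vector:
  assumes "f \<in> borel_measurable N" "g \<in> borel_measurable N"
  shows "(\<lambda>\<omega>. (f \<omega> :: real^'m^'n) *v g \<omega>) \<in> borel_measurable N"
proof (rule borel_measurable_continuous_Pair[OF assms])
  have "(\<lambda>x. fst x *v snd x) = (\<lambda>x::(real^'m^'n) \<times> (real^'m). \<chi> i. fst x $ i \<bullet> snd x)"
    by (simp add: vec_eq_iff matrix_vector_mul_component fun_eq_iff)
  then show "continuous_on UNIV (\<lambda>x::(real^'m^'n) \<times> (real^'m). fst x *v snd x)"
    by (simp only:) (intro continuous_intros)
qed

lemma (in pair_sigma_finite) integral_prod_mult:
  fixes f g :: "_ \<Rightarrow> real"
  assumes "integrable M1 f" "integrable M2 g"
  shows "integrable (M1 \<Otimes>\<^sub>M M2) (\<lambda>(x, y). f x * g y)"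
    and "(LINT z|(M1 \<Otimes>\<^sub>M M2). (\<lambda>(x, y). f x * g y) z) = (LINT x|M1. f x) * (LINT y|M2. g y)"
proof -
  have [measurable]: "f \<in> borel_measurable M1" "g \<in> borel_measurable M2" using assms by auto
  show i: "integrable (M1 \<Otimes>\<^sub>M M2) (\<lambda>(x, y). f x * g y)"
    using assms by (intro Fubini_integrable) (auto simp: abs_mult)
  show "(LINT z|(M1 \<Otimes>\<^sub>M M2). (\<lambda>(x, y). f x * g y) z) = (LINT x|M1. f x) * (LINT y|M2. g y)"
    using integral_fst[OF i] by simp
qed

lemma l2_sum_squared:
  assumes "\<And>i. i \<in> I \<Longrightarrow> sq_int N (f i)"
  shows "(l2 N (\<lambda>x. \<Sum>i\<in>I. f i x))\<^sup>2 = (\<Sum>i\<in>I. \<Sum>j\<in>I. (LINT x|N. f i x \<bullet> f j x))"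
proof -
  have "(l2 N (\<lambda>x. \<Sum>i\<in>I. f i x))\<^sup>2 = (LINT x|N. (\<Sum>i\<in>I. \<Sum>j\<in>I. f i x \<bullet> f j x))"
    unfolding l2_squared power2_norm_eq_inner inner_sum_left inner_sum_right
    by (subst sum.swap) (rule refl)
  also have "\<dots> = (\<Sum>i\<in>I. \<Sum>j\<in>I. (LINT x|N. f i x \<bullet> f j x))"
    using assms by (simp add: Bochner_Integration.integral_sum Bochner_Integration.integrable_sum sq_int_inner)
  finally show ?thesis .
qed

text \<open>The passage from the extended-real quantities of the definitions to real norms.\<close>

lemma l2_tendsto_0I:
  assumes sq: "\<And>n. sq_int N (f n)" and le: "\<And>n. ennreal ((l2 N (f n))\<^sup>2) \<le> u n" and u: "u \<longlonglongrightarrow> 0"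
  shows "(\<lambda>n. l2 N (f n)) \<longlonglongrightarrow> 0"
proof -
  have "(\<lambda>n. ennreal ((l2 N (f n))\<^sup>2)) \<longlonglongrightarrow> 0"
    by (rule tendsto_sandwich[OF _ _ tendsto_const u]) (auto simp: le)
  then have "(\<lambda>n. (l2 N (f n))\<^sup>2) \<longlonglongrightarrow> 0"
    using tendsto_ennrealD[of "\<lambda>n. (l2 N (f n))\<^sup>2" 0] by simp
  then have "(\<lambda>n. sqrt ((l2 N (f n))\<^sup>2)) \<longlonglongrightarrow> sqrt 0" by (rule tendsto_real_sqrt)
  then show ?thesis by simp
qed

context two_scale_setting
begin

abbreviation "D \<equiv> leb T"
abbreviation "P \<equiv> D \<Otimes>\<^sub>M M"

lemma space_D[simp]: "space D = {0..T}" by (simp add: space_restrict_space)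
lemma space_P: "space P = {0..T} \<times> space M" by (simp add: space_pair_measure)

sublocale D: finite_measure D by (rule finite_measure_leb)
sublocale DM: pair_sigma_finite D M ..
sublocale P: finite_measure P by (rule finite_measure_pair_measure) unfold_locales

lemma measurable_D: "f \<in> borel_measurable borel \<Longrightarrow> f \<in> borel_measurable D"
  by (rule measurable_restrict_space1) simp

lemma measurable_P_fst: "f \<in> borel_measurable borel \<Longrightarrow> (\<lambda>z. f (fst z)) \<in> borel_measurable P"
  by (rule measurable_compose[OF measurable_fst measurable_D])

lemma measurable_P_snd: "f \<in> borel_measurable M \<Longrightarrow> (\<lambda>z. f (snd z)) \<in> borel_measurable P"
  by (rule measurable_compose[OF measurable_snd])

lemma H2_sq_eq:
  assumes "case_prod Z \<in> borel_measurable P"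
  shows "H2_sq M T Z = (\<integral>\<^sup>+z. ennreal ((norm (case_prod Z z))\<^sup>2) \<partial>P)"
proof -
  have "(\<lambda>z. ennreal ((norm (case_prod Z z))\<^sup>2)) \<in> borel_measurable P"
    using assms by simp
  from DM.nn_integral_snd[OF this] show ?thesis
    unfolding H2_sq_def by (simp add: nn_integral_restrict_space)
qed

lemma sq_int_P_fstI:
  assumes f: "f \<in> borel_measurable D" "\<And>t. t \<in> {0..T} \<Longrightarrow> \<bar>f t\<bar> \<le> 1"
    and Z: "sq_int P (case_prod Z)"
  shows "sq_int P (\<lambda>(t, \<omega>). f t *\<^sub>R Z t \<omega>)"
proof (rule sq_int_mono[OF Z])
  have [measurable]: "case_prod Z \<in> borel_measurable P" "f \<in> borel_measurable D"
    using Z f by (auto simp: sq_int_def)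
  show "(\<lambda>(t, \<omega>). f t *\<^sub>R Z t \<omega>) \<in> borel_measurable P" by measurable
  show "AE z in P. norm ((\<lambda>(t, \<omega>). f t *\<^sub>R Z t \<omega>) z) \<le> norm (case_prod Z z)"
    using f(2) by (intro AE_I2) (auto simp: space_P mult_left_le_one_le)
qed

text \<open>One summand of a simple integrand, detached from any partition. Equal endpoints are
  allowed because cutting a partition interval to (s,t] may leave nothing of it.\<close>

definition elementary :: "real \<Rightarrow> real \<Rightarrow> ('w \<Rightarrow> real^'m^'n) \<Rightarrow> bool" where
  "elementary a b \<Phi> \<longleftrightarrow> 0 \<le> a \<and> a \<le> b \<and> \<Phi> \<in> borel_measurable (F a) \<and> (\<exists>C. \<forall>\<omega>\<in>space M. norm (\<Phi> \<omega>) \<le> C)"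

lemma elementary_sq_int_Phi: "elementary a b \<Phi> \<Longrightarrow> sq_int M \<Phi>"
  unfolding elementary_def by (auto intro: sq_int_bounded[OF finite_measure_axioms] measurable_F_M)

lemma sq_int_matrix_increment:
  fixes \<Phi> :: "'w \<Rightarrow> real^'m^'n"
  assumes "0 \<le> s" "s \<le> t" "\<Phi> \<in> borel_measurable M" "\<forall>\<omega>\<in>space M. norm (\<Phi> \<omega>) \<le> C"
  shows "sq_int M (\<lambda>\<omega>. \<Phi> \<omega> *v (W t \<omega> - W s \<omega>))"
proof (rule sq_int_mono[OF sq_int_scaleR[OF increment_sq_int[OF assms(1,2)], of C]])
  show "(\<lambda>\<omega>. \<Phi> \<omega> *v (W t \<omega> - W s \<omega>)) \<in> borel_measurable M"
    using assms by (intro borel_measurable_matrix_vector borel_measurable_diff W_measurable) auto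
  show "AE \<omega> in M. norm (\<Phi> \<omega> *v (W t \<omega> - W s \<omega>)) \<le> norm (C *\<^sub>R (W t \<omega> - W s \<omega>))"
  proof (rule AE_I2)
    fix \<omega> assume "\<omega> \<in> space M"
    then have "norm (\<Phi> \<omega>) \<le> \<bar>C\<bar>" using assms(4) by fastforce
    then show "norm (\<Phi> \<omega> *v (W t \<omega> - W s \<omega>)) \<le> norm (C *\<^sub>R (W t \<omega> - W s \<omega>))"
      using order_trans[OF norm_matrix_vector_le[of "\<Phi> \<omega>" "W t \<omega> - W s \<omega>"] mult_right_mono[of "norm (\<Phi> \<omega>)" "\<bar>C\<bar>"]]
      by simp
  qed
qed

lemma elementary_sq_int: "elementary a b \<Phi> \<Longrightarrow> sq_int M (\<lambda>\<omega>. \<Phi> \<omega> *v (W b \<omega> - W a \<omega>))"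
  unfolding elementary_def by (auto intro: sq_int_matrix_increment measurable_F_M)

text \<open>With a \<le> c both matrices are known at time c. The intervals are split at c and at
  the smaller right endpoint. A piece without counterpart in the other integral is orthogonal to it,
  because the earlier factor is known when the later increment starts; only the overlap
  survives.\<close>

lemma elementary_cross_le:
  fixes \<Phi> \<Psi> :: "'w \<Rightarrow> real^'m^'n"
  assumes e1: "elementary a b \<Phi>" and e2: "elementary c d \<Psi>" and ac: "a \<le> c"
  shows "expectation (\<lambda>\<omega>. (\<Phi> \<omega> *v (W b \<omega> - W a \<omega>)) \<bullet> (\<Psi> \<omega> *v (W d \<omega> - W c \<omega>)))
    = max 0 (min b d - max a c) * expectation (\<lambda>\<omega>. \<Phi> \<omega> \<bullet> \<Psi> \<omega>)"
proof -
  let ?I = "\<lambda>X r s \<omega>. (X \<omega> :: real^'m^'n) *v (W s \<omega> - W r \<omega>)"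
  obtain C where C: "\<And>\<omega>. \<omega> \<in> space M \<Longrightarrow> norm (\<Phi> \<omega>) \<le> C" using e1 by (auto simp: elementary_def)
  obtain C' where C': "\<And>\<omega>. \<omega> \<in> space M \<Longrightarrow> norm (\<Psi> \<omega>) \<le> C'" using e2 by (auto simp: elementary_def)
  have a: "0 \<le> a" "a \<le> b" "0 \<le> c" "c \<le> d" and Pm: "\<Phi> \<in> borel_measurable (F a)" and Qm: "\<Psi> \<in> borel_measurable (F c)"
    using e1 e2 by (auto simp: elementary_def)
  have Pc: "\<Phi> \<in> borel_measurable (F c)" using measurable_F_mono[OF Pm ac] .
  have sqP: "sq_int M (?I \<Phi> r s)" if "0 \<le> r" "r \<le> s" for r s
    using that C measurable_F_M[OF Pm] by (intro sq_int_matrix_increment) auto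
  have sqQ: "sq_int M (?I \<Psi> r s)" if "0 \<le> r" "r \<le> s" for r s
    using that C' measurable_F_M[OF Qm] by (intro sq_int_matrix_increment) auto
  have mI: "?I X r s \<in> borel_measurable (F u)" if "X \<in> borel_measurable (F v)" "0 \<le> r" "r \<le> s" "s \<le> u" "v \<le> u" for X r s u v
    using that by (intro borel_measurable_matrix_vector borel_measurable_diff W_measurable_F measurable_F_mono[OF that(1)]) auto
  have orthQ: "expectation (\<lambda>\<omega>. \<zeta> \<omega> \<bullet> ?I \<Psi> r s \<omega>) = 0"
    if "\<zeta> \<in> borel_measurable (F r)" "sq_int M \<zeta>" "c \<le> r" "r \<le> s" for \<zeta> r s
    using that a C' by (intro expectation_inner_matrix_increment[of r s \<Psi> C'] measurable_F_mono[OF Qm]) auto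
  have orthP: "expectation (\<lambda>\<omega>. ?I \<Phi> r s \<omega> \<bullet> \<zeta> \<omega>) = 0"
    if "\<zeta> \<in> borel_measurable (F r)" "sq_int M \<zeta>" "c \<le> r" "r \<le> s" for \<zeta> r s
    using that a ac C expectation_inner_matrix_increment[of r s \<Phi> C \<zeta>] measurable_F_mono[OF Pm, of r]
    by (auto simp: inner_commute)
  have add: "?I X r s \<omega> = ?I X r u \<omega> + ?I X u s \<omega>" for X r s u \<omega>
    by (simp add: matrix_vector_mult_add_rdistrib[symmetric] matrix_vector_right_distrib[symmetric])
  show ?thesis
  proof (cases "b \<le> c")
    case True
    then have "expectation (\<lambda>\<omega>. ?I \<Phi> a b \<omega> \<bullet> ?I \<Psi> c d \<omega>) = 0"
      using a ac by (intro orthQ mI[OF Pm] sqP) auto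
    moreover have "max 0 (min b d - max a c) = 0" using True ac by (auto simp: max_def min_def)
    ultimately show ?thesis by simp
  next
    case False
    then have cb: "c \<le> b" by simp
    have z0: "expectation (\<lambda>\<omega>. ?I \<Phi> a c \<omega> \<bullet> ?I \<Psi> c d \<omega>) = 0"
      using a ac by (intro orthQ mI[OF Pm] sqP) auto
    have z1: "expectation (\<lambda>\<omega>. ?I \<Phi> a b \<omega> \<bullet> ?I \<Psi> c d \<omega>) = expectation (\<lambda>\<omega>. ?I \<Phi> c b \<omega> \<bullet> ?I \<Psi> c d \<omega>)"
    proof -
      have "expectation (\<lambda>\<omega>. ?I \<Phi> a b \<omega> \<bullet> ?I \<Psi> c d \<omega>) =
          expectation (\<lambda>\<omega>. ?I \<Phi> a c \<omega> \<bullet> ?I \<Psi> c d \<omega> + ?I \<Phi> c b \<omega> \<bullet> ?I \<Psi> c d \<omega>)"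
        by (simp only: add[of \<Phi> _ b a c] inner_add_left)
      also have "\<dots> = expectation (\<lambda>\<omega>. ?I \<Phi> c b \<omega> \<bullet> ?I \<Psi> c d \<omega>)"
        using z0 a ac cb by (subst Bochner_Integration.integral_add) (auto intro!: sq_int_inner sqP sqQ)
      finally show ?thesis .
    qed
    show ?thesis
    proof (cases "b \<le> d")
      case True
      have "expectation (\<lambda>\<omega>. ?I \<Phi> c b \<omega> \<bullet> ?I \<Psi> c d \<omega>) =
          expectation (\<lambda>\<omega>. ?I \<Phi> c b \<omega> \<bullet> ?I \<Psi> c b \<omega> + ?I \<Phi> c b \<omega> \<bullet> ?I \<Psi> b d \<omega>)"
        by (simp only: add[of \<Psi> _ d c b] inner_add_right)
      also have "\<dots> = expectation (\<lambda>\<omega>. ?I \<Phi> c b \<omega> \<bullet> ?I \<Psi> c b \<omega>) + expectation (\<lambda>\<omega>. ?I \<Phi> c b \<omega> \<bullet> ?I \<Psi> b d \<omega>)"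
        using True a ac cb by (subst Bochner_Integration.integral_add) (auto intro!: sq_int_inner sqP sqQ)
      also have "expectation (\<lambda>\<omega>. ?I \<Phi> c b \<omega> \<bullet> ?I \<Psi> b d \<omega>) = 0"
        using True a ac cb by (intro orthQ mI[OF Pm] sqP) auto
      also have "expectation (\<lambda>\<omega>. ?I \<Phi> c b \<omega> \<bullet> ?I \<Psi> c b \<omega>) = (b - c) * expectation (\<lambda>\<omega>. \<Phi> \<omega> \<bullet> \<Psi> \<omega>)"
        using a cb C C' by (intro expectation_inner_matrix_increment2[OF _ _ Pc _ Qm]) auto
      finally show ?thesis unfolding z1 using True ac cb by (simp add: max_def min_def)
    next
      case False
      then have db: "d \<le> b" by simp
      have "expectation (\<lambda>\<omega>. ?I \<Phi> c b \<omega> \<bullet> ?I \<Psi> c d \<omega>) =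
          expectation (\<lambda>\<omega>. ?I \<Phi> c d \<omega> \<bullet> ?I \<Psi> c d \<omega> + ?I \<Phi> d b \<omega> \<bullet> ?I \<Psi> c d \<omega>)"
        by (simp only: add[of \<Phi> _ b c d] inner_add_left)
      also have "\<dots> = expectation (\<lambda>\<omega>. ?I \<Phi> c d \<omega> \<bullet> ?I \<Psi> c d \<omega>) + expectation (\<lambda>\<omega>. ?I \<Phi> d b \<omega> \<bullet> ?I \<Psi> c d \<omega>)"
        using db a ac cb by (subst Bochner_Integration.integral_add) (auto intro!: sq_int_inner sqP sqQ)
      also have "expectation (\<lambda>\<omega>. ?I \<Phi> d b \<omega> \<bullet> ?I \<Psi> c d \<omega>) = 0"
        using db a ac cb by (intro orthP mI[OF Qm] sqQ) auto
      also have "expectation (\<lambda>\<omega>. ?I \<Phi> c d \<omega> \<bullet> ?I \<Psi> c d \<omega>) = (d - c) * expectation (\<lambda>\<omega>. \<Phi> \<omega> \<bullet> \<Psi> \<omega>)"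
        using a cb C C' by (intro expectation_inner_matrix_increment2[OF _ _ Pc _ Qm]) auto
      finally show ?thesis unfolding z1 using db ac a by (simp add: max_def min_def)
    qed
  qed
qed

lemma elementary_cross:
  fixes \<Phi> \<Psi> :: "'w \<Rightarrow> real^'m^'n"
  assumes "elementary a b \<Phi>" "elementary c d \<Psi>"
  shows "expectation (\<lambda>\<omega>. (\<Phi> \<omega> *v (W b \<omega> - W a \<omega>)) \<bullet> (\<Psi> \<omega> *v (W d \<omega> - W c \<omega>)))
    = max 0 (min b d - max a c) * expectation (\<lambda>\<omega>. \<Phi> \<omega> \<bullet> \<Psi> \<omega>)"
proof (cases "a \<le> c")
  case True
  then show ?thesis using elementary_cross_le[OF assms] by simp
next
  case False
  then show ?thesis using elementary_cross_le[OF assms(2,1)]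
    by (simp add: inner_commute min.commute max.commute[of a c])
qed

text \<open>The intervals may overlap, so that differences of simple integrals need no common partition.\<close>

lemma elementary_isometry:
  fixes \<Phi> :: "'i \<Rightarrow> 'w \<Rightarrow> real^'m^'n"
  assumes ok: "\<And>i. i \<in> I \<Longrightarrow> elementary (a i) (b i) (\<Phi> i)" and bT: "\<And>i. i \<in> I \<Longrightarrow> b i \<le> T"
  shows "l2 M (\<lambda>\<omega>. \<Sum>i\<in>I. \<Phi> i \<omega> *v (W (b i) \<omega> - W (a i) \<omega>))
    = l2 P (\<lambda>(t, \<omega>). \<Sum>i\<in>I. indicator {a i<..b i} t *\<^sub>R \<Phi> i \<omega>)"
    and "sq_int P (\<lambda>(t, \<omega>). \<Sum>i\<in>I. indicator {a i<..b i} t *\<^sub>R \<Phi> i \<omega>)"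
    and "sq_int M (\<lambda>\<omega>. \<Sum>i\<in>I. \<Phi> i \<omega> *v (W (b i) \<omega> - W (a i) \<omega>))"
proof -
  let ?f = "\<lambda>i (t, \<omega>). indicator {a i<..b i} t *\<^sub>R \<Phi> i \<omega>"
  have eq: "(\<lambda>(t, \<omega>). \<Sum>i\<in>I. indicator {a i<..b i} t *\<^sub>R \<Phi> i \<omega>) = (\<lambda>z. \<Sum>i\<in>I. ?f i z)"
    by (simp add: fun_eq_iff)
  have sq: "sq_int P (?f i)" if i: "i \<in> I" for i
  proof -
    have sqP: "sq_int M (\<Phi> i)" using elementary_sq_int_Phi[OF ok[OF i]] .
    then have [measurable]: "\<Phi> i \<in> borel_measurable M" by (simp add: sq_int_def)
    obtain C where "\<forall>\<omega>\<in>space M. norm (\<Phi> i \<omega>) \<le> C" using ok[OF i] by (auto simp: elementary_def)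
    then have "\<forall>\<omega>\<in>space M. norm (\<Phi> i \<omega>) \<le> \<bar>C\<bar>" by fastforce
    moreover have "?f i \<in> borel_measurable P"
      unfolding split_beta'
      by (intro borel_measurable_scaleR measurable_P_fst measurable_P_snd) auto
    ultimately show ?thesis
      by (intro sq_int_bounded[OF P.finite_measure_axioms, of _ "\<bar>C\<bar>"])
         (auto simp: space_P indicator_def)
  qed
  show "sq_int P (\<lambda>(t, \<omega>). \<Sum>i\<in>I. indicator {a i<..b i} t *\<^sub>R \<Phi> i \<omega>)"
    unfolding eq by (rule sq_int_sum) (rule sq)
  show "sq_int M (\<lambda>\<omega>. \<Sum>i\<in>I. \<Phi> i \<omega> *v (W (b i) \<omega> - W (a i) \<omega>))"
    by (rule sq_int_sum) (rule elementary_sq_int[OF ok])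
  have "(LINT z|P. ?f i z \<bullet> ?f j z) = max 0 (min (b i) (b j) - max (a i) (a j)) * expectation (\<lambda>\<omega>. \<Phi> i \<omega> \<bullet> \<Phi> j \<omega>)"
    if ij: "i \<in> I" "j \<in> I" for i j
  proof -
    have oi: "0 \<le> a i" "a i \<le> b i" "b i \<le> T" "0 \<le> a j" "a j \<le> b j" "b j \<le> T"
      using ok[OF ij(1)] ok[OF ij(2)] bT[OF ij(1)] bT[OF ij(2)] by (auto simp: elementary_def)
    let ?J = "{max (a i) (a j)<..min (b i) (b j)}"
    have "(LINT z|P. ?f i z \<bullet> ?f j z) = (LINT z|P. (\<lambda>(t, \<omega>). indicator ?J t * (\<Phi> i \<omega> \<bullet> \<Phi> j \<omega>)) z)"
      by (intro Bochner_Integration.integral_cong) (auto simp: indicator_def)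
    also have "\<dots> = (LINT t|D. indicat_real ?J t) * (LINT \<omega>|M. \<Phi> i \<omega> \<bullet> \<Phi> j \<omega>)"
    proof (intro DM.integral_prod_mult sq_int_inner elementary_sq_int_Phi[OF ok[OF ij(1)]] elementary_sq_int_Phi[OF ok[OF ij(2)]])
      show "integrable D (indicator ?J :: real \<Rightarrow> real)"
        by (rule D.integrable_const_bound[of _ 1], rule AE_I2, simp add: indicator_def, rule measurable_D, simp)
    qed
    also have "(LINT t|D. indicat_real ?J t) = (LINT t|lborel. indicat_real ?J t)"
    proof -
      have "indicator {0..T} t *\<^sub>R indicator ?J t = (indicator ?J t :: real)" for t
        using oi by (auto simp: indicator_def)
      moreover have "(LINT t|D. indicat_real ?J t) = (LINT t|lborel. indicator {0..T} t *\<^sub>R (indicator ?J t :: real))"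
        by (rule integral_restrict_space) simp
      ultimately show ?thesis by (simp only:)
    qed
    also have "\<dots> = max 0 (min (b i) (b j) - max (a i) (a j))"
    proof -
      have "measure lborel {u<..v} = max 0 (v - u)" for u v :: real
        by (cases "u \<le> v") (simp_all add: max_def)
      then show ?thesis by simp
    qed
    finally show ?thesis .
  qed
  then have "(l2 P (\<lambda>(t, \<omega>). \<Sum>i\<in>I. indicator {a i<..b i} t *\<^sub>R \<Phi> i \<omega>))\<^sup>2
    = (l2 M (\<lambda>\<omega>. \<Sum>i\<in>I. \<Phi> i \<omega> *v (W (b i) \<omega> - W (a i) \<omega>)))\<^sup>2"
    unfolding eq by (subst (1 2) l2_sum_squared) (auto intro!: sq elementary_sq_int[OF ok] sum.cong simp: elementary_cross[OF ok ok])
  then show "l2 M (\<lambda>\<omega>. \<Sum>i\<in>I. \<Phi> i \<omega> *v (W (b i) \<omega> - W (a i) \<omega>))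
    = l2 P (\<lambda>(t, \<omega>). \<Sum>i\<in>I. indicator {a i<..b i} t *\<^sub>R \<Phi> i \<omega>)"
    by (auto simp: power2_eq_iff_nonneg)
qed

end

section \<open>The stochastic integral\<close>

context two_scale_setting
begin

lemma Prog_sets:
  assumes "C \<in> sets (Prog M F T)" "t \<in> {0..T}"
  shows "C \<inter> ({0..t} \<times> space M) \<in> sets (restrict_space borel {0..t} \<Otimes>\<^sub>M F t)"
  using assms by (simp add: sets_Prog)

text \<open>At the final time T the progressive condition is already product measurability, and
  \<open>F T\<close> is contained in \<open>M\<close>.\<close>

lemma sets_Prog_P: "sets (Prog M F T) \<subseteq> sets P"
proof
  fix C assume C: "C \<in> sets (Prog M F T)"
  then have "C \<subseteq> {0..T} \<times> space M" by (simp add: sets_Prog)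
  then have "C = C \<inter> ({0..T} \<times> space M)" by auto
  also have "\<dots> \<in> sets (restrict_space borel {0..T} \<Otimes>\<^sub>M F T)"
    using T_pos by (intro Prog_sets[OF C]) simp
  also have "\<dots> \<subseteq> sets P"
  proof -
    have "{a \<times> b |a b. a \<in> sets (restrict_space borel {0..T}) \<and> b \<in> sets (F T)}
        \<subseteq> {a \<times> b |a b. a \<in> sets D \<and> b \<in> sets M}"
      using subalgebra_F[of T] by (auto simp: subalgebra_def sets_restrict_space)
    then show ?thesis
      unfolding sets_pair_measure space_restrict_space space_F
      by (simp only: space_lborel space_borel sigma_sets_mono')
  qed
  finally show "C \<in> sets P" .
qed

lemma space_Prog: "space (Prog M F T) = {0..T} \<times> space M"
  unfolding Prog_def by (rule space_measure_of) auto

lemma measurable_Prog_P: "f \<in> borel_measurable (Prog M F T) \<Longrightarrow> f \<in> borel_measurable P"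
  using sets_Prog_P by (rule_tac measurable_from_subalg) (auto simp: subalgebra_def space_P space_Prog)

lemma measurable_Prog_restrict:
  fixes f :: "real \<times> 'w \<Rightarrow> 'b::topological_space"
  assumes f: "f \<in> borel_measurable (Prog M F T)" and t: "t \<in> {0..T}"
  shows "f \<in> borel_measurable (restrict_space borel {0..t} \<Otimes>\<^sub>M F t)"
proof (rule measurableI)
  fix A assume A: "A \<in> sets (borel :: 'b measure)"
  have "f -` A \<inter> space (Prog M F T) \<in> sets (Prog M F T)" using f A by (rule measurable_sets)
  from Prog_sets[OF this t]
  have "(f -` A \<inter> ({0..T} \<times> space M)) \<inter> ({0..t} \<times> space M) \<in> sets (restrict_space borel {0..t} \<Otimes>\<^sub>M F t)"
    by (simp add: space_Prog)
  moreover have "(f -` A \<inter> ({0..T} \<times> space M)) \<inter> ({0..t} \<times> space M) = f -` A \<inter> ({0..t} \<times> space M)"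
    using t by auto
  ultimately show "f -` A \<inter> space (restrict_space borel {0..t} \<Otimes>\<^sub>M F t) \<in> sets (restrict_space borel {0..t} \<Otimes>\<^sub>M F t)"
    by (simp add: space_pair_measure)
qed simp

text \<open>Restriction to [0,t] makes the process jointly measurable with \<open>F t\<close>, and
  the section at the endpoint t inherits this.\<close>

lemma measurable_Prog_section:
  assumes f: "case_prod Z \<in> borel_measurable (Prog M F T)" and t: "t \<in> {0..T}"
  shows "Z t \<in> borel_measurable (F t)"
proof -
  have "(\<lambda>\<omega>. (t, \<omega>)) \<in> F t \<rightarrow>\<^sub>M restrict_space borel {0..t} \<Otimes>\<^sub>M F t"
    using t by (intro measurable_Pair1') (simp add: space_restrict_space)
  from measurable_compose[OF this measurable_Prog_restrict[OF f t]] show ?thesis by simp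
qed

lemma H2D:
  assumes "Z \<in> H2 M F T"
  shows "case_prod Z \<in> borel_measurable (Prog M F T)" "sq_int P (case_prod Z)"
    "H2_sq M T Z = ennreal ((l2 P (case_prod Z))\<^sup>2)"
proof -
  show m: "case_prod Z \<in> borel_measurable (Prog M F T)" using assms by (simp add: H2_def)
  note mP = measurable_Prog_P[OF m]
  show sq: "sq_int P (case_prod Z)"
    using assms by (intro sq_intI_nn_integral mP) (simp add: H2_def H2_sq_eq[OF mP])
  show "H2_sq M T Z = ennreal ((l2 P (case_prod Z))\<^sup>2)"
    unfolding H2_sq_eq[OF mP] by (rule nn_integral_eq_l2[OF sq])
qed

lemma nn_integral_le_S2_sq:
  assumes "t \<in> {0..T}"
  shows "(\<integral>\<^sup>+\<omega>. ennreal ((norm (Y t \<omega>))\<^sup>2) \<partial>M) \<le> S2_sq M T Y"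
  unfolding S2_sq_def by (intro nn_integral_mono SUP_upper assms)

lemma S2D:
  assumes "Y \<in> S2 M F T" "t \<in> {0..T}"
  shows "Y t \<in> borel_measurable (F t)" "sq_int M (Y t)" "ennreal ((l2 M (Y t))\<^sup>2) \<le> S2_sq M T Y"
proof -
  show m: "Y t \<in> borel_measurable (F t)" using assms by (simp add: S2_def)
  have "(\<integral>\<^sup>+\<omega>. ennreal ((norm (Y t \<omega>))\<^sup>2) \<partial>M) < \<infinity>"
    using nn_integral_le_S2_sq[OF assms(2), of Y] assms(1) by (auto simp: S2_def intro: le_less_trans)
  then show sq: "sq_int M (Y t)" by (intro sq_intI_nn_integral measurable_F_M[OF m])
  show "ennreal ((l2 M (Y t))\<^sup>2) \<le> S2_sq M T Y"
    using nn_integral_le_S2_sq[OF assms(2), of Y] by (simp add: nn_integral_eq_l2[OF sq])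
qed

lemma simple_integrand_mono:
  assumes "simple_integrand M F T N p \<Phi>" "i \<le> j" "j \<le> N"
  shows "p i \<le> p j"
  using assms(2,3)
proof (induction j rule: dec_induct)
  case (step k)
  then have "p k < p (Suc k)" using assms(1) by (auto simp: simple_integrand_def)
  then show ?case using step by auto
qed simp

text \<open>Every partition interval is cut to (s,t]. Raising the left end to the maximum with s
  keeps \<open>\<Phi> i\<close> measurable there, and the outer \<open>max\<close> in
  \<open>b\<close> turns intervals that miss (s,t] into empty ones instead of reversed ones.\<close>

lemma simple_integral_increment_eq:
  fixes \<Phi> :: "nat \<Rightarrow> 'w \<Rightarrow> real^'m^'n"
  assumes si: "simple_integrand M F T N p \<Phi>" and st: "0 \<le> s" "s \<le> t" "t \<le> T"
  defines "a \<equiv> \<lambda>i. max (p i) s" and "b \<equiv> \<lambda>i. max (max (p i) s) (min (p (Suc i)) t)"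
  shows "simple_integral W N p \<Phi> t \<omega> - simple_integral W N p \<Phi> s \<omega> = (\<Sum>i<N. \<Phi> i \<omega> *v (W (b i) \<omega> - W (a i) \<omega>))"
    and "indicator {s<..t} r *\<^sub>R simple_process N p \<Phi> r \<omega> = (\<Sum>i<N. indicator {a i<..b i} r *\<^sub>R \<Phi> i \<omega>)"
    and "\<And>i. i < N \<Longrightarrow> elementary (a i) (b i) (\<Phi> i)"
    and "\<And>i. i < N \<Longrightarrow> b i \<le> T"
proof -
  have lt: "p i < p (Suc i)" if "i < N" for i using si that by (auto simp: simple_integrand_def)
  have p0: "0 \<le> p i" if "i \<le> N" for i
    using simple_integrand_mono[OF si, of 0 i] that si by (auto simp: simple_integrand_def)
  have pT: "p i \<le> T" if "i \<le> N" for i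
    using simple_integrand_mono[OF si, of i N] that si by (auto simp: simple_integrand_def)
  show "simple_integral W N p \<Phi> t \<omega> - simple_integral W N p \<Phi> s \<omega> = (\<Sum>i<N. \<Phi> i \<omega> *v (W (b i) \<omega> - W (a i) \<omega>))"
    unfolding simple_integral_def sum_subtractf[symmetric] matrix_vector_mult_diff_distrib[symmetric]
  proof (intro sum.cong refl arg_cong2[where f="(*v)"])
    fix i assume "i \<in> {..<N}"
    then have "p i < p (Suc i)" using lt by simp
    then show "W (min (p (Suc i)) t) \<omega> - W (min (p i) t) \<omega> - (W (min (p (Suc i)) s) \<omega> - W (min (p i) s) \<omega>)
        = W (b i) \<omega> - W (a i) \<omega>"
      using st unfolding a_def b_def
      by (cases "p (Suc i) \<le> s"; cases "p i \<le> s"; cases "p i \<le> t") (auto simp: min_def max_def)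
  qed
  show "indicator {s<..t} r *\<^sub>R simple_process N p \<Phi> r \<omega> = (\<Sum>i<N. indicator {a i<..b i} r *\<^sub>R \<Phi> i \<omega>)"
    unfolding simple_process_def scaleR_sum_right
    by (intro sum.cong refl) (auto simp: a_def b_def indicator_def)
  show "elementary (a i) (b i) (\<Phi> i)" if "i < N" for i
    using si that st p0[of i] unfolding elementary_def a_def b_def
    by (auto simp: simple_integrand_def intro: measurable_F_mono[of _ "p i"])
  show "b i \<le> T" if "i < N" for i
    using st pT[of i] pT[of "Suc i"] that unfolding b_def by auto
qed

lemma simple_integral_0:
  assumes si: "simple_integrand M F T N p \<Phi>"
  shows "simple_integral W N p \<Phi> 0 \<omega> = 0"
proof -
  have "min (p i) 0 = 0" if "i \<le> N" for i
    using simple_integrand_mono[OF si, of 0 i] that si by (auto simp: simple_integrand_def)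
  then show ?thesis by (simp add: simple_integral_def)
qed

lemma simple_process_0:
  assumes si: "simple_integrand M F T N p \<Phi>"
  shows "simple_process N p \<Phi> 0 \<omega> = 0"
proof -
  have "0 \<le> p i" if "i \<le> N" for i
    using simple_integrand_mono[OF si, of 0 i] that si by (auto simp: simple_integrand_def)
  then have "indicator {p i<..p (Suc i)} 0 = (0::real)" if "i < N" for i
    using that by (auto simp: indicator_def dest: less_imp_le leD)
  then show ?thesis by (simp add: simple_process_def)
qed

lemma simple_isometry:
  fixes \<Phi> \<Phi>' :: "nat \<Rightarrow> 'w \<Rightarrow> real^'m^'n"
  assumes si: "simple_integrand M F T N p \<Phi>" and si': "simple_integrand M F T N' p' \<Phi>'" and t: "t \<in> {0..T}"
  shows "l2 M (\<lambda>\<omega>. simple_integral W N p \<Phi> t \<omega> - simple_integral W N' p' \<Phi>' t \<omega>)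
    = l2 P (\<lambda>(s, \<omega>). indicator {0..t} s *\<^sub>R (simple_process N p \<Phi> s \<omega> - simple_process N' p' \<Phi>' s \<omega>))"
proof -
  \<comment> \<open>The two integrands are put side by side over a disjoint sum of index sets, the
    second one with a negative sign.\<close>
  let ?a = "case_sum (\<lambda>i. max (p i) 0) (\<lambda>i. max (p' i) 0)"
  let ?b = "case_sum (\<lambda>i. max (max (p i) 0) (min (p (Suc i)) t)) (\<lambda>i. max (max (p' i) 0) (min (p' (Suc i)) t))"
  let ?P = "case_sum \<Phi> (\<lambda>i \<omega>. - \<Phi>' i \<omega>)"
  let ?I = "{..<N} <+> {..<N'}"
  have tt: "0 \<le> (0::real)" "0 \<le> t" "t \<le> T" using t by auto
  note e = simple_integral_increment_eq[OF si tt] and e' = simple_integral_increment_eq[OF si' tt]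
  have 1: "elementary (?a i) (?b i) (?P i)" if "i \<in> ?I" for i
    using that e(3) e'(3) by (auto simp: elementary_def)
  have 2: "?b i \<le> T" if "i \<in> ?I" for i
    using that e(4) e'(4) by auto
  have neg: "(- A) *v x = - (A *v x)" for A :: "real^'m^'n" and x
    by (simp add: vec_eq_iff matrix_vector_mul_component)
  have "simple_integral W N p \<Phi> t \<omega> - simple_integral W N' p' \<Phi>' t \<omega> = (\<Sum>i\<in>?I. ?P i \<omega> *v (W (?b i) \<omega> - W (?a i) \<omega>))" for \<omega>
    using e(1)[of \<omega>] e'(1)[of \<omega>]
    by (simp add: sum.Plus neg sum_negf simple_integral_0[OF si] simple_integral_0[OF si'])
  moreover have "indicator {0..t} s *\<^sub>R (simple_process N p \<Phi> s \<omega> - simple_process N' p' \<Phi>' s \<omega>)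
      = (\<Sum>i\<in>?I. indicator {?a i<..?b i} s *\<^sub>R ?P i \<omega>)" for s \<omega>
  proof -
    have "(\<Sum>i\<in>?I. indicator {?a i<..?b i} s *\<^sub>R ?P i \<omega>)
        = indicator {0<..t} s *\<^sub>R simple_process N p \<Phi> s \<omega> - indicator {0<..t} s *\<^sub>R simple_process N' p' \<Phi>' s \<omega>"
      unfolding e(2) e'(2) sum.Plus[OF finite_lessThan finite_lessThan]
      by (simp only: sum.case scaleR_minus_right sum_negf add_uminus_conv_diff o_def)
    \<comment> \<open>Partition intervals are open on the left, so simple processes vanish at time 0
      and the closed interval may replace the half-open one.\<close>
    also have "\<dots> = indicator {0..t} s *\<^sub>R (simple_process N p \<Phi> s \<omega> - simple_process N' p' \<Phi>' s \<omega>)"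
      by (cases "s = 0") (simp_all add: simple_process_0[OF si] simple_process_0[OF si'] indicator_def scaleR_diff_right)
    finally show ?thesis by simp
  qed
  ultimately show ?thesis
    using elementary_isometry(1)[of ?I ?a ?b ?P, OF 1 2] by simp
qed

lemma simple_sq_int:
  fixes \<Phi> :: "nat \<Rightarrow> 'w \<Rightarrow> real^'m^'n"
  assumes si: "simple_integrand M F T N p \<Phi>" and t: "t \<in> {0..T}"
  shows "sq_int M (simple_integral W N p \<Phi> t)"
    and "sq_int P (case_prod (simple_process N p \<Phi>))"
proof -
  have tt: "0 \<le> (0::real)" "0 \<le> t" "t \<le> T" and TT: "0 \<le> (0::real)" "0 \<le> T" "T \<le> T" using t by auto
  note e = simple_integral_increment_eq[OF si tt] and e' = simple_integral_increment_eq[OF si TT]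
  have "simple_integral W N p \<Phi> t = (\<lambda>\<omega>. \<Sum>i<N. \<Phi> i \<omega> *v (W (max (max (p i) 0) (min (p (Suc i)) t)) \<omega> - W (max (p i) 0) \<omega>))"
    using e(1) by (simp add: fun_eq_iff simple_integral_0[OF si])
  then show "sq_int M (simple_integral W N p \<Phi> t)"
    using elementary_isometry(3)[of "{..<N}" "\<lambda>i. max (p i) 0" "\<lambda>i. max (max (p i) 0) (min (p (Suc i)) t)" \<Phi>] e(3,4)
    by simp
  have sq: "sq_int P (\<lambda>(s, \<omega>). \<Sum>i<N. indicator {max (p i) 0<..max (max (p i) 0) (min (p (Suc i)) T)} s *\<^sub>R \<Phi> i \<omega>)"
    using elementary_isometry(2)[of "{..<N}" "\<lambda>i. max (p i) 0" "\<lambda>i. max (max (p i) 0) (min (p (Suc i)) T)" \<Phi>] e'(3,4)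
    by simp
  have eq: "simple_process N p \<Phi> s \<omega> = (\<Sum>i<N. indicator {max (p i) 0<..max (max (p i) 0) (min (p (Suc i)) T)} s *\<^sub>R \<Phi> i \<omega>)"
    if "s \<in> {0..T}" for s \<omega>
    using that unfolding e'(2)[symmetric] by (cases "s = 0") (auto simp: simple_process_0[OF si])
  show "sq_int P (case_prod (simple_process N p \<Phi>))"
  proof (rule sq_int_cong_AE[OF sq])
    show "case_prod (simple_process N p \<Phi>) \<in> borel_measurable P"
      using sq unfolding sq_int_def
      by (subst measurable_cong[of P _ "\<lambda>(s, \<omega>). \<Sum>i<N. indicator {max (p i) 0<..max (max (p i) 0) (min (p (Suc i)) T)} s *\<^sub>R \<Phi> i \<omega>"])
         (auto simp: space_P eq)
  qed (auto simp: space_P eq intro!: AE_I2)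
qed

text \<open>After cutting, every summand is an elementary integral that starts no earlier than s,
  where \<zeta> is already known.\<close>

lemma simple_orth:
  fixes \<Phi> :: "nat \<Rightarrow> 'w \<Rightarrow> real^'m^'n"
  assumes si: "simple_integrand M F T N p \<Phi>" and st: "0 \<le> s" "s \<le> t" "t \<le> T"
    and z: "\<zeta> \<in> borel_measurable (F s)" "sq_int M \<zeta>"
  shows "expectation (\<lambda>\<omega>. \<zeta> \<omega> \<bullet> (simple_integral W N p \<Phi> t \<omega> - simple_integral W N p \<Phi> s \<omega>)) = 0"
proof -
  let ?a = "\<lambda>i. max (p i) s" and ?b = "\<lambda>i. max (max (p i) s) (min (p (Suc i)) t)"
  note e = simple_integral_increment_eq[OF si st]
  have "expectation (\<lambda>\<omega>. \<zeta> \<omega> \<bullet> (\<Phi> i \<omega> *v (W (?b i) \<omega> - W (?a i) \<omega>))) = 0" if i: "i < N" for i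
  proof -
    obtain C where "\<And>\<omega>. \<omega> \<in> space M \<Longrightarrow> norm (\<Phi> i \<omega>) \<le> C" using e(3)[OF i] by (auto simp: elementary_def)
    then show ?thesis
      using e(3)[OF i] z by (intro expectation_inner_matrix_increment[of _ _ "\<Phi> i" C]) (auto simp: elementary_def intro: measurable_F_mono)
  qed
  then show ?thesis
    unfolding e(1) inner_sum_right
    by (subst Bochner_Integration.integral_sum) (auto intro!: sq_int_inner z(2) elementary_sq_int e(3))
qed

text \<open>The supremum in the \<open>S2\<close> norm dominates every fixed time. What remains are
  two statements about \<open>l2\<close> along one common sequence of simple integrands.\<close>

lemma ito_approx_ex:
  fixes Z :: "real \<Rightarrow> 'w \<Rightarrow> real^'m^'n"
  assumes "ito_integral M F W T Z I"
  shows "\<exists>N p \<Phi>. (\<forall>n. simple_integrand M F T (N n) (p n) (\<Phi> n)) \<and>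
    (\<lambda>n. l2 P (\<lambda>z. case_prod (simple_process (N n) (p n) (\<Phi> n)) z - case_prod Z z)) \<longlonglongrightarrow> 0 \<and>
    (\<forall>t\<in>{0..T}. (\<lambda>n. l2 M (\<lambda>\<omega>. simple_integral W (N n) (p n) (\<Phi> n) t \<omega> - I t \<omega>)) \<longlonglongrightarrow> 0)"
proof -
  from assms obtain N p \<Phi> where Z: "Z \<in> H2 M F T" and I: "I \<in> S2 M F T"
    and si: "\<And>n. simple_integrand M F T (N n) (p n) (\<Phi> n)"
    and lZ: "(\<lambda>n. H2_sq M T (\<lambda>t \<omega>. simple_process (N n) (p n) (\<Phi> n) t \<omega> - Z t \<omega>)) \<longlonglongrightarrow> 0"
    and lI: "(\<lambda>n. S2_sq M T (\<lambda>t \<omega>. simple_integral W (N n) (p n) (\<Phi> n) t \<omega> - I t \<omega>)) \<longlonglongrightarrow> 0"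
    unfolding ito_integral_def by blast
  have T0: "T \<in> {0..T}" using T_pos by simp
  show ?thesis
  proof (intro exI conjI allI ballI, rule si)
    have sq: "sq_int P (\<lambda>z. case_prod (simple_process (N n) (p n) (\<Phi> n)) z - case_prod Z z)" for n
      by (intro sq_int_diff simple_sq_int(2)[OF si T0] H2D[OF Z])
    have eq: "(\<lambda>z. case_prod (simple_process (N n) (p n) (\<Phi> n)) z - case_prod Z z)
        = case_prod (\<lambda>t \<omega>. simple_process (N n) (p n) (\<Phi> n) t \<omega> - Z t \<omega>)" for n
      by (simp add: fun_eq_iff)
    show "(\<lambda>n. l2 P (\<lambda>z. case_prod (simple_process (N n) (p n) (\<Phi> n)) z - case_prod Z z)) \<longlonglongrightarrow> 0"
    proof (rule l2_tendsto_0I[OF sq _ lZ])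
      fix n
      have "H2_sq M T (\<lambda>t \<omega>. simple_process (N n) (p n) (\<Phi> n) t \<omega> - Z t \<omega>)
        = ennreal ((l2 P (\<lambda>z. case_prod (simple_process (N n) (p n) (\<Phi> n)) z - case_prod Z z))\<^sup>2)"
        using sq[of n] unfolding eq
        by (subst H2_sq_eq) (auto simp: nn_integral_eq_l2 sq_int_def)
      then show "ennreal ((l2 P (\<lambda>z. case_prod (simple_process (N n) (p n) (\<Phi> n)) z - case_prod Z z))\<^sup>2)
        \<le> H2_sq M T (\<lambda>t \<omega>. simple_process (N n) (p n) (\<Phi> n) t \<omega> - Z t \<omega>)" by simp
    qed
    fix t assume t: "t \<in> {0..T}"
    have sq: "sq_int M (\<lambda>\<omega>. simple_integral W (N n) (p n) (\<Phi> n) t \<omega> - I t \<omega>)" for n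
      by (intro sq_int_diff simple_sq_int(1)[OF si t] S2D[OF I t])
    show "(\<lambda>n. l2 M (\<lambda>\<omega>. simple_integral W (N n) (p n) (\<Phi> n) t \<omega> - I t \<omega>)) \<longlonglongrightarrow> 0"
    proof (rule l2_tendsto_0I[OF sq _ lI])
      show "ennreal ((l2 M (\<lambda>\<omega>. simple_integral W (N n) (p n) (\<Phi> n) t \<omega> - I t \<omega>))\<^sup>2)
        \<le> S2_sq M T (\<lambda>t \<omega>. simple_integral W (N n) (p n) (\<Phi> n) t \<omega> - I t \<omega>)" for n
        using nn_integral_le_S2_sq[OF t, of "\<lambda>t \<omega>. simple_integral W (N n) (p n) (\<Phi> n) t \<omega> - I t \<omega>"]
        by (simp add: nn_integral_eq_l2[OF sq])
    qed
  qed
qed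

lemma ito_integralD:
  assumes "ito_integral M F W T Z I"
  shows "Z \<in> H2 M F T" "I \<in> S2 M F T"
  using assms by (auto simp: ito_integral_def)

text \<open>Orthogonality to the past is stable under L2 limits, so it passes from simple integrals
  to their limit. It stands in for the martingale property and avoids conditional
  expectations.\<close>

lemma ito_orth:
  fixes Z :: "real \<Rightarrow> 'w \<Rightarrow> real^'m^'n"
  assumes ito: "ito_integral M F W T Z I" and st: "0 \<le> s" "s \<le> t" "t \<le> T"
    and z: "\<zeta> \<in> borel_measurable (F s)" "sq_int M \<zeta>"
  shows "expectation (\<lambda>\<omega>. \<zeta> \<omega> \<bullet> (I t \<omega> - I s \<omega>)) = 0"
proof -
  have s: "s \<in> {0..T}" and t: "t \<in> {0..T}" using st by auto
  obtain N p \<Phi> where si: "\<And>n. simple_integrand M F T (N n) (p n) (\<Phi> n)"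
    and "(\<lambda>n. l2 P (\<lambda>z. case_prod (simple_process (N n) (p n) (\<Phi> n)) z - case_prod Z z)) \<longlonglongrightarrow> 0"
    and l: "\<And>t. t \<in> {0..T} \<Longrightarrow> (\<lambda>n. l2 M (\<lambda>\<omega>. simple_integral W (N n) (p n) (\<Phi> n) t \<omega> - I t \<omega>)) \<longlonglongrightarrow> 0"
    using ito_approx_ex[OF ito] by blast
  let ?J = "\<lambda>n. simple_integral W (N n) (p n) (\<Phi> n)"
  have sqI: "sq_int M (I r)" if "r \<in> {0..T}" for r using S2D[OF ito_integralD(2)[OF ito] that] by simp
  have "(\<lambda>n. l2 M (\<lambda>\<omega>. (?J n t \<omega> - ?J n s \<omega>) - (I t \<omega> - I s \<omega>))) \<longlonglongrightarrow> 0"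
  proof (rule tendsto_sandwich[OF _ _ tendsto_const])
    show "\<forall>\<^sub>F n in sequentially. l2 M (\<lambda>\<omega>. (?J n t \<omega> - ?J n s \<omega>) - (I t \<omega> - I s \<omega>))
      \<le> l2 M (\<lambda>\<omega>. ?J n t \<omega> - I t \<omega>) + l2 M (\<lambda>\<omega>. ?J n s \<omega> - I s \<omega>)"
    proof (rule always_eventually, rule allI)
      fix n
      have "(\<lambda>\<omega>. (?J n t \<omega> - ?J n s \<omega>) - (I t \<omega> - I s \<omega>)) = (\<lambda>\<omega>. (?J n t \<omega> - I t \<omega>) - (?J n s \<omega> - I s \<omega>))"
        by (simp add: fun_eq_iff algebra_simps)
      then show "l2 M (\<lambda>\<omega>. (?J n t \<omega> - ?J n s \<omega>) - (I t \<omega> - I s \<omega>))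
        \<le> l2 M (\<lambda>\<omega>. ?J n t \<omega> - I t \<omega>) + l2 M (\<lambda>\<omega>. ?J n s \<omega> - I s \<omega>)"
        using l2_triangle_diff[OF sq_int_diff[OF simple_sq_int(1)[OF si t] sqI[OF t]] sq_int_diff[OF simple_sq_int(1)[OF si s] sqI[OF s]], of n n]
        by simp
    qed
    show "(\<lambda>n. l2 M (\<lambda>\<omega>. ?J n t \<omega> - I t \<omega>) + l2 M (\<lambda>\<omega>. ?J n s \<omega> - I s \<omega>)) \<longlonglongrightarrow> 0"
      using tendsto_add[OF l[OF t] l[OF s]] by simp
  qed auto
  then have "(\<lambda>n. expectation (\<lambda>\<omega>. \<zeta> \<omega> \<bullet> (?J n t \<omega> - ?J n s \<omega>))) \<longlonglongrightarrow> expectation (\<lambda>\<omega>. \<zeta> \<omega> \<bullet> (I t \<omega> - I s \<omega>))"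
    by (intro LINT_inner_tendsto_l2 z(2) sq_int_diff simple_sq_int(1)[OF si] sqI s t) auto
  then have "(\<lambda>n. 0) \<longlonglongrightarrow> expectation (\<lambda>\<omega>. \<zeta> \<omega> \<bullet> (I t \<omega> - I s \<omega>))"
    by (simp only: simple_orth[OF si st z])
  then show ?thesis by (rule LIMSEQ_const_iff[THEN iffD1, symmetric])
qed

text \<open>The isometry of the approximating simple integrals passes to the limit. The statement is
  about a difference because \<open>ito_integral\<close> is a relation: subtracting two integrals
  inside it would ask for simple integrands over common partitions.\<close>

lemma ito_diff_isometry:
  fixes Z Z' :: "real \<Rightarrow> 'w \<Rightarrow> real^'m^'n"
  assumes ito: "ito_integral M F W T Z I" and ito': "ito_integral M F W T Z' I'" and t: "t \<in> {0..T}"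
  shows "l2 M (\<lambda>\<omega>. I t \<omega> - I' t \<omega>) \<le> l2 P (\<lambda>(s, \<omega>). indicator {0..t} s *\<^sub>R (Z s \<omega> - Z' s \<omega>))"
proof -
  obtain N p \<Phi> where si: "\<And>n. simple_integrand M F T (N n) (p n) (\<Phi> n)"
    and lZ: "(\<lambda>n. l2 P (\<lambda>z. case_prod (simple_process (N n) (p n) (\<Phi> n)) z - case_prod Z z)) \<longlonglongrightarrow> 0"
    and lI: "\<And>t. t \<in> {0..T} \<Longrightarrow> (\<lambda>n. l2 M (\<lambda>\<omega>. simple_integral W (N n) (p n) (\<Phi> n) t \<omega> - I t \<omega>)) \<longlonglongrightarrow> 0"
    using ito_approx_ex[OF ito] by blast
  obtain N' p' \<Phi>' where si': "\<And>n. simple_integrand M F T (N' n) (p' n) (\<Phi>' n)"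
    and lZ': "(\<lambda>n. l2 P (\<lambda>z. case_prod (simple_process (N' n) (p' n) (\<Phi>' n)) z - case_prod Z' z)) \<longlonglongrightarrow> 0"
    and lI': "\<And>t. t \<in> {0..T} \<Longrightarrow> (\<lambda>n. l2 M (\<lambda>\<omega>. simple_integral W (N' n) (p' n) (\<Phi>' n) t \<omega> - I' t \<omega>)) \<longlonglongrightarrow> 0"
    using ito_approx_ex[OF ito'] by blast
  let ?J = "\<lambda>n. simple_integral W (N n) (p n) (\<Phi> n) t" and ?J' = "\<lambda>n. simple_integral W (N' n) (p' n) (\<Phi>' n) t"
  let ?H = "\<lambda>n. case_prod (simple_process (N n) (p n) (\<Phi> n))" and ?H' = "\<lambda>n. case_prod (simple_process (N' n) (p' n) (\<Phi>' n))"
  let ?i = "\<lambda>z::real\<times>'w. indicator {0..t} (fst z) :: real"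
  have sqI: "sq_int M (I t)" "sq_int M (I' t)" using S2D[OF ito_integralD(2)[OF ito] t] S2D[OF ito_integralD(2)[OF ito'] t] by auto
  have sqJ: "sq_int M (?J n)" "sq_int M (?J' n)" for n using simple_sq_int(1)[OF si t] simple_sq_int(1)[OF si' t] by auto
  have sqH: "sq_int P (?H n)" "sq_int P (?H' n)" for n using simple_sq_int(2)[OF si t] simple_sq_int(2)[OF si' t] by auto
  have sqZ: "sq_int P (case_prod Z)" "sq_int P (case_prod Z')" using H2D[OF ito_integralD(1)[OF ito]] H2D[OF ito_integralD(1)[OF ito']] by auto
  have im: "?i \<in> borel_measurable P" by (intro measurable_P_fst borel_measurable_indicator) simp
  have sqi: "sq_int P (\<lambda>z. ?i z *\<^sub>R f z)" if "sq_int P f" for f :: "_ \<Rightarrow> real^'m^'n"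
    using that im by (intro sq_int_mono[OF that] borel_measurable_scaleR) (auto simp: sq_int_def indicator_def)
  have le_i: "l2 P (\<lambda>z. ?i z *\<^sub>R f z) \<le> l2 P f" if "sq_int P f" for f :: "_ \<Rightarrow> real^'m^'n"
    by (intro l2_mono[OF that]) (auto simp: indicator_def)
  have iso: "l2 M (\<lambda>\<omega>. ?J n \<omega> - ?J' n \<omega>) = l2 P (\<lambda>z. ?i z *\<^sub>R (?H n z - ?H' n z))" for n
    unfolding simple_isometry[OF si si' t] by (intro arg_cong[where f="l2 P"]) (auto simp: fun_eq_iff)
  \<comment> \<open>On the side of the integrals the triangle inequality runs through
    \<open>?J n\<close> and \<open>?J' n\<close>, on the side of the integrands through the
    corresponding simple processes. All terms but the last vanish in the limit.\<close>
  have step: "l2 M (\<lambda>\<omega>. I t \<omega> - I' t \<omega>) \<le> (l2 M (\<lambda>\<omega>. ?J n \<omega> - I t \<omega>) + l2 M (\<lambda>\<omega>. ?J' n \<omega> - I' t \<omega>)) +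
      (l2 P (\<lambda>z. ?H n z - case_prod Z z) + l2 P (\<lambda>z. ?H' n z - case_prod Z' z)) + l2 P (\<lambda>z. ?i z *\<^sub>R (case_prod Z z - case_prod Z' z))" for n
  proof -
    have "l2 M (\<lambda>\<omega>. I t \<omega> - I' t \<omega>) \<le> l2 M (\<lambda>\<omega>. I t \<omega> - ?J n \<omega>) + l2 M (\<lambda>\<omega>. ?J n \<omega> - I' t \<omega>)"
      by (rule l2_triangle3) (rule sqI sqJ)+
    also have "l2 M (\<lambda>\<omega>. ?J n \<omega> - I' t \<omega>) \<le> l2 M (\<lambda>\<omega>. ?J n \<omega> - ?J' n \<omega>) + l2 M (\<lambda>\<omega>. ?J' n \<omega> - I' t \<omega>)"
      by (rule l2_triangle3) (rule sqI sqJ)+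
    finally have 1: "l2 M (\<lambda>\<omega>. I t \<omega> - I' t \<omega>) \<le> l2 M (\<lambda>\<omega>. ?J n \<omega> - I t \<omega>) + l2 M (\<lambda>\<omega>. ?J' n \<omega> - I' t \<omega>) + l2 M (\<lambda>\<omega>. ?J n \<omega> - ?J' n \<omega>)"
      by (simp add: l2_minus_commute[of M "I t"])
    let ?u = "\<lambda>z. ?H n z - case_prod Z z" and ?v = "\<lambda>z. ?H' n z - case_prod Z' z" and ?w = "\<lambda>z. case_prod Z z - case_prod Z' z"
    have sq: "sq_int P ?u" "sq_int P ?v" "sq_int P ?w" by (intro sq_int_diff sqH sqZ)+
    have "(\<lambda>z. ?i z *\<^sub>R (?H n z - ?H' n z)) = (\<lambda>z. ?i z *\<^sub>R ((?u z - ?v z) + ?w z))" by (simp add: fun_eq_iff)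
    then have "l2 P (\<lambda>z. ?i z *\<^sub>R (?H n z - ?H' n z)) = l2 P (\<lambda>z. ?i z *\<^sub>R (?u z - ?v z) + ?i z *\<^sub>R ?w z)"
      by (simp only: scaleR_add_right)
    also have "\<dots> \<le> l2 P (\<lambda>z. ?i z *\<^sub>R (?u z - ?v z)) + l2 P (\<lambda>z. ?i z *\<^sub>R ?w z)"
      by (intro l2_triangle sqi sq_int_diff sq)
    also have "l2 P (\<lambda>z. ?i z *\<^sub>R (?u z - ?v z)) \<le> l2 P (\<lambda>z. ?u z - ?v z)" by (intro le_i sq_int_diff sq)
    also have "l2 P (\<lambda>z. ?u z - ?v z) \<le> l2 P ?u + l2 P ?v" by (intro l2_triangle_diff sq)
    finally show ?thesis using 1 unfolding iso by linarith
  qed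
  have "(\<lambda>n. (l2 M (\<lambda>\<omega>. ?J n \<omega> - I t \<omega>) + l2 M (\<lambda>\<omega>. ?J' n \<omega> - I' t \<omega>)) +
      (l2 P (\<lambda>z. ?H n z - case_prod Z z) + l2 P (\<lambda>z. ?H' n z - case_prod Z' z)) + l2 P (\<lambda>z. ?i z *\<^sub>R (case_prod Z z - case_prod Z' z)))
      \<longlonglongrightarrow> (0 + 0) + (0 + 0) + l2 P (\<lambda>z. ?i z *\<^sub>R (case_prod Z z - case_prod Z' z))"
    by (intro tendsto_add tendsto_const lI[OF t] lI'[OF t] lZ lZ')
  then have "l2 M (\<lambda>\<omega>. I t \<omega> - I' t \<omega>) \<le> (0 + 0) + (0 + 0) + l2 P (\<lambda>z. ?i z *\<^sub>R (case_prod Z z - case_prod Z' z))"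
    by (rule LIMSEQ_le_const) (use step in blast)
  then show ?thesis by (simp add: split_beta')
qed

text \<open>Comparison with the zero integral turns the isometry for differences into one for a
  single integral.\<close>

lemma ito_zero: "ito_integral M F W T (\<lambda>_ _. 0 :: real^'m^'n) (\<lambda>_ _. 0)"
proof -
  let ?p = "\<lambda>i::nat. if i = 0 then 0 else T" and ?\<Phi> = "\<lambda>(i::nat) (\<omega>::'w). 0 :: real^'m^'n"
  have "simple_integrand M F T 1 ?p ?\<Phi>"
    using T_pos by (auto simp: simple_integrand_def)
  moreover have "simple_process 1 ?p ?\<Phi> = (\<lambda>_ _. 0)" by (simp add: simple_process_def fun_eq_iff)
  moreover have "simple_integral W 1 ?p ?\<Phi> = (\<lambda>_ _. 0)" by (simp add: simple_integral_def fun_eq_iff)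
  moreover have "{0..T} \<noteq> {}" using T_pos by auto
  ultimately show ?thesis
    unfolding ito_integral_def H2_def S2_def
    by (intro conjI exI[of _ "\<lambda>_. 1"] exI[of _ "\<lambda>_. ?p"] exI[of _ "\<lambda>_. ?\<Phi>"])
       (auto simp: H2_sq_def S2_sq_def)
qed

lemma ito_isometry:
  fixes Z :: "real \<Rightarrow> 'w \<Rightarrow> real^'m^'n"
  assumes "ito_integral M F W T Z I" "t \<in> {0..T}"
  shows "l2 M (I t) \<le> l2 P (\<lambda>(s, \<omega>). indicator {0..t} s *\<^sub>R Z s \<omega>)"
  using ito_diff_isometry[OF assms(1) ito_zero assms(2)] by simp

text \<open>Simple integrals vanish at time 0. Their limit is determined by
  \<open>ito_integral\<close> only up to indistinguishability, hence the almost-sure form.\<close>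

lemma ito_0:
  fixes Z :: "real \<Rightarrow> 'w \<Rightarrow> real^'m^'n"
  assumes "ito_integral M F W T Z I"
  shows "AE \<omega> in M. I 0 \<omega> = 0"
proof -
  have t: "0 \<in> {0..T}" using T_pos by simp
  obtain N p \<Phi> where si: "\<And>n. simple_integrand M F T (N n) (p n) (\<Phi> n)"
    and "(\<lambda>n. l2 P (\<lambda>z. case_prod (simple_process (N n) (p n) (\<Phi> n)) z - case_prod Z z)) \<longlonglongrightarrow> 0"
    and l: "\<And>t. t \<in> {0..T} \<Longrightarrow> (\<lambda>n. l2 M (\<lambda>\<omega>. simple_integral W (N n) (p n) (\<Phi> n) t \<omega> - I t \<omega>)) \<longlonglongrightarrow> 0"
    using ito_approx_ex[OF assms] by blast
  have "(\<lambda>n::nat. l2 M (I 0)) \<longlonglongrightarrow> 0"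
    using l[OF t] by (simp add: simple_integral_0[OF si] l2_minus)
  then have "l2 M (I 0) = 0" by (rule LIMSEQ_const_iff[THEN iffD1])
  then have "(LINT \<omega>|M. (norm (I 0 \<omega>))\<^sup>2) = 0" by (simp add: l2_def)
  then have "AE \<omega> in M. (norm (I 0 \<omega>))\<^sup>2 = 0"
    using sq_int_integrable[OF S2D(2)[OF ito_integralD(2)[OF assms] t]]
    by (subst (asm) integral_nonneg_eq_0_iff_AE) auto
  then show ?thesis by simp
qed

end

section \<open>Doob's inequality and the energy identity\<close>

lemma leb_integral_eq:
  fixes g :: "real \<Rightarrow> 'b::euclidean_space"
  assumes "t \<in> {0..T}"
  shows "(LINT s:{0..t}|lborel. g s) = (LINT s|leb T. indicator {0..t} s *\<^sub>R g s)"
proof -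
  have "indicator {0..T} s *\<^sub>R indicator {0..t} s *\<^sub>R g s = indicator {0..t} s *\<^sub>R g s" for s
    using assms by (auto simp: indicator_def)
  moreover have "(LINT s|leb T. indicator {0..t} s *\<^sub>R g s) = (LINT s|lborel. indicator {0..T} s *\<^sub>R indicator {0..t} s *\<^sub>R g s)"
    by (rule integral_restrict_space) simp
  ultimately show ?thesis by (simp only: set_lebesgue_integral_def)
qed

lemma measurable_leb: "f \<in> borel_measurable borel \<Longrightarrow> f \<in> borel_measurable (leb T)"
  by (rule measurable_restrict_space1) simp

lemma integrable_leb_indicator:
  fixes g :: "real \<Rightarrow> 'b::euclidean_space"
  assumes "integrable (leb T) g" "A \<in> sets borel"
  shows "integrable (leb T) (\<lambda>s. indicator A s *\<^sub>R g s)"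
proof (rule Bochner_Integration.integrable_bound[OF assms(1)])
  have "indicat_real A \<in> borel_measurable (leb T)" using assms(2) by (intro measurable_leb) simp
  then show "(\<lambda>s. indicator A s *\<^sub>R g s) \<in> borel_measurable (leb T)"
    using assms(1) by (intro borel_measurable_scaleR) auto
qed (auto simp: indicator_def)

lemma AE_leb_neq: "AE s in leb T. s \<noteq> r"
proof -
  have "AE s in lborel. s \<noteq> r" by (rule AE_lborel_singleton)
  then show ?thesis by (subst AE_restrict_space_iff) (auto elim: eventually_mono)
qed

text \<open>The square is split along the diagonal; both halves contribute the same amount.\<close>

lemma norm_squared_indefinite_integral:
  fixes g :: "real \<Rightarrow> 'b::euclidean_space"
  assumes g: "integrable (leb T) g" and t: "t \<in> {0..T}"
  defines "u \<equiv> \<lambda>s. LINT r|leb T. indicator {0..s} r *\<^sub>R g r"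
  shows "(norm (u t))\<^sup>2 = 2 * (LINT s|leb T. indicator {0..t} s * (u s \<bullet> g s))"
proof -
  interpret D: finite_measure "leb T" by (rule finite_measure_leb)
  interpret DD: pair_sigma_finite "leb T" "leb T" ..
  let ?D = "leb T" and ?DD = "leb T \<Otimes>\<^sub>M leb T"
  let ?i = "indicator {0..t} :: real \<Rightarrow> real"
  define H where "H r s = ?i r * ?i s * (g r \<bullet> g s)" for r s
  have [measurable]: "g \<in> borel_measurable ?D" using g by auto
  have im[measurable]: "?i \<in> borel_measurable ?D" by (rule measurable_leb) simp
  have gf: "(\<lambda>z. g (fst z)) \<in> borel_measurable ?DD" "(\<lambda>z. g (snd z)) \<in> borel_measurable ?DD"
    "(\<lambda>z. ?i (fst z)) \<in> borel_measurable ?DD" "(\<lambda>z. ?i (snd z)) \<in> borel_measurable ?DD"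
    by (auto intro: measurable_compose[OF measurable_fst] measurable_compose[OF measurable_snd] im)
  have idm: "(\<lambda>x. x) \<in> borel_measurable ?D" by (rule measurable_leb) simp
  have le: "{z \<in> space ?DD. fst z \<le> snd z} \<in> sets ?DD" 
    by (intro borel_measurable_le measurable_compose[OF measurable_fst idm] measurable_compose[OF measurable_snd idm])
  have Hm: "case_prod H \<in> borel_measurable ?DD"
    unfolding H_def split_beta' using gf by (intro borel_measurable_times borel_measurable_inner) auto
  have Hi: "integrable ?DD (case_prod H)"
  proof (rule Bochner_Integration.integrable_bound[OF DD.integral_prod_mult(1)[OF integrable_norm[OF g] integrable_norm[OF g]] Hm], rule AE_I2)
    fix z
    show "norm (case_prod H z) \<le> norm (case z of (x, y) \<Rightarrow> norm (g x) * norm (g y))"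
      using Cauchy_Schwarz_ineq2[of "g (fst z)" "g (snd z)"] by (auto simp: H_def split_beta' indicator_def abs_mult)
  qed
  define H1 where "H1 r s = (if r \<le> s then H r s else 0)" for r s
  define H2 where "H2 r s = (if s < r then H r s else 0)" for r s
  have H1m: "case_prod H1 \<in> borel_measurable ?DD"
  proof -
    have "(\<lambda>z. if fst z \<le> snd z then case_prod H z else 0) \<in> borel_measurable ?DD"
      by (rule measurable_If[OF Hm _ le]) simp
    moreover have "(\<lambda>z. if fst z \<le> snd z then case_prod H z else 0) = case_prod H1"
      by (auto simp: fun_eq_iff H1_def)
    ultimately show ?thesis by simp
  qed
  have H2m: "case_prod H2 \<in> borel_measurable ?DD"
  proof -
    have "(\<lambda>z. if fst z \<le> snd z then 0 else case_prod H z) \<in> borel_measurable ?DD"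
      by (rule measurable_If[OF _ Hm le]) simp
    moreover have "(\<lambda>z. if fst z \<le> snd z then 0 else case_prod H z) = case_prod H2"
      by (auto simp: fun_eq_iff H2_def)
    ultimately show ?thesis by simp
  qed
  have H1i: "integrable ?DD (case_prod H1)"
    by (rule Bochner_Integration.integrable_bound[OF Hi H1m]) (auto simp: H1_def)
  have H2i: "integrable ?DD (case_prod H2)"
    by (rule Bochner_Integration.integrable_bound[OF Hi H2m]) (auto simp: H2_def)
  have ig: "integrable ?D (\<lambda>s. indicator {0..r} s *\<^sub>R g s)" for r by (rule integrable_leb_indicator[OF g]) simp
  have "(LINT z|?DD. case_prod H1 z) = (LINT s|?D. (LINT r|?D. H1 r s))" by (rule DD.integral_snd[OF H1i, symmetric])
  also have "\<dots> = (LINT s|?D. ?i s * (u s \<bullet> g s))"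
  proof (rule Bochner_Integration.integral_cong[OF refl])
    fix s
    have "(LINT r|?D. H1 r s) = (LINT r|?D. ?i s * ((indicator {0..s} r *\<^sub>R g r) \<bullet> g s))"
      by (intro Bochner_Integration.integral_cong) (auto simp: H1_def H_def indicator_def)
    also have "\<dots> = ?i s * (u s \<bullet> g s)"
      unfolding u_def integral_mult_right_zero by (intro arg_cong2[where f="(*)"] refl integral_inner_left ig)
    finally show "(LINT r|?D. H1 r s) = ?i s * (u s \<bullet> g s)" .
  qed
  finally have 1: "(LINT z|?DD. case_prod H1 z) = (LINT s|?D. ?i s * (u s \<bullet> g s))" .
  have "(LINT z|?DD. case_prod H2 z) = (LINT r|?D. (LINT s|?D. H2 r s))" using DD.integral_fst[OF H2i] by simp
  also have "\<dots> = (LINT s|?D. ?i s * (u s \<bullet> g s))"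
  proof (rule Bochner_Integration.integral_cong[OF refl])
    fix r
    \<comment> \<open>The strict inequality in \<open>H2\<close> and the closed interval in
      \<open>u r\<close> differ only at the point s = r, a null set.\<close>
    have "(LINT s|?D. H2 r s) = (LINT s|?D. ?i r * ((indicator {0..r} s *\<^sub>R g s) \<bullet> g r))"
    proof (rule integral_cong_AE)
      show "(\<lambda>s. H2 r s) \<in> borel_measurable ?D"
      proof -
        have "(\<lambda>s. if s < r then ?i r * ?i s * (g r \<bullet> g s) else 0) \<in> borel_measurable ?D"
        proof (rule measurable_If)
          show "{s \<in> space ?D. s < r} \<in> sets ?D" by (rule borel_measurable_less[OF idm]) simp
        qed (auto intro!: borel_measurable_times borel_measurable_inner im)
        then show ?thesis by (simp only: H2_def H_def)
      qed
      show "AE s in ?D. H2 r s = ?i r * ((indicator {0..r} s *\<^sub>R g s) \<bullet> g r)"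
        using AE_leb_neq[of r T] by eventually_elim (auto simp: H2_def H_def indicator_def inner_commute)
      show "(\<lambda>s. ?i r * ((indicator {0..r} s *\<^sub>R g s) \<bullet> g r)) \<in> borel_measurable ?D"
        using borel_measurable_integrable[OF ig[of r]] by (intro borel_measurable_times borel_measurable_inner) auto
    qed
    also have "\<dots> = ?i r * (u r \<bullet> g r)"
      unfolding u_def integral_mult_right_zero by (intro arg_cong2[where f="(*)"] refl integral_inner_left ig)
    finally show "(LINT s|?D. H2 r s) = ?i r * (u r \<bullet> g r)" .
  qed
  finally have 2: "(LINT z|?DD. case_prod H2 z) = (LINT s|?D. ?i s * (u s \<bullet> g s))" .
  have "(LINT z|?DD. case_prod H z) = (LINT r|?D. (LINT s|?D. H r s))" using DD.integral_fst[OF Hi] by simp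
  also have "\<dots> = (LINT r|?D. (?i r *\<^sub>R g r) \<bullet> u t)"
  proof (rule Bochner_Integration.integral_cong[OF refl])
    fix r
    have "(LINT s|?D. H r s) = (LINT s|?D. (?i r *\<^sub>R g r) \<bullet> (?i s *\<^sub>R g s))"
      by (intro Bochner_Integration.integral_cong) (auto simp: H_def)
    also have "\<dots> = (?i r *\<^sub>R g r) \<bullet> u t" using ig[of t] unfolding u_def by (intro integral_inner_right) auto
    finally show "(LINT s|?D. H r s) = (?i r *\<^sub>R g r) \<bullet> u t" .
  qed
  also have "\<dots> = u t \<bullet> u t" using ig[of t] unfolding u_def by (intro integral_inner_left) auto
  finally have "(norm (u t))\<^sup>2 = (LINT z|?DD. case_prod H z)" by (simp add: power2_norm_eq_inner)
  also have "\<dots> = (LINT z|?DD. case_prod H1 z + case_prod H2 z)"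
    by (intro Bochner_Integration.integral_cong) (auto simp: H1_def H2_def)
  also have "\<dots> = (LINT z|?DD. case_prod H1 z) + (LINT z|?DD. case_prod H2 z)"
    by (rule Bochner_Integration.integral_add[OF H1i H2i])
  finally show ?thesis unfolding 1 2 by simp
qed

section \<open>Continuous processes on the product of time and probability space\<close>

context two_scale_setting
begin

text \<open>Rounding down to the grid of mesh 1 / c n. The cap \<open>min T\<close> is inactive at
  the rounded times; it is there so that every grid index, not only those reached by rounding, names
  a time in [0,T].\<close>

lemma floor_grid_tendsto:
  assumes t: "t \<in> {0..T}" and c: "filterlim c at_top sequentially" and cpos: "\<And>n. 0 < (c n :: real)"
  shows "(\<lambda>n. min T (real (nat \<lfloor>c n * t\<rfloor>) / c n)) \<longlonglongrightarrow> t"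
    and "min T (real (nat \<lfloor>c n * t\<rfloor>) / c n) \<in> {0..T}"
proof -
  have lo: "real (nat \<lfloor>c n * t\<rfloor>) / c n \<le> t" "t - 1 / c n \<le> real (nat \<lfloor>c n * t\<rfloor>) / c n" for n
  proof -
    have "0 \<le> c n * t" using t cpos[of n] by simp
    then have "real (nat \<lfloor>c n * t\<rfloor>) = of_int \<lfloor>c n * t\<rfloor>" by simp
    moreover have "of_int \<lfloor>c n * t\<rfloor> \<le> c n * t" "c n * t - 1 \<le> of_int \<lfloor>c n * t\<rfloor>" by linarith+
    ultimately show "real (nat \<lfloor>c n * t\<rfloor>) / c n \<le> t" "t - 1 / c n \<le> real (nat \<lfloor>c n * t\<rfloor>) / c n"
    proof -
      assume fl: "real (nat \<lfloor>c n * t\<rfloor>) = of_int \<lfloor>c n * t\<rfloor>" "of_int \<lfloor>c n * t\<rfloor> \<le> c n * t" "c n * t - 1 \<le> of_int \<lfloor>c n * t\<rfloor>"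
      have "t = (c n * t) / c n" "t - 1 / c n = (c n * t - 1) / c n" using cpos[of n] by (simp_all add: field_simps)
      then show "real (nat \<lfloor>c n * t\<rfloor>) / c n \<le> t" "t - 1 / c n \<le> real (nat \<lfloor>c n * t\<rfloor>) / c n"
        using divide_right_mono[OF fl(2), of "c n"] divide_right_mono[OF fl(3), of "c n"] cpos[of n] fl(1) by simp_all
    qed
  qed
  then have eq: "min T (real (nat \<lfloor>c n * t\<rfloor>) / c n) = real (nat \<lfloor>c n * t\<rfloor>) / c n" for n
    using t by (intro min_absorb2) (auto intro: order_trans)
  have "(\<lambda>n. 1 / c n) \<longlonglongrightarrow> 0"
    using tendsto_inverse_0_at_top[OF c] by (simp add: inverse_eq_divide)
  then have "(\<lambda>n. t - 1 / c n) \<longlonglongrightarrow> t - 0" by (intro tendsto_diff tendsto_const)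
  then have l: "(\<lambda>n. t - 1 / c n) \<longlonglongrightarrow> t" by simp
  show "(\<lambda>n. min T (real (nat \<lfloor>c n * t\<rfloor>) / c n)) \<longlonglongrightarrow> t"
    unfolding eq by (rule tendsto_sandwich[OF _ _ l tendsto_const]) (auto simp: lo)
  show "min T (real (nat \<lfloor>c n * t\<rfloor>) / c n) \<in> {0..T}"
    using T_pos cpos[of n] by auto
qed

text \<open>The values at rounded-down times converge by continuity, and each approximation involves
  only countably many random variables.\<close>

lemma measurable_P_continuous:
  fixes Y :: "real \<Rightarrow> 'w \<Rightarrow> 'b::euclidean_space"
  assumes m: "\<And>t. t \<in> {0..T} \<Longrightarrow> Y t \<in> borel_measurable M"
    and c: "\<And>\<omega>. \<omega> \<in> space M \<Longrightarrow> continuous_on {0..T} (\<lambda>t. Y t \<omega>)"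
  shows "case_prod Y \<in> borel_measurable P"
proof (rule borel_measurable_LIMSEQ_metric)
  let ?c = "\<lambda>n. real (Suc n)"
  let ?g = "\<lambda>n t. min T (real (nat \<lfloor>?c n * t\<rfloor>) / ?c n)"
  have cl: "filterlim ?c at_top sequentially"
    by (rule filterlim_compose[OF filterlim_real_sequentially filterlim_Suc])
  show "(\<lambda>z. Y (?g n (fst z)) (snd z)) \<in> borel_measurable P" for n
  proof (rule measurable_compose_countable[where f="\<lambda>i z. Y (min T (real i / ?c n)) (snd z)" and g="\<lambda>z. nat \<lfloor>?c n * fst z\<rfloor>"])
    show "(\<lambda>z. Y (min T (real i / ?c n)) (snd z)) \<in> borel_measurable P" for i
      by (rule measurable_P_snd, rule m) (use T_pos in auto)
    have "(\<lambda>t. nat \<lfloor>?c n * t\<rfloor>) \<in> borel \<rightarrow>\<^sub>M count_space UNIV" by measurable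
    then have "(\<lambda>t. nat \<lfloor>?c n * t\<rfloor>) \<in> D \<rightarrow>\<^sub>M count_space UNIV" by (intro measurable_restrict_space1) simp
    then show "(\<lambda>z. nat \<lfloor>?c n * fst z\<rfloor>) \<in> P \<rightarrow>\<^sub>M count_space UNIV"
      by (rule measurable_compose[OF measurable_fst])
  qed
  fix z assume z: "z \<in> space P"
  then have t: "fst z \<in> {0..T}" and w: "snd z \<in> space M" by (auto simp: space_P)
  have "(\<lambda>n. Y (?g n (fst z)) (snd z)) \<longlonglongrightarrow> Y (fst z) (snd z)"
  proof (rule continuous_on_tendsto_compose[OF c[OF w] floor_grid_tendsto(1)[OF t cl] t])
    show cpos: "0 < ?c n" for n by simp
    show "eventually (\<lambda>n. ?g n (fst z) \<in> {0..T}) sequentially"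
      by (rule always_eventually, rule allI, rule floor_grid_tendsto(2)[OF t cl cpos])
  qed
  then show "(\<lambda>n. Y (?g n (fst z)) (snd z)) \<longlonglongrightarrow> case_prod Y z" by (simp add: split_beta')
qed

lemma S2_sq_int_P:
  fixes Y :: "real \<Rightarrow> 'w \<Rightarrow> 'b::euclidean_space"
  assumes Y: "Y \<in> S2 M F T"
  shows "sq_int P (case_prod Y)"
proof (rule sq_intI_nn_integral)
  show m: "case_prod Y \<in> borel_measurable P"
    using Y by (intro measurable_P_continuous measurable_F_M[OF S2D(1)[OF Y]]) (auto simp: S2_def)
  have "(\<integral>\<^sup>+z. ennreal ((norm (case_prod Y z))\<^sup>2) \<partial>P) = (\<integral>\<^sup>+t. (\<integral>\<^sup>+\<omega>. ennreal ((norm (Y t \<omega>))\<^sup>2) \<partial>M) \<partial>D)"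
    using m nn_integral_fst[of "\<lambda>z. ennreal ((norm (case_prod Y z))\<^sup>2)" D] by simp
  also have "\<dots> \<le> (\<integral>\<^sup>+t. S2_sq M T Y \<partial>D)"
    by (intro nn_integral_mono nn_integral_le_S2_sq) simp
  also have "\<dots> = S2_sq M T Y * emeasure D (space D)" by simp
  also have "\<dots> < \<infinity>"
  proof -
    have "emeasure D (space D) < top" using D.emeasure_finite[of "space D"] by (simp only: top.not_eq_extremum)
    then show ?thesis using Y by (auto simp: S2_def ennreal_mult_less_top simp del: space_D)
  qed
  finally show "(\<integral>\<^sup>+z. ennreal ((norm (case_prod Y z))\<^sup>2) \<partial>P) < \<infinity>" .
qed

lemma sq_int_P_sections:
  assumes "sq_int P (case_prod Z)"
  shows "AE t in D. sq_int M (Z t)" "AE \<omega> in M. sq_int D (\<lambda>t. Z t \<omega>)"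
proof -
  have m: "case_prod Z \<in> borel_measurable P" and i: "integrable P (\<lambda>(t, \<omega>). (norm (Z t \<omega>))\<^sup>2)"
    using assms by (auto simp: sq_int_def split_beta')
  have m1: "Z t \<in> borel_measurable M" if "t \<in> space D" for t using measurable_Pair2[OF m that] by simp
  have m2: "(\<lambda>t. Z t \<omega>) \<in> borel_measurable D" if "\<omega> \<in> space M" for \<omega> using measurable_Pair1[OF m that] by simp
  show "AE t in D. sq_int M (Z t)"
    using DM.AE_integrable_fst[OF i] AE_space by eventually_elim (simp add: sq_int_def m1)
  show "AE \<omega> in M. sq_int D (\<lambda>t. Z t \<omega>)"
    using DM.AE_integrable_snd[OF i] AE_space by eventually_elim (simp add: sq_int_def m2)
qed

section \<open>Doob's inequality from orthogonality of increments\<close>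

text \<open>The L2 martingale property with the test variables kept explicit: instead of a vanishing
  conditional expectation, the increment is orthogonal to everything square integrable that is known
  at time s.\<close>

definition mart_like :: "(real \<Rightarrow> 'w \<Rightarrow> 'b::euclidean_space) \<Rightarrow> bool" where
  "mart_like Y \<longleftrightarrow> (\<forall>t\<in>{0..T}. Y t \<in> borel_measurable (F t) \<and> sq_int M (Y t)) \<and>
    (\<forall>s t \<zeta>. 0 \<le> s \<longrightarrow> s \<le> t \<longrightarrow> t \<le> T \<longrightarrow> \<zeta> \<in> borel_measurable (F s) \<longrightarrow> sq_int M \<zeta> \<longrightarrow>
      expectation (\<lambda>\<omega>. \<zeta> \<omega> \<bullet> (Y t \<omega> - Y s \<omega>)) = 0)"

lemma mart_likeD:
  assumes "mart_like Y"
  shows "t \<in> {0..T} \<Longrightarrow> Y t \<in> borel_measurable (F t)" "t \<in> {0..T} \<Longrightarrow> sq_int M (Y t)"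
    "0 \<le> s \<Longrightarrow> s \<le> t \<Longrightarrow> t \<le> T \<Longrightarrow> \<zeta> \<in> borel_measurable (F s) \<Longrightarrow> sq_int M \<zeta> \<Longrightarrow>
      expectation (\<lambda>\<omega>. \<zeta> \<omega> \<bullet> (Y t \<omega> - Y s \<omega>)) = 0"
  using assms unfolding mart_like_def by blast+

lemma mart_like_ito:
  fixes Z :: "real \<Rightarrow> 'w \<Rightarrow> real^'m^'n"
  assumes "ito_integral M F W T Z I"
  shows "mart_like I"
  unfolding mart_like_def using S2D[OF ito_integralD(2)[OF assms]] ito_orth[OF assms] by blast

lemma mart_like_diff:
  fixes Y Y' :: "real \<Rightarrow> 'w \<Rightarrow> 'b::euclidean_space"
  assumes Y: "mart_like Y" and Y': "mart_like Y'"
  shows "mart_like (\<lambda>t \<omega>. Y t \<omega> - Y' t \<omega>)"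
  unfolding mart_like_def
proof (intro conjI allI ballI impI)
  show "(\<lambda>\<omega>. Y t \<omega> - Y' t \<omega>) \<in> borel_measurable (F t)" "sq_int M (\<lambda>\<omega>. Y t \<omega> - Y' t \<omega>)" if "t \<in> {0..T}" for t
    using mart_likeD(1,2)[OF Y that] mart_likeD(1,2)[OF Y' that] by (auto intro: sq_int_diff)
  fix s t :: real and \<zeta> :: "'w \<Rightarrow> 'b"
  assume st: "0 \<le> s" "s \<le> t" "t \<le> T" and z: "\<zeta> \<in> borel_measurable (F s)" "sq_int M \<zeta>"
  have i: "s \<in> {0..T}" "t \<in> {0..T}" using st by auto
  have "expectation (\<lambda>\<omega>. \<zeta> \<omega> \<bullet> (Y t \<omega> - Y' t \<omega> - (Y s \<omega> - Y' s \<omega>)))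
    = expectation (\<lambda>\<omega>. \<zeta> \<omega> \<bullet> (Y t \<omega> - Y s \<omega>) - \<zeta> \<omega> \<bullet> (Y' t \<omega> - Y' s \<omega>))"
    by (intro Bochner_Integration.integral_cong) (auto simp: algebra_simps inner_diff_right)
  also have "\<dots> = 0"
    using mart_likeD(3)[OF Y st z] mart_likeD(3)[OF Y' st z] i mart_likeD(2)[OF Y] mart_likeD(2)[OF Y']
    by (subst Bochner_Integration.integral_diff) (auto intro!: sq_int_inner z(2) sq_int_diff)
  finally show "expectation (\<lambda>\<omega>. \<zeta> \<omega> \<bullet> (Y t \<omega> - Y' t \<omega> - (Y s \<omega> - Y' s \<omega>))) = 0" .
qed

text \<open>The deterministic core of Doob's inequality. While the maximum m stays fixed the sum
  telescopes; when the new value x raises it, the quantity m x - m^2/2 does not decrease, because as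
  a function of m it is largest at m = x.\<close>

lemma running_max_pathwise:
  fixes s :: "nat \<Rightarrow> real"
  assumes "\<And>k. 0 \<le> s k"
  shows "(\<Sum>k<n. Max (s ` {..k}) * (s (Suc k) - s k)) \<le> Max (s ` {..n}) * s n - (Max (s ` {..n}))\<^sup>2 / 2"
proof (induction n)
  case 0
  then show ?case by (simp add: power2_eq_square)
next
  case (Suc n)
  let ?m = "Max (s ` {..n})" and ?m' = "Max (s ` {..Suc n})"
  have m': "?m' = max (s (Suc n)) ?m" by (simp add: atMost_Suc)
  have "(\<Sum>k<Suc n. Max (s ` {..k}) * (s (Suc k) - s k)) \<le> ?m * s n - ?m\<^sup>2 / 2 + ?m * (s (Suc n) - s n)"
    using Suc by simp
  also have "\<dots> = ?m * s (Suc n) - ?m\<^sup>2 / 2" by (simp add: algebra_simps)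
  also have "\<dots> \<le> ?m' * s (Suc n) - ?m'\<^sup>2 / 2"
  proof -
    have "m * x - m\<^sup>2 / 2 \<le> max x m * x - (max x m)\<^sup>2 / 2" for m x :: real
    proof (cases "x \<le> m")
      case False
      have "2 * m * x \<le> m\<^sup>2 + x\<^sup>2" by (rule sum_squares_bound)
      moreover have "max x m = x" using False by simp
      ultimately show ?thesis by (simp add: power2_eq_square)
    qed (simp add: max_def)
    then show ?thesis unfolding m' .
  qed
  finally show ?case .
qed

text \<open>The unit vector \<open>sgn y\<close> is a subgradient of the norm at y. This is what
  makes the norm of a martingale a submartingale.\<close>

lemma norm_ge_inner_sgn: "(norm x - norm y) \<ge> sgn y \<bullet> (x - y)" for x y :: "'b::euclidean_space"
proof (cases "y = 0")
  case False
  have "sgn y \<bullet> x \<le> norm (sgn y) * norm x" by (rule norm_cauchy_schwarz)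
  moreover have "norm (sgn y) = 1" using False by (simp add: norm_sgn)
  moreover have "sgn y \<bullet> y = norm y" using False by (simp add: sgn_div_norm power2_norm_eq_inner[symmetric] power2_eq_square)
  ultimately show ?thesis by (simp add: inner_diff_right)
qed simp

text \<open>The pathwise inequality is averaged. Its left-hand side has nonnegative mean: an
  increment of the norm dominates the increment of Y in the current direction of Y, and the latter
  is orthogonal to the past.\<close>

lemma doob_discrete:
  fixes Y :: "real \<Rightarrow> 'w \<Rightarrow> 'b::euclidean_space"
  assumes Y: "mart_like Y" and tau: "\<And>k. \<tau> k \<in> {0..T}" "\<And>k. \<tau> k \<le> \<tau> (Suc k)"
  defines "m \<equiv> \<lambda>k \<omega>. Max ((\<lambda>j. norm (Y (\<tau> j) \<omega>)) ` {..k})"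
  shows "sq_int M (m n)" "(l2 M (m n))\<^sup>2 \<le> 4 * (l2 M (Y (\<tau> n)))\<^sup>2"
proof -
  let ?s = "\<lambda>k \<omega>. norm (Y (\<tau> k) \<omega>)"
  have mono: "\<tau> j \<le> \<tau> k" if "j \<le> k" for j k by (rule lift_Suc_mono_le[of \<tau>, OF tau(2) that])
  have Ym: "Y (\<tau> j) \<in> borel_measurable (F (\<tau> k))" if "j \<le> k" for j k
    by (rule measurable_F_mono[OF mart_likeD(1)[OF Y tau(1)] mono[OF that]])
  have mSuc: "m (Suc k) \<omega> = max (?s (Suc k) \<omega>) (m k \<omega>)" for k \<omega> by (simp add: m_def atMost_Suc)
  have m0: "0 \<le> m k \<omega>" for k \<omega>
    unfolding m_def by (rule order_trans[OF norm_ge_zero[of "Y (\<tau> 0) \<omega>"] Max_ge]) auto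
  have mm: "m k \<in> borel_measurable (F (\<tau> l))" if "k \<le> l" for k l
    using that
  proof (induction k)
    case 0
    then show ?case using Ym[of 0 l] by (simp add: m_def)
  next
    case (Suc k)
    then have "(\<lambda>\<omega>. max (?s (Suc k) \<omega>) (m k \<omega>)) \<in> borel_measurable (F (\<tau> l))"
      using Ym[of "Suc k" l] by (intro borel_measurable_max) auto
    then show ?case by (simp add: mSuc[abs_def])
  qed
  have sqs: "sq_int M (?s k)" for k by (intro sq_int_norm mart_likeD(2)[OF Y tau(1)])
  have sqm: "sq_int M (m k)" for k
  proof (induction k)
    case 0
    then show ?case using sqs[of 0] by (simp add: m_def)
  next
    case (Suc k)
    show ?case
    proof (rule sq_int_mono[OF sq_int_add[OF Suc sqs[of "Suc k"]] measurable_F_M[OF mm[OF order_refl]]])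
      have "norm (m (Suc k) \<omega>) \<le> norm (m k \<omega> + ?s (Suc k) \<omega>)" for \<omega>
        using m0[of k \<omega>] by (simp add: mSuc max_def)
      then show "AE \<omega> in M. norm (m (Suc k) \<omega>) \<le> norm (m k \<omega> + ?s (Suc k) \<omega>)" by simp
    qed
  qed
  show "sq_int M (m n)" by (rule sqm)
  have i1: "integrable M (\<lambda>\<omega>. m k \<omega> * (?s (Suc k) \<omega> - ?s k \<omega>))" for k
    using sq_int_inner[OF sqm sq_int_diff[OF sqs sqs]] by simp
  have pos: "0 \<le> expectation (\<lambda>\<omega>. m k \<omega> * (?s (Suc k) \<omega> - ?s k \<omega>))" for k
  proof -
    \<comment> \<open>The running maximum times the current direction is known at time
      \<open>\<tau> k\<close>, hence an admissible test variable.\<close>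
    let ?z = "\<lambda>\<omega>. m k \<omega> *\<^sub>R sgn (Y (\<tau> k) \<omega>)"
    have zm: "?z \<in> borel_measurable (F (\<tau> k))"
      unfolding sgn_div_norm using mm[of k k] Ym[of k k]
      by (intro borel_measurable_scaleR borel_measurable_inverse borel_measurable_norm) auto
    have sqz: "sq_int M ?z"
    proof (rule sq_int_mono[OF sqm[of k] measurable_F_M[OF zm]])
      show "AE \<omega> in M. norm (?z \<omega>) \<le> norm (m k \<omega>)"
        by (intro AE_I2) (auto simp: norm_sgn)
    qed
    have "0 = expectation (\<lambda>\<omega>. ?z \<omega> \<bullet> (Y (\<tau> (Suc k)) \<omega> - Y (\<tau> k) \<omega>))"
      using mart_likeD(3)[OF Y _ tau(2) _ zm sqz] tau(1) by auto
    also have "\<dots> \<le> expectation (\<lambda>\<omega>. m k \<omega> * (?s (Suc k) \<omega> - ?s k \<omega>))"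
    proof (rule integral_mono[OF sq_int_inner[OF sqz sq_int_diff] i1])
      show "sq_int M (Y (\<tau> (Suc k)))" "sq_int M (Y (\<tau> k))" by (intro mart_likeD(2)[OF Y tau(1)])+
      show "?z \<omega> \<bullet> (Y (\<tau> (Suc k)) \<omega> - Y (\<tau> k) \<omega>) \<le> m k \<omega> * (?s (Suc k) \<omega> - ?s k \<omega>)" for \<omega>
        using mult_left_mono[OF norm_ge_inner_sgn m0] by simp
    qed
    finally show ?thesis .
  qed
  have "0 \<le> (\<Sum>k<n. expectation (\<lambda>\<omega>. m k \<omega> * (?s (Suc k) \<omega> - ?s k \<omega>)))" by (intro sum_nonneg pos)
  also have "\<dots> = expectation (\<lambda>\<omega>. \<Sum>k<n. m k \<omega> * (?s (Suc k) \<omega> - ?s k \<omega>))"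
    using i1 by (subst Bochner_Integration.integral_sum) auto
  also have "\<dots> \<le> expectation (\<lambda>\<omega>. (?s n \<omega>)\<^sup>2 - (m n \<omega>)\<^sup>2 / 4)"
  proof (rule integral_mono)
    show "integrable M (\<lambda>\<omega>. \<Sum>k<n. m k \<omega> * (?s (Suc k) \<omega> - ?s k \<omega>))" using i1 by auto
    show "integrable M (\<lambda>\<omega>. (?s n \<omega>)\<^sup>2 - (m n \<omega>)\<^sup>2 / 4)"
      using sq_int_integrable[OF sqs[of n]] sq_int_integrable[OF sqm[of n]] by simp
    fix \<omega>
    have "(\<Sum>k<n. m k \<omega> * (?s (Suc k) \<omega> - ?s k \<omega>)) \<le> m n \<omega> * ?s n \<omega> - (m n \<omega>)\<^sup>2 / 2"
      unfolding m_def by (rule running_max_pathwise) simp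
    \<comment> \<open>Half of the available m^2/2 is spent here; the remaining m^2/4 is the origin
      of the constant 4.\<close>
    moreover have "m n \<omega> * ?s n \<omega> \<le> (m n \<omega>)\<^sup>2 / 4 + (?s n \<omega>)\<^sup>2"
      using sum_squares_bound[of "m n \<omega> / 2" "?s n \<omega>"] by (simp add: power_divide)
    ultimately show "(\<Sum>k<n. m k \<omega> * (?s (Suc k) \<omega> - ?s k \<omega>)) \<le> (?s n \<omega>)\<^sup>2 - (m n \<omega>)\<^sup>2 / 4" by linarith
  qed
  also have "\<dots> = (l2 M (Y (\<tau> n)))\<^sup>2 - (l2 M (m n))\<^sup>2 / 4"
    using sq_int_integrable[OF sqs[of n]] sq_int_integrable[OF sqm[of n]] by (simp add: l2_squared)
  finally show "(l2 M (m n))\<^sup>2 \<le> 4 * (l2 M (Y (\<tau> n)))\<^sup>2" by simp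
qed

text \<open>By continuity the supremum over all times is reached along finite grids. Their suprema
  increase to \<open>S\<close>, a measurable majorant that takes the place of the uncountable
  supremum under the integral.\<close>

lemma doob:
  fixes Y :: "real \<Rightarrow> 'w \<Rightarrow> 'b::euclidean_space"
  assumes Y: "mart_like Y" and c: "\<And>\<omega>. \<omega> \<in> space M \<Longrightarrow> continuous_on {0..T} (\<lambda>t. Y t \<omega>)"
  shows "\<exists>S\<in>borel_measurable M. (\<forall>\<omega>\<in>space M. (SUP t\<in>{0..T}. ennreal ((norm (Y t \<omega>))\<^sup>2)) \<le> S \<omega>) \<and>
    (\<integral>\<^sup>+\<omega>. S \<omega> \<partial>M) \<le> ennreal (4 * (l2 M (Y T))\<^sup>2)"
proof -
  \<comment> \<open>With mesh T / 2^n the node of index 2^n is exactly T, and the grids are nested,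
    so that their suprema increase with n.\<close>
  let ?c = "\<lambda>n. 2 ^ n / T :: real"
  let ?\<tau> = "\<lambda>n k. min T (real k / ?c n)"
  let ?e = "\<lambda>t \<omega>. ennreal ((norm (Y t \<omega>))\<^sup>2)"
  let ?g = "\<lambda>n \<omega>. SUP k\<in>{..2^n}. ?e (?\<tau> n k) \<omega>"
  have cpos: "0 < ?c n" for n using T_pos by simp
  have "filterlim (\<lambda>n. 2 ^ n :: real) at_top sequentially"
  proof (rule filterlim_at_top_mono[OF filterlim_real_sequentially], rule always_eventually, rule allI)
    show "real n \<le> 2 ^ n" for n by (rule less_imp_le[OF of_nat_less_two_power])
  qed
  then have "filterlim (\<lambda>n. inverse T * 2 ^ n) at_top sequentially"
    using T_pos by (intro filterlim_tendsto_pos_mult_at_top[OF tendsto_const]) auto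
  then have cl: "filterlim ?c at_top sequentially"
    by (simp add: divide_inverse mult.commute)
  have tau: "?\<tau> n k \<in> {0..T}" "?\<tau> n k \<le> ?\<tau> n (Suc k)" for n k
  proof -
    have "real k / ?c n \<le> real (Suc k) / ?c n" by (rule divide_right_mono) (use cpos[of n] in auto)
    then show "?\<tau> n k \<le> ?\<tau> n (Suc k)" by (rule min.mono[OF order_refl])
  qed (use T_pos in auto)
  have tauT: "?\<tau> n (2 ^ n) = T" for n using T_pos by simp
  have gm: "?g n \<in> borel_measurable M" for n
    using measurable_F_M[OF mart_likeD(1)[OF Y tau(1)]] by (intro borel_measurable_SUP) auto
  have inc: "incseq ?g"
  proof (rule incseq_SucI, rule le_funI, rule SUP_mono)
    fix n \<omega> k assume k: "k \<in> {..(2::nat) ^ n}"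
    have "real k / ?c n = real (2 * k) / ?c (Suc n)" by simp
    then show "\<exists>j\<in>{..2 ^ Suc n}. ?e (?\<tau> n k) \<omega> \<le> ?e (?\<tau> (Suc n) j) \<omega>"
      using k by (intro bexI[of _ "2 * k"]) auto
  qed
  have sup: "(SUP t\<in>{0..T}. ?e t \<omega>) \<le> (SUP n. ?g n \<omega>)" if w: "\<omega> \<in> space M" for \<omega>
  proof (rule SUP_least)
    fix t assume t: "t \<in> {0..T}"
    let ?k = "\<lambda>n. nat \<lfloor>?c n * t\<rfloor>"
    have lim: "(\<lambda>n. Y (?\<tau> n (?k n)) \<omega>) \<longlonglongrightarrow> Y t \<omega>"
      by (rule continuous_on_tendsto_compose[OF c[OF w] floor_grid_tendsto(1)[OF t cl cpos] t])
         (rule always_eventually, rule allI, rule tau(1))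
    have lim': "(\<lambda>n. ?e (?\<tau> n (?k n)) \<omega>) \<longlonglongrightarrow> ?e t \<omega>"
      by (intro tendsto_ennrealI tendsto_power tendsto_norm lim)
    have le: "?e (?\<tau> n (?k n)) \<omega> \<le> (SUP n. ?g n \<omega>)" for n
    proof -
      have "?c n * t \<le> 2 ^ n" using t T_pos by (simp add: field_simps)
      then have "\<lfloor>?c n * t\<rfloor> \<le> 2 ^ n" by (simp add: floor_le_iff)
      then have "?k n \<le> 2 ^ n" by (simp add: nat_le_iff)
      then have "?e (?\<tau> n (?k n)) \<omega> \<le> ?g n \<omega>" by (intro SUP_upper) simp
      also have "\<dots> \<le> (SUP n. ?g n \<omega>)" by (rule SUP_upper) simp
      finally show ?thesis .
    qed
    show "?e t \<omega> \<le> (SUP n. ?g n \<omega>)"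
      by (rule LIMSEQ_le_const2[OF lim']) (rule exI, rule allI, rule impI, rule le)
  qed
  have "(\<integral>\<^sup>+\<omega>. (SUP n. ?g n \<omega>) \<partial>M) = (SUP n. \<integral>\<^sup>+\<omega>. ?g n \<omega> \<partial>M)"
    by (rule nn_integral_monotone_convergence_SUP[OF inc gm])
  also have "\<dots> \<le> ennreal (4 * (l2 M (Y T))\<^sup>2)"
  proof (rule SUP_least)
    fix n
    let ?m = "\<lambda>\<omega>. Max ((\<lambda>j. norm (Y (?\<tau> n j) \<omega>)) ` {..2 ^ n})"
    have "(\<integral>\<^sup>+\<omega>. ?g n \<omega> \<partial>M) \<le> (\<integral>\<^sup>+\<omega>. ennreal ((norm (?m \<omega>))\<^sup>2) \<partial>M)"
    proof (intro nn_integral_mono SUP_least ennreal_leI power_mono norm_ge_zero)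
      fix \<omega> k assume "k \<in> {..(2::nat) ^ n}"
      then have "norm (Y (?\<tau> n k) \<omega>) \<le> ?m \<omega>" by (intro Max_ge) auto
      then show "norm (Y (?\<tau> n k) \<omega>) \<le> norm (?m \<omega>)" by simp
    qed
    also have "\<dots> = ennreal ((l2 M ?m)\<^sup>2)" by (rule nn_integral_eq_l2[OF doob_discrete(1)[where \<tau>="?\<tau> n", OF Y tau]])
    also have "\<dots> \<le> ennreal (4 * (l2 M (Y T))\<^sup>2)"
      using doob_discrete(2)[where \<tau>="?\<tau> n" and n="2 ^ n", OF Y tau] unfolding tauT by (rule ennreal_leI)
    finally show "(\<integral>\<^sup>+\<omega>. ?g n \<omega> \<partial>M) \<le> ennreal (4 * (l2 M (Y T))\<^sup>2)" .
  qed
  finally have le: "(\<integral>\<^sup>+\<omega>. (SUP n. ?g n \<omega>) \<partial>M) \<le> ennreal (4 * (l2 M (Y T))\<^sup>2)" .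
  have "(\<lambda>\<omega>. SUP n. ?g n \<omega>) \<in> borel_measurable M"
    by (rule borel_measurable_SUP[OF countableI_type], rule gm)
  then show ?thesis by (rule bexI[rotated]) (use sup le in blast)
qed

section \<open>The energy identity\<close>

lemma sq_int_P_snd: "sq_int M g \<Longrightarrow> sq_int P (\<lambda>(t, \<omega>). g \<omega>)"
proof -
  assume g: "sq_int M g"
  have "integrable P (\<lambda>(t, \<omega>). 1 * (norm (g \<omega>))\<^sup>2)"
    using g by (intro DM.integral_prod_mult) (auto simp: sq_int_def)
  moreover have "(\<lambda>z. g (snd z)) \<in> borel_measurable P"
    using g by (intro measurable_P_snd) (simp add: sq_int_def)
  ultimately show ?thesis by (simp add: sq_int_def split_beta')
qed

text \<open>The square of Y = Y 0 + U + I, with U the drift part, is expanded. The square of U is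
  treated path by path, Y 0 is orthogonal to I, and in the product of I t with the drift at time s
  the value I t may be replaced by I s because \<open>f s\<close> is known at s. The drift terms
  then recombine to Y s against f s, as Ito's formula would give in mean.\<close>

lemma energy_identity:
  fixes Y f I :: "real \<Rightarrow> 'w \<Rightarrow> 'b::euclidean_space"
  assumes f: "sq_int P (case_prod f)" "\<And>t. t \<in> {0..T} \<Longrightarrow> f t \<in> borel_measurable (F t)"
    and I: "mart_like I" "sq_int P (case_prod I)" "AE \<omega> in M. I 0 \<omega> = 0"
    and Y: "sq_int P (case_prod Y)" "\<And>t. t \<in> {0..T} \<Longrightarrow> sq_int M (Y t)" "Y 0 \<in> borel_measurable (F 0)"
    and eq: "AE \<omega> in M. \<forall>t\<in>{0..T}. Y t \<omega> = Y 0 \<omega> + (LINT s|D. indicator {0..t} s *\<^sub>R f s \<omega>) + I t \<omega>"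
    and t: "t \<in> {0..T}"
  shows "(l2 M (Y t))\<^sup>2 = (l2 M (Y 0))\<^sup>2
    + 2 * (LINT z|P. (\<lambda>(s, \<omega>). indicator {0..t} s * (Y s \<omega> \<bullet> f s \<omega>)) z) + (l2 M (I t))\<^sup>2"
proof -
  have t0: "0 \<in> {0..T}" using T_pos by simp
  let ?i = "indicator {0..t} :: real \<Rightarrow> real"
  \<comment> \<open>Defining U by subtraction makes it jointly measurable at once; that it is the
    indefinite integral of f holds only almost surely.\<close>
  define U where "U s \<omega> = Y s \<omega> - Y 0 \<omega> - I s \<omega>" for s \<omega>
  have sqI: "sq_int M (I s)" if "s \<in> {0..T}" for s using mart_likeD(2)[OF I(1) that] .
  have sqU: "sq_int M (U t)" unfolding U_def by (intro sq_int_diff Y(2) t t0 sqI)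
  have eqU: "case_prod U = (\<lambda>z. case_prod Y z - (\<lambda>(s, \<omega>). Y 0 \<omega>) z - case_prod I z)"
    by (auto simp: U_def fun_eq_iff)
  have sqU_P: "sq_int P (case_prod U)"
    unfolding eqU by (intro sq_int_diff Y(1) I(2) sq_int_P_snd Y(2) t0)
  have AEf: "AE \<omega> in M. integrable D (\<lambda>s. f s \<omega>)"
    using sq_int_P_sections(2)[OF f(1)] by eventually_elim (rule sq_int_imp_integrable[OF D.finite_measure_axioms])
  have AEU: "AE \<omega> in M. \<forall>s\<in>{0..T}. U s \<omega> = (LINT r|D. indicator {0..s} r *\<^sub>R f r \<omega>)"
    using eq
  proof eventually_elim
    case (elim \<omega>)
    show ?case
    proof
      fix s assume "s \<in> {0..T}"
      with elim have "Y s \<omega> = Y 0 \<omega> + (LINT r|D. indicator {0..s} r *\<^sub>R f r \<omega>) + I s \<omega>" by blast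
      then show "U s \<omega> = (LINT r|D. indicator {0..s} r *\<^sub>R f r \<omega>)" unfolding U_def by simp
    qed
  qed
  have ip: "integrable P (\<lambda>(s, \<omega>). ?i s * (h s \<omega> \<bullet> f s \<omega>))" if "sq_int P (case_prod h)" for h :: "real \<Rightarrow> 'w \<Rightarrow> 'b"
  proof -
    have "sq_int P (\<lambda>(s, \<omega>). ?i s *\<^sub>R h s \<omega>)"
    proof (rule sq_int_P_fstI[OF _ _ that])
      show "?i \<in> borel_measurable D" by (rule measurable_D) simp
    qed (simp add: indicator_def)
    from sq_int_inner[OF this f(1)] show ?thesis by (simp add: split_beta')
  qed
  have meas_swap: "(\<lambda>\<omega>. LINT s|D. ?i s * (h s \<omega> \<bullet> f s \<omega>)) \<in> borel_measurable M" if "sq_int P (case_prod h)" for h :: "real \<Rightarrow> 'w \<Rightarrow> 'b"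
    using DM.integrable_snd[OF ip[OF that]] by auto
  have sec: "(LINT \<omega>|M. (LINT s|D. ?i s * (h s \<omega> \<bullet> f s \<omega>))) = (LINT z|P. (\<lambda>(s, \<omega>). ?i s * (h s \<omega> \<bullet> f s \<omega>)) z)"
    if "sq_int P (case_prod h)" for h :: "real \<Rightarrow> 'w \<Rightarrow> 'b"
    using DM.integral_snd[OF ip[OF that]] by simp
  have EU: "(l2 M (U t))\<^sup>2 = 2 * (LINT z|P. (\<lambda>(s, \<omega>). ?i s * (U s \<omega> \<bullet> f s \<omega>)) z)"
  proof -
    have "(l2 M (U t))\<^sup>2 = (LINT \<omega>|M. 2 * (LINT s|D. ?i s * (U s \<omega> \<bullet> f s \<omega>)))"
      unfolding l2_squared
    proof (rule integral_cong_AE)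
      show "(\<lambda>\<omega>. (norm (U t \<omega>))\<^sup>2) \<in> borel_measurable M" using sqU by (auto simp: sq_int_def)
      show "(\<lambda>\<omega>. 2 * (LINT s|D. ?i s * (U s \<omega> \<bullet> f s \<omega>))) \<in> borel_measurable M"
        using meas_swap[OF sqU_P] by (intro borel_measurable_times) auto
      show "AE \<omega> in M. (norm (U t \<omega>))\<^sup>2 = 2 * (LINT s|D. ?i s * (U s \<omega> \<bullet> f s \<omega>))"
        using AEf AEU
      proof eventually_elim
        case (elim \<omega>)
        have "(LINT s|D. ?i s * (U s \<omega> \<bullet> f s \<omega>)) = (LINT s|D. ?i s * ((LINT r|D. indicator {0..s} r *\<^sub>R f r \<omega>) \<bullet> f s \<omega>))"
          using elim(2) by (intro Bochner_Integration.integral_cong) auto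
        then show ?case using norm_squared_indefinite_integral[OF elim(1) t] elim(2) t by simp
      qed
    qed
    also have "\<dots> = 2 * (LINT z|P. (\<lambda>(s, \<omega>). ?i s * (U s \<omega> \<bullet> f s \<omega>)) z)"
      unfolding integral_mult_right_zero sec[OF sqU_P] ..
    finally show ?thesis .
  qed
  have const: "(LINT \<omega>|M. \<zeta> \<omega> \<bullet> U t \<omega>) = (LINT z|P. (\<lambda>(s, \<omega>). ?i s * (\<zeta> \<omega> \<bullet> f s \<omega>)) z)"
    if z: "sq_int M \<zeta>" for \<zeta>
  proof -
    have "(LINT \<omega>|M. \<zeta> \<omega> \<bullet> U t \<omega>) = (LINT \<omega>|M. (LINT s|D. ?i s * (\<zeta> \<omega> \<bullet> f s \<omega>)))"
    proof (rule integral_cong_AE)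
      show "(\<lambda>\<omega>. \<zeta> \<omega> \<bullet> U t \<omega>) \<in> borel_measurable M" using sqU z by (auto simp: sq_int_def)
      show "(\<lambda>\<omega>. LINT s|D. ?i s * (\<zeta> \<omega> \<bullet> f s \<omega>)) \<in> borel_measurable M"
        using meas_swap[OF sq_int_P_snd[OF z]] .
      show "AE \<omega> in M. \<zeta> \<omega> \<bullet> U t \<omega> = (LINT s|D. ?i s * (\<zeta> \<omega> \<bullet> f s \<omega>))"
        using AEf AEU
      proof eventually_elim
        case (elim \<omega>)
        have "integrable D (\<lambda>s. ?i s *\<^sub>R f s \<omega>)" by (rule integrable_leb_indicator[OF elim(1)]) simp
        then have "(LINT s|D. \<zeta> \<omega> \<bullet> (?i s *\<^sub>R f s \<omega>)) = \<zeta> \<omega> \<bullet> (LINT s|D. ?i s *\<^sub>R f s \<omega>)"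
          by (intro integral_inner_right)
        then show ?case using elim(2) t by simp
      qed
    qed
    then show ?thesis using sec[OF sq_int_P_snd[OF z]] by simp
  qed
  have EI: "(LINT \<omega>|M. I t \<omega> \<bullet> U t \<omega>) = (LINT z|P. (\<lambda>(s, \<omega>). ?i s * (I s \<omega> \<bullet> f s \<omega>)) z)"
  proof -
    note i1 = ip[OF sq_int_P_snd[OF sqI[OF t]]] and i2 = ip[OF I(2)]
    have "(LINT \<omega>|M. I t \<omega> \<bullet> U t \<omega>) = (LINT z|P. (\<lambda>(s, \<omega>). ?i s * (I t \<omega> \<bullet> f s \<omega>)) z)"
      by (rule const[OF sqI[OF t]])
    also have "\<dots> = (LINT s|D. (LINT \<omega>|M. ?i s * (I t \<omega> \<bullet> f s \<omega>)))"
      using DM.integral_fst[OF i1] by simp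
    also have "\<dots> = (LINT s|D. (LINT \<omega>|M. ?i s * (I s \<omega> \<bullet> f s \<omega>)))"
    proof (rule integral_cong_AE)
      show "(\<lambda>s. LINT \<omega>|M. ?i s * (I t \<omega> \<bullet> f s \<omega>)) \<in> borel_measurable D"
        using DM.integrable_fst[OF i1] by auto
      show "(\<lambda>s. LINT \<omega>|M. ?i s * (I s \<omega> \<bullet> f s \<omega>)) \<in> borel_measurable D"
        using DM.integrable_fst[OF i2] by auto
      \<comment> \<open>For almost every s the section \<open>f s\<close> is square integrable, so
        it can serve as test variable for the increment of I from s to t.\<close>
      show "AE s in D. (LINT \<omega>|M. ?i s * (I t \<omega> \<bullet> f s \<omega>)) = (LINT \<omega>|M. ?i s * (I s \<omega> \<bullet> f s \<omega>))"
        using sq_int_P_sections(1)[OF f(1)] AE_space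
      proof eventually_elim
        case (elim s)
        show ?case
        proof (cases "s \<le> t")
          case True
          have s: "0 \<le> s" "s \<in> {0..T}" using elim by auto
          have "(LINT \<omega>|M. f s \<omega> \<bullet> (I t \<omega> - I s \<omega>)) = 0"
            using mart_likeD(3)[OF I(1) s(1) True _ f(2)[OF s(2)] elim(1)] t by simp
          moreover have "(LINT \<omega>|M. f s \<omega> \<bullet> (I t \<omega> - I s \<omega>)) = (LINT \<omega>|M. I t \<omega> \<bullet> f s \<omega>) - (LINT \<omega>|M. I s \<omega> \<bullet> f s \<omega>)"
            unfolding inner_diff_right
            by (subst Bochner_Integration.integral_diff)
               (auto intro!: sq_int_inner elim(1) sqI t s simp: inner_commute)
          ultimately show ?thesis by simp
        qed simp
      qed
    qed
    also have "\<dots> = (LINT z|P. (\<lambda>(s, \<omega>). ?i s * (I s \<omega> \<bullet> f s \<omega>)) z)"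
      using DM.integral_fst[OF i2] by simp
    finally show ?thesis .
  qed
  have Y0I: "(LINT \<omega>|M. Y 0 \<omega> \<bullet> I t \<omega>) = 0"
  proof -
    have "(LINT \<omega>|M. Y 0 \<omega> \<bullet> I t \<omega>) = (LINT \<omega>|M. Y 0 \<omega> \<bullet> (I t \<omega> - I 0 \<omega>))"
      using sqI[OF t] sqI[OF t0] Y(2)[OF t0] I(3) by (intro integral_cong_AE) (auto simp: sq_int_def)
    also have "\<dots> = 0" using mart_likeD(3)[OF I(1) _ _ _ Y(3) Y(2)[OF t0]] t by simp
    finally show ?thesis .
  qed
  then have Y0I': "(LINT \<omega>|M. I t \<omega> \<bullet> Y 0 \<omega>) = 0" by (simp add: inner_commute)
  have "Y t \<omega> = (Y 0 \<omega> + U t \<omega>) + I t \<omega>" for \<omega> by (simp add: U_def)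
  then have "l2 M (Y t) = l2 M (\<lambda>\<omega>. (Y 0 \<omega> + U t \<omega>) + I t \<omega>)" by (intro l2_cong) simp
  then have "(l2 M (Y t))\<^sup>2 = (l2 M (Y 0))\<^sup>2 + 2 * (LINT \<omega>|M. Y 0 \<omega> \<bullet> U t \<omega>) + (l2 M (U t))\<^sup>2
      + 2 * (LINT \<omega>|M. (Y 0 \<omega> + U t \<omega>) \<bullet> I t \<omega>) + (l2 M (I t))\<^sup>2"
    by (simp only: l2_add_squared[OF sq_int_add[OF Y(2)[OF t0] sqU] sqI[OF t]] l2_add_squared[OF Y(2)[OF t0] sqU])
  also have "(LINT \<omega>|M. (Y 0 \<omega> + U t \<omega>) \<bullet> I t \<omega>) = (LINT \<omega>|M. I t \<omega> \<bullet> U t \<omega>)"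
    unfolding inner_add_left
    by (subst Bochner_Integration.integral_add) (auto intro!: sq_int_inner Y(2) t0 sqU sqI t simp: Y0I' inner_commute)
  finally have "(l2 M (Y t))\<^sup>2 = (l2 M (Y 0))\<^sup>2 + (l2 M (I t))\<^sup>2
      + 2 * ((LINT z|P. (\<lambda>(s, \<omega>). ?i s * (Y 0 \<omega> \<bullet> f s \<omega>)) z) + (LINT z|P. (\<lambda>(s, \<omega>). ?i s * (U s \<omega> \<bullet> f s \<omega>)) z)
        + (LINT z|P. (\<lambda>(s, \<omega>). ?i s * (I s \<omega> \<bullet> f s \<omega>)) z))"
    unfolding EU EI const[OF Y(2)[OF t0]] by simp
  also have "(LINT z|P. (\<lambda>(s, \<omega>). ?i s * (Y 0 \<omega> \<bullet> f s \<omega>)) z) + (LINT z|P. (\<lambda>(s, \<omega>). ?i s * (U s \<omega> \<bullet> f s \<omega>)) z)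
        + (LINT z|P. (\<lambda>(s, \<omega>). ?i s * (I s \<omega> \<bullet> f s \<omega>)) z)
      = (LINT z|P. (\<lambda>(s, \<omega>). ?i s * (Y 0 \<omega> \<bullet> f s \<omega>)) z + (\<lambda>(s, \<omega>). ?i s * (U s \<omega> \<bullet> f s \<omega>)) z
        + (\<lambda>(s, \<omega>). ?i s * (I s \<omega> \<bullet> f s \<omega>)) z)"
    using ip[OF sq_int_P_snd[OF Y(2)[OF t0]]] ip[OF sqU_P] ip[OF I(2)]
    by (simp only: Bochner_Integration.integral_add Bochner_Integration.integrable_add)
  also have "\<dots> = (LINT z|P. (\<lambda>(s, \<omega>). ?i s * (Y s \<omega> \<bullet> f s \<omega>)) z)"
    by (intro Bochner_Integration.integral_cong refl) (auto simp: U_def algebra_simps inner_diff_left)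
  finally show ?thesis by simp
qed

end

section \<open>Approximation by absolutely continuous adapted processes\<close>

lemma integrable_indicator_Icc: "integrable lborel (\<lambda>x::real. c * indicat_real {a..b} x)"
proof -
  have "integrable lborel (indicat_real {a..b::real})"
    by (rule integrable_real_indicator) (auto simp: emeasure_lborel_Icc_eq)
  then show ?thesis by (rule integrable_mult_right)
qed

lemma set_integrable_bounded:
  fixes g :: "real \<Rightarrow> 'b::euclidean_space"
  assumes "g \<in> borel_measurable borel" "\<And>x. norm (g x) \<le> C"
  shows "integrable lborel (\<lambda>x. indicator {a..b} x *\<^sub>R g x)"
proof (rule Bochner_Integration.integrable_bound)
  show "integrable lborel (\<lambda>x. C * indicat_real {a..b} x)" by (rule integrable_indicator_Icc)
  show "(\<lambda>x. indicator {a..b} x *\<^sub>R g x) \<in> borel_measurable lborel"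
    using assms(1) by (intro borel_measurable_scaleR borel_measurable_indicator) auto
  show "AE x in lborel. norm (indicator {a..b} x *\<^sub>R g x) \<le> norm (C * indicat_real {a..b} x)"
    using assms(2) by (intro AE_I2) (auto simp: indicator_def intro: order_trans[OF _ abs_ge_self])
qed

text \<open>Lebesgue differentiation. Averages over the past are wanted since they preserve
  adaptedness; reflecting the line reduces them to averages over intervals [x, x + h].\<close>

lemma AE_backward_average:
  fixes g :: "real \<Rightarrow> 'b::euclidean_space"
  assumes gm: "g \<in> borel_measurable borel" and gb: "\<And>x. norm (g x) \<le> C"
  shows "AE t in lborel. (\<lambda>n. (LINT s|lborel. indicator {t - 1 / real (Suc n)..t} s *\<^sub>R g s) /\<^sub>R (1 / real (Suc n))) \<longlonglongrightarrow> g t"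
proof -
  let ?f = "\<lambda>x. g (- x)"
  have fm: "?f \<in> borel_measurable borel" by (rule measurable_compose[OF _ gm]) simp
  have si: "set_integrable lborel {a..b} ?f" for a b
    unfolding set_integrable_def by (rule set_integrable_bounded[OF fm gb])
  have "?f integrable_on cbox a b" for a b
    using set_borel_integral_eq_integral(1)[OF si[of a b]] by simp
  from integrable_ccontinuous_explicit[OF this] obtain N where N: "negligible N"
    and lim: "\<And>x e. x \<notin> N \<Longrightarrow> 0 < e \<Longrightarrow> \<exists>d>0. \<forall>h. 0 < h \<and> h < d \<longrightarrow>
      norm (integral (cbox x (x + h *\<^sub>R One)) ?f /\<^sub>R h ^ DIM(real) - ?f x) < e" by blast
  have "negligible (uminus ` N)"
    by (rule negligible_differentiable_image_negligible[OF _ N]) (auto simp: differentiable_on_def intro!: differentiable_minus differentiable_ident)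
  then have "AE t in lebesgue. t \<notin> uminus ` N" unfolding negligible_iff_null_sets by (rule AE_not_in)
  then have "AE t in lborel. t \<notin> uminus ` N" by (simp only: AE_completion_iff)
  then show ?thesis
  proof eventually_elim
    case (elim t)
    then have tN: "- t \<notin> N" by force
    have eq: "integral (cbox (- t) (- t + h *\<^sub>R One)) ?f = (LINT s|lborel. indicator {t - h..t} s *\<^sub>R g s)" for h :: real
    proof -
      have "(LINT s|lborel. indicator {t - h..t} s *\<^sub>R g s) = (LINT s|lborel. indicator {t - h..t} (- s) *\<^sub>R g (- s))"
        using lborel_integral_real_affine[of "-1" "\<lambda>s. indicator {t - h..t} s *\<^sub>R g s" 0] by simp
      also have "\<dots> = (LINT s:{- t..- t + h}|lborel. ?f s)"
        unfolding set_lebesgue_integral_def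
        by (intro Bochner_Integration.integral_cong refl) (auto simp: indicator_def)
      also have "\<dots> = integral {- t..- t + h} ?f" by (rule set_borel_integral_eq_integral(2)[OF si])
      finally show ?thesis by simp
    qed
    show ?case
    proof (rule LIMSEQ_I)
      fix e :: real assume "0 < e"
      from lim[OF tN this] obtain d where d: "0 < d" "\<And>h. 0 < h \<Longrightarrow> h < d \<Longrightarrow>
        norm (integral (cbox (- t) (- t + h *\<^sub>R One)) ?f /\<^sub>R h ^ DIM(real) - ?f (- t)) < e" by blast
      obtain n0 where n0: "inverse (real (Suc n0)) < d" using reals_Archimedean[OF d(1)] by blast
      show "\<exists>no. \<forall>n\<ge>no. norm ((LINT s|lborel. indicator {t - 1 / real (Suc n)..t} s *\<^sub>R g s) /\<^sub>R (1 / real (Suc n)) - g t) < e"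
      proof (intro exI allI impI)
        fix n assume "n0 \<le> n"
        then have "inverse (real (Suc n)) \<le> inverse (real (Suc n0))" by (intro le_imp_inverse_le) auto
        then have "1 / real (Suc n) < d" using n0 by (simp add: inverse_eq_divide)
        from d(2)[OF _ this] show "norm ((LINT s|lborel. indicator {t - 1 / real (Suc n)..t} s *\<^sub>R g s) /\<^sub>R (1 / real (Suc n)) - g t) < e"
          unfolding eq by (simp del: of_nat_Suc)
      qed
    qed
  qed
qed

text \<open>The average over [t - h, t] has derivative (g t - g (t - h)) / h; this is the integrated
  form, obtained by shifting one of two integrals. The indicator of {h..} keeps the shifted argument
  nonnegative, in agreement with g = 0 before time 0.\<close>

lemma backward_average_eq:
  fixes g :: "real \<Rightarrow> 'b::euclidean_space"
  assumes gm: "g \<in> borel_measurable borel" and gb: "\<And>x. norm (g x) \<le> C"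
    and g0: "\<And>x. x < 0 \<Longrightarrow> g x = 0" and h: "0 < h"
  shows "(LINT s|lborel. indicator {0..t} s *\<^sub>R ((g s - indicator {h..} s *\<^sub>R g (s - h)) /\<^sub>R h))
    = (LINT s|lborel. indicator {t - h..t} s *\<^sub>R g s) /\<^sub>R h"
proof -
  note I = set_integrable_bounded[OF gm gb]
  have gm': "(\<lambda>s. g (s - h)) \<in> borel_measurable borel" by (rule measurable_compose[OF _ gm]) simp
  note I' = set_integrable_bounded[OF gm' gb]
  have "(LINT s|lborel. indicator {0..t} s *\<^sub>R ((g s - indicator {h..} s *\<^sub>R g (s - h)) /\<^sub>R h))
    = (LINT s|lborel. (indicator {0..t} s *\<^sub>R g s - indicator {h..t} s *\<^sub>R g (s - h)) /\<^sub>R h)"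
    using h by (intro Bochner_Integration.integral_cong refl) (auto simp: indicator_def)
  also have "\<dots> = ((LINT s|lborel. indicator {0..t} s *\<^sub>R g s) - (LINT s|lborel. indicator {h..t} s *\<^sub>R g (s - h))) /\<^sub>R h"
    using I[of 0 t] I'[of h t] by simp
  also have "(LINT s|lborel. indicator {h..t} s *\<^sub>R g (s - h)) = (LINT s|lborel. indicator {0..t - h} s *\<^sub>R g s)"
  proof -
    have "(LINT s|lborel. indicator {h..t} s *\<^sub>R g (s - h)) = (LINT s|lborel. indicator {h..t} (h + s) *\<^sub>R g s)"
      using lborel_integral_real_affine[of 1 "\<lambda>s. indicator {h..t} s *\<^sub>R g (s - h)" h] by simp
    also have "\<dots> = (LINT s|lborel. indicator {0..t - h} s *\<^sub>R g s)"
      by (intro Bochner_Integration.integral_cong refl) (auto simp: indicator_def)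
    finally show ?thesis .
  qed
  also have "(LINT s|lborel. indicator {0..t} s *\<^sub>R g s) - (LINT s|lborel. indicator {0..t - h} s *\<^sub>R g s)
    = (LINT s|lborel. indicator {0..t} s *\<^sub>R g s - indicator {0..t - h} s *\<^sub>R g s)"
    using I[of 0 t] I[of 0 "t - h"] by simp
  also have "\<dots> = (LINT s|lborel. indicator {t - h..t} s *\<^sub>R g s)"
  proof (rule integral_cong_AE)
    show "(\<lambda>s. indicator {0..t} s *\<^sub>R g s - indicator {0..t - h} s *\<^sub>R g s) \<in> borel_measurable lborel"
      using I[of 0 t] I[of 0 "t - h"] by (intro borel_measurable_diff) auto
    show "(\<lambda>s. indicator {t - h..t} s *\<^sub>R g s) \<in> borel_measurable lborel" using I[of "t - h" t] by auto
    \<comment> \<open>Subtracting the closed intervals loses their common endpoint t - h, which is a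
      null set.\<close>
    show "AE s in lborel. indicator {0..t} s *\<^sub>R g s - indicator {0..t - h} s *\<^sub>R g s = indicator {t - h..t} s *\<^sub>R g s"
      using AE_lborel_singleton[of "t - h"]
    proof eventually_elim
      case (elim s)
      show ?case
        using elim g0[of s] h by (cases "s < 0") (auto simp: indicator_def)
    qed
  qed
  finally show ?thesis .
qed

section \<open>Truncation and backward averages of an adapted process\<close>

context two_scale_setting
begin

lemma l2_tendsto_dominated:
  fixes f :: "nat \<Rightarrow> 'c \<Rightarrow> 'b::euclidean_space"
  assumes f: "\<And>n. f n \<in> borel_measurable N" and w: "sq_int N w"
    and le: "\<And>n. AE x in N. norm (f n x) \<le> norm (w x)" and lim: "AE x in N. (\<lambda>n. f n x) \<longlonglongrightarrow> 0"
  shows "(\<lambda>n. l2 N (f n)) \<longlonglongrightarrow> 0"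
proof -
  have "(\<lambda>n. LINT x|N. (norm (f n x))\<^sup>2) \<longlonglongrightarrow> (LINT x|N. 0)"
  proof (rule integral_dominated_convergence[where w="\<lambda>x. (norm (w x))\<^sup>2"])
    show "integrable N (\<lambda>x. (norm (w x))\<^sup>2)" using w by (simp add: sq_int_def)
    show "AE x in N. (\<lambda>n. (norm (f n x))\<^sup>2) \<longlonglongrightarrow> 0"
      using lim
    proof eventually_elim
      case (elim x)
      have "(\<lambda>n. (norm (f n x))\<^sup>2) \<longlonglongrightarrow> (norm (0::'b))\<^sup>2" by (intro tendsto_power tendsto_norm elim)
      then show ?case by simp
    qed
    show "AE x in N. norm ((norm (f n x))\<^sup>2) \<le> (norm (w x))\<^sup>2" for n
      using le[of n] by eventually_elim (simp add: power_mono)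
  qed (use f in auto)
  then have "(\<lambda>n. sqrt (LINT x|N. (norm (f n x))\<^sup>2)) \<longlonglongrightarrow> sqrt 0" by (intro tendsto_real_sqrt) simp
  then show ?thesis by (simp add: l2_def)
qed

lemma truncation_tendsto:
  fixes \<alpha> :: "real \<Rightarrow> 'w \<Rightarrow> 'b::euclidean_space"
  assumes "sq_int P (case_prod \<alpha>)"
  shows "(\<lambda>n. l2 P (\<lambda>z. (if norm (case_prod \<alpha> z) \<le> real n then case_prod \<alpha> z else 0) - case_prod \<alpha> z)) \<longlonglongrightarrow> 0"
proof (rule l2_tendsto_dominated[OF _ assms])
  have m: "case_prod \<alpha> \<in> borel_measurable P" using assms by (simp add: sq_int_def)
  have "{z \<in> space P. norm (case_prod \<alpha> z) \<le> real n} \<in> sets P" for n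
    using m by (intro borel_measurable_le borel_measurable_norm) auto
  then show "(\<lambda>z. (if norm (case_prod \<alpha> z) \<le> real n then case_prod \<alpha> z else 0) - case_prod \<alpha> z) \<in> borel_measurable P" for n
    using m by (intro borel_measurable_diff measurable_If) auto
  show "AE z in P. norm ((if norm (case_prod \<alpha> z) \<le> real n then case_prod \<alpha> z else 0) - case_prod \<alpha> z) \<le> norm (case_prod \<alpha> z)" for n
    by (rule AE_I2) auto
  show "AE z in P. (\<lambda>n. (if norm (case_prod \<alpha> z) \<le> real n then case_prod \<alpha> z else 0) - case_prod \<alpha> z) \<longlonglongrightarrow> 0"
  proof (rule AE_I2)
    fix z
    obtain k where k: "norm (case_prod \<alpha> z) \<le> real k" using real_arch_simple by blast
    have "eventually (\<lambda>n. (if norm (case_prod \<alpha> z) \<le> real n then case_prod \<alpha> z else 0) - case_prod \<alpha> z = 0) sequentially"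
      using eventually_ge_at_top[of k]
    proof eventually_elim
      case (elim n)
      then have "norm (case_prod \<alpha> z) \<le> real n" using k by linarith
      then show ?case by simp
    qed
    then show "(\<lambda>n. (if norm (case_prod \<alpha> z) \<le> real n then case_prod \<alpha> z else 0) - case_prod \<alpha> z) \<longlonglongrightarrow> 0"
      by (rule tendsto_eventually)
  qed
qed

text \<open>Subtracting p from a process with a stochastic differential changes only its drift, by
  q. Adaptedness of q is what the energy identity then asks for.\<close>

definition adapted_primitive :: "(real \<Rightarrow> 'w \<Rightarrow> 'b::euclidean_space) \<Rightarrow> (real \<Rightarrow> 'w \<Rightarrow> 'b) \<Rightarrow> bool" where
  "adapted_primitive q p \<longleftrightarrow> sq_int P (case_prod q) \<and> (\<forall>t\<in>{0..T}. q t \<in> borel_measurable (F t)) \<and>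
    (\<forall>t \<omega>. p t \<omega> = (LINT s|D. indicator {0..t} s *\<^sub>R q s \<omega>)) \<and>
    sq_int P (case_prod p) \<and> (\<forall>t\<in>{0..T}. sq_int M (p t))"

text \<open>The primitives are the averages of g over the last h n units of time. Boundedness of g
  bounds q for each n and gives a single dominating constant for all averages, so that pointwise
  differentiation becomes convergence in L2.\<close>

lemma bounded_adapted_primitive_approx:
  fixes g :: "real \<Rightarrow> 'w \<Rightarrow> 'b::euclidean_space"
  assumes gm: "case_prod g \<in> borel_measurable P" and gF: "\<And>t. t \<in> {0..T} \<Longrightarrow> g t \<in> borel_measurable (F t)"
    and gb: "\<And>t \<omega>. norm (g t \<omega>) \<le> C"
  shows "\<exists>q p. (\<forall>n::nat. adapted_primitive (q n) (p n)) \<and> (\<lambda>n. l2 P (\<lambda>z. case_prod (p n) z - case_prod g z)) \<longlonglongrightarrow> 0"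
proof -
  have C0: "0 \<le> C" using order_trans[OF norm_ge_zero gb[of 0]] .
  define h :: "nat \<Rightarrow> real" where "h n = 1 / real (Suc n)" for n
  have h: "0 < h n" for n by (simp add: h_def)
  \<comment> \<open>\<open>max 0\<close> only keeps the argument inside the time domain; while t < h
    n the indicator removes the term, which amounts to g = 0 before time 0.\<close>
  define q where "q n t \<omega> = (g t \<omega> - indicator {h n..} t *\<^sub>R g (max 0 (t - h n)) \<omega>) /\<^sub>R h n" for n t \<omega>
  define p where "p n t \<omega> = (LINT s|D. indicator {0..t} s *\<^sub>R q n s \<omega>)" for n t \<omega>
  \<comment> \<open>Extension by zero to the whole line, on which the averaging lemmas are
    stated.\<close>
  define G where "G \<omega> s = indicator {0..T} s *\<^sub>R g s \<omega>" for \<omega> s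
  have Gm: "G \<omega> \<in> borel_measurable borel" if "\<omega> \<in> space M" for \<omega>
  proof -
    have "(\<lambda>t. g t \<omega>) \<in> borel_measurable D" using measurable_Pair1[OF gm that] by simp
    then show ?thesis
      unfolding G_def[abs_def] by (subst (asm) borel_measurable_restrict_space_iff) auto
  qed
  have Gb: "norm (G \<omega> s) \<le> C" for \<omega> s using gb[of s \<omega>] C0 by (simp add: G_def indicator_def)
  have q_m: "case_prod (q n) \<in> borel_measurable P" for n
  proof -
    have "(\<lambda>t. max 0 (t - h n)) \<in> D \<rightarrow>\<^sub>M D"
    proof (rule measurable_restrict_space2)
      show "(\<lambda>t. max 0 (t - h n)) \<in> space D \<rightarrow> {0..T}" using T_pos h[of n] by auto
      show "(\<lambda>t. max 0 (t - h n)) \<in> D \<rightarrow>\<^sub>M lborel"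
        using measurable_D[of "\<lambda>t::real. max 0 (t - h n)"] by simp
    qed
    then have "(\<lambda>z. (max 0 (fst z - h n), snd z)) \<in> P \<rightarrow>\<^sub>M P"
      by (intro measurable_Pair measurable_compose[OF measurable_fst] measurable_snd)
    from measurable_compose[OF this gm] have s: "(\<lambda>z. g (max 0 (fst z - h n)) (snd z)) \<in> borel_measurable P" by simp
    have i: "(\<lambda>z. indicat_real {h n..} (fst z)) \<in> borel_measurable P"
      by (rule measurable_P_fst) simp
    show ?thesis
      using gm s i unfolding q_def split_beta' by (intro borel_measurable_scaleR borel_measurable_diff) auto
  qed
  have q_F: "q n t \<in> borel_measurable (F t)" if t: "t \<in> {0..T}" for n t
  proof -
    have "max 0 (t - h n) \<in> {0..T}" "max 0 (t - h n) \<le> t" using t h[of n] by auto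
    then have "g (max 0 (t - h n)) \<in> borel_measurable (F t)" by (rule measurable_F_mono[OF gF])
    then show ?thesis unfolding q_def using gF[OF t] by (intro borel_measurable_scaleR borel_measurable_diff) auto
  qed
  have q_b: "norm (q n t \<omega>) \<le> (C + C) / h n" for n t \<omega>
  proof -
    have "norm (g t \<omega> - indicator {h n..} t *\<^sub>R g (max 0 (t - h n)) \<omega>) \<le> norm (g t \<omega>) + norm (indicat_real {h n..} t *\<^sub>R g (max 0 (t - h n)) \<omega>)"
      by (rule norm_triangle_ineq4)
    also have "\<dots> \<le> C + C" using gb C0 by (intro add_mono) (auto simp: indicator_def)
    finally show ?thesis unfolding q_def using h[of n] by (simp add: divide_inverse mult.commute mult_left_mono)
  qed
  have q_sq: "sq_int P (case_prod (q n))" for n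
    using q_b by (intro sq_int_bounded[OF P.finite_measure_axioms q_m]) (auto simp: split_beta')
  have pG: "p n t \<omega> = (LINT s|lborel. indicator {t - h n..t} s *\<^sub>R G \<omega> s) /\<^sub>R h n"
    if t: "t \<in> {0..T}" and w: "\<omega> \<in> space M" for n t \<omega>
  proof -
    have "p n t \<omega> = (LINT s|lborel. indicator {0..t} s *\<^sub>R q n s \<omega>)"
      unfolding p_def using leb_integral_eq[OF t, of "\<lambda>s. q n s \<omega>"] by (simp add: set_lebesgue_integral_def)
    also have "\<dots> = (LINT s|lborel. indicator {0..t} s *\<^sub>R ((G \<omega> s - indicator {h n..} s *\<^sub>R G \<omega> (s - h n)) /\<^sub>R h n))"
      using t h[of n] by (intro Bochner_Integration.integral_cong refl) (auto simp: q_def G_def indicator_def max_def)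
    also have "\<dots> = (LINT s|lborel. indicator {t - h n..t} s *\<^sub>R G \<omega> s) /\<^sub>R h n"
      by (rule backward_average_eq[OF Gm[OF w] Gb _ h]) (simp add: G_def)
    finally show ?thesis .
  qed
  have p_b: "norm (p n t \<omega>) \<le> C" if t: "t \<in> {0..T}" and w: "\<omega> \<in> space M" for n t \<omega>
  proof -
    have "norm (LINT s|lborel. indicator {t - h n..t} s *\<^sub>R G \<omega> s) \<le> (LINT s|lborel. C * indicat_real {t - h n..t} s)"
    proof (rule order_trans[OF integral_norm_bound integral_mono])
      show "integrable lborel (\<lambda>s. norm (indicator {t - h n..t} s *\<^sub>R G \<omega> s))"
        by (rule integrable_norm[OF set_integrable_bounded[OF Gm[OF w] Gb]])
      show "norm (indicator {t - h n..t} s *\<^sub>R G \<omega> s) \<le> C * indicat_real {t - h n..t} s" for s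
        using Gb[of \<omega> s] by (simp add: indicator_def)
    qed (rule integrable_indicator_Icc)
    also have "\<dots> = C * h n" using h[of n] by simp
    finally show ?thesis unfolding pG[OF t w] using h[of n] by (simp add: field_simps)
  qed
  have p_m: "case_prod (p n) \<in> borel_measurable P" for n
  proof -
    \<comment> \<open>Joint measurability of p: it is an integral over s with parameter z, and the
      constraint s \<le> fst z is made part of a jointly measurable integrand.\<close>
    have 1: "(\<lambda>w. case_prod (q n) (snd w, snd (fst w))) \<in> borel_measurable (P \<Otimes>\<^sub>M D)"
      by (rule measurable_compose[OF _ q_m])
         (intro measurable_Pair measurable_snd measurable_compose[OF measurable_fst measurable_snd])
    have idm: "(\<lambda>x. x) \<in> borel_measurable D" by (rule measurable_D) simp
    have "{w \<in> space (P \<Otimes>\<^sub>M D). snd w \<le> fst (fst w)} \<in> sets (P \<Otimes>\<^sub>M D)"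
      by (intro borel_measurable_le measurable_compose[OF measurable_snd idm]
          measurable_compose[OF measurable_fst measurable_compose[OF measurable_fst idm]])
    from measurable_If[OF 1 borel_measurable_const[of 0] this]
    have "(\<lambda>w. if snd w \<le> fst (fst w) then case_prod (q n) (snd w, snd (fst w)) else 0) \<in> borel_measurable (P \<Otimes>\<^sub>M D)" .
    then have "case_prod (\<lambda>z s. if s \<le> fst z then q n s (snd z) else 0) \<in> borel_measurable (P \<Otimes>\<^sub>M D)"
      by (simp add: split_beta' cong: if_cong)
    from D.borel_measurable_lebesgue_integral[OF this]
    have "(\<lambda>z. LINT s|D. (if s \<le> fst z then q n s (snd z) else 0)) \<in> borel_measurable P" .
    moreover have "(LINT s|D. (if s \<le> fst z then q n s (snd z) else 0)) = case_prod (p n) z" for z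
      unfolding p_def split_beta' by (intro Bochner_Integration.integral_cong) (auto simp: indicator_def)
    ultimately show ?thesis by simp
  qed
  have p_sq: "sq_int P (case_prod (p n))" for n
    using p_b by (intro sq_int_bounded[OF P.finite_measure_axioms p_m, of _ C]) (auto simp: space_P)
  have p_sqM: "sq_int M (p n t)" if "t \<in> {0..T}" for n t
    using p_b[OF that] measurable_Pair2[OF p_m, of t] that by (intro sq_int_bounded[OF finite_measure_axioms, of _ C]) auto
  have sm: "adapted_primitive (q n) (p n)" for n
    unfolding adapted_primitive_def using q_sq q_F p_sq p_sqM by (simp add: p_def)
  let ?u = "\<lambda>n t \<omega>. (norm (p n t \<omega> - g t \<omega>))\<^sup>2"
  have g_sq: "sq_int P (case_prod g)"
    using gb by (intro sq_int_bounded[OF P.finite_measure_axioms gm, of C]) auto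
  have ui: "integrable P (case_prod (?u n))" for n
    using sq_int_integrable[OF sq_int_diff[OF p_sq[of n] g_sq]] by (simp add: split_beta')
  have ub: "?u n t \<omega> \<le> (2 * C)\<^sup>2" if "t \<in> {0..T}" "\<omega> \<in> space M" for n t \<omega>
  proof (rule power_mono)
    show "norm (p n t \<omega> - g t \<omega>) \<le> 2 * C"
      using norm_triangle_ineq4[of "p n t \<omega>" "g t \<omega>"] p_b[OF that, of n] gb[of t \<omega>] by linarith
  qed simp
  have um: "(\<lambda>t. ?u n t \<omega>) \<in> borel_measurable D" if w: "\<omega> \<in> space M" for n \<omega>
    using measurable_Pair1[OF borel_measurable_integrable[OF ui[of n]] w] by simp
  \<comment> \<open>The exceptional times of the differentiation theorem depend on \<omega>.
    Dominated convergence is therefore used twice, in t for fixed \<omega> and then in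
    \<omega>.\<close>
  have lim_w: "(\<lambda>n. LINT t|D. ?u n t \<omega>) \<longlonglongrightarrow> 0" if w: "\<omega> \<in> space M" for \<omega>
  proof -
    have "AE t in lborel. (\<lambda>n. (LINT s|lborel. indicator {t - h n..t} s *\<^sub>R G \<omega> s) /\<^sub>R h n) \<longlonglongrightarrow> G \<omega> t"
      unfolding h_def by (rule AE_backward_average[OF Gm[OF w] Gb])
    then have "AE t in D. (\<lambda>n. (LINT s|lborel. indicator {t - h n..t} s *\<^sub>R G \<omega> s) /\<^sub>R h n) \<longlonglongrightarrow> G \<omega> t"
      by (subst AE_restrict_space_iff) (auto elim: eventually_mono)
    then have ae: "AE t in D. (\<lambda>n. ?u n t \<omega>) \<longlonglongrightarrow> 0"
      using AE_space
    proof eventually_elim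
      case (elim t)
      then have t: "t \<in> {0..T}" by simp
      have "(\<lambda>n. p n t \<omega>) \<longlonglongrightarrow> g t \<omega>" using elim(1) t by (simp add: pG[OF t w] G_def)
      then have "(\<lambda>n. ?u n t \<omega>) \<longlonglongrightarrow> (norm (g t \<omega> - g t \<omega>))\<^sup>2" by (intro tendsto_intros)
      then show ?case by simp
    qed
    have "(\<lambda>n. LINT t|D. ?u n t \<omega>) \<longlonglongrightarrow> (LINT t|D. 0)"
    proof (rule integral_dominated_convergence[where w="\<lambda>_. (2 * C)\<^sup>2"])
      show "AE t in D. norm (?u n t \<omega>) \<le> (2 * C)\<^sup>2" for n
        using ub[OF _ w] by (intro AE_I2) simp
    qed (use um[OF w] ae in auto)
    then show ?thesis by simp
  qed
  have "(\<lambda>n. LINT \<omega>|M. (LINT t|D. ?u n t \<omega>)) \<longlonglongrightarrow> (LINT \<omega>|M. 0)"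
  proof (rule integral_dominated_convergence[where w="\<lambda>_. (LINT t|D. (2 * C)\<^sup>2)"])
    show "(\<lambda>\<omega>. LINT t|D. ?u n t \<omega>) \<in> borel_measurable M" for n
      using DM.integrable_snd[OF ui[of n]] by auto
    show "AE \<omega> in M. (\<lambda>n. LINT t|D. ?u n t \<omega>) \<longlonglongrightarrow> 0" using lim_w by (intro AE_I2)
    show "AE \<omega> in M. norm (LINT t|D. ?u n t \<omega>) \<le> (LINT t|D. (2 * C)\<^sup>2)" for n
    proof (rule AE_I2)
      fix \<omega> assume w: "\<omega> \<in> space M"
      have i: "integrable D (\<lambda>t. ?u n t \<omega>)"
        using ub[OF _ w] by (intro D.integrable_const_bound[of _ "(2 * C)\<^sup>2"] AE_I2 um[OF w]) auto
      have "norm (LINT t|D. ?u n t \<omega>) = (LINT t|D. ?u n t \<omega>)" by (simp add: integral_nonneg_AE)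
      also have "\<dots> \<le> (LINT t|D. (2 * C)\<^sup>2)"
        using ub[OF _ w] by (intro integral_mono i) auto
      finally show "norm (LINT t|D. ?u n t \<omega>) \<le> (LINT t|D. (2 * C)\<^sup>2)" .
    qed
  qed auto
  moreover have "(LINT \<omega>|M. (LINT t|D. ?u n t \<omega>)) = (LINT z|P. (norm (case_prod (p n) z - case_prod g z))\<^sup>2)" for n
    using DM.integral_snd[OF ui[of n]] by (simp add: split_beta')
  ultimately have "(\<lambda>n. sqrt (LINT z|P. (norm (case_prod (p n) z - case_prod g z))\<^sup>2)) \<longlonglongrightarrow> sqrt 0"
    by (intro tendsto_real_sqrt) simp
  then have "(\<lambda>n. l2 P (\<lambda>z. case_prod (p n) z - case_prod g z)) \<longlonglongrightarrow> 0" by (simp add: l2_def)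
  then show ?thesis using sm by blast
qed

text \<open>Truncation takes half of the error and makes the process bounded, which leaves the other
  half to averaging.\<close>

lemma adapted_primitive_approx:
  fixes \<alpha> :: "real \<Rightarrow> 'w \<Rightarrow> 'b::euclidean_space"
  assumes sq: "sq_int P (case_prod \<alpha>)" and aF: "\<And>t. t \<in> {0..T} \<Longrightarrow> \<alpha> t \<in> borel_measurable (F t)" and e: "0 < e"
  shows "\<exists>q p. adapted_primitive q p \<and> l2 P (\<lambda>z. case_prod p z - case_prod \<alpha> z) < e"
proof -
  have m: "case_prod \<alpha> \<in> borel_measurable P" using sq by (simp add: sq_int_def)
  from LIMSEQ_D[OF truncation_tendsto[OF sq], of "e/2"] e obtain n where
    n: "l2 P (\<lambda>z. (if norm (case_prod \<alpha> z) \<le> real n then case_prod \<alpha> z else 0) - case_prod \<alpha> z) < e / 2" by auto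
  define g where "g t \<omega> = (if norm (\<alpha> t \<omega>) \<le> real n then \<alpha> t \<omega> else 0)" for t \<omega>
  have gz: "case_prod g z = (if norm (case_prod \<alpha> z) \<le> real n then case_prod \<alpha> z else 0)" for z
    by (cases z) (simp add: g_def)
  have gm: "case_prod g \<in> borel_measurable P"
  proof -
    have "{z \<in> space P. norm (case_prod \<alpha> z) \<le> real n} \<in> sets P"
      using m by (intro borel_measurable_le borel_measurable_norm) auto
    from measurable_If[OF m borel_measurable_const[of 0] this] show ?thesis by (simp only: gz[symmetric])
  qed
  have gF: "g t \<in> borel_measurable (F t)" if "t \<in> {0..T}" for t
  proof -
    have "{\<omega> \<in> space (F t). norm (\<alpha> t \<omega>) \<le> real n} \<in> sets (F t)"
      using aF[OF that] by (intro borel_measurable_le borel_measurable_norm) auto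
    from measurable_If[OF aF[OF that] borel_measurable_const[of 0] this] show ?thesis by (simp only: g_def[abs_def])
  qed
  have gb: "norm (g t \<omega>) \<le> real n" for t \<omega> by (simp add: g_def)
  from bounded_adapted_primitive_approx[OF gm gF gb] obtain q p where sm: "\<forall>k::nat. adapted_primitive (q k) (p k)"
    and l: "(\<lambda>k. l2 P (\<lambda>z. case_prod (p k) z - case_prod g z)) \<longlonglongrightarrow> 0" by blast
  from LIMSEQ_D[OF l, of "e/2"] e obtain k where k: "l2 P (\<lambda>z. case_prod (p k) z - case_prod g z) < e / 2" by auto
  have g_sq: "sq_int P (case_prod g)"
    using gb by (intro sq_int_bounded[OF P.finite_measure_axioms gm, of "real n"]) auto
  have p_sq: "sq_int P (case_prod (p k))" using sm by (simp add: adapted_primitive_def)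
  have "l2 P (\<lambda>z. case_prod (p k) z - case_prod \<alpha> z) \<le> l2 P (\<lambda>z. case_prod (p k) z - case_prod g z) + l2 P (\<lambda>z. case_prod g z - case_prod \<alpha> z)"
    by (rule l2_triangle3[OF p_sq g_sq sq])
  also have "\<dots> < e" using k n by (simp only: gz)
  finally show ?thesis using sm by blast
qed

end

section \<open>Laws of time-dependent random variables\<close>

context two_scale_setting
begin

lemma law_in_P2:
  fixes \<theta> :: "'w \<Rightarrow> 'b::euclidean_space"
  assumes "sq_int M \<theta>"
  shows "law M \<theta> \<in> P2"
  using assms by (auto simp: P2_def sq_int_def integrable_distr_eq intro: prob_space_distr)

lemma norm_P2_law:
  fixes \<theta> :: "'w \<Rightarrow> 'b::euclidean_space"
  assumes "\<theta> \<in> borel_measurable M"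
  shows "norm_P2 (law M \<theta>) = l2 M \<theta>"
  using assms by (simp add: norm_P2_def l2_def integral_distr)

text \<open>The joint law of the two variables is one of the couplings over which the infimum
  runs.\<close>

lemma W2_law_le:
  fixes \<theta> \<psi> :: "'w \<Rightarrow> 'b::euclidean_space"
  assumes "\<theta> \<in> borel_measurable M" "\<psi> \<in> borel_measurable M"
  shows "W2 (law M \<theta>) (law M \<psi>) \<le> l2 M (\<lambda>\<omega>. \<theta> \<omega> - \<psi> \<omega>)"
proof -
  let ?\<pi> = "distr M (borel \<Otimes>\<^sub>M borel) (\<lambda>\<omega>. (\<theta> \<omega>, \<psi> \<omega>))"
  have m: "(\<lambda>\<omega>. (\<theta> \<omega>, \<psi> \<omega>)) \<in> M \<rightarrow>\<^sub>M borel \<Otimes>\<^sub>M borel" using assms by simp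
  have dm: "(\<lambda>z. (norm (fst z - snd z :: 'b))\<^sup>2) \<in> borel_measurable (borel \<Otimes>\<^sub>M borel)" by measurable
  have "?\<pi> \<in> couplings (law M \<theta>) (law M \<psi>)"
    unfolding couplings_def using m by (auto intro: prob_space_distr simp: distr_distr o_def)
  moreover have "sqrt (LINT z|?\<pi>. (norm (fst z - snd z))\<^sup>2) = l2 M (\<lambda>\<omega>. \<theta> \<omega> - \<psi> \<omega>)"
    unfolding l2_def by (subst integral_distr[OF m dm]) simp
  moreover have "bdd_below ((\<lambda>\<pi>. sqrt (LINT z|\<pi>. (norm (fst z - snd z))\<^sup>2)) ` couplings (law M \<theta>) (law M \<psi>))"
    by (rule bdd_belowI2[of _ 0]) (simp add: integral_nonneg_AE)
  ultimately show ?thesis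
    unfolding W2_def by (metis (no_types, lifting) cINF_lower)
qed

section \<open>Measurability of the law as a function of time\<close>

abbreviation dist_set :: "('w \<Rightarrow> 'b::euclidean_space) set \<Rightarrow> ('w \<Rightarrow> 'b) \<Rightarrow> real" where
  "dist_set S \<theta> \<equiv> (INF \<psi>\<in>S. l2 M (\<lambda>\<omega>. \<theta> \<omega> - \<psi> \<omega>))"

lemma dist_set_bdd: "bdd_below ((\<lambda>\<psi>. l2 M (\<lambda>\<omega>. \<theta> \<omega> - \<psi> \<omega>)) ` S)"
  by (rule bdd_belowI2[of _ 0]) simp

lemma dist_set_lipschitz:
  fixes \<theta> \<theta>' :: "'w \<Rightarrow> 'b::euclidean_space"
  assumes S: "S \<noteq> {}" "\<And>\<psi>. \<psi> \<in> S \<Longrightarrow> sq_int M \<psi>" and sq: "sq_int M \<theta>" "sq_int M \<theta>'"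
  shows "\<bar>dist_set S \<theta> - dist_set S \<theta>'\<bar> \<le> l2 M (\<lambda>\<omega>. \<theta> \<omega> - \<theta>' \<omega>)"
proof -
  have 1: "dist_set S \<theta> - l2 M (\<lambda>\<omega>. \<theta> \<omega> - \<theta>' \<omega>) \<le> dist_set S \<theta>'" if sq: "sq_int M \<theta>" "sq_int M \<theta>'" for \<theta> \<theta>' :: "'w \<Rightarrow> 'b"
  proof (rule cINF_greatest[OF S(1)])
    fix \<psi> assume p: "\<psi> \<in> S"
    have "dist_set S \<theta> \<le> l2 M (\<lambda>\<omega>. \<theta> \<omega> - \<psi> \<omega>)" by (rule cINF_lower[OF dist_set_bdd p])
    also have "\<dots> \<le> l2 M (\<lambda>\<omega>. \<theta> \<omega> - \<theta>' \<omega>) + l2 M (\<lambda>\<omega>. \<theta>' \<omega> - \<psi> \<omega>)"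
      by (rule l2_triangle3[OF sq S(2)[OF p]])
    finally show "dist_set S \<theta> - l2 M (\<lambda>\<omega>. \<theta> \<omega> - \<theta>' \<omega>) \<le> l2 M (\<lambda>\<omega>. \<theta>' \<omega> - \<psi> \<omega>)" by simp
  qed
  show ?thesis using 1[OF sq] 1[OF sq(2,1)] l2_minus_commute[of M \<theta> \<theta>'] by linarith
qed

text \<open>Pulling the Wasserstein-open sets back to \<open>L\<^sup>2(M)\<close>, where the triangle inequality is
  elementary, avoids gluing of couplings.\<close>

lemma law_measurable_D:
  fixes \<theta> :: "real \<Rightarrow> 'w \<Rightarrow> 'b::euclidean_space"
  assumes sq: "\<And>t. t \<in> {0..T} \<Longrightarrow> sq_int M (\<theta> t)"
    and d: "\<And>S. S \<noteq> {} \<Longrightarrow> (\<And>\<psi>. \<psi> \<in> S \<Longrightarrow> sq_int M \<psi>) \<Longrightarrow> (\<lambda>t. dist_set S (\<theta> t)) \<in> borel_measurable D"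
  shows "(\<lambda>t. law M (\<theta> t)) \<in> D \<rightarrow>\<^sub>M borel_P2"
  unfolding borel_P2_def
proof (rule measurable_measure_of)
  show "(\<lambda>t. law M (\<theta> t)) \<in> space D \<rightarrow> P2" using law_in_P2[OF sq] by auto
  fix U :: "'b measure set" assume "U \<in> {U. U \<subseteq> P2 \<and> (\<forall>\<mu>\<in>U. \<exists>r>0. {\<mu>' \<in> P2. W2 \<mu> \<mu>' < r} \<subseteq> U)}"
  then have op: "\<And>\<mu>. \<mu> \<in> U \<Longrightarrow> \<exists>r>0. {\<mu>' \<in> P2. W2 \<mu> \<mu>' < r} \<subseteq> U" by blast
  \<comment> \<open>The law of \<open>\<theta> t\<close> lies in U exactly if
    \<open>\<theta> t\<close> has positive distance from these variables. Openness of U gives one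
    direction; for the other, \<open>\<theta> t\<close> would itself belong to S and have distance
    0.\<close>
  define S where "S = {\<psi>. sq_int M \<psi> \<and> law M \<psi> \<notin> U}"
  show "(\<lambda>t. law M (\<theta> t)) -` U \<inter> space D \<in> sets D"
  proof (cases "S = {}")
    case True
    then have "(\<lambda>t. law M (\<theta> t)) -` U \<inter> space D = space D" using sq by (auto simp: S_def)
    then show ?thesis by (simp only: sets.top)
  next
    case False
    have "law M (\<theta> t) \<in> U \<longleftrightarrow> 0 < dist_set S (\<theta> t)" if t: "t \<in> {0..T}" for t
    proof
      assume "law M (\<theta> t) \<in> U"
      from op[OF this] obtain r where r: "0 < r" "{\<mu>' \<in> P2. W2 (law M (\<theta> t)) \<mu>' < r} \<subseteq> U" by blast
      have "r \<le> dist_set S (\<theta> t)"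
      proof (rule cINF_greatest[OF False])
        fix \<psi> assume p: "\<psi> \<in> S"
        then have sqp: "sq_int M \<psi>" by (simp add: S_def)
        have "\<not> W2 (law M (\<theta> t)) (law M \<psi>) < r" using p r(2) law_in_P2[OF sqp] by (auto simp: S_def)
        then show "r \<le> l2 M (\<lambda>\<omega>. \<theta> t \<omega> - \<psi> \<omega>)"
          using W2_law_le[of "\<theta> t" \<psi>] sq[OF t] sqp by (simp add: sq_int_def)
      qed
      then show "0 < dist_set S (\<theta> t)" using r(1) by linarith
    next
      assume pos: "0 < dist_set S (\<theta> t)"
      show "law M (\<theta> t) \<in> U"
      proof (rule ccontr)
        assume "law M (\<theta> t) \<notin> U"
        then have "\<theta> t \<in> S" using sq[OF t] by (simp add: S_def)
        from cINF_lower[OF dist_set_bdd[of "\<theta> t"] this] pos show False by simp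
      qed
    qed
    then have "(\<lambda>t. law M (\<theta> t)) -` U \<inter> space D = {t \<in> space D. 0 < dist_set S (\<theta> t)}" by auto
    also have "\<dots> \<in> sets D"
      using d[OF False] by (intro borel_measurable_less borel_measurable_const) (auto simp: S_def)
    finally show ?thesis .
  qed
qed blast

text \<open>Cauchy-Schwarz in time against the indicator of (s,t]: as a map into L2, p is Hoelder
  continuous of order 1/2. Distances in L2 from p t are therefore continuous in t.\<close>

lemma adapted_primitive_lipschitz:
  fixes q p :: "real \<Rightarrow> 'w \<Rightarrow> 'b::euclidean_space"
  assumes sm: "adapted_primitive q p" and st: "0 \<le> s" "s \<le> t" "t \<le> T"
  shows "(l2 M (\<lambda>\<omega>. p t \<omega> - p s \<omega>))\<^sup>2 \<le> (t - s) * (l2 P (case_prod q))\<^sup>2"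
proof -
  have q: "sq_int P (case_prod q)" and p: "\<And>t \<omega>. p t \<omega> = (LINT s|D. indicator {0..t} s *\<^sub>R q s \<omega>)"
    and psq: "sq_int M (p s)" "sq_int M (p t)" using sm st by (auto simp: adapted_primitive_def)
  have qi: "integrable P (\<lambda>(r, \<omega>). (norm (q r \<omega>))\<^sup>2)" using q by (simp add: sq_int_def split_beta')
  let ?i = "indicator {s<..t} :: real \<Rightarrow> real"
  have im: "?i \<in> borel_measurable D" by (rule measurable_D) simp
  have isq: "sq_int D ?i"
    by (intro sq_int_bounded[OF D.finite_measure_axioms im, of 1]) (simp add: indicator_def)
  have il: "(l2 D ?i)\<^sup>2 \<le> t - s"
  proof -
    have "(l2 D ?i)\<^sup>2 = (LINT r|D. indicat_real {s<..t} r)"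
      unfolding l2_squared by (intro Bochner_Integration.integral_cong refl) (auto simp: indicator_def)
    also have "\<dots> = (LINT r|lborel. indicator {0..T} r *\<^sub>R indicat_real {s<..t} r)"
      by (rule integral_restrict_space) simp
    also have "\<dots> = (LINT r|lborel. indicat_real {s<..t} r)"
      using st by (intro Bochner_Integration.integral_cong refl) (auto simp: indicator_def)
    also have "\<dots> = t - s" using st by simp
    finally show ?thesis by simp
  qed
  have "(l2 M (\<lambda>\<omega>. p t \<omega> - p s \<omega>))\<^sup>2 \<le> (LINT \<omega>|M. (t - s) * (LINT r|D. (norm (q r \<omega>))\<^sup>2))"
    unfolding l2_squared
  proof (rule integral_mono_AE)
    show "integrable M (\<lambda>\<omega>. (norm (p t \<omega> - p s \<omega>))\<^sup>2)" using sq_int_diff[OF psq(2,1)] by (simp add: sq_int_def)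
    show "integrable M (\<lambda>\<omega>. (t - s) * (LINT r|D. (norm (q r \<omega>))\<^sup>2))"
      by (rule integrable_mult_right[OF DM.integrable_snd[OF qi]])
    show "AE \<omega> in M. (norm (p t \<omega> - p s \<omega>))\<^sup>2 \<le> (t - s) * (LINT r|D. (norm (q r \<omega>))\<^sup>2)"
      using sq_int_P_sections(2)[OF q]
    proof eventually_elim
      case (elim \<omega>)
      have i: "integrable D (\<lambda>r. q r \<omega>)" by (rule sq_int_imp_integrable[OF D.finite_measure_axioms elim])
      have ii: "integrable D (\<lambda>r. indicator {0..u} r *\<^sub>R q r \<omega>)" for u by (rule integrable_leb_indicator[OF i]) simp
      have "p t \<omega> - p s \<omega> = (LINT r|D. indicator {0..t} r *\<^sub>R q r \<omega> - indicator {0..s} r *\<^sub>R q r \<omega>)"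
        unfolding p by (rule Bochner_Integration.integral_diff[symmetric, OF ii ii])
      also have "\<dots> = (LINT r|D. ?i r *\<^sub>R q r \<omega>)"
        using st by (intro Bochner_Integration.integral_cong refl) (auto simp: indicator_def)
      finally have "norm (p t \<omega> - p s \<omega>) \<le> (LINT r|D. norm (?i r *\<^sub>R q r \<omega>))" by (simp only: integral_norm_bound)
      also have "\<dots> = (LINT r|D. norm (?i r) * norm (q r \<omega>))" by simp
      also have "\<dots> \<le> l2 D ?i * l2 D (\<lambda>r. q r \<omega>)" by (rule LINT_norm_mult_le_l2[OF isq elim])
      finally have "(norm (p t \<omega> - p s \<omega>))\<^sup>2 \<le> (l2 D ?i * l2 D (\<lambda>r. q r \<omega>))\<^sup>2" by (rule power_mono) simp
      also have "\<dots> = (l2 D ?i)\<^sup>2 * (l2 D (\<lambda>r. q r \<omega>))\<^sup>2" by (rule power_mult_distrib)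
      also have "\<dots> \<le> (t - s) * (l2 D (\<lambda>r. q r \<omega>))\<^sup>2" by (rule mult_right_mono[OF il]) simp
      finally show ?case by (simp only: l2_squared)
    qed
  qed
  also have "\<dots> = (t - s) * (LINT \<omega>|M. (LINT r|D. (norm (q r \<omega>))\<^sup>2))" by simp
  also have "(LINT \<omega>|M. (LINT r|D. (norm (q r \<omega>))\<^sup>2)) = (l2 P (case_prod q))\<^sup>2"
    using DM.integral_snd[OF qi] by (simp add: l2_squared split_beta')
  finally show ?thesis .
qed

lemma adapted_primitive_dist_set_measurable:
  fixes q p :: "real \<Rightarrow> 'w \<Rightarrow> 'b::euclidean_space"
  assumes sm: "adapted_primitive q p" and S: "S \<noteq> {}" "\<And>\<psi>. \<psi> \<in> S \<Longrightarrow> sq_int M \<psi>"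
  shows "(\<lambda>t. dist_set S (p t)) \<in> borel_measurable D"
proof -
  let ?L = "l2 P (case_prod q)"
  have sq: "sq_int M (p t)" if "t \<in> {0..T}" for t using sm that by (simp add: adapted_primitive_def)
  have b: "\<bar>dist_set S (p t) - dist_set S (p s)\<bar> \<le> sqrt (\<bar>t - s\<bar> * ?L\<^sup>2)" if st: "s \<in> {0..T}" "t \<in> {0..T}" "s \<le> t" for s t
  proof -
    have "\<bar>dist_set S (p t) - dist_set S (p s)\<bar> \<le> l2 M (\<lambda>\<omega>. p t \<omega> - p s \<omega>)"
      by (rule dist_set_lipschitz[OF S sq sq]) (use st in auto)
    also have "\<dots> \<le> sqrt ((t - s) * ?L\<^sup>2)"
      by (rule real_le_rsqrt[OF adapted_primitive_lipschitz[OF sm]]) (use st in auto)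
    finally show ?thesis using st by simp
  qed
  have b': "\<bar>dist_set S (p t) - dist_set S (p s)\<bar> \<le> sqrt (\<bar>t - s\<bar> * ?L\<^sup>2)" if st: "s \<in> {0..T}" "t \<in> {0..T}" for s t
    using b[of s t] b[of t s] st by (cases "s \<le> t") (auto simp: abs_minus_commute)
  have "continuous_on {0..T} (\<lambda>t. dist_set S (p t))"
    unfolding continuous_on_def
  proof
    fix x assume x: "x \<in> {0..T}"
    have l: "((\<lambda>t. sqrt (\<bar>t - x\<bar> * ?L\<^sup>2)) \<longlongrightarrow> sqrt (\<bar>x - x\<bar> * ?L\<^sup>2)) (at x within {0..T})"
      by (intro tendsto_intros)
    have "((\<lambda>t. dist_set S (p t) - dist_set S (p x)) \<longlongrightarrow> 0) (at x within {0..T})"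
    proof (rule Lim_null_comparison)
      show "((\<lambda>t. sqrt (\<bar>t - x\<bar> * ?L\<^sup>2)) \<longlongrightarrow> 0) (at x within {0..T})" using l by simp
      show "eventually (\<lambda>t. norm (dist_set S (p t) - dist_set S (p x)) \<le> sqrt (\<bar>t - x\<bar> * ?L\<^sup>2)) (at x within {0..T})"
        unfolding eventually_at_filter by (rule always_eventually) (use b'[OF x] in auto)
    qed
    then show "((\<lambda>t. dist_set S (p t)) \<longlongrightarrow> dist_set S (p x)) (at x within {0..T})" by (rule LIM_zero_cancel)
  qed
  then have "(\<lambda>t. dist_set S (p t)) \<in> borel_measurable (restrict_space borel {0..T})"
    by (rule borel_measurable_continuous_on_restrict)
  moreover have "borel_measurable (restrict_space borel {0..T}) = (borel_measurable D :: (real \<Rightarrow> real) set)"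
    by (rule measurable_cong_sets) (simp_all add: sets_restrict_space)
  ultimately show ?thesis by simp
qed

text \<open>Primitives approximating \<alpha> over the product space converge, along a subsequence,
  in L2 at almost every time, and distances to sets converge with them. On the remaining null set of
  times the variable is set to 0, so that its law lies in \<open>P2\<close> at every time.\<close>

lemma law_measurable_modification:
  fixes \<alpha> :: "real \<Rightarrow> 'w \<Rightarrow> 'b::euclidean_space"
  assumes sq: "sq_int P (case_prod \<alpha>)" and aF: "\<And>t. t \<in> {0..T} \<Longrightarrow> \<alpha> t \<in> borel_measurable (F t)"
  shows "\<exists>N\<in>null_sets D. (\<forall>t\<in>{0..T} - N. sq_int M (\<alpha> t)) \<and>
    (\<lambda>t. law M (if t \<in> N then (\<lambda>_. 0) else \<alpha> t)) \<in> D \<rightarrow>\<^sub>M borel_P2"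
proof -
  have "\<forall>n. \<exists>q p. adapted_primitive q p \<and> l2 P (\<lambda>z. case_prod p z - case_prod \<alpha> z) < 1 / real (Suc n)"
    by (intro allI adapted_primitive_approx[OF sq aF]) auto
  then obtain q p where sm: "\<And>n. adapted_primitive (q n) (p n)"
    and l: "\<And>n. l2 P (\<lambda>z. case_prod (p n) z - case_prod \<alpha> z) < 1 / real (Suc n)" by metis
  have psq: "sq_int P (case_prod (p n))" "\<And>t. t \<in> {0..T} \<Longrightarrow> sq_int M (p n t)" for n
    using sm[of n] by (auto simp: adapted_primitive_def)
  let ?u = "\<lambda>n t. (LINT \<omega>|M. (norm (p n t \<omega> - \<alpha> t \<omega>))\<^sup>2)"
  have ui: "integrable P (\<lambda>(t, \<omega>). (norm (p n t \<omega> - \<alpha> t \<omega>))\<^sup>2)" for n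
    using sq_int_integrable[OF sq_int_diff[OF psq(1)[of n] sq]] by (simp add: split_beta')
  have "(\<lambda>n. l2 P (\<lambda>z. case_prod (p n) z - case_prod \<alpha> z)) \<longlonglongrightarrow> 0"
  proof (rule tendsto_sandwich[OF _ _ tendsto_const])
    show "(\<lambda>n. 1 / real (Suc n)) \<longlonglongrightarrow> 0" using LIMSEQ_inverse_real_of_nat by (simp add: inverse_eq_divide)
    show "\<forall>\<^sub>F n in sequentially. l2 P (\<lambda>z. case_prod (p n) z - case_prod \<alpha> z) \<le> 1 / real (Suc n)"
      using l by (intro always_eventually allI less_imp_le)
  qed simp
  then have "(\<lambda>n. (l2 P (\<lambda>z. case_prod (p n) z - case_prod \<alpha> z))\<^sup>2) \<longlonglongrightarrow> 0\<^sup>2" by (intro tendsto_power)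
  moreover have "(l2 P (\<lambda>z. case_prod (p n) z - case_prod \<alpha> z))\<^sup>2 = (LINT t|D. norm (?u n t))" for n
  proof -
    have "(l2 P (\<lambda>z. case_prod (p n) z - case_prod \<alpha> z))\<^sup>2 = (LINT t|D. ?u n t)"
      using DM.integral_fst[OF ui[of n]] by (simp add: l2_squared split_beta')
    then show ?thesis by (simp add: integral_nonneg_AE)
  qed
  ultimately have "(\<lambda>n. LINT t|D. norm (?u n t)) \<longlonglongrightarrow> 0" by (simp only: zero_power2)
  from tendsto_L1_AE_subseq[OF DM.integrable_fst[OF ui] this] obtain r :: "nat \<Rightarrow> nat"
    where "AE t in D. (\<lambda>n. ?u (r n) t) \<longlonglongrightarrow> 0" by blast
  then have "AE t in D. (\<lambda>n. ?u (r n) t) \<longlonglongrightarrow> 0 \<and> sq_int M (\<alpha> t)"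
    using sq_int_P_sections(1)[OF sq] by eventually_elim simp
  then obtain N where N: "N \<in> null_sets D" and Nl: "{t \<in> space D. \<not> ((\<lambda>n. ?u (r n) t) \<longlonglongrightarrow> 0 \<and> sq_int M (\<alpha> t))} \<subseteq> N"
    by (auto simp: eventually_ae_filter)
  have ok: "(\<lambda>n. ?u (r n) t) \<longlonglongrightarrow> 0" "sq_int M (\<alpha> t)" if "t \<in> {0..T} - N" for t
    using that Nl by auto
  let ?\<theta> = "\<lambda>t. if t \<in> N then (\<lambda>_. 0) else \<alpha> t"
  have "(\<lambda>t. law M (?\<theta> t)) \<in> D \<rightarrow>\<^sub>M borel_P2"
  proof (rule law_measurable_D)
    show "sq_int M (?\<theta> t)" if "t \<in> {0..T}" for t using ok(2)[of t] that by auto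
    fix S :: "('w \<Rightarrow> 'b) set" assume S: "S \<noteq> {}" "\<And>\<psi>. \<psi> \<in> S \<Longrightarrow> sq_int M \<psi>"
    have NS: "{t \<in> space D. t \<in> N} \<in> sets D"
    proof -
      have "N \<in> sets D" using N by auto
      moreover have "{t \<in> space D. t \<in> N} = N" using sets.sets_into_space[OF \<open>N \<in> sets D\<close>] by auto
      ultimately show ?thesis by simp
    qed
    show "(\<lambda>t. dist_set S (?\<theta> t)) \<in> borel_measurable D"
    proof (rule borel_measurable_LIMSEQ_real)
      show "(\<lambda>t. if t \<in> N then dist_set S (\<lambda>_. 0) else dist_set S (p (r n) t)) \<in> borel_measurable D" for n
        by (rule measurable_If[OF borel_measurable_const adapted_primitive_dist_set_measurable[OF sm S] NS])
      fix t assume "t \<in> space D"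
      then have t: "t \<in> {0..T}" by simp
      show "(\<lambda>n. if t \<in> N then dist_set S (\<lambda>_. 0) else dist_set S (p (r n) t)) \<longlonglongrightarrow> dist_set S (?\<theta> t)"
      proof (cases "t \<in> N")
        case False
        then have tN: "t \<in> {0..T} - N" using t by simp
        have "(\<lambda>n. sqrt (?u (r n) t)) \<longlonglongrightarrow> sqrt 0" by (rule tendsto_real_sqrt[OF ok(1)[OF tN]])
        then have lz: "(\<lambda>n. l2 M (\<lambda>\<omega>. p (r n) t \<omega> - \<alpha> t \<omega>)) \<longlonglongrightarrow> 0" by (simp add: l2_def)
        have "(\<lambda>n. dist_set S (p (r n) t) - dist_set S (\<alpha> t)) \<longlonglongrightarrow> 0"
        proof (rule Lim_null_comparison[OF _ lz], rule always_eventually, rule allI)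
          show "norm (dist_set S (p (r n) t) - dist_set S (\<alpha> t)) \<le> l2 M (\<lambda>\<omega>. p (r n) t \<omega> - \<alpha> t \<omega>)" for n
            using dist_set_lipschitz[OF S psq(2)[OF t] ok(2)[OF tN]] by simp
        qed
        then have "(\<lambda>n. dist_set S (p (r n) t)) \<longlonglongrightarrow> dist_set S (\<alpha> t)" by (rule LIM_zero_cancel)
        then show ?thesis using False by simp
      qed simp
    qed
  qed
  then show ?thesis using N ok(2) by blast
qed

section \<open>Coefficients evaluated at processes and their laws\<close>

lemma measurable_along_P:
  fixes h :: "('w, 'd::finite, 'k::finite, 'v::euclidean_space) coefficient"
  assumes h: "coeff_measurable M F T h"
    and X: "case_prod X \<in> borel_measurable P" "(\<lambda>t. law M (X t)) \<in> D \<rightarrow>\<^sub>M borel_P2"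
    and A: "case_prod A \<in> borel_measurable P" "(\<lambda>t. law M (A t)) \<in> D \<rightarrow>\<^sub>M borel_P2"
  shows "(\<lambda>(t, \<omega>). h t \<omega> (X t \<omega>) (law M (X t)) (A t \<omega>) (law M (A t))) \<in> borel_measurable P"
proof -
  have id: "(\<lambda>z. z) \<in> P \<rightarrow>\<^sub>M Prog M F T"
  proof (rule measurableI)
    fix C assume "C \<in> sets (Prog M F T)"
    then have "C \<in> sets P" using sets_Prog_P by blast
    then show "(\<lambda>z. z) -` C \<inter> space P \<in> sets P" by auto
  qed (simp add: space_P space_Prog)
  have "(\<lambda>z. (z, case_prod X z, law M (X (fst z)), case_prod A z, law M (A (fst z))))
      \<in> P \<rightarrow>\<^sub>M Prog M F T \<Otimes>\<^sub>M borel \<Otimes>\<^sub>M borel_P2 \<Otimes>\<^sub>M borel \<Otimes>\<^sub>M borel_P2"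
    by (intro measurable_Pair id X(1) A(1) measurable_compose[OF measurable_fst X(2)] measurable_compose[OF measurable_fst A(2)])
  from measurable_compose[OF this h[unfolded coeff_measurable_def]]
  show ?thesis by (simp add: split_beta')
qed

text \<open>A vanishing iterated integral says something almost everywhere through a jointly
  measurable integrand. Modifying both processes on null sets of times provides such an integrand
  and leaves the iterated integral unchanged.\<close>

lemma along_zero_AE:
  fixes h :: "('w, 'd::finite, 'k::finite, 'v::euclidean_space) coefficient"
  assumes h: "coeff_measurable M F T h"
    and X: "sq_int P (case_prod X)" "\<And>t. t \<in> {0..T} \<Longrightarrow> X t \<in> borel_measurable (F t)"
    and A: "sq_int P (case_prod A)" "\<And>t. t \<in> {0..T} \<Longrightarrow> A t \<in> borel_measurable (F t)"
    and z: "H2_sq M T (along M h X A) = 0"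
  shows "AE t in D. AE \<omega> in M. h t \<omega> (X t \<omega>) (law M (X t)) (A t \<omega>) (law M (A t)) = 0"
proof -
  from law_measurable_modification[OF X] obtain N1 where N1: "N1 \<in> null_sets D" "\<And>t. t \<in> {0..T} - N1 \<Longrightarrow> sq_int M (X t)"
    "(\<lambda>t. law M (if t \<in> N1 then (\<lambda>_. 0) else X t)) \<in> D \<rightarrow>\<^sub>M borel_P2" by blast
  from law_measurable_modification[OF A] obtain N2 where N2: "N2 \<in> null_sets D" "\<And>t. t \<in> {0..T} - N2 \<Longrightarrow> sq_int M (A t)"
    "(\<lambda>t. law M (if t \<in> N2 then (\<lambda>_. 0) else A t)) \<in> D \<rightarrow>\<^sub>M borel_P2" by blast
  define X' where "X' t = (if t \<in> N1 then (\<lambda>_. 0) else X t)" for t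
  define A' where "A' t = (if t \<in> N2 then (\<lambda>_. 0) else A t)" for t
  have modm: "case_prod (\<lambda>t. if t \<in> N then (\<lambda>_. 0) else Y t) \<in> borel_measurable P"
    if N: "N \<in> null_sets D" and Y: "case_prod Y \<in> borel_measurable P" for N and Y :: "real \<Rightarrow> 'w \<Rightarrow> 'c::euclidean_space"
  proof -
    have Ns: "N \<in> sets D" using N by auto
    have "{z \<in> space P. fst z \<in> N} = N \<times> space M" using sets.sets_into_space[OF Ns] by (auto simp: space_P)
    then have "{z \<in> space P. fst z \<in> N} \<in> sets P" using Ns by simp
    from measurable_If[OF borel_measurable_const[of 0] Y this]
    have "(\<lambda>z. if fst z \<in> N then 0 else case_prod Y z) \<in> borel_measurable P" .
    moreover have "(\<lambda>z. if fst z \<in> N then 0 else case_prod Y z) = case_prod (\<lambda>t. if t \<in> N then (\<lambda>_. 0) else Y t)"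
      by (auto simp: fun_eq_iff)
    ultimately show ?thesis by simp
  qed
  let ?\<Phi> = "\<lambda>t \<omega>. h t \<omega> (X' t \<omega>) (law M (X' t)) (A' t \<omega>) (law M (A' t))"
  have Phm: "case_prod ?\<Phi> \<in> borel_measurable P"
    unfolding X'_def A'_def using X(1) A(1) N1 N2
    by (intro measurable_along_P[OF h] modm) (auto simp: sq_int_def)
  have eq: "along M h X A t \<omega> = ?\<Phi> t \<omega>" if "t \<in> {0..T}" "t \<notin> N1" "t \<notin> N2" for t \<omega>
    using that law_in_P2[OF N1(2)[of t]] law_in_P2[OF N2(2)[of t]] by (simp add: along_def X'_def A'_def)
  have aeN: "AE t in D. t \<notin> N1 \<and> t \<notin> N2"
    using AE_not_in[OF N1(1)] AE_not_in[OF N2(1)] by eventually_elim simp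
  then have aeN': "AE t in lborel. t \<in> {0..T} \<longrightarrow> t \<notin> N1 \<and> t \<notin> N2"
    by (subst (asm) AE_restrict_space_iff) auto
  have "H2_sq M T ?\<Phi> = H2_sq M T (along M h X A)"
    unfolding H2_sq_def
  proof (rule nn_integral_cong, rule nn_integral_cong_AE)
    fix \<omega>
    show "AE t in lborel. ennreal ((norm (?\<Phi> t \<omega>))\<^sup>2) * indicator {0..T} t = ennreal ((norm (along M h X A t \<omega>))\<^sup>2) * indicator {0..T} t"
      using aeN' by eventually_elim (auto simp: eq indicator_def)
  qed
  then have "(\<integral>\<^sup>+z. ennreal ((norm (case_prod ?\<Phi> z))\<^sup>2) \<partial>P) = 0" using z H2_sq_eq[OF Phm] by simp
  then have "AE z in P. ennreal ((norm (case_prod ?\<Phi> z))\<^sup>2) = 0"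
    using Phm by (subst (asm) nn_integral_0_iff_AE) auto
  then have "AE z in P. case_prod ?\<Phi> z = 0" by eventually_elim (simp add: ennreal_eq_0_iff)
  from DM.AE_pair[OF this] have "AE t in D. AE \<omega> in M. ?\<Phi> t \<omega> = 0" by simp
  with aeN show ?thesis
  proof eventually_elim
    case (elim t)
    then show ?case by (simp add: X'_def A'_def)
  qed
qed

end

section \<open>Gronwall and drift bounds\<close>

text \<open>A weighted supremum replaces iteration: with weight exp (-2 C t) the integral term costs
  half of the supremum m, so that m \<le> R + m/2 and m \<le> 2 R. The bound \<open>Bd\<close> makes
  m finite.\<close>

lemma gronwall_leb:
  fixes \<phi> :: "real \<Rightarrow> real"
  assumes C: "0 < C" and T: "0 < T" and R: "0 \<le> R"
    and b: "\<And>t. t \<in> {0..T} \<Longrightarrow> 0 \<le> \<phi> t" "\<And>t. t \<in> {0..T} \<Longrightarrow> \<phi> t \<le> Bd"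
    and le: "\<And>t. t \<in> {0..T} \<Longrightarrow> \<phi> t \<le> R + C * (LINT s|leb T. indicator {0..t} s * \<phi> s)"
    and t: "t \<in> {0..T}"
  shows "\<phi> t \<le> 2 * R * exp (2 * C * T)"
proof -
  let ?\<gamma> = "2 * C"
  define m where "m = (SUP t\<in>{0..T}. exp (- ?\<gamma> * t) * \<phi> t)"
  have bd: "bdd_above ((\<lambda>t. exp (- ?\<gamma> * t) * \<phi> t) ` {0..T})"
  proof (rule bdd_aboveI2)
    fix s assume s: "s \<in> {0..T}"
    then have "exp (- ?\<gamma> * s) \<le> 1" using C by simp
    then have "exp (- ?\<gamma> * s) * \<phi> s \<le> 1 * \<phi> s" by (rule mult_right_mono) (rule b(1)[OF s])
    then show "exp (- ?\<gamma> * s) * \<phi> s \<le> Bd" using b(2)[OF s] by simp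
  qed
  have m_ge: "exp (- ?\<gamma> * s) * \<phi> s \<le> m" if "s \<in> {0..T}" for s
    unfolding m_def by (rule cSUP_upper[OF that bd])
  have m0: "0 \<le> m" using order_trans[OF _ m_ge[of 0]] T b(1)[of 0] by simp
  have phi: "\<phi> s \<le> m * exp (?\<gamma> * s)" if "s \<in> {0..T}" for s
  proof -
    have "exp (?\<gamma> * s) * (exp (- ?\<gamma> * s) * \<phi> s) \<le> exp (?\<gamma> * s) * m"
      by (rule mult_left_mono[OF m_ge[OF that]]) simp
    moreover have "exp (?\<gamma> * s) * (exp (- ?\<gamma> * s) * \<phi> s) = \<phi> s" by (simp add: exp_minus)
    ultimately show ?thesis by (simp only: mult.commute[of m])
  qed
  have I: "(LINT s|leb T. indicator {0..r} s * \<phi> s) \<le> m * (exp (?\<gamma> * r) / ?\<gamma>)" if r: "r \<in> {0..T}" for r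
  proof -
    have bi: "has_bochner_integral lborel (\<lambda>s. exp (?\<gamma> * s) * indicator {0..r} s) (exp (?\<gamma> * r) / ?\<gamma> - exp (?\<gamma> * 0) / ?\<gamma>)"
      using r C by (intro has_bochner_integral_FTC_Icc_real) (auto intro!: derivative_eq_intros)
    have ex: "(LINT s|leb T. indicator {0..r} s * exp (?\<gamma> * s)) = exp (?\<gamma> * r) / ?\<gamma> - 1 / ?\<gamma>"
      using leb_integral_eq[OF r, of "\<lambda>s. exp (?\<gamma> * s)"] has_bochner_integral_integral_eq[OF bi]
      by (simp add: set_lebesgue_integral_def mult.commute)
    have exi: "integrable (leb T) (\<lambda>s. indicator {0..r} s * exp (?\<gamma> * s))"
    proof (rule finite_measure.integrable_const_bound[where B="exp (?\<gamma> * T)", OF finite_measure_leb])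
      show "AE s in leb T. norm (indicator {0..r} s * exp (?\<gamma> * s)) \<le> exp (?\<gamma> * T)"
        using C by (intro AE_I2) (simp add: indicator_def space_restrict_space)
      have "(\<lambda>s. indicator {0..r} s * exp (?\<gamma> * s)) \<in> borel_measurable borel" by measurable
      then show "(\<lambda>s. indicator {0..r} s * exp (?\<gamma> * s)) \<in> borel_measurable (leb T)" by (rule measurable_leb)
    qed
    have "(LINT s|leb T. indicator {0..r} s * \<phi> s) \<le> (LINT s|leb T. m * (indicator {0..r} s * exp (?\<gamma> * s)))"
    proof (cases "integrable (leb T) (\<lambda>s. indicator {0..r} s * \<phi> s)")
      case True
      show ?thesis
        by (rule integral_mono[OF True integrable_mult_right[OF exi]])
           (use phi in \<open>auto simp: indicator_def space_restrict_space\<close>)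
    next
      \<comment> \<open>The integral is then 0 by convention, and the right-hand side is
        nonnegative.\<close>
      case False
      then show ?thesis
        using m0 by (simp add: not_integrable_integral_eq integral_nonneg_AE)
    qed
    also have "\<dots> = m * (exp (?\<gamma> * r) / ?\<gamma> - 1 / ?\<gamma>)" using ex by simp
    also have "\<dots> \<le> m * (exp (?\<gamma> * r) / ?\<gamma>)" using C by (intro mult_left_mono m0) simp
    finally show ?thesis .
  qed
  have "m \<le> R + m / 2"
    unfolding m_def[of]
  proof (rule cSUP_least)
    show "{0..T} \<noteq> {}" using T by simp
    fix r assume r: "r \<in> {0..T}"
    have "\<phi> r \<le> R + C * (m * (exp (?\<gamma> * r) / ?\<gamma>))"
      using le[OF r] mult_left_mono[OF I[OF r], of C] C by linarith
    \<comment> \<open>C / (2 C) = 1/2 is the reason for the exponent 2 C.\<close>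
    also have "\<dots> = R + m / 2 * exp (?\<gamma> * r)" using C by simp
    finally have "exp (- ?\<gamma> * r) * \<phi> r \<le> exp (- ?\<gamma> * r) * (R + m / 2 * exp (?\<gamma> * r))"
      by (rule mult_left_mono) simp
    also have "\<dots> = exp (- ?\<gamma> * r) * R + m / 2 * (exp (- ?\<gamma> * r) * exp (?\<gamma> * r))" by (simp add: algebra_simps)
    also have "exp (- ?\<gamma> * r) * exp (?\<gamma> * r) = 1" by (simp add: exp_minus)
    also have "exp (- ?\<gamma> * r) * R \<le> R"
      using r C R by (intro mult_left_le_one_le) auto
    finally have "exp (- ?\<gamma> * r) * \<phi> r \<le> R + m / 2" by simp
    then show "exp (- ?\<gamma> * r) * \<phi> r \<le> R + (SUP t\<in>{0..T}. exp (- ?\<gamma> * t) * \<phi> t) / 2" by (simp only: m_def)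
  qed
  then have "m \<le> 2 * R" by simp
  moreover have "exp (?\<gamma> * t) \<le> exp (?\<gamma> * T)" using t C by simp
  ultimately have "m * exp (?\<gamma> * t) \<le> 2 * R * exp (?\<gamma> * T)" using R m0 by (intro mult_mono) auto
  then show ?thesis using phi[OF t] by linarith
qed

section \<open>Norms up to time t and mean-field bounds\<close>

context two_scale_setting
begin

abbreviation sqP :: "(real \<Rightarrow> 'w \<Rightarrow> 'b::euclidean_space) \<Rightarrow> bool" where
  "sqP Z \<equiv> sq_int P (case_prod Z)"

text \<open>The L2 norm over [0,t] and the probability space; its square is the time integral that
  Gronwall's inequality acts on.\<close>

definition tn :: "real \<Rightarrow> (real \<Rightarrow> 'w \<Rightarrow> 'b::euclidean_space) \<Rightarrow> real" where
  "tn t Z = l2 P (\<lambda>(s, \<omega>). indicator {0..t} s *\<^sub>R Z s \<omega>)"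

lemma tn_nonneg[simp]: "0 \<le> tn t Z" by (simp add: tn_def)

lemma sqP_add: "sqP Z \<Longrightarrow> sqP Z' \<Longrightarrow> sqP (\<lambda>s \<omega>. Z s \<omega> + Z' s \<omega>)"
  using sq_int_add[of P "case_prod Z" "case_prod Z'"] by (simp add: split_beta')

lemma sqP_diff: "sqP Z \<Longrightarrow> sqP Z' \<Longrightarrow> sqP (\<lambda>s \<omega>. Z s \<omega> - Z' s \<omega>)"
  using sq_int_diff[of P "case_prod Z" "case_prod Z'"] by (simp add: split_beta')

lemma sqP_scaleR: "sqP Z \<Longrightarrow> sqP (\<lambda>s \<omega>. c *\<^sub>R Z s \<omega>)"
  using sq_int_scaleR[of P "case_prod Z" c] by (simp add: split_beta')

lemma sqP_norm: "sqP Z \<Longrightarrow> sqP (\<lambda>s \<omega>. norm (Z s \<omega>))"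
  using sq_int_norm[of P "case_prod Z"] by (simp add: split_beta')

lemma sqP_const: "sqP (\<lambda>s \<omega>. c)"
  using sq_int_const[OF P.finite_measure_axioms, of c] by (simp add: split_beta')

lemma sqP_time: "sqP Z \<Longrightarrow> sqP (\<lambda>s \<omega>. indicator {0..t} s *\<^sub>R Z s \<omega>)"
  by (rule sq_int_P_fstI) (auto intro!: measurable_D simp: indicator_def)

lemma tn_scaleR: "tn t (\<lambda>s \<omega>. c *\<^sub>R Z s \<omega>) = \<bar>c\<bar> * tn t Z"
proof -
  have "(\<lambda>(s, \<omega>). indicator {0..t} s *\<^sub>R c *\<^sub>R Z s \<omega>) = (\<lambda>z. c *\<^sub>R (\<lambda>(s, \<omega>). indicator {0..t} s *\<^sub>R Z s \<omega>) z)"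
    by (auto simp: fun_eq_iff)
  then show ?thesis unfolding tn_def by (simp only: l2_scaleR)
qed

lemma tn_norm: "tn t (\<lambda>s \<omega>. norm (Z s \<omega>)) = tn t Z"
  unfolding tn_def by (rule l2_cong) (auto simp: indicator_def)

lemma tn_triangle: "sqP Z \<Longrightarrow> sqP Z' \<Longrightarrow> tn t (\<lambda>s \<omega>. Z s \<omega> + Z' s \<omega>) \<le> tn t Z + tn t Z'"
  using l2_triangle[OF sqP_time[of Z t] sqP_time[of Z' t]]
  by (simp add: tn_def split_beta' scaleR_add_right)

lemma tn_le: "sqP Z \<Longrightarrow> tn t Z \<le> l2 P (case_prod Z)"
  unfolding tn_def by (rule l2_mono) (auto simp: indicator_def)

lemma tn_T: "tn T Z = l2 P (case_prod Z)"
  unfolding tn_def by (rule l2_cong) (auto simp: space_P indicator_def)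

lemma tn_const: "tn t (\<lambda>s \<omega>. 1 :: real) \<le> sqrt T"
proof -
  have "tn t (\<lambda>s \<omega>. 1 :: real) \<le> l2 P (case_prod (\<lambda>s \<omega>. 1 :: real))" by (rule tn_le[OF sqP_const])
  also have "\<dots> = sqrt (measure P (space P))" by (simp add: l2_def split_beta')
  also have "measure P (space P) = T"
  proof -
    have "emeasure P (space P) = emeasure D (space D) * emeasure M (space M)"
      unfolding space_pair_measure by (rule emeasure_pair_measure_Times[OF sets.top sets.top])
    also have "\<dots> = ennreal T"
      using T_pos by (simp add: emeasure_space_1 emeasure_restrict_space)
    finally show ?thesis using T_pos by (simp add: measure_def)
  qed
  finally show ?thesis .
qed

lemma AE_P_fst: "(AE t in D. Q t) \<Longrightarrow> AE z in P. Q (fst z)"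
proof -
  assume "AE t in D. Q t"
  then obtain N where N: "N \<in> null_sets D" "{t \<in> space D. \<not> Q t} \<subseteq> N" by (auto simp: eventually_ae_filter)
  have "N \<in> sets D" using N(1) by auto
  then have "emeasure P (N \<times> space M) = emeasure D N * emeasure M (space M)" by (intro emeasure_pair_measure_Times) auto
  then have "N \<times> space M \<in> null_sets P" using N(1) \<open>N \<in> sets D\<close> by (auto simp: null_sets_def)
  then show ?thesis
    by (rule AE_I') (use N(2) in \<open>auto simp: space_P\<close>)
qed

lemma tn_mono:
  assumes Z: "sqP Z" and Z': "case_prod Z' \<in> borel_measurable P"
    and le: "AE s in D. \<forall>\<omega>\<in>space M. norm (Z' s \<omega>) \<le> norm (Z s \<omega>)"
  shows "sqP Z'" "tn t Z' \<le> tn t Z"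
proof -
  have ae: "AE z in P. norm (case_prod Z' z) \<le> norm (case_prod Z z)"
    using AE_P_fst[OF le] AE_space by eventually_elim (auto simp: space_P split_beta')
  show "sqP Z'" by (rule sq_int_mono[OF Z Z' ae])
  show "tn t Z' \<le> tn t Z"
    unfolding tn_def using ae by (intro l2_mono[OF sqP_time[OF Z]]) (auto simp: indicator_def elim: eventually_mono)
qed

lemma tn_squared:
  assumes "sqP Z"
  shows "integrable D (\<lambda>s. indicator {0..t} s * (l2 M (Z s))\<^sup>2)"
    "(tn t Z)\<^sup>2 = (LINT s|D. indicator {0..t} s * (l2 M (Z s))\<^sup>2)"
proof -
  have i: "integrable P (\<lambda>(s, \<omega>). indicator {0..t} s * (norm (Z s \<omega>))\<^sup>2)"
    using sq_int_integrable[OF sqP_time[OF assms, of t]]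
    by (rule Bochner_Integration.integrable_cong[THEN iffD1, rotated 2]) (auto simp: indicator_def)
  show "integrable D (\<lambda>s. indicator {0..t} s * (l2 M (Z s))\<^sup>2)"
    using DM.integrable_fst[OF i] by (simp add: l2_squared)
  have "(tn t Z)\<^sup>2 = (LINT z|P. (\<lambda>(s, \<omega>). indicator {0..t} s * (norm (Z s \<omega>))\<^sup>2) z)"
    unfolding tn_def l2_squared by (intro Bochner_Integration.integral_cong refl) (auto simp: indicator_def)
  also have "\<dots> = (LINT s|D. indicator {0..t} s * (l2 M (Z s))\<^sup>2)"
    using DM.integral_fst[OF i] by (simp add: l2_squared)
  finally show "(tn t Z)\<^sup>2 = (LINT s|D. indicator {0..t} s * (l2 M (Z s))\<^sup>2)" .
qed

text \<open>Distances between laws are bounded by functions of time alone. Read as processes that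
  are constant in \<omega>, these have the same norm because \<open>M\<close> is a
  probability.\<close>

lemma mean_sqP:
  assumes "sqP Z"
  shows "sqP (\<lambda>s \<omega>. l2 M (Z s))" "tn t (\<lambda>s \<omega>. l2 M (Z s)) = tn t Z"
proof -
  have i: "integrable P (\<lambda>(s, \<omega>). (norm (Z s \<omega>))\<^sup>2)" using assms by (simp add: sq_int_def split_beta')
  have i2: "integrable D (\<lambda>s. (l2 M (Z s))\<^sup>2)" using DM.integrable_fst[OF i] by (simp add: l2_squared)
  then have "(\<lambda>s. sqrt ((l2 M (Z s))\<^sup>2)) \<in> borel_measurable D"
    by (intro measurable_compose[OF borel_measurable_integrable borel_measurable_sqrt])
  then have m: "(\<lambda>s. l2 M (Z s)) \<in> borel_measurable D" by simp
  have "integrable P (\<lambda>(s, \<omega>). (l2 M (Z s))\<^sup>2 * 1)"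
    by (rule DM.integral_prod_mult(1)[OF i2]) simp
  then show sq: "sqP (\<lambda>s \<omega>. l2 M (Z s))"
    using measurable_compose[OF measurable_fst m] by (simp add: sq_int_def split_beta')
  have "(tn t (\<lambda>s \<omega>. l2 M (Z s)))\<^sup>2 = (tn t Z)\<^sup>2"
    unfolding tn_squared(2)[OF sq] tn_squared(2)[OF assms]
    by (simp add: l2_def prob_space)
  then show "tn t (\<lambda>s \<omega>. l2 M (Z s)) = tn t Z" by (simp add: power2_eq_iff_nonneg)
qed

text \<open>Growth estimates use \<kappa> = 1, Lipschitz estimates \<kappa> = 0. Each process enters
  through its value and through its law, hence the factors 2.\<close>

lemma mean_field_bound:
  fixes H :: "real \<Rightarrow> 'w \<Rightarrow> 'v::euclidean_space"
  assumes H: "case_prod H \<in> borel_measurable P" and Z: "sqP Z1" "sqP Z2" and K: "0 \<le> K" "0 \<le> \<kappa>"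
    and le: "AE s in D. \<forall>\<omega>\<in>space M. norm (H s \<omega>) \<le> K * (\<kappa> + norm (Z1 s \<omega>) + l2 M (Z1 s) + norm (Z2 s \<omega>) + l2 M (Z2 s))"
  shows "sqP H" "tn t H \<le> K * (\<kappa> * sqrt T + 2 * tn t Z1 + 2 * tn t Z2)"
proof -
  let ?a = "\<lambda>s \<omega>. \<kappa> *\<^sub>R (1::real)" and ?b = "\<lambda>s \<omega>. norm (Z1 s \<omega>)" and ?c = "\<lambda>s (\<omega>::'w). l2 M (Z1 s)"
    and ?d = "\<lambda>s \<omega>. norm (Z2 s \<omega>)" and ?e = "\<lambda>s (\<omega>::'w). l2 M (Z2 s)"
  note sa = sqP_const[of "\<kappa> *\<^sub>R (1::real)"] and sb = sqP_norm[OF Z(1)] and sc = mean_sqP(1)[OF Z(1)]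
    and sd = sqP_norm[OF Z(2)] and se = mean_sqP(1)[OF Z(2)]
  note ab = sqP_add[OF sa sb] note abc = sqP_add[OF ab sc] note abcd = sqP_add[OF abc sd] note abcde = sqP_add[OF abcd se]
  have tot: "sqP (\<lambda>s \<omega>. K *\<^sub>R (?a s \<omega> + ?b s \<omega> + ?c s \<omega> + ?d s \<omega> + ?e s \<omega>))" by (rule sqP_scaleR[OF abcde])
  have le': "AE s in D. \<forall>\<omega>\<in>space M. norm (H s \<omega>) \<le> norm (K *\<^sub>R (?a s \<omega> + ?b s \<omega> + ?c s \<omega> + ?d s \<omega> + ?e s \<omega>))"
    using le
  proof eventually_elim
    case (elim s)
    show ?case
    proof
      fix \<omega> assume "\<omega> \<in> space M"
      with elim have "norm (H s \<omega>) \<le> K * (\<kappa> + norm (Z1 s \<omega>) + l2 M (Z1 s) + norm (Z2 s \<omega>) + l2 M (Z2 s))" by blast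
      also have "\<dots> \<le> norm (K *\<^sub>R (?a s \<omega> + ?b s \<omega> + ?c s \<omega> + ?d s \<omega> + ?e s \<omega>))" by simp
      finally show "norm (H s \<omega>) \<le> norm (K *\<^sub>R (?a s \<omega> + ?b s \<omega> + ?c s \<omega> + ?d s \<omega> + ?e s \<omega>))" .
    qed
  qed
  show "sqP H" by (rule tn_mono(1)[OF tot H le'])
  have "tn t H \<le> tn t (\<lambda>s \<omega>. K *\<^sub>R (?a s \<omega> + ?b s \<omega> + ?c s \<omega> + ?d s \<omega> + ?e s \<omega>))" by (rule tn_mono(2)[OF tot H le'])
  also have "\<dots> = K * tn t (\<lambda>s \<omega>. ?a s \<omega> + ?b s \<omega> + ?c s \<omega> + ?d s \<omega> + ?e s \<omega>)"
    using tn_scaleR[of t K "\<lambda>s \<omega>. ?a s \<omega> + ?b s \<omega> + ?c s \<omega> + ?d s \<omega> + ?e s \<omega>"] K by (simp only: abs_of_nonneg)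
  also have "\<dots> \<le> K * (\<kappa> * sqrt T + 2 * tn t Z1 + 2 * tn t Z2)"
  proof (rule mult_left_mono[OF _ K(1)])
    have "tn t ?a \<le> \<kappa> * sqrt T"
    proof -
      have "tn t ?a = \<kappa> * tn t (\<lambda>s \<omega>. 1::real)" using tn_scaleR[of t \<kappa> "\<lambda>s \<omega>. 1::real"] K by simp
      then show ?thesis using mult_left_mono[OF tn_const K(2)] by simp
    qed
    then show "tn t (\<lambda>s \<omega>. ?a s \<omega> + ?b s \<omega> + ?c s \<omega> + ?d s \<omega> + ?e s \<omega>) \<le> \<kappa> * sqrt T + 2 * tn t Z1 + 2 * tn t Z2"
      using tn_triangle[OF abcd se, of t] tn_triangle[OF abc sd, of t] tn_triangle[OF ab sc, of t] tn_triangle[OF sa sb, of t]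
      unfolding tn_norm mean_sqP(2)[OF Z(1)] mean_sqP(2)[OF Z(2)] by linarith
  qed
  finally show "tn t H \<le> K * (\<kappa> * sqrt T + 2 * tn t Z1 + 2 * tn t Z2)" .
qed

lemma norm_LINT_D_le:
  fixes g :: "real \<Rightarrow> 'v::euclidean_space"
  assumes "sq_int D g"
  shows "(norm (LINT s|D. g s))\<^sup>2 \<le> T * (LINT s|D. (norm (g s))\<^sup>2)"
proof -
  have l1: "(l2 D (\<lambda>s. 1::real))\<^sup>2 = T"
    using T_pos by (simp add: l2_squared measure_def emeasure_restrict_space)
  have "norm (LINT s|D. g s) \<le> (LINT s|D. norm (g s))" by (rule integral_norm_bound)
  also have "\<dots> = (LINT s|D. norm (1::real) * norm (g s))" by simp
  also have "\<dots> \<le> l2 D (\<lambda>s. 1::real) * l2 D g"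
    by (rule LINT_norm_mult_le_l2[OF sq_int_const[OF D.finite_measure_axioms] assms])
  finally have "(norm (LINT s|D. g s))\<^sup>2 \<le> (l2 D (\<lambda>s. 1::real) * l2 D g)\<^sup>2" by (rule power_mono) simp
  also have "\<dots> = T * (LINT s|D. (norm (g s))\<^sup>2)" unfolding power_mult_distrib l1 by (simp add: l2_squared)
  finally show ?thesis .
qed

text \<open>The bounds come from Cauchy-Schwarz in time. The last one has a single exceptional set
  for all t, as needed under a supremum.\<close>

lemma drift_bound:
  fixes f :: "real \<Rightarrow> 'w \<Rightarrow> 'v::euclidean_space"
  assumes f: "sqP f"
  shows "sq_int M (\<lambda>\<omega>. LINT s|D. indicator {0..t} s *\<^sub>R f s \<omega>)"
    "l2 M (\<lambda>\<omega>. LINT s|D. indicator {0..t} s *\<^sub>R f s \<omega>) \<le> sqrt T * tn t f"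
    "AE \<omega> in M. \<forall>t. (norm (LINT s|D. indicator {0..t} s *\<^sub>R f s \<omega>))\<^sup>2 \<le> T * (LINT s|D. (norm (f s \<omega>))\<^sup>2)"
proof -
  let ?f = "\<lambda>s \<omega>. indicator {0..t} s *\<^sub>R f s \<omega>"
  note ft = sqP_time[OF f, of t]
  have "integrable P (case_prod ?f)" by (rule sq_int_imp_integrable[OF P.finite_measure_axioms ft])
  from DM.integrable_snd[OF this] have m: "(\<lambda>\<omega>. LINT s|D. ?f s \<omega>) \<in> borel_measurable M" by auto
  have i: "integrable P (\<lambda>(s, \<omega>). (norm (?f s \<omega>))\<^sup>2)" using ft by (simp add: sq_int_def split_beta')
  have i': "integrable M (\<lambda>\<omega>. T * (LINT s|D. (norm (?f s \<omega>))\<^sup>2))" by (rule integrable_mult_right[OF DM.integrable_snd[OF i]])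
  have ae: "AE \<omega> in M. (norm (LINT s|D. ?f s \<omega>))\<^sup>2 \<le> T * (LINT s|D. (norm (?f s \<omega>))\<^sup>2)"
    using sq_int_P_sections(2)[OF ft] by eventually_elim (rule norm_LINT_D_le)
  show sq: "sq_int M (\<lambda>\<omega>. LINT s|D. ?f s \<omega>)"
    unfolding sq_int_def
  proof
    show "integrable M (\<lambda>\<omega>. (norm (LINT s|D. ?f s \<omega>))\<^sup>2)"
      using ae m by (intro Bochner_Integration.integrable_bound[OF i']) (auto elim!: eventually_mono)
  qed (rule m)
  have "(l2 M (\<lambda>\<omega>. LINT s|D. ?f s \<omega>))\<^sup>2 \<le> (LINT \<omega>|M. T * (LINT s|D. (norm (?f s \<omega>))\<^sup>2))"
    unfolding l2_squared by (rule integral_mono_AE[OF sq_int_integrable[OF sq] i' ae])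
  also have "\<dots> = T * (tn t f)\<^sup>2"
    using DM.integral_snd[OF i] by (simp add: tn_def l2_squared split_beta')
  also have "\<dots> = (sqrt T * tn t f)\<^sup>2" using T_pos by (simp add: power_mult_distrib)
  finally show "l2 M (\<lambda>\<omega>. LINT s|D. ?f s \<omega>) \<le> sqrt T * tn t f"
    by (rule power2_le_imp_le) (use T_pos in simp)
  show "AE \<omega> in M. \<forall>t. (norm (LINT s|D. indicator {0..t} s *\<^sub>R f s \<omega>))\<^sup>2 \<le> T * (LINT s|D. (norm (f s \<omega>))\<^sup>2)"
    using sq_int_P_sections(2)[OF f]
  proof eventually_elim
    case (elim \<omega>)
    show ?case
    proof
      fix t
      have sq: "sq_int D (\<lambda>s. indicator {0..t} s *\<^sub>R f s \<omega>)"
      proof (rule sq_int_mono[OF elim])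
        show "(\<lambda>s. indicator {0..t} s *\<^sub>R f s \<omega>) \<in> borel_measurable D"
          by (rule borel_measurable_scaleR[OF measurable_D]) (use elim in \<open>auto simp: sq_int_def\<close>)
      qed (auto simp: indicator_def)
      have "(LINT s|D. (norm (indicator {0..t} s *\<^sub>R f s \<omega>))\<^sup>2) \<le> (LINT s|D. (norm (f s \<omega>))\<^sup>2)"
        by (rule integral_mono[OF sq_int_integrable[OF sq] sq_int_integrable[OF elim]]) (simp add: indicator_def)
      then have "T * (LINT s|D. (norm (indicator {0..t} s *\<^sub>R f s \<omega>))\<^sup>2) \<le> T * (LINT s|D. (norm (f s \<omega>))\<^sup>2)"
        using T_pos by (intro mult_left_mono) auto
      then show "(norm (LINT s|D. indicator {0..t} s *\<^sub>R f s \<omega>))\<^sup>2 \<le> T * (LINT s|D. (norm (f s \<omega>))\<^sup>2)"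
        using norm_LINT_D_le[OF sq] by linarith
    qed
  qed
qed

text \<open>From (x + y)^2 \<le> 2 x^2 + 2 y^2: the drift contributes 2 T by Cauchy-Schwarz in time,
  the martingale part twice the constant 4 of Doob's inequality.\<close>

lemma S2_sq_drift_mart:
  fixes Y f I :: "real \<Rightarrow> 'w \<Rightarrow> 'v::euclidean_space"
  assumes f: "sqP f" and I: "mart_like I" "\<And>\<omega>. \<omega> \<in> space M \<Longrightarrow> continuous_on {0..T} (\<lambda>t. I t \<omega>)"
    and Y: "AE \<omega> in M. \<forall>t\<in>{0..T}. Y t \<omega> = (LINT s|D. indicator {0..t} s *\<^sub>R f s \<omega>) + I t \<omega>"
  shows "S2_sq M T Y \<le> ennreal (2 * T * (l2 P (case_prod f))\<^sup>2 + 8 * (l2 M (I T))\<^sup>2)"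
proof -
  from doob[OF I] obtain S where S: "S \<in> borel_measurable M"
    "\<And>\<omega>. \<omega> \<in> space M \<Longrightarrow> (SUP t\<in>{0..T}. ennreal ((norm (I t \<omega>))\<^sup>2)) \<le> S \<omega>"
    "(\<integral>\<^sup>+\<omega>. S \<omega> \<partial>M) \<le> ennreal (4 * (l2 M (I T))\<^sup>2)" by blast
  have i: "integrable P (\<lambda>(s, \<omega>). (norm (f s \<omega>))\<^sup>2)" using f by (simp add: sq_int_def split_beta')
  let ?A = "\<lambda>\<omega>. 2 * T * (LINT s|D. (norm (f s \<omega>))\<^sup>2)"
  have iA: "integrable M ?A" by (rule integrable_mult_right[OF DM.integrable_snd[OF i]])
  have A0: "0 \<le> ?A \<omega>" for \<omega> using T_pos by (simp add: integral_nonneg_AE)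
  have "S2_sq M T Y \<le> (\<integral>\<^sup>+\<omega>. ennreal (?A \<omega>) + 2 * S \<omega> \<partial>M)"
    unfolding S2_sq_def
  proof (rule nn_integral_mono_AE)
    show "AE \<omega> in M. (SUP t\<in>{0..T}. ennreal ((norm (Y t \<omega>))\<^sup>2)) \<le> ennreal (?A \<omega>) + 2 * S \<omega>"
      using Y drift_bound(3)[OF f] AE_space
    proof eventually_elim
      case (elim \<omega>)
      show ?case
      proof (rule SUP_least)
        fix t assume t: "t \<in> {0..T}"
        let ?V = "LINT s|D. indicator {0..t} s *\<^sub>R f s \<omega>"
        have "norm (Y t \<omega>) \<le> norm ?V + norm (I t \<omega>)" using elim(1) t by (simp add: norm_triangle_ineq)
        then have "(norm (Y t \<omega>))\<^sup>2 \<le> (norm ?V + norm (I t \<omega>))\<^sup>2" by (rule power_mono) simp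
        also have "\<dots> \<le> 2 * (norm ?V)\<^sup>2 + 2 * (norm (I t \<omega>))\<^sup>2"
          using sum_squares_bound[of "norm ?V" "norm (I t \<omega>)"] by (simp add: power2_sum)
        also have "\<dots> \<le> ?A \<omega> + 2 * (norm (I t \<omega>))\<^sup>2" using elim(2) by simp
        finally have "ennreal ((norm (Y t \<omega>))\<^sup>2) \<le> ennreal (?A \<omega> + 2 * (norm (I t \<omega>))\<^sup>2)" by (rule ennreal_leI)
        also have "\<dots> = ennreal (?A \<omega>) + 2 * ennreal ((norm (I t \<omega>))\<^sup>2)"
          using A0[of \<omega>] by (simp add: ennreal_plus ennreal_mult)
        also have "\<dots> \<le> ennreal (?A \<omega>) + 2 * S \<omega>"
        proof (intro add_left_mono mult_left_mono)
          have "ennreal ((norm (I t \<omega>))\<^sup>2) \<le> (SUP t\<in>{0..T}. ennreal ((norm (I t \<omega>))\<^sup>2))" by (rule SUP_upper[OF t])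
          then show "ennreal ((norm (I t \<omega>))\<^sup>2) \<le> S \<omega>" using S(2)[OF elim(3)] by (rule order_trans)
        qed simp
        finally show "ennreal ((norm (Y t \<omega>))\<^sup>2) \<le> ennreal (?A \<omega>) + 2 * S \<omega>" .
      qed
    qed
  qed
  also have "\<dots> = (\<integral>\<^sup>+\<omega>. ennreal (?A \<omega>) \<partial>M) + 2 * (\<integral>\<^sup>+\<omega>. S \<omega> \<partial>M)"
    using S(1) iA by (subst nn_integral_add) (auto simp: nn_integral_cmult)
  also have "(\<integral>\<^sup>+\<omega>. ennreal (?A \<omega>) \<partial>M) = ennreal (2 * T * (l2 P (case_prod f))\<^sup>2)"
  proof -
    have "(\<integral>\<^sup>+\<omega>. ennreal (?A \<omega>) \<partial>M) = ennreal (LINT \<omega>|M. ?A \<omega>)"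
      using A0 by (intro nn_integral_eq_integral iA) auto
    also have "(LINT \<omega>|M. ?A \<omega>) = 2 * T * (l2 P (case_prod f))\<^sup>2"
      using DM.integral_snd[OF i] by (simp add: l2_squared split_beta')
    finally show ?thesis .
  qed
  also have "ennreal (2 * T * (l2 P (case_prod f))\<^sup>2) + 2 * (\<integral>\<^sup>+\<omega>. S \<omega> \<partial>M)
      \<le> ennreal (2 * T * (l2 P (case_prod f))\<^sup>2) + 2 * ennreal (4 * (l2 M (I T))\<^sup>2)"
    by (intro add_left_mono mult_left_mono S(3)) simp
  also have "\<dots> = ennreal (2 * T * (l2 P (case_prod f))\<^sup>2 + 8 * (l2 M (I T))\<^sup>2)"
  proof -
    have "2 * ennreal (4 * (l2 M (I T))\<^sup>2) = ennreal (2 * (4 * (l2 M (I T))\<^sup>2))" by (simp add: ennreal_mult)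
    then show ?thesis using T_pos by (simp add: ennreal_plus)
  qed
  finally show ?thesis .
qed

end

section \<open>Coefficients along processes\<close>

context two_scale_setting
begin

definition grows :: "real \<Rightarrow> ('w, 'd::finite, 'k::finite, 'v::euclidean_space) coefficient \<Rightarrow> bool" where
  "grows K h \<longleftrightarrow> (\<forall>t\<in>{0..T}. \<forall>\<omega>\<in>space M. \<forall>x a. \<forall>\<mu>\<in>P2. \<forall>\<nu>\<in>P2.
     norm (h t \<omega> x \<mu> a \<nu>) \<le> K * (1 + norm x + norm_P2 \<mu> + norm a + norm_P2 \<nu>))"

definition lips :: "real \<Rightarrow> ('w, 'd::finite, 'k::finite, 'v::euclidean_space) coefficient \<Rightarrow> bool" where
  "lips K h \<longleftrightarrow> (\<forall>t\<in>{0..T}. \<forall>\<omega>\<in>space M. \<forall>x x' a a'. \<forall>\<mu>\<in>P2. \<forall>\<mu>'\<in>P2. \<forall>\<nu>\<in>P2. \<forall>\<nu>'\<in>P2.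
     norm (h t \<omega> x \<mu> a \<nu> - h t \<omega> x' \<mu>' a' \<nu>') \<le> K * (norm (x - x') + W2 \<mu> \<mu>' + norm (a - a') + W2 \<nu> \<nu>'))"

lemma sqP_good_times:
  assumes "sqP X" "sqP A"
  shows "AE s in D. s \<in> {0..T} \<and> sq_int M (X s) \<and> sq_int M (A s)"
  using sq_int_P_sections(1)[OF assms(1)] sq_int_P_sections(1)[OF assms(2)] AE_space by eventually_elim simp

lemma along_eq:
  assumes "sq_int M (X s)" "sq_int M (A s)"
  shows "along M h X A s \<omega> = h s \<omega> (X s \<omega>) (law M (X s)) (A s \<omega>) (law M (A s))"
  using assms by (simp add: along_def law_in_P2)

lemma grows_law:
  assumes g: "grows K h" and t: "t \<in> {0..T}" "\<omega> \<in> space M" and x: "sq_int M x" and a: "sq_int M a"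
  shows "norm (h t \<omega> (x \<omega>) (law M x) (a \<omega>) (law M a)) \<le> K * (1 + norm (x \<omega>) + l2 M x + norm (a \<omega>) + l2 M a)"
proof -
  have "x \<in> borel_measurable M" "a \<in> borel_measurable M" using x a by (auto simp: sq_int_def)
  from this[THEN norm_P2_law] show ?thesis
    using g[unfolded grows_def, rule_format, OF t law_in_P2[OF x] law_in_P2[OF a], of "x \<omega>" "a \<omega>"] by simp
qed

lemma lips_law:
  assumes l: "lips K h" "0 \<le> K" and t: "t \<in> {0..T}" "\<omega> \<in> space M"
    and x: "sq_int M x" "sq_int M x'" and a: "sq_int M a" "sq_int M a'"
  shows "norm (h t \<omega> (x \<omega>) (law M x) (a \<omega>) (law M a) - h t \<omega> (x' \<omega>) (law M x') (a' \<omega>) (law M a'))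
    \<le> K * (norm (x \<omega> - x' \<omega>) + l2 M (\<lambda>\<omega>. x \<omega> - x' \<omega>) + norm (a \<omega> - a' \<omega>) + l2 M (\<lambda>\<omega>. a \<omega> - a' \<omega>))"
proof -
  have "norm (h t \<omega> (x \<omega>) (law M x) (a \<omega>) (law M a) - h t \<omega> (x' \<omega>) (law M x') (a' \<omega>) (law M a'))
    \<le> K * (norm (x \<omega> - x' \<omega>) + W2 (law M x) (law M x') + norm (a \<omega> - a' \<omega>) + W2 (law M a) (law M a'))"
    using l(1)[unfolded lips_def, rule_format, OF t law_in_P2[OF x(1)] law_in_P2[OF x(2)] law_in_P2[OF a(1)] law_in_P2[OF a(2)]] .
  also have "\<dots> \<le> K * (norm (x \<omega> - x' \<omega>) + l2 M (\<lambda>\<omega>. x \<omega> - x' \<omega>) + norm (a \<omega> - a' \<omega>) + l2 M (\<lambda>\<omega>. a \<omega> - a' \<omega>))"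
    using W2_law_le[of x x'] W2_law_le[of a a'] x a l(2)
    by (intro mult_left_mono add_mono) (auto simp: sq_int_def)
  finally show ?thesis .
qed

text \<open>The scalar r is carried along for the noise \<beta>(\<epsilon>) \<Sigma>: the stochastic
  differential guarantees measurability of this product, from which that of \<Sigma> alone cannot be
  recovered when \<beta>(\<epsilon>) = 0.\<close>

lemma along_growth:
  fixes h :: "('w, 'd::finite, 'k::finite, 'v::euclidean_space) coefficient"
  assumes g: "grows K h" "0 \<le> K" and X: "sqP X" and A: "sqP A"
    and m: "case_prod (\<lambda>t \<omega>. r *\<^sub>R along M h X A t \<omega>) \<in> borel_measurable P"
  shows "sqP (\<lambda>t \<omega>. r *\<^sub>R along M h X A t \<omega>)"
    "tn t (\<lambda>t \<omega>. r *\<^sub>R along M h X A t \<omega>) \<le> \<bar>r\<bar> * (K * (sqrt T + 2 * tn t X + 2 * tn t A))"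
proof -
  have le: "AE s in D. \<forall>\<omega>\<in>space M. norm (r *\<^sub>R along M h X A s \<omega>)
      \<le> (\<bar>r\<bar> * K) * (1 + norm (X s \<omega>) + l2 M (X s) + norm (A s \<omega>) + l2 M (A s))"
    using sqP_good_times[OF X A]
  proof eventually_elim
    case (elim s)
    show ?case
    proof
      fix \<omega> assume w: "\<omega> \<in> space M"
      have "norm (along M h X A s \<omega>) \<le> K * (1 + norm (X s \<omega>) + l2 M (X s) + norm (A s \<omega>) + l2 M (A s))"
        using grows_law[OF g(1) _ w, of s "X s" "A s"] elim by (simp add: along_eq)
      then have "\<bar>r\<bar> * norm (along M h X A s \<omega>) \<le> \<bar>r\<bar> * (K * (1 + norm (X s \<omega>) + l2 M (X s) + norm (A s \<omega>) + l2 M (A s)))"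
        by (rule mult_left_mono) simp
      then show "norm (r *\<^sub>R along M h X A s \<omega>) \<le> (\<bar>r\<bar> * K) * (1 + norm (X s \<omega>) + l2 M (X s) + norm (A s \<omega>) + l2 M (A s))"
        by (simp add: mult.assoc)
    qed
  qed
  have K: "0 \<le> \<bar>r\<bar> * K" "(0::real) \<le> 1" using g(2) by auto
  show "sqP (\<lambda>t \<omega>. r *\<^sub>R along M h X A t \<omega>)" by (rule mean_field_bound(1)[OF m X A K le])
  show "tn t (\<lambda>t \<omega>. r *\<^sub>R along M h X A t \<omega>) \<le> \<bar>r\<bar> * (K * (sqrt T + 2 * tn t X + 2 * tn t A))"
    using mean_field_bound(2)[OF m X A K le, of t] by (simp add: mult.assoc)
qed

lemma along_lips:
  fixes h :: "('w, 'd::finite, 'k::finite, 'v::euclidean_space) coefficient"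
  assumes l: "lips K h" "0 \<le> K" and X: "sqP X" "sqP X'" and A: "sqP A" "sqP A'"
    and m: "case_prod (along M h X A) \<in> borel_measurable P" "case_prod (along M h X' A') \<in> borel_measurable P"
  shows "sqP (\<lambda>s \<omega>. along M h X A s \<omega> - along M h X' A' s \<omega>)"
    "tn t (\<lambda>s \<omega>. along M h X A s \<omega> - along M h X' A' s \<omega>)
      \<le> K * (2 * tn t (\<lambda>s \<omega>. X s \<omega> - X' s \<omega>) + 2 * tn t (\<lambda>s \<omega>. A s \<omega> - A' s \<omega>))"
proof -
  have le: "AE s in D. \<forall>\<omega>\<in>space M. norm (along M h X A s \<omega> - along M h X' A' s \<omega>)
      \<le> K * (0 + norm (X s \<omega> - X' s \<omega>) + l2 M (\<lambda>\<omega>. X s \<omega> - X' s \<omega>) + norm (A s \<omega> - A' s \<omega>) + l2 M (\<lambda>\<omega>. A s \<omega> - A' s \<omega>))"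
    using sqP_good_times[OF X(1) A(1)] sqP_good_times[OF X(2) A(2)]
  proof eventually_elim
    case (elim s)
    show ?case
    proof
      fix \<omega> assume w: "\<omega> \<in> space M"
      show "norm (along M h X A s \<omega> - along M h X' A' s \<omega>)
        \<le> K * (0 + norm (X s \<omega> - X' s \<omega>) + l2 M (\<lambda>\<omega>. X s \<omega> - X' s \<omega>) + norm (A s \<omega> - A' s \<omega>) + l2 M (\<lambda>\<omega>. A s \<omega> - A' s \<omega>))"
        using lips_law[OF l _ w, of s "X s" "X' s" "A s" "A' s"] elim by (simp add: along_eq)
    qed
  qed
  have m': "case_prod (\<lambda>s \<omega>. along M h X A s \<omega> - along M h X' A' s \<omega>) \<in> borel_measurable P"
    using borel_measurable_diff[OF m] by (simp add: split_beta')
  show "sqP (\<lambda>s \<omega>. along M h X A s \<omega> - along M h X' A' s \<omega>)"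
    by (rule mean_field_bound(1)[OF m' sqP_diff[OF X] sqP_diff[OF A] l(2) order_refl le])
  show "tn t (\<lambda>s \<omega>. along M h X A s \<omega> - along M h X' A' s \<omega>)
      \<le> K * (2 * tn t (\<lambda>s \<omega>. X s \<omega> - X' s \<omega>) + 2 * tn t (\<lambda>s \<omega>. A s \<omega> - A' s \<omega>))"
    using mean_field_bound(2)[OF m' sqP_diff[OF X] sqP_diff[OF A] l(2) order_refl le, of t] by simp
qed

lemma coeff_section_measurable:
  fixes h :: "('w, 'd::finite, 'k::finite, 'v::euclidean_space) coefficient"
  assumes h: "coeff_measurable M F T h" and t: "t \<in> {0..T}"
    and x: "x \<in> borel_measurable M" "a \<in> borel_measurable M" and mu: "\<mu> \<in> P2" "\<nu> \<in> P2"
  shows "(\<lambda>\<omega>. h t \<omega> (x \<omega>) \<mu> (a \<omega>) \<nu>) \<in> borel_measurable M"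
proof -
  have sp: "space borel_P2 = (P2 :: 'z::euclidean_space measure set)"
    unfolding borel_P2_def by (rule space_measure_of) blast
  have "(\<lambda>\<omega>. (t, \<omega>)) \<in> M \<rightarrow>\<^sub>M Prog M F T"
  proof (rule measurableI)
    show "(t, \<omega>) \<in> space (Prog M F T)" if "\<omega> \<in> space M" for \<omega> using that t by (simp add: space_Prog)
    fix C assume "C \<in> sets (Prog M F T)"
    then have "C \<in> sets P" using sets_Prog_P by blast
    from measurable_sets[OF measurable_Pair1'[of t D M] this] t
    show "(\<lambda>\<omega>. (t, \<omega>)) -` C \<inter> space M \<in> sets M" by simp
  qed
  then have "(\<lambda>\<omega>. ((t, \<omega>), x \<omega>, \<mu>, a \<omega>, \<nu>)) \<in> M \<rightarrow>\<^sub>M Prog M F T \<Otimes>\<^sub>M borel \<Otimes>\<^sub>M borel_P2 \<Otimes>\<^sub>M borel \<Otimes>\<^sub>M borel_P2"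
    using mu by (intro measurable_Pair x measurable_const) (simp_all add: sp)
  from measurable_compose[OF this h[unfolded coeff_measurable_def]] show ?thesis by simp
qed

text \<open>Expectations of inner products with B are to be split at a fixed time; linear growth
  supplies the square integrability for this.\<close>

lemma coeff_section_sq_int:
  fixes h :: "('w, 'd::finite, 'k::finite, 'v::euclidean_space) coefficient"
  assumes h: "coeff_measurable M F T h" and g: "grows K h" "0 \<le> K" and t: "t \<in> {0..T}"
    and x: "sq_int M x" and a: "sq_int M a"
  shows "sq_int M (\<lambda>\<omega>. h t \<omega> (x \<omega>) (law M x) (a \<omega>) (law M a))"
proof (rule sq_int_mono)
  let ?w = "\<lambda>\<omega>. K *\<^sub>R ((1 + l2 M x + l2 M a) + (norm (x \<omega>) + norm (a \<omega>)))"
  show "sq_int M ?w"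
    by (intro sq_int_scaleR sq_int_add sq_int_const[OF finite_measure_axioms] sq_int_norm x a)
  show "(\<lambda>\<omega>. h t \<omega> (x \<omega>) (law M x) (a \<omega>) (law M a)) \<in> borel_measurable M"
    using x a by (intro coeff_section_measurable[OF h t] law_in_P2) (auto simp: sq_int_def)
  show "AE \<omega> in M. norm (h t \<omega> (x \<omega>) (law M x) (a \<omega>) (law M a)) \<le> norm (?w \<omega>)"
  proof (rule AE_I2)
    fix \<omega> assume "\<omega> \<in> space M"
    from grows_law[OF g(1) t this x a]
    have "norm (h t \<omega> (x \<omega>) (law M x) (a \<omega>) (law M a)) \<le> ?w \<omega>" by (simp add: algebra_simps)
    then show "norm (h t \<omega> (x \<omega>) (law M x) (a \<omega>) (law M a)) \<le> norm (?w \<omega>)" by simp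
  qed
qed

lemma stoch_differentialE:
  fixes Y :: "real \<Rightarrow> 'w \<Rightarrow> real^'n"
  assumes "has_stoch_differential M F W T Y f Z"
  obtains I where "case_prod f \<in> borel_measurable P" "case_prod Z \<in> borel_measurable P" "sqP Z" "ito_integral M F W T Z I"
    "AE \<omega> in M. \<forall>t\<in>{0..T}. Y t \<omega> = Y 0 \<omega> + (LINT s|D. indicator {0..t} s *\<^sub>R f s \<omega>) + I t \<omega>"
    "\<forall>t\<in>{0..T}. f t \<in> borel_measurable (F t)"
proof -
  from assms obtain I where f: "case_prod f \<in> borel_measurable (Prog M F T)" and I: "ito_integral M F W T Z I"
    and eq: "AE \<omega> in M. \<forall>t\<in>{0..T}. Y t \<omega> = Y 0 \<omega> + (LINT s:{0..t}|lborel. f s \<omega>) + I t \<omega>"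
    unfolding has_stoch_differential_def by blast
  have sqZ: "sqP Z" using H2D(2)[OF ito_integralD(1)[OF I]] .
  show thesis
  proof (rule that[OF measurable_Prog_P[OF f] _ sqZ I])
    show "case_prod Z \<in> borel_measurable P" using sqZ by (simp add: sq_int_def)
    show "AE \<omega> in M. \<forall>t\<in>{0..T}. Y t \<omega> = Y 0 \<omega> + (LINT s|D. indicator {0..t} s *\<^sub>R f s \<omega>) + I t \<omega>"
      using eq
    proof eventually_elim
      case (elim \<omega>)
      show ?case
      proof
        fix t assume t: "t \<in> {0..T}"
        with elim have "Y t \<omega> = Y 0 \<omega> + (LINT s:{0..t}|lborel. f s \<omega>) + I t \<omega>" by blast
        then show "Y t \<omega> = Y 0 \<omega> + (LINT s|D. indicator {0..t} s *\<^sub>R f s \<omega>) + I t \<omega>"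
          unfolding leb_integral_eq[OF t] .
      qed
    qed
    show "\<forall>t\<in>{0..T}. f t \<in> borel_measurable (F t)" using measurable_Prog_section[OF f] by blast
  qed
qed

end

section \<open>The two-scale system and its constants\<close>

locale two_scale_system = two_scale_setting M G W T + assumption_A M "filt M G W" T \<beta> b \<sigma> B \<Sigma>
  for M G :: "'w measure" and W :: "real \<Rightarrow> 'w \<Rightarrow> real ^ 'm" and T :: real and \<beta> :: "real \<Rightarrow> real"
    and b :: "('w, 'd::finite, 'k::finite, real ^ 'd) coefficient"
    and \<sigma> :: "('w, 'd, 'k, real ^ 'm ^ 'd) coefficient"
    and B :: "('w, 'd, 'k, real ^ 'k) coefficient"
    and \<Sigma> :: "('w, 'd, 'k, real ^ 'm ^ 'k) coefficient"
begin

text \<open>K is the larger of the growth and the Lipschitz constant. Enlarging a constant is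
  legitimate in front of a nonnegative bracket; for \<open>W2\<close>, an infimum of reals,
  nonnegativity rests on the set of couplings being nonempty, and the product measure is
  one.\<close>

lemma constants:
  obtains K where "0 < K" "lips K b" "lips K \<sigma>" "grows K b" "grows K \<sigma>" "grows K B" "grows K \<Sigma>"
    "\<And>t \<omega> x x' a \<mu> \<mu>' \<nu>. t \<in> {0..T} \<Longrightarrow> \<omega> \<in> space M \<Longrightarrow> \<mu> \<in> P2 \<Longrightarrow> \<mu>' \<in> P2 \<Longrightarrow> \<nu> \<in> P2 \<Longrightarrow>
      norm (B t \<omega> x \<mu> a \<nu> - B t \<omega> x' \<mu>' a \<nu>) \<le> K * (norm (x - x') + W2 \<mu> \<mu>')"
proof -
  from growth obtain Kg where Kg: "0 < Kg" and gr: "\<forall>t\<in>{0..T}. \<forall>\<omega>\<in>space M. \<forall>x a. \<forall>\<mu>\<in>P2. \<forall>\<nu>\<in>P2.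
        norm (b t \<omega> x \<mu> a \<nu>) + norm (\<sigma> t \<omega> x \<mu> a \<nu>) \<le> Kg * (1 + norm x + norm_P2 \<mu> + norm a + norm_P2 \<nu>) \<and>
        norm (B t \<omega> x \<mu> a \<nu>) + norm (\<Sigma> t \<omega> x \<mu> a \<nu>) \<le> Kg * (1 + norm x + norm_P2 \<mu> + norm a + norm_P2 \<nu>)"
    by blast
  from lipschitz obtain Kl where Kl: "0 < Kl" and li: "\<forall>t\<in>{0..T}. \<forall>\<omega>\<in>space M. \<forall>x x' a a'. \<forall>\<mu>\<in>P2. \<forall>\<mu>'\<in>P2. \<forall>\<nu>\<in>P2. \<forall>\<nu>'\<in>P2.
        norm (b t \<omega> x \<mu> a \<nu> - b t \<omega> x' \<mu>' a' \<nu>')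
          \<le> Kl * (norm (x - x') + W2 \<mu> \<mu>' + norm (a - a') + W2 \<nu> \<nu>') \<and>
        norm (\<sigma> t \<omega> x \<mu> a \<nu> - \<sigma> t \<omega> x' \<mu>' a' \<nu>')
          \<le> Kl * (norm (x - x') + W2 \<mu> \<mu>' + norm (a - a') + W2 \<nu> \<nu>') \<and>
        norm (\<Sigma> t \<omega> x \<mu> a \<nu> - \<Sigma> t \<omega> x' \<mu>' a' \<nu>')
          \<le> Kl * (norm (x - x') + W2 \<mu> \<mu>' + norm (a - a') + W2 \<nu> \<nu>') \<and>
        norm (B t \<omega> x \<mu> a \<nu> - B t \<omega> x' \<mu>' a \<nu>) \<le> Kl * (norm (x - x') + W2 \<mu> \<mu>')"
    by blast
  let ?K = "max Kg Kl"
  have W0: "0 \<le> W2 \<mu> \<mu>'" if "\<mu> \<in> P2" "\<mu>' \<in> P2" for \<mu> \<mu>' :: "'z::euclidean_space measure"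
  proof -
    have "couplings \<mu> \<mu>' \<noteq> {}"
    proof -
      interpret m: prob_space \<mu> using that(1) by (simp add: P2_def)
      interpret m': prob_space \<mu>' using that(2) by (simp add: P2_def)
      interpret mm: pair_prob_space \<mu> \<mu>' ..
      have s: "sets \<mu> = sets borel" "sets \<mu>' = sets borel" using that by (auto simp: P2_def)
      have "\<mu> \<Otimes>\<^sub>M \<mu>' \<in> couplings \<mu> \<mu>'"
        unfolding couplings_def
      proof (intro CollectI conjI)
        show "prob_space (\<mu> \<Otimes>\<^sub>M \<mu>')" by (rule mm.prob_space_axioms)
        show "sets (\<mu> \<Otimes>\<^sub>M \<mu>') = sets (borel \<Otimes>\<^sub>M borel)" by (rule sets_pair_measure_cong[OF s])
        have "distr (\<mu> \<Otimes>\<^sub>M \<mu>') borel fst = distr (\<mu> \<Otimes>\<^sub>M \<mu>') \<mu> fst" by (rule distr_cong) (auto simp: s)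
        then show "distr (\<mu> \<Otimes>\<^sub>M \<mu>') borel fst = \<mu>" by (simp add: m'.distr_pair_fst)
        have "distr (\<mu> \<Otimes>\<^sub>M \<mu>') borel snd = distr (\<mu> \<Otimes>\<^sub>M \<mu>') \<mu>' snd" by (rule distr_cong) (auto simp: s)
        also have "\<dots> = distr (\<mu>' \<Otimes>\<^sub>M \<mu>) \<mu>' fst"
          by (subst mm.distr_pair_swap) (simp add: distr_distr o_def split_beta')
        finally show "distr (\<mu> \<Otimes>\<^sub>M \<mu>') borel snd = \<mu>'" by (simp add: m.distr_pair_fst)
      qed
      then show ?thesis by blast
    qed
    then show ?thesis unfolding W2_def by (intro cINF_greatest) (auto simp: integral_nonneg_AE)
  qed
  have N0: "0 \<le> norm_P2 \<mu>" for \<mu> :: "'z::euclidean_space measure" by (simp add: norm_P2_def integral_nonneg_AE)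
  have g: "u \<le> ?K * (1 + norm x + norm_P2 \<mu> + norm a + norm_P2 \<nu>)"
    if "u \<le> Kg * (1 + norm x + norm_P2 \<mu> + norm a + norm_P2 \<nu>)" for u x \<mu> a \<nu>
    by (rule order_trans[OF that]) (intro mult_right_mono add_nonneg_nonneg N0, auto)
  have l: "u \<le> ?K * (norm (x - x') + W2 \<mu> \<mu>' + norm (a - a') + W2 \<nu> \<nu>')"
    if "u \<le> Kl * (norm (x - x') + W2 \<mu> \<mu>' + norm (a - a') + W2 \<nu> \<nu>')" "\<mu> \<in> P2" "\<mu>' \<in> P2" "\<nu> \<in> P2" "\<nu>' \<in> P2"
    for u and x x' :: "real^'d" and \<mu> \<mu>' and a a' :: "real^'k" and \<nu> \<nu>'
    by (rule order_trans[OF that(1)]) (intro mult_right_mono add_nonneg_nonneg W0 that, auto)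
  show thesis
  proof (rule that[of ?K])
    show "0 < ?K" using Kg by simp
    show "lips ?K b" unfolding lips_def using li by (intro ballI allI l) auto
    show "lips ?K \<sigma>" unfolding lips_def using li by (intro ballI allI l) auto
    show "grows ?K b" unfolding grows_def
    proof (intro ballI allI g)
      fix t \<omega> x a and \<mu> :: "(real^'d) measure" and \<nu> :: "(real^'k) measure"
      assume "t \<in> {0..T}" "\<omega> \<in> space M" "\<mu> \<in> P2" "\<nu> \<in> P2"
      with gr have "norm (b t \<omega> x \<mu> a \<nu>) + norm (\<sigma> t \<omega> x \<mu> a \<nu>) \<le> Kg * (1 + norm x + norm_P2 \<mu> + norm a + norm_P2 \<nu>)" by blast
      then show "norm (b t \<omega> x \<mu> a \<nu>) \<le> Kg * (1 + norm x + norm_P2 \<mu> + norm a + norm_P2 \<nu>)"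
        using norm_ge_zero[of "\<sigma> t \<omega> x \<mu> a \<nu>"] by linarith
    qed
    show "grows ?K \<sigma>" unfolding grows_def
    proof (intro ballI allI g)
      fix t \<omega> x a and \<mu> :: "(real^'d) measure" and \<nu> :: "(real^'k) measure"
      assume "t \<in> {0..T}" "\<omega> \<in> space M" "\<mu> \<in> P2" "\<nu> \<in> P2"
      with gr have "norm (b t \<omega> x \<mu> a \<nu>) + norm (\<sigma> t \<omega> x \<mu> a \<nu>) \<le> Kg * (1 + norm x + norm_P2 \<mu> + norm a + norm_P2 \<nu>)" by blast
      then show "norm (\<sigma> t \<omega> x \<mu> a \<nu>) \<le> Kg * (1 + norm x + norm_P2 \<mu> + norm a + norm_P2 \<nu>)"
        using norm_ge_zero[of "b t \<omega> x \<mu> a \<nu>"] by linarith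
    qed
    show "grows ?K B" unfolding grows_def
    proof (intro ballI allI g)
      fix t \<omega> x a and \<mu> :: "(real^'d) measure" and \<nu> :: "(real^'k) measure"
      assume "t \<in> {0..T}" "\<omega> \<in> space M" "\<mu> \<in> P2" "\<nu> \<in> P2"
      with gr have "norm (B t \<omega> x \<mu> a \<nu>) + norm (\<Sigma> t \<omega> x \<mu> a \<nu>) \<le> Kg * (1 + norm x + norm_P2 \<mu> + norm a + norm_P2 \<nu>)" by blast
      then show "norm (B t \<omega> x \<mu> a \<nu>) \<le> Kg * (1 + norm x + norm_P2 \<mu> + norm a + norm_P2 \<nu>)"
        using norm_ge_zero[of "\<Sigma> t \<omega> x \<mu> a \<nu>"] by linarith
    qed
    show "grows ?K \<Sigma>" unfolding grows_def
    proof (intro ballI allI g)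
      fix t \<omega> x a and \<mu> :: "(real^'d) measure" and \<nu> :: "(real^'k) measure"
      assume "t \<in> {0..T}" "\<omega> \<in> space M" "\<mu> \<in> P2" "\<nu> \<in> P2"
      with gr have "norm (B t \<omega> x \<mu> a \<nu>) + norm (\<Sigma> t \<omega> x \<mu> a \<nu>) \<le> Kg * (1 + norm x + norm_P2 \<mu> + norm a + norm_P2 \<nu>)" by blast
      then show "norm (\<Sigma> t \<omega> x \<mu> a \<nu>) \<le> Kg * (1 + norm x + norm_P2 \<mu> + norm a + norm_P2 \<nu>)"
        using norm_ge_zero[of "B t \<omega> x \<mu> a \<nu>"] by linarith
    qed
    fix t \<omega> x x' a and \<mu> \<mu>' :: "(real^'d) measure" and \<nu> :: "(real^'k) measure"
    assume h: "t \<in> {0..T}" "\<omega> \<in> space M" "\<mu> \<in> P2" "\<mu>' \<in> P2" "\<nu> \<in> P2"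
    have "norm (B t \<omega> x \<mu> a \<nu> - B t \<omega> x' \<mu>' a \<nu>) \<le> Kl * (norm (x - x') + W2 \<mu> \<mu>')"
      using li h by blast
    also have "\<dots> \<le> ?K * (norm (x - x') + W2 \<mu> \<mu>')"
      by (intro mult_right_mono add_nonneg_nonneg W0 h) auto
    finally show "norm (B t \<omega> x \<mu> a \<nu> - B t \<omega> x' \<mu>' a \<nu>) \<le> ?K * (norm (x - x') + W2 \<mu> \<mu>')" .
  qed
qed

end

section \<open>Stability estimates\<close>

text \<open>Young's inequality, from the square of c u - 2 K v divided by 2 c. The weight is such
  that the u-term uses up half of the monotonicity constant c.\<close>

lemma absorb_product:
  fixes c K u v :: real
  assumes "0 < c"
  shows "2 * K * v * u \<le> c / 2 * u\<^sup>2 + 2 * K\<^sup>2 / c * v\<^sup>2"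
proof -
  have "0 \<le> (c * u - 2 * K * v)\<^sup>2" by simp
  then have "4 * (c * (K * (v * u))) \<le> c\<^sup>2 * u\<^sup>2 + 4 * (K\<^sup>2 * v\<^sup>2)"
    by (simp add: power2_diff power_mult_distrib algebra_simps)
  then have "4 * (c * (K * (v * u))) / (2 * c) \<le> (c\<^sup>2 * u\<^sup>2 + 4 * (K\<^sup>2 * v\<^sup>2)) / (2 * c)"
    by (rule divide_right_mono) (use assms in simp)
  moreover have "4 * (c * (K * (v * u))) / (2 * c) = 2 * K * v * u" using assms by simp
  moreover have "(c\<^sup>2 * u\<^sup>2 + 4 * (K\<^sup>2 * v\<^sup>2)) / (2 * c) = c / 2 * u\<^sup>2 + 2 * K\<^sup>2 / c * v\<^sup>2"
    using assms by (simp add: add_divide_distrib power2_eq_square)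
  ultimately show ?thesis by simp
qed

text \<open>Closes an estimate in which the unknown error occurs on both sides.\<close>

lemma smallness_bound:
  fixes S :: real
  assumes "0 \<le> S" "S \<le> k * (1 + S)" "k \<le> 1 / 2"
  shows "S \<le> 2 * k"
proof -
  have "k * S \<le> 1 / 2 * S" by (rule mult_right_mono[OF assms(3,1)])
  moreover have "S \<le> k + k * S" using assms(2) by (simp add: algebra_simps)
  ultimately show ?thesis by linarith
qed

lemma power2_sum3_le: "(x + y + z)\<^sup>2 \<le> 3 * (x\<^sup>2 + y\<^sup>2 + (z::real)\<^sup>2)"
proof -
  have "2 * x * y \<le> x\<^sup>2 + y\<^sup>2" "2 * x * z \<le> x\<^sup>2 + z\<^sup>2" "2 * y * z \<le> y\<^sup>2 + z\<^sup>2"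
    by (rule sum_squares_bound)+
  then show ?thesis by (simp add: power2_eq_square algebra_simps)
qed

context two_scale_system
begin

text \<open>B is compared in two steps: from (x, a) to (x, \<alpha>) by monotonicity alone, then
  from (x, \<alpha>) to (x', \<alpha>), where it vanishes, by the Lipschitz bound in the slow
  variable and its law. The cross term of the second step is absorbed at the price of half of
  c.\<close>

lemma monotone_estimate:
  assumes K: "0 \<le> K" "grows K B"
    and Bl: "\<And>t \<omega> x x' a \<mu> \<mu>' \<nu>. t \<in> {0..T} \<Longrightarrow> \<omega> \<in> space M \<Longrightarrow> \<mu> \<in> P2 \<Longrightarrow> \<mu>' \<in> P2 \<Longrightarrow> \<nu> \<in> P2 \<Longrightarrow>
      norm (B t \<omega> x \<mu> a \<nu> - B t \<omega> x' \<mu>' a \<nu>) \<le> K * (norm (x - x') + W2 \<mu> \<mu>')"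
    and c: "0 < c" and mono: "\<And>t \<zeta> \<theta> \<theta>'. t \<in> {0..T} \<Longrightarrow> \<zeta> \<in> L2_rv M M \<Longrightarrow> \<theta> \<in> L2_rv M M \<Longrightarrow> \<theta>' \<in> L2_rv M M \<Longrightarrow>
        (LINT \<omega>|M. (B t \<omega> (\<zeta> \<omega>) (law M \<zeta>) (\<theta> \<omega>) (law M \<theta>)
                     - B t \<omega> (\<zeta> \<omega>) (law M \<zeta>) (\<theta>' \<omega>) (law M \<theta>')) \<bullet> (\<theta> \<omega> - \<theta>' \<omega>))
          \<le> - c * (LINT \<omega>|M. (norm (\<theta> \<omega> - \<theta>' \<omega>))\<^sup>2)"
    and s: "s \<in> {0..T}" and x: "sq_int M x" "sq_int M x'" and a: "sq_int M a" "sq_int M \<alpha>"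
    and zero: "AE \<omega> in M. B s \<omega> (x' \<omega>) (law M x') (\<alpha> \<omega>) (law M \<alpha>) = 0"
  shows "(LINT \<omega>|M. (a \<omega> - \<alpha> \<omega>) \<bullet> B s \<omega> (x \<omega>) (law M x) (a \<omega>) (law M a))
    \<le> - (c / 2) * (l2 M (\<lambda>\<omega>. a \<omega> - \<alpha> \<omega>))\<^sup>2 + 2 * K\<^sup>2 / c * (l2 M (\<lambda>\<omega>. x \<omega> - x' \<omega>))\<^sup>2"
proof -
  let ?b1 = "\<lambda>\<omega>. B s \<omega> (x \<omega>) (law M x) (a \<omega>) (law M a)" and ?b2 = "\<lambda>\<omega>. B s \<omega> (x \<omega>) (law M x) (\<alpha> \<omega>) (law M \<alpha>)"
    and ?b3 = "\<lambda>\<omega>. B s \<omega> (x' \<omega>) (law M x') (\<alpha> \<omega>) (law M \<alpha>)"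
  let ?da = "\<lambda>\<omega>. a \<omega> - \<alpha> \<omega>" and ?dx = "\<lambda>\<omega>. x \<omega> - x' \<omega>"
  have L2I: "\<zeta> \<in> L2_rv M M" if "sq_int M \<zeta>" for \<zeta> :: "'w \<Rightarrow> 'z::euclidean_space"
    using that by (simp add: sq_int_def L2_rv_def)
  have sq1: "sq_int M ?b1" and sq2: "sq_int M ?b2" and sq3: "sq_int M ?b3"
    using coeff_section_sq_int[OF meas(3) K(2,1) s] x a by auto
  note sda = sq_int_diff[OF a] and sdx = sq_int_diff[OF x]
  have "(LINT \<omega>|M. ?da \<omega> \<bullet> ?b1 \<omega>) = (LINT \<omega>|M. (?b1 \<omega> - ?b2 \<omega>) \<bullet> ?da \<omega> + (?b2 \<omega> - ?b3 \<omega>) \<bullet> ?da \<omega>)"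
  proof (rule integral_cong_AE)
    show "(\<lambda>\<omega>. ?da \<omega> \<bullet> ?b1 \<omega>) \<in> borel_measurable M"
      by (rule borel_measurable_integrable[OF sq_int_inner[OF sda sq1]])
    show "(\<lambda>\<omega>. (?b1 \<omega> - ?b2 \<omega>) \<bullet> ?da \<omega> + (?b2 \<omega> - ?b3 \<omega>) \<bullet> ?da \<omega>) \<in> borel_measurable M"
      by (rule borel_measurable_integrable[OF Bochner_Integration.integrable_add])
         (intro sq_int_inner sq_int_diff sq1 sq2 sq3 a)+
    show "AE \<omega> in M. ?da \<omega> \<bullet> ?b1 \<omega> = (?b1 \<omega> - ?b2 \<omega>) \<bullet> ?da \<omega> + (?b2 \<omega> - ?b3 \<omega>) \<bullet> ?da \<omega>"
      using zero by eventually_elim (simp add: inner_diff_left inner_diff_right inner_commute)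
  qed
  also have "\<dots> = (LINT \<omega>|M. (?b1 \<omega> - ?b2 \<omega>) \<bullet> ?da \<omega>) + (LINT \<omega>|M. (?b2 \<omega> - ?b3 \<omega>) \<bullet> ?da \<omega>)"
    by (rule Bochner_Integration.integral_add) (intro sq_int_inner sq_int_diff sq1 sq2 sq3 a)+
  also have "(LINT \<omega>|M. (?b1 \<omega> - ?b2 \<omega>) \<bullet> ?da \<omega>) \<le> - c * (l2 M ?da)\<^sup>2"
    unfolding l2_squared by (rule mono[OF s L2I[OF x(1)] L2I[OF a(1)] L2I[OF a(2)]])
  also have "(LINT \<omega>|M. (?b2 \<omega> - ?b3 \<omega>) \<bullet> ?da \<omega>) \<le> (2 * K * l2 M ?dx) * l2 M ?da"
  proof -
    have "(LINT \<omega>|M. (?b2 \<omega> - ?b3 \<omega>) \<bullet> ?da \<omega>) \<le> l2 M (\<lambda>\<omega>. ?b2 \<omega> - ?b3 \<omega>) * l2 M ?da"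
      using abs_LINT_inner_le_l2[OF sq_int_diff[OF sq2 sq3] sda] by linarith
    also have "l2 M (\<lambda>\<omega>. ?b2 \<omega> - ?b3 \<omega>) \<le> 2 * K * l2 M ?dx"
    proof -
      let ?w = "\<lambda>\<omega>. K *\<^sub>R (norm (?dx \<omega>) + l2 M ?dx)"
      have sc: "sq_int M (\<lambda>\<omega>. l2 M ?dx)" by (rule sq_int_const[OF finite_measure_axioms])
      have "l2 M (\<lambda>\<omega>. ?b2 \<omega> - ?b3 \<omega>) \<le> l2 M ?w"
      proof (rule l2_mono)
        show "sq_int M ?w" by (intro sq_int_scaleR sq_int_add sq_int_norm sdx sc)
        show "AE \<omega> in M. norm (?b2 \<omega> - ?b3 \<omega>) \<le> norm (?w \<omega>)"
        proof (rule AE_I2)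
          fix \<omega> assume w: "\<omega> \<in> space M"
          have "norm (?b2 \<omega> - ?b3 \<omega>) \<le> K * (norm (?dx \<omega>) + W2 (law M x) (law M x'))"
            by (rule Bl[OF s w law_in_P2[OF x(1)] law_in_P2[OF x(2)] law_in_P2[OF a(2)]])
          also have "\<dots> \<le> K * (norm (?dx \<omega>) + l2 M ?dx)"
            using W2_law_le[of x x'] x K(1) by (intro mult_left_mono add_mono) (auto simp: sq_int_def)
          finally show "norm (?b2 \<omega> - ?b3 \<omega>) \<le> norm (?w \<omega>)" by simp
        qed
      qed
      also have "\<dots> = K * l2 M (\<lambda>\<omega>. norm (?dx \<omega>) + l2 M ?dx)" using K(1) by (simp only: l2_scaleR abs_of_nonneg)
      also have "l2 M (\<lambda>\<omega>. norm (?dx \<omega>) + l2 M ?dx) \<le> l2 M (\<lambda>\<omega>. norm (?dx \<omega>)) + l2 M (\<lambda>\<omega>. l2 M ?dx)"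
        by (rule l2_triangle[OF sq_int_norm[OF sdx] sc])
      also have "l2 M (\<lambda>\<omega>. l2 M ?dx) = l2 M ?dx" by (simp add: l2_def[of M "\<lambda>\<omega>. l2 M ?dx"] prob_space)
      finally show ?thesis using K(1) by (simp add: l2_norm mult_left_mono)
    qed
    finally show ?thesis by (simp add: mult_right_mono)
  qed
  finally have "(LINT \<omega>|M. ?da \<omega> \<bullet> ?b1 \<omega>) \<le> - c * (l2 M ?da)\<^sup>2 + 2 * K * l2 M ?dx * l2 M ?da" by simp
  then show ?thesis using absorb_product[OF c, of K "l2 M ?dx" "l2 M ?da"] by simp
qed

text \<open>Both processes start from the same value, so their difference is a drift plus a
  martingale. Cauchy-Schwarz in time gives the factor sqrt T, the isometry the factor 1, and Doob
  the uniform version. The first bound is local in t, as Gronwall's inequality requires.\<close>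

lemma slow_estimate:
  assumes K: "0 \<le> K" "lips K b" "lips K \<sigma>"
    and X: "X \<in> S2 M F T" "X' \<in> S2 M F T" and A: "sqP A" "sqP A'"
    and d: "has_stoch_differential M F W T X (along M b X A) (along M \<sigma> X A)"
      "has_stoch_differential M F W T X' (along M b X' A') (along M \<sigma> X' A')"
    and init: "AE \<omega> in M. X 0 \<omega> = X' 0 \<omega>"
  shows "t \<in> {0..T} \<Longrightarrow> l2 M (\<lambda>\<omega>. X t \<omega> - X' t \<omega>)
      \<le> (sqrt T + 1) * (K * (2 * tn t (\<lambda>s \<omega>. X s \<omega> - X' s \<omega>) + 2 * tn t (\<lambda>s \<omega>. A s \<omega> - A' s \<omega>)))"
    and "S2_sq M T (\<lambda>t \<omega>. X t \<omega> - X' t \<omega>)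
      \<le> ennreal ((2 * T + 8) * (K * (2 * tn T (\<lambda>s \<omega>. X s \<omega> - X' s \<omega>) + 2 * tn T (\<lambda>s \<omega>. A s \<omega> - A' s \<omega>)))\<^sup>2)"
proof -
  note sX = S2_sq_int_P[OF X(1)] S2_sq_int_P[OF X(2)]
  obtain I where I: "case_prod (along M b X A) \<in> borel_measurable P" "case_prod (along M \<sigma> X A) \<in> borel_measurable P"
    "sqP (along M \<sigma> X A)" "ito_integral M F W T (along M \<sigma> X A) I"
    "AE \<omega> in M. \<forall>t\<in>{0..T}. X t \<omega> = X 0 \<omega> + (LINT s|D. indicator {0..t} s *\<^sub>R along M b X A s \<omega>) + I t \<omega>"
    by (rule stoch_differentialE[OF d(1)]) (rule that, assumption+)
  obtain I' where I': "case_prod (along M b X' A') \<in> borel_measurable P" "case_prod (along M \<sigma> X' A') \<in> borel_measurable P"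
    "sqP (along M \<sigma> X' A')" "ito_integral M F W T (along M \<sigma> X' A') I'"
    "AE \<omega> in M. \<forall>t\<in>{0..T}. X' t \<omega> = X' 0 \<omega> + (LINT s|D. indicator {0..t} s *\<^sub>R along M b X' A' s \<omega>) + I' t \<omega>"
    by (rule stoch_differentialE[OF d(2)]) (rule that, assumption+)
  let ?db = "\<lambda>s \<omega>. along M b X A s \<omega> - along M b X' A' s \<omega>"
    and ?ds = "\<lambda>s \<omega>. along M \<sigma> X A s \<omega> - along M \<sigma> X' A' s \<omega>"
    and ?dX = "\<lambda>s \<omega>. X s \<omega> - X' s \<omega>" and ?dA = "\<lambda>s \<omega>. A s \<omega> - A' s \<omega>" and ?dI = "\<lambda>s \<omega>. I s \<omega> - I' s \<omega>"
  let ?L = "\<lambda>t. K * (2 * tn t ?dX + 2 * tn t ?dA)"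
  note lb = along_lips[OF K(2,1) sX A I(1) I'(1)] and ls = along_lips[OF K(3,1) sX A I(2) I'(2)]
  have L0: "0 \<le> ?L t" for t using K(1) by simp
  \<comment> \<open>Linear growth makes each drift integrable separately, so that the integral of
    their difference splits.\<close>
  have sqb: "sqP (along M b X A)" "sqP (along M b X' A')" if "grows Kb b" "0 \<le> Kb" for Kb
    using along_growth(1)[OF that sX(1) A(1), of 1] along_growth(1)[OF that sX(2) A(2), of 1] I(1) I'(1) by simp_all
  obtain Kb where Kb: "grows Kb b" "0 \<le> Kb" using constants by (metis less_imp_le)
  note sqb = sqb[OF Kb]
  have eq: "AE \<omega> in M. \<forall>t\<in>{0..T}. ?dX t \<omega> = (LINT s|D. indicator {0..t} s *\<^sub>R ?db s \<omega>) + ?dI t \<omega>"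
    using I(5) I'(5) init sq_int_P_sections(2)[OF sqb(1)] sq_int_P_sections(2)[OF sqb(2)]
  proof eventually_elim
    case (elim \<omega>)
    note i = elim(4,5)[THEN sq_int_imp_integrable[OF D.finite_measure_axioms]]
    show ?case
    proof
      fix t assume t: "t \<in> {0..T}"
      have ii: "integrable D (\<lambda>s. indicator {0..t} s *\<^sub>R along M b X A s \<omega>)" "integrable D (\<lambda>s. indicator {0..t} s *\<^sub>R along M b X' A' s \<omega>)"
        using integrable_leb_indicator[OF i(1)] integrable_leb_indicator[OF i(2)] by auto
      have "(LINT s|D. indicator {0..t} s *\<^sub>R ?db s \<omega>)
        = (LINT s|D. indicator {0..t} s *\<^sub>R along M b X A s \<omega>) - (LINT s|D. indicator {0..t} s *\<^sub>R along M b X' A' s \<omega>)"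
        unfolding scaleR_diff_right by (rule Bochner_Integration.integral_diff[OF ii])
      moreover have "X t \<omega> = X 0 \<omega> + (LINT s|D. indicator {0..t} s *\<^sub>R along M b X A s \<omega>) + I t \<omega>" using elim(1) t by blast
      moreover have "X' t \<omega> = X' 0 \<omega> + (LINT s|D. indicator {0..t} s *\<^sub>R along M b X' A' s \<omega>) + I' t \<omega>" using elim(2) t by blast
      ultimately show "?dX t \<omega> = (LINT s|D. indicator {0..t} s *\<^sub>R ?db s \<omega>) + ?dI t \<omega>"
        using elim(3) by (simp only:) simp
    qed
  qed
  have sqI: "sq_int M (?dI t)" if "t \<in> {0..T}" for t
    using S2D(2)[OF ito_integralD(2)[OF I(4)] that] S2D(2)[OF ito_integralD(2)[OF I'(4)] that] by (rule sq_int_diff)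
  have iso: "l2 M (?dI t) \<le> ?L t" if t: "t \<in> {0..T}" for t
    using ito_diff_isometry[OF I(4) I'(4) t] ls(2)[of t] by (simp add: tn_def)
  show "l2 M (?dX t) \<le> (sqrt T + 1) * ?L t" if t: "t \<in> {0..T}"
  proof -
    let ?V = "\<lambda>\<omega>. LINT s|D. indicator {0..t} s *\<^sub>R ?db s \<omega>"
    have sqX: "sq_int M (?dX t)" using S2D(2)[OF X(1) t] S2D(2)[OF X(2) t] by (rule sq_int_diff)
    have "l2 M (?dX t) = l2 M (\<lambda>\<omega>. ?V \<omega> + ?dI t \<omega>)"
    proof (rule l2_cong_AE)
      show "?dX t \<in> borel_measurable M" using sqX by (simp add: sq_int_def)
      show "(\<lambda>\<omega>. ?V \<omega> + ?dI t \<omega>) \<in> borel_measurable M"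
        using sq_int_add[OF drift_bound(1)[OF lb(1)] sqI[OF t]] by (simp add: sq_int_def)
      show "AE \<omega> in M. ?dX t \<omega> = ?V \<omega> + ?dI t \<omega>" using eq by eventually_elim (use t in blast)
    qed
    also have "\<dots> \<le> l2 M ?V + l2 M (?dI t)" by (rule l2_triangle[OF drift_bound(1)[OF lb(1)] sqI[OF t]])
    also have "l2 M ?V \<le> sqrt T * tn t ?db" by (rule drift_bound(2)[OF lb(1)])
    also have "\<dots> \<le> sqrt T * ?L t" by (rule mult_left_mono[OF lb(2)]) (use T_pos in simp)
    also have "l2 M (?dI t) \<le> ?L t" by (rule iso[OF t])
    finally show ?thesis by (simp add: distrib_right)
  qed
  have T: "T \<in> {0..T}" using T_pos by simp
  have ctsI: "continuous_on {0..T} (\<lambda>t. ?dI t \<omega>)" if "\<omega> \<in> space M" for \<omega>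
    using ito_integralD(2)[OF I(4)] ito_integralD(2)[OF I'(4)] that by (intro continuous_on_diff) (auto simp: S2_def)
  have "S2_sq M T ?dX \<le> ennreal (2 * T * (l2 P (case_prod ?db))\<^sup>2 + 8 * (l2 M (?dI T))\<^sup>2)"
    by (rule S2_sq_drift_mart[OF lb(1) mart_like_diff[OF mart_like_ito[OF I(4)] mart_like_ito[OF I'(4)]] ctsI eq])
  also have "\<dots> \<le> ennreal ((2 * T + 8) * (?L T)\<^sup>2)"
  proof (rule ennreal_leI)
    have "(l2 P (case_prod ?db))\<^sup>2 \<le> (?L T)\<^sup>2" using lb(2)[of T] unfolding tn_T by (intro power_mono) auto
    then have "2 * T * (l2 P (case_prod ?db))\<^sup>2 \<le> 2 * T * (?L T)\<^sup>2" using T_pos by (intro mult_left_mono) auto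
    moreover have "(l2 M (?dI T))\<^sup>2 \<le> (?L T)\<^sup>2" using iso[OF T] by (intro power_mono) auto
    ultimately show "2 * T * (l2 P (case_prod ?db))\<^sup>2 + 8 * (l2 M (?dI T))\<^sup>2 \<le> (2 * T + 8) * (?L T)\<^sup>2"
      by (simp add: distrib_right)
  qed
  finally show "S2_sq M T ?dX \<le> ennreal ((2 * T + 8) * (?L T)\<^sup>2)" .
qed

text \<open>The energy identity is applied to \<epsilon> (A - p), whose drift is B - \<epsilon> q,
  and divided by \<epsilon>. In the pairing with B one writes A - p = (A - \<alpha>) + (\<alpha> -
  p): monotonicity acts on the first part, while the second is paired with B through the growth
  bound g.\<close>

lemma fast_estimate:
  assumes K: "0 \<le> K" "grows K B" "grows K \<Sigma>"
    and Bl: "\<And>t \<omega> x x' a \<mu> \<mu>' \<nu>. t \<in> {0..T} \<Longrightarrow> \<omega> \<in> space M \<Longrightarrow> \<mu> \<in> P2 \<Longrightarrow> \<mu>' \<in> P2 \<Longrightarrow> \<nu> \<in> P2 \<Longrightarrow>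
      norm (B t \<omega> x \<mu> a \<nu> - B t \<omega> x' \<mu>' a \<nu>) \<le> K * (norm (x - x') + W2 \<mu> \<mu>')"
    and c: "0 < c" and mono: "\<And>t \<zeta> \<theta> \<theta>'. t \<in> {0..T} \<Longrightarrow> \<zeta> \<in> L2_rv M M \<Longrightarrow> \<theta> \<in> L2_rv M M \<Longrightarrow> \<theta>' \<in> L2_rv M M \<Longrightarrow>
        (LINT \<omega>|M. (B t \<omega> (\<zeta> \<omega>) (law M \<zeta>) (\<theta> \<omega>) (law M \<theta>)
                     - B t \<omega> (\<zeta> \<omega>) (law M \<zeta>) (\<theta>' \<omega>) (law M \<theta>')) \<bullet> (\<theta> \<omega> - \<theta>' \<omega>))
          \<le> - c * (LINT \<omega>|M. (norm (\<theta> \<omega> - \<theta>' \<omega>))\<^sup>2)"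
    and X: "X \<in> S2 M F T" "X' \<in> S2 M F T" and A: "A \<in> S2 M F T" and \<alpha>: "sqP \<alpha>"
    and zero: "AE t in D. AE \<omega> in M. B t \<omega> (X' t \<omega>) (law M (X' t)) (\<alpha> t \<omega>) (law M (\<alpha> t)) = 0"
    and e: "0 < \<epsilon>" and d: "has_stoch_differential M F W T (\<lambda>t \<omega>. \<epsilon> *\<^sub>R A t \<omega>) (along M B X A) (\<lambda>t \<omega>. \<beta> \<epsilon> *\<^sub>R along M \<Sigma> X A t \<omega>)"
    and sm: "adapted_primitive q p" and t: "t \<in> {0..T}"
  defines "g \<equiv> K * (sqrt T + 2 * tn T X + 2 * tn T A)"
  shows "c * (tn t (\<lambda>s \<omega>. A s \<omega> - \<alpha> s \<omega>))\<^sup>2 \<le> 4 * K\<^sup>2 / c * (tn t (\<lambda>s \<omega>. X s \<omega> - X' s \<omega>))\<^sup>2 +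
    (\<epsilon> * (l2 M (A 0))\<^sup>2 + 2 * tn T (\<lambda>s \<omega>. p s \<omega> - \<alpha> s \<omega>) * g + 2 * \<epsilon> * tn T (\<lambda>s \<omega>. A s \<omega> - p s \<omega>) * tn T q
      + (\<beta> \<epsilon>)\<^sup>2 / \<epsilon> * g\<^sup>2)"
proof -
  note sX = S2_sq_int_P[OF X(1)] S2_sq_int_P[OF X(2)] and sA = S2_sq_int_P[OF A]
  have t0: "0 \<in> {0..T}" using T_pos by simp
  have q: "sqP q" "\<And>t. t \<in> {0..T} \<Longrightarrow> q t \<in> borel_measurable (F t)" and p: "\<And>t \<omega>. p t \<omega> = (LINT s|D. indicator {0..t} s *\<^sub>R q s \<omega>)"
    and sp: "sqP p" "\<And>t. t \<in> {0..T} \<Longrightarrow> sq_int M (p t)" using sm by (auto simp: adapted_primitive_def)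
  let ?B = "along M B X A" and ?Z = "\<lambda>t \<omega>. \<beta> \<epsilon> *\<^sub>R along M \<Sigma> X A t \<omega>"
  obtain I where I: "case_prod ?B \<in> borel_measurable P" "case_prod ?Z \<in> borel_measurable P" "sqP ?Z" "ito_integral M F W T ?Z I"
    "AE \<omega> in M. \<forall>t\<in>{0..T}. \<epsilon> *\<^sub>R A t \<omega> = \<epsilon> *\<^sub>R A 0 \<omega> + (LINT s|D. indicator {0..t} s *\<^sub>R ?B s \<omega>) + I t \<omega>"
    "\<forall>t\<in>{0..T}. ?B t \<in> borel_measurable (F t)"
    by (rule stoch_differentialE[OF d]) (rule that, assumption+)
  \<comment> \<open>g bounds the growth of B and \<Sigma> along the solution over all of [0,T],
    hence over every [0,t].\<close>
  have gr: "K * (sqrt T + 2 * tn t X + 2 * tn t A) \<le> g" for t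
    unfolding g_def tn_T by (intro mult_left_mono add_mono order_refl tn_le sX(1) sA K(1)) auto
  have g0: "0 \<le> g" using K(1) T_pos by (simp add: g_def)
  have sB: "sqP ?B" and nB: "tn t ?B \<le> g" for t
    using along_growth[OF K(2,1) sX(1) sA, of 1] I(1) order_trans[OF _ gr] by auto
  have nZ: "tn t ?Z \<le> \<bar>\<beta> \<epsilon>\<bar> * g" for t
    using along_growth(2)[OF K(3,1) sX(1) sA I(2), of t] mult_left_mono[OF gr[of t], of "\<bar>\<beta> \<epsilon>\<bar>"] by linarith
  define Y where "Y s \<omega> = \<epsilon> *\<^sub>R (A s \<omega> - p s \<omega>)" for s \<omega>
  define f where "f s \<omega> = ?B s \<omega> - \<epsilon> *\<^sub>R q s \<omega>" for s \<omega>
  have sf: "sqP f" unfolding f_def[abs_def] by (rule sqP_diff[OF sB sqP_scaleR[OF q(1)]])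
  have sY: "sqP Y" unfolding Y_def[abs_def] by (rule sqP_scaleR[OF sqP_diff[OF sA sp(1)]])
  have sYM: "sq_int M (Y s)" if "s \<in> {0..T}" for s
    unfolding Y_def[abs_def] by (intro sq_int_scaleR sq_int_diff S2D(2)[OF A that] sp(2)[OF that])
  have fF: "f s \<in> borel_measurable (F s)" if "s \<in> {0..T}" for s
    unfolding f_def[abs_def] using bspec[OF I(6) that] q(2)[OF that] by (intro borel_measurable_diff borel_measurable_scaleR) auto
  \<comment> \<open>An integral over the single point 0. The initial value is therefore \<epsilon> A
    0, and no value of \<alpha> at time 0 enters.\<close>
  have p0: "p 0 \<omega> = 0" for \<omega>
    unfolding p by (rule integral_eq_zero_AE, rule eventually_mono[OF AE_leb_neq[of 0 T]]) (simp add: indicator_def)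
  have Y0: "Y 0 \<in> borel_measurable (F 0)"
    unfolding Y_def[abs_def] p0 using S2D(1)[OF A t0] by (intro borel_measurable_scaleR) auto
  have eq: "AE \<omega> in M. \<forall>t\<in>{0..T}. Y t \<omega> = Y 0 \<omega> + (LINT s|D. indicator {0..t} s *\<^sub>R f s \<omega>) + I t \<omega>"
    using I(5) sq_int_P_sections(2)[OF sB] sq_int_P_sections(2)[OF q(1)]
  proof eventually_elim
    case (elim \<omega>)
    note i = elim(2,3)[THEN sq_int_imp_integrable[OF D.finite_measure_axioms]]
    show ?case
    proof
      fix t assume t: "t \<in> {0..T}"
      have ii: "integrable D (\<lambda>s. indicator {0..t} s *\<^sub>R ?B s \<omega>)" "integrable D (\<lambda>s. \<epsilon> *\<^sub>R (indicator {0..t} s *\<^sub>R q s \<omega>))"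
        by (rule integrable_leb_indicator[OF i(1)], simp)
           (rule integrable_scaleR_right[OF integrable_leb_indicator[OF i(2)]], simp)
      have "(LINT s|D. indicator {0..t} s *\<^sub>R f s \<omega>) = (LINT s|D. indicator {0..t} s *\<^sub>R ?B s \<omega> - \<epsilon> *\<^sub>R (indicator {0..t} s *\<^sub>R q s \<omega>))"
        by (intro Bochner_Integration.integral_cong refl) (simp add: f_def scaleR_diff_right)
      also have "\<dots> = (LINT s|D. indicator {0..t} s *\<^sub>R ?B s \<omega>) - (LINT s|D. \<epsilon> *\<^sub>R (indicator {0..t} s *\<^sub>R q s \<omega>))"
        by (rule Bochner_Integration.integral_diff[OF ii])
      also have "(LINT s|D. \<epsilon> *\<^sub>R (indicator {0..t} s *\<^sub>R q s \<omega>)) = \<epsilon> *\<^sub>R p t \<omega>" unfolding p by (rule integral_scaleR_right)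
      finally have 1: "(LINT s|D. indicator {0..t} s *\<^sub>R f s \<omega>) = (LINT s|D. indicator {0..t} s *\<^sub>R ?B s \<omega>) - \<epsilon> *\<^sub>R p t \<omega>" .
      have "\<epsilon> *\<^sub>R A t \<omega> = \<epsilon> *\<^sub>R A 0 \<omega> + (LINT s|D. indicator {0..t} s *\<^sub>R ?B s \<omega>) + I t \<omega>" using elim(1) t by blast
      then show "Y t \<omega> = Y 0 \<omega> + (LINT s|D. indicator {0..t} s *\<^sub>R f s \<omega>) + I t \<omega>"
        unfolding 1 Y_def p0 scaleR_diff_right by simp
    qed
  qed
  let ?i = "indicator {0..t} :: real \<Rightarrow> real"
  have ip: "integrable P (\<lambda>(s, \<omega>). ?i s * (u s \<omega> \<bullet> v s \<omega>))" if "sqP u" "sqP v" for u v :: "real \<Rightarrow> 'w \<Rightarrow> real^'k"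
    using sq_int_inner[OF sqP_time[OF that(1), of t] that(2)] by (simp add: split_beta')
  have ipb: "\<bar>LINT z|P. (\<lambda>(s, \<omega>). ?i s * (u s \<omega> \<bullet> v s \<omega>)) z\<bar> \<le> tn T u * tn T v" if "sqP u" "sqP v" for u v :: "real \<Rightarrow> 'w \<Rightarrow> real^'k"
  proof -
    have "\<bar>LINT z|P. (\<lambda>(s, \<omega>). ?i s *\<^sub>R u s \<omega>) z \<bullet> case_prod v z\<bar> \<le> tn t u * l2 P (case_prod v)"
      unfolding tn_def by (rule abs_LINT_inner_le_l2[OF sqP_time[OF that(1)] that(2)])
    also have "\<dots> \<le> tn T u * tn T v" unfolding tn_T by (rule mult_right_mono[OF tn_le[OF that(1)]]) simp
    finally show ?thesis by (simp add: split_beta')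
  qed
  let ?dA = "\<lambda>s \<omega>. A s \<omega> - \<alpha> s \<omega>" and ?dX = "\<lambda>s \<omega>. X s \<omega> - X' s \<omega>" and ?ap = "\<lambda>s \<omega>. \<alpha> s \<omega> - p s \<omega>" and ?Ap = "\<lambda>s \<omega>. A s \<omega> - p s \<omega>"
  have sdA: "sqP ?dA" and sdX: "sqP ?dX" and sap: "sqP ?ap" and sAp: "sqP ?Ap" by (intro sqP_diff sA sX \<alpha> sp)+
  \<comment> \<open>Only the sign of the left-hand side is kept; the useful quantity is the time
    integral that monotonicity produces on the right.\<close>
  have "0 \<le> (l2 M (Y t))\<^sup>2" by simp
  also have "\<dots> = (l2 M (Y 0))\<^sup>2 + 2 * (LINT z|P. (\<lambda>(s, \<omega>). ?i s * (Y s \<omega> \<bullet> f s \<omega>)) z) + (l2 M (I t))\<^sup>2"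
    by (rule energy_identity[OF sf fF mart_like_ito[OF I(4)] S2_sq_int_P[OF ito_integralD(2)[OF I(4)]] ito_0[OF I(4)] sY sYM Y0 eq t])
  also have "(l2 M (Y 0))\<^sup>2 = \<epsilon>\<^sup>2 * (l2 M (A 0))\<^sup>2"
    unfolding Y_def[abs_def] p0 by (simp add: l2_scaleR power_mult_distrib)
  also have "(LINT z|P. (\<lambda>(s, \<omega>). ?i s * (Y s \<omega> \<bullet> f s \<omega>)) z)
    = \<epsilon> * ((LINT z|P. (\<lambda>(s, \<omega>). ?i s * (?dA s \<omega> \<bullet> ?B s \<omega>)) z) + (LINT z|P. (\<lambda>(s, \<omega>). ?i s * (?ap s \<omega> \<bullet> ?B s \<omega>)) z)
      - \<epsilon> * (LINT z|P. (\<lambda>(s, \<omega>). ?i s * (?Ap s \<omega> \<bullet> q s \<omega>)) z))"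
  proof -
    have "(LINT z|P. (\<lambda>(s, \<omega>). ?i s * (Y s \<omega> \<bullet> f s \<omega>)) z)
      = (LINT z|P. \<epsilon> * ((\<lambda>(s, \<omega>). ?i s * (?dA s \<omega> \<bullet> ?B s \<omega>)) z + (\<lambda>(s, \<omega>). ?i s * (?ap s \<omega> \<bullet> ?B s \<omega>)) z
        - \<epsilon> * (\<lambda>(s, \<omega>). ?i s * (?Ap s \<omega> \<bullet> q s \<omega>)) z))"
      by (intro Bochner_Integration.integral_cong refl)
         (auto simp: Y_def f_def inner_diff_left inner_diff_right algebra_simps)
    also have "\<dots> = \<epsilon> * ((LINT z|P. (\<lambda>(s, \<omega>). ?i s * (?dA s \<omega> \<bullet> ?B s \<omega>)) z) + (LINT z|P. (\<lambda>(s, \<omega>). ?i s * (?ap s \<omega> \<bullet> ?B s \<omega>)) z)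
      - \<epsilon> * (LINT z|P. (\<lambda>(s, \<omega>). ?i s * (?Ap s \<omega> \<bullet> q s \<omega>)) z))"
      using ip[OF sdA sB] ip[OF sap sB] ip[OF sAp q(1)]
      by (simp only: integral_mult_right_zero Bochner_Integration.integral_add Bochner_Integration.integral_diff
          Bochner_Integration.integrable_add integrable_mult_right)
    finally show ?thesis .
  qed
  also have "(LINT z|P. (\<lambda>(s, \<omega>). ?i s * (?dA s \<omega> \<bullet> ?B s \<omega>)) z) \<le> - (c / 2) * (tn t ?dA)\<^sup>2 + 2 * K\<^sup>2 / c * (tn t ?dX)\<^sup>2"
  proof -
    have "(LINT z|P. (\<lambda>(s, \<omega>). ?i s * (?dA s \<omega> \<bullet> ?B s \<omega>)) z) = (LINT s|D. (LINT \<omega>|M. ?i s * (?dA s \<omega> \<bullet> ?B s \<omega>)))"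
      using DM.integral_fst[OF ip[OF sdA sB]] by simp
    also have "\<dots> \<le> (LINT s|D. - (c / 2) * (?i s * (l2 M (?dA s))\<^sup>2) + 2 * K\<^sup>2 / c * (?i s * (l2 M (?dX s))\<^sup>2))"
    proof (rule integral_mono_AE)
      show "integrable D (\<lambda>s. LINT \<omega>|M. ?i s * (?dA s \<omega> \<bullet> ?B s \<omega>))" by (rule DM.integrable_fst[OF ip[OF sdA sB]])
      show "integrable D (\<lambda>s. - (c / 2) * (?i s * (l2 M (?dA s))\<^sup>2) + 2 * K\<^sup>2 / c * (?i s * (l2 M (?dX s))\<^sup>2))"
        by (intro Bochner_Integration.integrable_add integrable_mult_right tn_squared(1) sdA sdX)
      show "AE s in D. (LINT \<omega>|M. ?i s * (?dA s \<omega> \<bullet> ?B s \<omega>))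
          \<le> - (c / 2) * (?i s * (l2 M (?dA s))\<^sup>2) + 2 * K\<^sup>2 / c * (?i s * (l2 M (?dX s))\<^sup>2)"
        using sqP_good_times[OF sX(2) \<alpha>] zero
      proof eventually_elim
        case (elim s)
        then have s: "s \<in> {0..T}" and x: "sq_int M (X s)" "sq_int M (X' s)" and a: "sq_int M (A s)" "sq_int M (\<alpha> s)"
          using S2D(2)[OF X(1)] S2D(2)[OF A] by auto
        have "(LINT \<omega>|M. ?dA s \<omega> \<bullet> ?B s \<omega>) \<le> - (c / 2) * (l2 M (?dA s))\<^sup>2 + 2 * K\<^sup>2 / c * (l2 M (?dX s))\<^sup>2"
          unfolding along_eq[where X=X and A=A and s=s, OF x(1) a(1)]
          by (rule monotone_estimate[OF K(1,2) Bl c mono s x a elim(2)])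
        then show ?case by (simp add: indicator_def)
      qed
    qed
    also have "\<dots> = - (c / 2) * (tn t ?dA)\<^sup>2 + 2 * K\<^sup>2 / c * (tn t ?dX)\<^sup>2"
      unfolding tn_squared(2)[OF sdA] tn_squared(2)[OF sdX] using tn_squared(1)[OF sdA, of t] tn_squared(1)[OF sdX, of t]
      by (simp only: Bochner_Integration.integral_add integrable_mult_right integral_mult_right_zero)
    finally show ?thesis .
  qed
  also have "(LINT z|P. (\<lambda>(s, \<omega>). ?i s * (?ap s \<omega> \<bullet> ?B s \<omega>)) z) \<le> tn T (\<lambda>s \<omega>. p s \<omega> - \<alpha> s \<omega>) * g"
  proof -
    have "tn T ?ap = tn T (\<lambda>s \<omega>. p s \<omega> - \<alpha> s \<omega>)"
      unfolding tn_def by (rule l2_cong) (auto simp: norm_minus_commute)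
    then show ?thesis
      using ipb[OF sap sB] mult_left_mono[OF nB[of T], of "tn T ?ap"] by simp
  qed
  also have "(l2 M (I t))\<^sup>2 \<le> (\<beta> \<epsilon>)\<^sup>2 * g\<^sup>2"
  proof -
    have "l2 M (I t) \<le> \<bar>\<beta> \<epsilon>\<bar> * g" using ito_isometry[OF I(4) t] nZ[of t] by (simp add: tn_def)
    then have "(l2 M (I t))\<^sup>2 \<le> (\<bar>\<beta> \<epsilon>\<bar> * g)\<^sup>2" by (rule power_mono) simp
    then show ?thesis by (simp add: power_mult_distrib)
  qed
  finally have fin: "0 \<le> \<epsilon>\<^sup>2 * (l2 M (A 0))\<^sup>2 + 2 * (\<epsilon> * (- (c / 2) * (tn t ?dA)\<^sup>2 + 2 * K\<^sup>2 / c * (tn t ?dX)\<^sup>2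
      + tn T (\<lambda>s \<omega>. p s \<omega> - \<alpha> s \<omega>) * g - \<epsilon> * (LINT z|P. (\<lambda>(s, \<omega>). ?i s * (?Ap s \<omega> \<bullet> q s \<omega>)) z))) + (\<beta> \<epsilon>)\<^sup>2 * g\<^sup>2"
    using e by (simp add: mult_left_mono)
  have "\<epsilon> * - (LINT z|P. (\<lambda>(s, \<omega>). ?i s * (?Ap s \<omega> \<bullet> q s \<omega>)) z) \<le> \<epsilon> * (tn T ?Ap * tn T q)"
    using ipb[OF sAp q(1)] e by (intro mult_left_mono) auto
  then have "\<epsilon> * (- (c / 2) * (tn t ?dA)\<^sup>2 + 2 * K\<^sup>2 / c * (tn t ?dX)\<^sup>2
      + tn T (\<lambda>s \<omega>. p s \<omega> - \<alpha> s \<omega>) * g - \<epsilon> * (LINT z|P. (\<lambda>(s, \<omega>). ?i s * (?Ap s \<omega> \<bullet> q s \<omega>)) z))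
    \<le> \<epsilon> * (- (c / 2) * (tn t ?dA)\<^sup>2 + 2 * K\<^sup>2 / c * (tn t ?dX)\<^sup>2
      + tn T (\<lambda>s \<omega>. p s \<omega> - \<alpha> s \<omega>) * g + \<epsilon> * (tn T ?Ap * tn T q))"
    using e by (intro mult_left_mono) auto
  \<comment> \<open>Factoring out \<epsilon> turns the squared noise bound into
    \<beta>(\<epsilon>)^2 / \<epsilon> and leaves one \<epsilon> with the initial value and one with
    q.\<close>
  with fin have "0 \<le> \<epsilon> * (\<epsilon> * (l2 M (A 0))\<^sup>2 - c * (tn t ?dA)\<^sup>2 + 4 * K\<^sup>2 / c * (tn t ?dX)\<^sup>2
      + 2 * tn T (\<lambda>s \<omega>. p s \<omega> - \<alpha> s \<omega>) * g + 2 * \<epsilon> * tn T ?Ap * tn T q + (\<beta> \<epsilon>)\<^sup>2 / \<epsilon> * g\<^sup>2)"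
    using e by (simp add: power2_eq_square algebra_simps)
  then have "0 \<le> \<epsilon> * (l2 M (A 0))\<^sup>2 - c * (tn t ?dA)\<^sup>2 + 4 * K\<^sup>2 / c * (tn t ?dX)\<^sup>2
      + 2 * tn T (\<lambda>s \<omega>. p s \<omega> - \<alpha> s \<omega>) * g + 2 * \<epsilon> * tn T ?Ap * tn T q + (\<beta> \<epsilon>)\<^sup>2 / \<epsilon> * g\<^sup>2"
    using e by (simp only: zero_le_mult_iff) auto
  then show ?thesis by simp
qed

end

section \<open>Convergence\<close>

text \<open>Separates 1 + S from the quantities that can be made small. The constant 3 + H + L
  dominates each of L + 2, 1 + H and H, which occur in front of the three terms.\<close>

lemma remainder_bound:
  fixes S :: real
  assumes n: "0 \<le> S" "0 \<le> r" "0 \<le> Q" "0 \<le> \<gamma>" "0 \<le> \<epsilon>" "0 \<le> L" "0 \<le> H"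
  shows "\<epsilon> * (L + 2 * S + 2 * r\<^sup>2 + Q) + r * ((1 + H) * (1 + S)) + \<gamma> * (H * (1 + S))
    \<le> (3 + H + L) * (1 + S) * (r + \<epsilon> * (1 + r\<^sup>2 + Q) + \<gamma>)"
proof -
  let ?w = "r\<^sup>2 + Q"
  have w: "0 \<le> ?w" using n by simp
  have "L + 2 * S + 2 * r\<^sup>2 + Q \<le> (L + 2) * (1 + S + ?w)"
  proof -
    have "0 \<le> L * S + L * ?w + Q" using n w by simp
    then show ?thesis by (simp add: algebra_simps)
  qed
  also have "\<dots> \<le> (3 + H + L) * ((1 + S) * (1 + ?w))"
  proof (rule mult_mono)
    have "0 \<le> S * ?w" using n w by simp
    then show "1 + S + ?w \<le> (1 + S) * (1 + ?w)" by (simp add: algebra_simps)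
  qed (use n w in auto)
  finally have "\<epsilon> * (L + 2 * S + 2 * r\<^sup>2 + Q) \<le> \<epsilon> * ((3 + H + L) * ((1 + S) * (1 + ?w)))"
    by (rule mult_left_mono) (rule n)
  moreover have "r * ((1 + H) * (1 + S)) \<le> r * ((3 + H + L) * (1 + S))"
    using n by (intro mult_left_mono mult_right_mono) auto
  moreover have "\<gamma> * (H * (1 + S)) \<le> \<gamma> * ((3 + H + L) * (1 + S))"
    using n by (intro mult_left_mono mult_right_mono) auto
  moreover have "(3 + H + L) * (1 + S) * (r + \<epsilon> * (1 + r\<^sup>2 + Q) + \<gamma>)
    = \<epsilon> * ((3 + H + L) * ((1 + S) * (1 + ?w))) + r * ((3 + H + L) * (1 + S)) + \<gamma> * ((3 + H + L) * (1 + S))"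
    by (simp add: algebra_simps)
  ultimately show ?thesis by linarith
qed

lemma square_2_sum_le: "(k * (2 * u + 2 * v))\<^sup>2 \<le> 8 * k\<^sup>2 * (u\<^sup>2 + (v::real)\<^sup>2)"
proof -
  have "(2 * u + 2 * v)\<^sup>2 \<le> 8 * (u\<^sup>2 + v\<^sup>2)"
    using sum_squares_bound[of u v] by (simp add: power2_eq_square algebra_simps)
  then have "k\<^sup>2 * (2 * u + 2 * v)\<^sup>2 \<le> k\<^sup>2 * (8 * (u\<^sup>2 + v\<^sup>2))" by (rule mult_left_mono) simp
  then show ?thesis unfolding power_mult_distrib by (simp only: mult_ac)
qed

context two_scale_system
begin

text \<open>The total squared error S, integrated over time for both components; the uniform error
  of X is recovered from it by \<open>slow_estimate\<close>.\<close>

definition err :: "(real \<Rightarrow> 'w \<Rightarrow> real^'d) \<Rightarrow> (real \<Rightarrow> 'w \<Rightarrow> real^'k) \<Rightarrow> (real \<Rightarrow> 'w \<Rightarrow> real^'d) \<Rightarrow> (real \<Rightarrow> 'w \<Rightarrow> real^'k) \<Rightarrow> real" where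
  "err X A X' A' = (tn T (\<lambda>s \<omega>. X s \<omega> - X' s \<omega>))\<^sup>2 + (tn T (\<lambda>s \<omega>. A s \<omega> - A' s \<omega>))\<^sup>2"

text \<open>The order of quantifiers matters: C comes before \<epsilon>, the solution and the pair
  (q, p). The fast estimate bounds A - \<open>\<alpha>hat\<close> by X - \<open>Xhat\<close> plus a
  remainder R, the slow estimate with Gronwall bounds both by R, and R is bounded by 1 + S times
  quantities that can be made small.\<close>

lemma main_bound:
  assumes eqp: "equilibrium_pair M F W T b \<sigma> B \<xi> Xhat \<alpha>hat" and eta: "\<eta> \<in> borel_measurable M"
  shows "\<exists>C>0. \<forall>\<epsilon>>0. \<forall>X A. two_scale_solution M F W T \<beta> b \<sigma> B \<Sigma> \<xi> \<eta> \<epsilon> X A \<longrightarrow>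
    (\<forall>q p. adapted_primitive q p \<longrightarrow> err X A Xhat \<alpha>hat \<le> C * (1 + err X A Xhat \<alpha>hat) *
      (tn T (\<lambda>s \<omega>. p s \<omega> - \<alpha>hat s \<omega>) + \<epsilon> * (1 + (tn T (\<lambda>s \<omega>. p s \<omega> - \<alpha>hat s \<omega>))\<^sup>2 + (tn T q)\<^sup>2) + (\<beta> \<epsilon>)\<^sup>2 / \<epsilon>)) \<and>
    S2_sq M T (\<lambda>t \<omega>. X t \<omega> - Xhat t \<omega>) \<le> ennreal (C * err X A Xhat \<alpha>hat)"
proof -
  obtain K where K: "0 < K" "lips K b" "lips K \<sigma>" "grows K B" "grows K \<Sigma>"
    and Bl: "\<And>t \<omega> x x' a \<mu> \<mu>' \<nu>. t \<in> {0..T} \<Longrightarrow> \<omega> \<in> space M \<Longrightarrow> \<mu> \<in> P2 \<Longrightarrow> \<mu>' \<in> P2 \<Longrightarrow> \<nu> \<in> P2 \<Longrightarrow>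
      norm (B t \<omega> x \<mu> a \<nu> - B t \<omega> x' \<mu>' a \<nu>) \<le> K * (norm (x - x') + W2 \<mu> \<mu>')"
    by (rule constants) blast
  have K0: "0 \<le> K" using K by simp
  from monotone obtain c where c: "0 < c" and mono': "\<forall>t\<in>{0..T}. \<forall>\<zeta>\<in>L2_rv M M. \<forall>\<theta>\<in>L2_rv M M. \<forall>\<theta>'\<in>L2_rv M M.
        (LINT \<omega>|M. (B t \<omega> (\<zeta> \<omega>) (law M \<zeta>) (\<theta> \<omega>) (law M \<theta>)
                     - B t \<omega> (\<zeta> \<omega>) (law M \<zeta>) (\<theta>' \<omega>) (law M \<theta>')) \<bullet> (\<theta> \<omega> - \<theta>' \<omega>))
          \<le> - c * (LINT \<omega>|M. (norm (\<theta> \<omega> - \<theta>' \<omega>))\<^sup>2)" by blast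
  note mono = mono'[rule_format]
  have Xh: "Xhat \<in> S2 M F T" and ah: "\<alpha>hat \<in> H2 M F T" and dh: "has_stoch_differential M F W T Xhat (along M b Xhat \<alpha>hat) (along M \<sigma> Xhat \<alpha>hat)"
    and ih: "AE \<omega> in M. Xhat 0 \<omega> = \<xi> \<omega>" and zh: "H2_sq M T (along M B Xhat \<alpha>hat) = 0"
    using eqp by (auto simp: equilibrium_pair_def)
  note sXh = S2_sq_int_P[OF Xh] and sah = H2D(2)[OF ah]
  have zero: "AE t in D. AE \<omega> in M. B t \<omega> (Xhat t \<omega>) (law M (Xhat t)) (\<alpha>hat t \<omega>) (law M (\<alpha>hat t)) = 0"
    by (rule along_zero_AE[OF meas(3) sXh S2D(1)[OF Xh] sah measurable_Prog_section[OF H2D(1)[OF ah]] zh])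
  \<comment> \<open>\<open>h0\<close> and \<open>H\<close> bound the growth along the solution by 1
    + S. \<open>C1\<close> comes from the slow estimate, \<open>k\<close> from the fast one after
    division by c. \<open>C2\<close> is the Gronwall rate, with 1 added to make it positive, and
    \<open>L\<close> the Gronwall factor. \<open>C5\<close> bounds S by R, and \<open>C\<close> adds
    the constant of the supremum bound so as to serve both claims.\<close>
  define h0 where "h0 = sqrt T + 2 * tn T Xhat + 2 * tn T \<alpha>hat"
  define H where "H = 3 * K\<^sup>2 * (h0\<^sup>2 + 4)"
  define L0 where "L0 = (l2 M \<eta>)\<^sup>2"
  define C1 where "C1 = 8 * ((sqrt T + 1) * K)\<^sup>2"
  define k where "k = 4 * K\<^sup>2 / c\<^sup>2"
  define C2 where "C2 = C1 * (1 + k) + 1"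
  define L where "L = 2 * (C1 / c) * exp (2 * C2 * T)"
  define C5 where "C5 = T * L + k * (T * L) + 1 / c"
  define C where "C = C5 * (3 + H + L0) + (2 * T + 8) * (8 * K\<^sup>2)"
  have pos: "0 \<le> h0" "0 \<le> H" "0 \<le> L0" "0 \<le> C1" "0 \<le> k" "0 < C2" "0 \<le> L" "0 \<le> C5"
  proof -
    show "0 \<le> h0" using T_pos by (simp add: h0_def)
    show "0 \<le> H" by (simp add: H_def)
    show "0 \<le> L0" by (simp add: L0_def)
    show C1: "0 \<le> C1" by (simp add: C1_def)
    show k: "0 \<le> k" by (simp add: k_def)
    have "0 \<le> C1 * (1 + k)" using C1 k by simp
    then show "0 < C2" by (simp add: C2_def)
    show L: "0 \<le> L" using C1 c by (simp add: L_def)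
    show "0 \<le> C5" using L k c T_pos by (simp add: C5_def)
  qed
  have Cpos: "0 < C"
  proof -
    have "0 < (2 * T + 8) * (8 * K\<^sup>2)" using T_pos K by simp
    moreover have "0 \<le> C5 * (3 + H + L0)" using pos by simp
    ultimately show ?thesis unfolding C_def by linarith
  qed
  show ?thesis
  proof (intro exI[of _ C] conjI Cpos allI impI)
    fix \<epsilon> :: real and X A
    assume e: "0 < \<epsilon>" and sol: "two_scale_solution M F W T \<beta> b \<sigma> B \<Sigma> \<xi> \<eta> \<epsilon> X A"
    then have X: "X \<in> S2 M F T" and A: "A \<in> S2 M F T" and dX: "has_stoch_differential M F W T X (along M b X A) (along M \<sigma> X A)"
      and dA: "has_stoch_differential M F W T (\<lambda>t \<omega>. \<epsilon> *\<^sub>R A t \<omega>) (along M B X A) (\<lambda>t \<omega>. \<beta> \<epsilon> *\<^sub>R along M \<Sigma> X A t \<omega>)"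
      and iX: "AE \<omega> in M. X 0 \<omega> = \<xi> \<omega>" and iA: "AE \<omega> in M. A 0 \<omega> = \<eta> \<omega>"
      by (auto simp: two_scale_solution_def)
    note sX = S2_sq_int_P[OF X] and sA = S2_sq_int_P[OF A]
    have T: "T \<in> {0..T}" "0 \<in> {0..T}" using T_pos by auto
    let ?dX = "\<lambda>s \<omega>. X s \<omega> - Xhat s \<omega>" and ?dA = "\<lambda>s \<omega>. A s \<omega> - \<alpha>hat s \<omega>"
    let ?S = "err X A Xhat \<alpha>hat"
    have sdX: "sqP ?dX" and sdA: "sqP ?dA" by (intro sqP_diff sX sXh sA sah)+
    have S: "?S = (tn T ?dX)\<^sup>2 + (tn T ?dA)\<^sup>2" by (simp add: err_def)
    have S0: "0 \<le> ?S" by (simp add: S)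
    have init: "AE \<omega> in M. X 0 \<omega> = Xhat 0 \<omega>" using iX ih by eventually_elim simp
    note slow = slow_estimate[OF K0 K(2,3) X Xh sA sah dX dh init]
    show "S2_sq M T ?dX \<le> ennreal (C * ?S)"
    proof (rule order_trans[OF slow(2)], rule ennreal_leI)
      have "(K * (2 * tn T ?dX + 2 * tn T ?dA))\<^sup>2 \<le> 8 * K\<^sup>2 * ?S" unfolding S by (rule square_2_sum_le)
      then have "(2 * T + 8) * (K * (2 * tn T ?dX + 2 * tn T ?dA))\<^sup>2 \<le> (2 * T + 8) * (8 * K\<^sup>2 * ?S)"
        using T_pos by (intro mult_left_mono) auto
      also have "\<dots> = (2 * T + 8) * (8 * K\<^sup>2) * ?S" by simp
      also have "\<dots> \<le> C * ?S"
        using pos S0 by (intro mult_right_mono) (auto simp: C_def)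
      finally show "(2 * T + 8) * (K * (2 * tn T ?dX + 2 * tn T ?dA))\<^sup>2 \<le> C * ?S" .
    qed
    fix q p :: "real \<Rightarrow> 'w \<Rightarrow> real^'k" assume sm: "adapted_primitive q p"
    then have sp: "sqP p" and sq: "sqP q" by (auto simp: adapted_primitive_def)
    let ?r = "tn T (\<lambda>s \<omega>. p s \<omega> - \<alpha>hat s \<omega>)" and ?Q = "(tn T q)\<^sup>2" and ?\<gamma> = "(\<beta> \<epsilon>)\<^sup>2 / \<epsilon>"
    define g where "g = K * (sqrt T + 2 * tn T X + 2 * tn T A)"
    \<comment> \<open>The part of the fast estimate without X - \<open>Xhat\<close>; through g and A
      - p it still contains the solution.\<close>
    define R where "R = \<epsilon> * (l2 M (A 0))\<^sup>2 + 2 * ?r * g + 2 * \<epsilon> * tn T (\<lambda>s \<omega>. A s \<omega> - p s \<omega>) * tn T q + ?\<gamma> * g\<^sup>2"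
    have g0: "0 \<le> g" using K0 T_pos by (simp add: g_def)
    have R0: "0 \<le> R" using e g0 by (simp add: R_def)
    have v: "(tn t ?dA)\<^sup>2 \<le> k * (tn t ?dX)\<^sup>2 + R / c" if t: "t \<in> {0..T}" for t
    proof -
      have "c * (tn t ?dA)\<^sup>2 \<le> 4 * K\<^sup>2 / c * (tn t ?dX)\<^sup>2 + R"
        unfolding R_def g_def by (rule fast_estimate[OF K0 K(4,5) Bl c mono X Xh A sah zero e dA sm t])
      then have "(tn t ?dA)\<^sup>2 \<le> (4 * K\<^sup>2 / c * (tn t ?dX)\<^sup>2 + R) / c"
        using c by (simp add: pos_le_divide_eq mult.commute)
      also have "\<dots> = k * (tn t ?dX)\<^sup>2 + R / c" by (simp add: k_def add_divide_distrib power2_eq_square)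
      finally show ?thesis .
    qed
    have x: "(l2 M (?dX t))\<^sup>2 \<le> C1 * ((tn t ?dX)\<^sup>2 + (tn t ?dA)\<^sup>2)" if t: "t \<in> {0..T}" for t
    proof -
      have "l2 M (?dX t) \<le> (sqrt T + 1) * K * (2 * tn t ?dX + 2 * tn t ?dA)"
        using slow(1)[OF t] by (simp only: mult.assoc)
      then have "(l2 M (?dX t))\<^sup>2 \<le> ((sqrt T + 1) * K * (2 * tn t ?dX + 2 * tn t ?dA))\<^sup>2" by (rule power_mono) simp
      also have "\<dots> \<le> C1 * ((tn t ?dX)\<^sup>2 + (tn t ?dA)\<^sup>2)" unfolding C1_def by (rule square_2_sum_le)
      finally show ?thesis .
    qed
    have tT: "(tn t ?dX)\<^sup>2 \<le> (tn T ?dX)\<^sup>2" "(tn t ?dA)\<^sup>2 \<le> (tn T ?dA)\<^sup>2" for t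
      unfolding tn_T by (intro power_mono tn_le sdX sdA tn_nonneg)+
    have xL: "(l2 M (?dX t))\<^sup>2 \<le> L * R" if t: "t \<in> {0..T}" for t
    proof -
      have "(l2 M (?dX t))\<^sup>2 \<le> 2 * (C1 / c * R) * exp (2 * C2 * T)"
      \<comment> \<open>\<open>Bd\<close> may be any finite bound; S provides one and does not
        appear in the conclusion of Gronwall's inequality.\<close>
      proof (rule gronwall_leb[OF pos(6) T_pos _ _ _ _ t, where Bd="C1 * ?S"])
        show "0 \<le> C1 / c * R" using pos c R0 by simp
        show "0 \<le> (l2 M (?dX s))\<^sup>2" for s by simp
        show "(l2 M (?dX s))\<^sup>2 \<le> C1 * ?S" if s: "s \<in> {0..T}" for s
          unfolding S using x[OF s] tT[of s] mult_left_mono[OF add_mono[OF tT(1)[of s] tT(2)[of s]] pos(4)] by linarith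
        fix s assume s: "s \<in> {0..T}"
        have "(l2 M (?dX s))\<^sup>2 \<le> C1 * ((tn s ?dX)\<^sup>2 + (k * (tn s ?dX)\<^sup>2 + R / c))"
          using x[OF s] mult_left_mono[OF add_left_mono[OF v[OF s], of "(tn s ?dX)\<^sup>2"] pos(4)] by linarith
        also have "\<dots> = C1 / c * R + C1 * (1 + k) * (tn s ?dX)\<^sup>2" by (simp add: algebra_simps)
        also have "\<dots> \<le> C1 / c * R + C2 * (tn s ?dX)\<^sup>2" by (simp add: C2_def distrib_right)
        finally show "(l2 M (?dX s))\<^sup>2 \<le> C1 / c * R + C2 * (LINT r|D. indicator {0..s} r * (l2 M (?dX r))\<^sup>2)"
          unfolding tn_squared(2)[OF sdX] .
      qed
      then show ?thesis by (simp add: L_def mult_ac)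
    qed
    have uT: "(tn T ?dX)\<^sup>2 \<le> T * (L * R)"
    proof -
      have "(tn T ?dX)\<^sup>2 \<le> (LINT s|D. L * R)"
        unfolding tn_squared(2)[OF sdX]
      proof (rule integral_mono[OF tn_squared(1)[OF sdX]])
        show "indicator {0..T} s * (l2 M (?dX s))\<^sup>2 \<le> L * R" if "s \<in> space D" for s
          using xL[of s] that by simp
      qed simp
      also have "\<dots> = T * (L * R)"
        using T_pos by (simp add: measure_def emeasure_restrict_space)
      finally show ?thesis .
    qed
    have SR: "?S \<le> C5 * R"
    proof -
      have "?S \<le> T * (L * R) + (k * (T * (L * R)) + R / c)"
        unfolding S using uT v[OF T(1)] mult_left_mono[OF uT pos(5)] by linarith
      also have "\<dots> = C5 * R" by (simp add: C5_def algebra_simps)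
      finally show ?thesis .
    qed
    have A0: "(l2 M (A 0))\<^sup>2 = L0"
      unfolding L0_def using S2D(2)[OF A T(2)] eta iA by (subst l2_cong_AE[of "A 0" M \<eta>]) (auto simp: sq_int_def)
    \<comment> \<open>The factor 1 + S arises here, by splitting the solution into the fixed pair
      and the error.\<close>
    have gS: "g\<^sup>2 \<le> H * (1 + ?S)"
    proof -
      have "tn T X \<le> tn T ?dX + tn T Xhat" using tn_triangle[OF sdX sXh, of T] by simp
      moreover have "tn T A \<le> tn T ?dA + tn T \<alpha>hat" using tn_triangle[OF sdA sah, of T] by simp
      ultimately have "sqrt T + 2 * tn T X + 2 * tn T A \<le> h0 + 2 * tn T ?dX + 2 * tn T ?dA" by (simp add: h0_def)
      then have "g \<le> K * (h0 + 2 * tn T ?dX + 2 * tn T ?dA)" unfolding g_def by (rule mult_left_mono[OF _ K0])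
      then have "g\<^sup>2 \<le> (K * (h0 + 2 * tn T ?dX + 2 * tn T ?dA))\<^sup>2" by (rule power_mono[OF _ g0])
      also have "\<dots> = K\<^sup>2 * (h0 + 2 * tn T ?dX + 2 * tn T ?dA)\<^sup>2" by (rule power_mult_distrib)
      also have "\<dots> \<le> K\<^sup>2 * (3 * (h0\<^sup>2 + (2 * tn T ?dX)\<^sup>2 + (2 * tn T ?dA)\<^sup>2))"
        by (rule mult_left_mono[OF power2_sum3_le]) simp
      also have "\<dots> = 3 * K\<^sup>2 * (h0\<^sup>2 + 4 * ?S)" by (simp add: S power_mult_distrib)
      also have "\<dots> \<le> 3 * K\<^sup>2 * ((h0\<^sup>2 + 4) * (1 + ?S))"
      proof (rule mult_left_mono)
        have "0 \<le> h0\<^sup>2 * ?S" using S0 by simp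
        then show "h0\<^sup>2 + 4 * ?S \<le> (h0\<^sup>2 + 4) * (1 + ?S)" by (simp add: distrib_left distrib_right)
      qed simp
      finally show ?thesis by (simp add: H_def)
    qed
    \<comment> \<open>g occurs linearly in this term; 2 g \<le> 1 + g^2 brings it to the same form
      as the noise term.\<close>
    have r: "2 * ?r * g \<le> ?r * ((1 + H) * (1 + ?S))"
    proof -
      have "2 * g \<le> 1 + g\<^sup>2" using sum_squares_bound[of 1 g] by simp
      also have "\<dots> \<le> (1 + H) * (1 + ?S)" using gS S0 by (simp add: distrib_left distrib_right)
      finally have "?r * (2 * g) \<le> ?r * ((1 + H) * (1 + ?S))" by (rule mult_left_mono) simp
      then show ?thesis by (simp add: mult_ac)
    qed
    \<comment> \<open>A - p is split at \<open>\<alpha>hat\<close>, which leaves S and r^2. The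
      squared norm of q is compensated only by the factor \<epsilon>.\<close>
    have Ap: "2 * \<epsilon> * tn T (\<lambda>s \<omega>. A s \<omega> - p s \<omega>) * tn T q \<le> \<epsilon> * (2 * ?S + 2 * ?r\<^sup>2 + ?Q)"
    proof -
      let ?Ap = "tn T (\<lambda>s \<omega>. A s \<omega> - p s \<omega>)"
      have "?Ap \<le> tn T ?dA + tn T (\<lambda>s \<omega>. \<alpha>hat s \<omega> - p s \<omega>)"
        using tn_triangle[OF sdA sqP_diff[OF sah sp], of T] by simp
      also have "tn T (\<lambda>s \<omega>. \<alpha>hat s \<omega> - p s \<omega>) = ?r"
        unfolding tn_def by (rule l2_cong) (auto simp: norm_minus_commute)
      finally have "?Ap\<^sup>2 \<le> (tn T ?dA + ?r)\<^sup>2" by (rule power_mono) simp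
      also have "\<dots> \<le> 2 * (tn T ?dA)\<^sup>2 + 2 * ?r\<^sup>2"
        using sum_squares_bound[of "tn T ?dA" ?r] by (simp add: power2_sum)
      also have "\<dots> \<le> 2 * ?S + 2 * ?r\<^sup>2" by (simp add: S)
      finally have "2 * ?Ap * tn T q \<le> 2 * ?S + 2 * ?r\<^sup>2 + ?Q" using sum_squares_bound[of ?Ap "tn T q"] by linarith
      then have "\<epsilon> * (2 * ?Ap * tn T q) \<le> \<epsilon> * (2 * ?S + 2 * ?r\<^sup>2 + ?Q)" using e by (intro mult_left_mono) auto
      then show ?thesis by (simp add: mult_ac)
    qed
    have ga: "?\<gamma> * g\<^sup>2 \<le> ?\<gamma> * (H * (1 + ?S))" using e by (intro mult_left_mono[OF gS]) simp
    have "R \<le> \<epsilon> * L0 + ?r * ((1 + H) * (1 + ?S)) + \<epsilon> * (2 * ?S + 2 * ?r\<^sup>2 + ?Q) + ?\<gamma> * (H * (1 + ?S))"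
      unfolding R_def A0 using r Ap ga by linarith
    also have "\<dots> = \<epsilon> * (L0 + 2 * ?S + 2 * ?r\<^sup>2 + ?Q) + ?r * ((1 + H) * (1 + ?S)) + ?\<gamma> * (H * (1 + ?S))"
      by (simp add: distrib_left)
    also have "\<dots> \<le> (3 + H + L0) * (1 + ?S) * (?r + \<epsilon> * (1 + ?r\<^sup>2 + ?Q) + ?\<gamma>)"
      by (rule remainder_bound) (use S0 e pos in auto)
    finally have "C5 * R \<le> C5 * ((3 + H + L0) * (1 + ?S) * (?r + \<epsilon> * (1 + ?r\<^sup>2 + ?Q) + ?\<gamma>))"
      by (rule mult_left_mono[OF _ pos(8)])
    also have "\<dots> = C5 * (3 + H + L0) * ((1 + ?S) * (?r + \<epsilon> * (1 + ?r\<^sup>2 + ?Q) + ?\<gamma>))" by (simp only: mult.assoc)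
    also have "\<dots> \<le> C * ((1 + ?S) * (?r + \<epsilon> * (1 + ?r\<^sup>2 + ?Q) + ?\<gamma>))"
      using S0 e T_pos by (intro mult_right_mono mult_nonneg_nonneg add_nonneg_nonneg) (auto simp: C_def)
    finally show "?S \<le> C * (1 + ?S) * (?r + \<epsilon> * (1 + ?r\<^sup>2 + ?Q) + ?\<gamma>)" using SR by (simp only: mult.assoc)
  qed
qed

lemma err_tendsto:
  assumes eqp: "equilibrium_pair M F W T b \<sigma> B \<xi> Xhat \<alpha>hat" and eta: "\<eta> \<in> borel_measurable M"
    and sol: "\<And>\<epsilon>. \<epsilon> > 0 \<Longrightarrow> two_scale_solution M F W T \<beta> b \<sigma> B \<Sigma> \<xi> \<eta> \<epsilon> (X \<epsilon>) (A \<epsilon>)"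
  shows "((\<lambda>\<epsilon>. err (X \<epsilon>) (A \<epsilon>) Xhat \<alpha>hat) \<longlongrightarrow> 0) (at_right 0)"
    and "((\<lambda>\<epsilon>. S2_norm M T (\<lambda>t \<omega>. X \<epsilon> t \<omega> - Xhat t \<omega>)) \<longlongrightarrow> 0) (at_right 0)"
proof -
  let ?S = "\<lambda>\<epsilon>. err (X \<epsilon>) (A \<epsilon>) Xhat \<alpha>hat"
  from main_bound[OF eqp eta] obtain C where C: "0 < C" and bd: "\<And>\<epsilon> q p. 0 < \<epsilon> \<Longrightarrow> adapted_primitive q p \<Longrightarrow> ?S \<epsilon> \<le> C * (1 + ?S \<epsilon>) *
      (tn T (\<lambda>s \<omega>. p s \<omega> - \<alpha>hat s \<omega>) + \<epsilon> * (1 + (tn T (\<lambda>s \<omega>. p s \<omega> - \<alpha>hat s \<omega>))\<^sup>2 + (tn T q)\<^sup>2) + (\<beta> \<epsilon>)\<^sup>2 / \<epsilon>)"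
    and bdS: "\<And>\<epsilon>. 0 < \<epsilon> \<Longrightarrow> S2_sq M T (\<lambda>t \<omega>. X \<epsilon> t \<omega> - Xhat t \<omega>) \<le> ennreal (C * ?S \<epsilon>)"
    using sol by blast
  have ah: "\<alpha>hat \<in> H2 M F T" using eqp by (simp add: equilibrium_pair_def)
  have S0: "0 \<le> ?S \<epsilon>" for \<epsilon> by (simp add: err_def)
  have posev: "eventually (\<lambda>\<epsilon>::real. 0 < \<epsilon>) (at_right 0)" by (rule eventually_at_right_less)
  \<comment> \<open>Rewriting \<beta>^2 / \<epsilon> as (\<beta> / \<epsilon>)^2 \<epsilon> brings
    in the assumption on \<beta> / \<epsilon>.\<close>
  have gl: "((\<lambda>\<epsilon>. (\<beta> \<epsilon>)\<^sup>2 / \<epsilon>) \<longlongrightarrow> 0) (at_right 0)"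
  proof -
    have "((\<lambda>\<epsilon>. (\<beta> \<epsilon> / \<epsilon>)\<^sup>2 * \<epsilon>) \<longlongrightarrow> 0\<^sup>2 * 0) (at_right 0)"
      by (intro tendsto_mult tendsto_power beta tendsto_ident_at)
    moreover have "eventually (\<lambda>\<epsilon>. (\<beta> \<epsilon> / \<epsilon>)\<^sup>2 * \<epsilon> = (\<beta> \<epsilon>)\<^sup>2 / \<epsilon>) (at_right 0)"
      using posev by eventually_elim (simp add: power2_eq_square)
    ultimately show ?thesis by (simp add: tendsto_cong)
  qed
  show lim: "(?S \<longlongrightarrow> 0) (at_right 0)"
  proof (rule tendstoI)
    fix \<delta> :: real assume d: "0 < \<delta>"
    \<comment> \<open>The value 1/2 lets the self-referential bound close with outcome 2 \<kappa>,
      and \<delta>/4 keeps that outcome below \<delta>.\<close>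
    define \<kappa> where "\<kappa> = min (1 / 2) (\<delta> / 4)"
    have k: "0 < \<kappa>" "\<kappa> \<le> 1 / 2" "2 * \<kappa> < \<delta>" using d by (auto simp: \<kappa>_def min_def)
    \<comment> \<open>p is fixed here, before \<epsilon>. Half of the budget \<kappa> / C goes to r,
      the other half to the terms that vanish with \<epsilon>.\<close>
    obtain q p where sm: "adapted_primitive q p" and r: "l2 P (\<lambda>z. case_prod p z - case_prod \<alpha>hat z) < \<kappa> / (2 * C)"
      using adapted_primitive_approx[OF H2D(2)[OF ah] measurable_Prog_section[OF H2D(1)[OF ah]], of "\<kappa> / (2 * C)"] k C by auto
    let ?r = "tn T (\<lambda>s \<omega>. p s \<omega> - \<alpha>hat s \<omega>)" and ?Q = "(tn T q)\<^sup>2"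
    have r': "?r < \<kappa> / (2 * C)" using r unfolding tn_T by (simp add: split_beta')
    have "((\<lambda>\<epsilon>. \<epsilon> * (1 + ?r\<^sup>2 + ?Q) + (\<beta> \<epsilon>)\<^sup>2 / \<epsilon>) \<longlongrightarrow> 0 * (1 + ?r\<^sup>2 + ?Q) + 0) (at_right 0)"
      by (intro tendsto_add tendsto_mult tendsto_ident_at tendsto_const gl)
    then have "((\<lambda>\<epsilon>. \<epsilon> * (1 + ?r\<^sup>2 + ?Q) + (\<beta> \<epsilon>)\<^sup>2 / \<epsilon>) \<longlongrightarrow> 0) (at_right 0)" by simp
    from order_tendstoD(2)[OF this, of "\<kappa> / (2 * C)"] k C
    have "eventually (\<lambda>\<epsilon>. \<epsilon> * (1 + ?r\<^sup>2 + ?Q) + (\<beta> \<epsilon>)\<^sup>2 / \<epsilon> < \<kappa> / (2 * C)) (at_right 0)" by simp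
    then show "eventually (\<lambda>\<epsilon>. dist (?S \<epsilon>) 0 < \<delta>) (at_right 0)"
      using posev
    proof eventually_elim
      case (elim \<epsilon>)
      let ?\<rho> = "?r + \<epsilon> * (1 + ?r\<^sup>2 + ?Q) + (\<beta> \<epsilon>)\<^sup>2 / \<epsilon>"
      have "?\<rho> \<le> \<kappa> / C" using elim(1) r' by (simp add: field_simps)
      then have "C * ?\<rho> \<le> C * (\<kappa> / C)" using C by (intro mult_left_mono) auto
      then have "C * ?\<rho> \<le> \<kappa>" using C by simp
      then have "C * ?\<rho> * (1 + ?S \<epsilon>) \<le> \<kappa> * (1 + ?S \<epsilon>)" using S0[of \<epsilon>] by (intro mult_right_mono) auto
      then have "?S \<epsilon> \<le> \<kappa> * (1 + ?S \<epsilon>)" using bd[OF elim(2) sm] by (simp only: mult_ac)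
      from smallness_bound[OF S0 this k(2)] k(3) S0[of \<epsilon>] show ?case by (simp add: dist_real_def)
    qed
  qed
  show "((\<lambda>\<epsilon>. S2_norm M T (\<lambda>t \<omega>. X \<epsilon> t \<omega> - Xhat t \<omega>)) \<longlongrightarrow> 0) (at_right 0)"
  proof (rule tendsto_sandwich[OF _ _ tendsto_const])
    have "((\<lambda>\<epsilon>. sqrt (C * ?S \<epsilon>)) \<longlongrightarrow> sqrt (C * 0)) (at_right 0)" by (intro tendsto_intros lim)
    then show "((\<lambda>\<epsilon>. sqrt (C * ?S \<epsilon>)) \<longlongrightarrow> 0) (at_right 0)" by simp
    show "eventually (\<lambda>\<epsilon>. S2_norm M T (\<lambda>t \<omega>. X \<epsilon> t \<omega> - Xhat t \<omega>) \<le> sqrt (C * ?S \<epsilon>)) (at_right 0)"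
      using posev
    proof eventually_elim
      case (elim \<epsilon>)
      have "0 \<le> C * ?S \<epsilon>" using C S0[of \<epsilon>] by simp
      then show ?case unfolding S2_norm_def
        by (intro real_sqrt_le_mono enn2real_leI bdS elim)
    qed
    show "eventually (\<lambda>\<epsilon>. 0 \<le> S2_norm M T (\<lambda>t \<omega>. X \<epsilon> t \<omega> - Xhat t \<omega>)) (at_right 0)"
      by (simp add: S2_norm_def)
  qed
qed

end

theorem theorem2p8:
  fixes M G :: "'w measure" and W :: "real \<Rightarrow> 'w \<Rightarrow> real ^ 'm" and T :: real
    and \<beta> :: "real \<Rightarrow> real"
    and b :: "('w, 'd::finite, 'k::finite, real ^ 'd) coefficient"
    and \<sigma> :: "('w, 'd, 'k, real ^ 'm ^ 'd) coefficient"
    and B :: "('w, 'd, 'k, real ^ 'k) coefficient"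
    and \<Sigma> :: "('w, 'd, 'k, real ^ 'm ^ 'k) coefficient"
    and \<xi> :: "'w \<Rightarrow> real ^ 'd" and \<eta> :: "'w \<Rightarrow> real ^ 'k"
    and Xhat :: "real \<Rightarrow> 'w \<Rightarrow> real ^ 'd" and \<alpha>hat :: "real \<Rightarrow> 'w \<Rightarrow> real ^ 'k"
    and X :: "real \<Rightarrow> real \<Rightarrow> 'w \<Rightarrow> real ^ 'd" and A :: "real \<Rightarrow> real \<Rightarrow> 'w \<Rightarrow> real ^ 'k"
  assumes "two_scale_setting M G W T"
    and "assumption_A M (filt M G W) T \<beta> b \<sigma> B \<Sigma>"
    and "assumption_B M G (filt M G W) W T b \<sigma> B"
    and "\<xi> \<in> L2_rv M G" and "\<eta> \<in> L2_rv M G"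
    and "equilibrium_pair M (filt M G W) W T b \<sigma> B \<xi> Xhat \<alpha>hat"
    and "\<And>\<epsilon>. \<epsilon> > 0 \<Longrightarrow>
      two_scale_solution M (filt M G W) W T \<beta> b \<sigma> B \<Sigma> \<xi> \<eta> \<epsilon> (X \<epsilon>) (A \<epsilon>)"
  shows "((\<lambda>\<epsilon>. H2_norm M T (\<lambda>t \<omega>. A \<epsilon> t \<omega> - \<alpha>hat t \<omega>)) \<longlongrightarrow> 0) (at_right 0) \<and>
         ((\<lambda>\<epsilon>. S2_norm M T (\<lambda>t \<omega>. X \<epsilon> t \<omega> - Xhat t \<omega>)) \<longlongrightarrow> 0) (at_right 0)"
proof -
  interpret two_scale_system M G W T \<beta> b \<sigma> B \<Sigma>
    by (intro two_scale_system.intro assms(1,2))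
  have eta: "\<eta> \<in> borel_measurable M"
    using assms(5) measurable_from_subalg[OF G_sub] by (auto simp: L2_rv_def)
  note lim = err_tendsto[OF assms(6) eta assms(7)]
  have ah: "\<alpha>hat \<in> H2 M F T" using assms(6) by (simp add: equilibrium_pair_def)
  have "((\<lambda>\<epsilon>. H2_norm M T (\<lambda>t \<omega>. A \<epsilon> t \<omega> - \<alpha>hat t \<omega>)) \<longlongrightarrow> 0) (at_right 0)"
  proof (rule tendsto_sandwich[OF _ _ tendsto_const])
    have "((\<lambda>\<epsilon>. sqrt (err (X \<epsilon>) (A \<epsilon>) Xhat \<alpha>hat)) \<longlongrightarrow> sqrt 0) (at_right 0)" by (intro tendsto_intros lim)
    then show "((\<lambda>\<epsilon>. sqrt (err (X \<epsilon>) (A \<epsilon>) Xhat \<alpha>hat)) \<longlongrightarrow> 0) (at_right 0)" by simp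
    \<comment> \<open>The squared \<open>H2\<close> norm is one of the two summands of
      \<open>err\<close>.\<close>
    show "eventually (\<lambda>\<epsilon>. H2_norm M T (\<lambda>t \<omega>. A \<epsilon> t \<omega> - \<alpha>hat t \<omega>) \<le> sqrt (err (X \<epsilon>) (A \<epsilon>) Xhat \<alpha>hat)) (at_right 0)"
      using eventually_at_right_less[of "0::real"]
    proof eventually_elim
      case (elim \<epsilon>)
      have sA: "sqP (A \<epsilon>)" using assms(7)[OF elim] S2_sq_int_P by (auto simp: two_scale_solution_def)
      have sq: "sqP (\<lambda>t \<omega>. A \<epsilon> t \<omega> - \<alpha>hat t \<omega>)" by (rule sqP_diff[OF sA H2D(2)[OF ah]])
      have "H2_sq M T (\<lambda>t \<omega>. A \<epsilon> t \<omega> - \<alpha>hat t \<omega>) = ennreal ((tn T (\<lambda>t \<omega>. A \<epsilon> t \<omega> - \<alpha>hat t \<omega>))\<^sup>2)"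
        unfolding tn_T using sq by (subst H2_sq_eq) (auto simp: sq_int_def nn_integral_eq_l2[OF sq])
      then show ?case unfolding H2_norm_def by (intro real_sqrt_le_mono) (simp add: err_def)
    qed
    show "eventually (\<lambda>\<epsilon>. 0 \<le> H2_norm M T (\<lambda>t \<omega>. A \<epsilon> t \<omega> - \<alpha>hat t \<omega>)) (at_right 0)"
      by (simp add: H2_norm_def)
  qed
  then show ?thesis using lim(2) by simp
qed

end
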